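(* Let $A$ be the infinitesimal generator of a $C_0$-semigroup $\{U(t)\}_{t\ge 0}$ on $H$ which is exponentially stable: $\|U(t)\|\le \mathcal N e^{-\nu t}$ for all $t\ge 0$, with constants $\mathcal N,\nu>0$. Let $F,G\in C(\mathbb R\times H,H)$ satisfy: (C1) there is $A_0\ge0$ with $|F(t,0)|,|G(t,0)|\le A_0$ for all $t\in\mathbb R$; (C2) there is $\mathcal L\ge0$ with $|F(t,x_1)-F(t,x_2)|\le\mathcal L|x_1-x_2|$ and $|G(t,x_1)-G(t,x_2)|\le\mathcal L|x_1-x_2|$ for all $t\in\mathbb R$, $x_1,x_2\in H$. Consider the equation $$dx(t)=(Ax(t)+F(t,x(t)))\,dt+G(t,x(t))\,dW(t).\qquad(\mathrm{S})$$ Then the following hold. (i) If $\mathcal L<\dfrac{\nu}{\mathcal N\sqrt{2+\nu}}$, then (S) has a unique (mild) solution $\xi\in C(\mathbb R,B[0,r])$, where $$r=\frac{\mathcal N A_0\sqrt{2+\nu}}{\nu-\mathcal N\mathcal L\sqrt{2+\nu}},\qquad B[0,r]:=\{x\in L^2(\mathbb P,H):\|x\|_2\le r\}.$$ (ii) If $\mathcal L<\dfrac{\nu}{2\mathcal N\sqrt{1+\nu}}$ and additionally (C3) holds, i.e. $F$ and $G$ are continuous in $t$ uniformly with respect to $x$ on each bounded subset $Q\subset H$, then (a) $\mathfrak M^u_{(F,G)}\subseteq\tilde{\mathfrak M}^u_\xi$; (b) the solution $\xi$ is uniformly comparable in distribution, i.e. $\mathfrak M_{(F,G)}\subseteq\tilde{\mathfrak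 M}_\xi$.
   Context: $(H,|\cdot|)$ is a real separable Hilbert space, $(\Omega,\mathcal F,\mathbb P)$ a probability space, $L^2(\mathbb P,H)$ the space of $H$-valued random variables with $\|x\|_2:=(\mathbb E|x|^2)^{1/2}<\infty$. $C(\mathbb R,B[0,r])$ is the set of continuous maps from $\mathbb R$ to $B[0,r]\subset L^2(\mathbb P,H)$. $W$ is a two-sided standard one-dimensional Brownian motion on $(\Omega,\mathcal F,\mathbb P)$, and $\mathcal F_t:=\sigma\{W(u):u\le t\}$. A (mild) solution of (S) is an $\mathcal F_t$-adapted process $\{x(t)\}_{t\in\mathbb R}$ with $x(t)=U(t-t_0)x(t_0)+\int_{t_0}^tU(t-s)F(s,x(s))\,ds+\int_{t_0}^tU(t-s)G(s,x(s))\,dW(s)$ for all $t\ge t_0$ and each $t_0\in\mathbb R$. "$F$ is continuous in $t$ uniformly with respect to $x\in Q$" means: for every $t_0\in\mathbb R$ and $\varepsilon>0$ there is $\delta>0$ such that $|t-t_0|<\delta$ implies $\sup_{x\in Q}|F(t,x)-F(t_0,x)|<\varepsilon$. $BUC(\mathbb R\times H,H)$ is the set of functions $\mathbb R\times H\to H$ that are continuous in $t$ uniformly with respect to $x$ on every bounded subset of $H$ and bounded on every bounded subset of $\mathbb R\times H$, with the topology of uniform convergence on bounded subsets of $\mathbb R\times H$. With $F^\tau(t,x):=F(t+\tau,x)$, $\mathfrak M_{(F,G)}$ is the set of all sequences $\{t_n\}\subset\mathbb R$ such that $(F^{t_n},G^{t_n})$ converges in $BUC(\mathbb R\times H,H)\times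 BUC(\mathbb R\times H,H)$; $\mathfrak M^u_{(F,G)}$ is the set of all $\{t_n\}$ such that this convergence is uniform in $t\in\mathbb R$, i.e. there are $\tilde F,\tilde G\in BUC(\mathbb R\times H,H)$ with $\sup_{t\in\mathbb R,|x|\le R}|F(t+t_n,x)-\tilde F(t,x)|\to0$ and $\sup_{t\in\mathbb R,|x|\le R}|G(t+t_n,x)-\tilde G(t,x)|\to0$ for every $R>0$. $\mathcal P(H)$ is the set of Borel probability measures on $H$ with the metric $\beta(\mu_1,\mu_2)=\sup\{|\int \phi\,d\mu_1-\int \phi\,d\mu_2|:\mathrm{Lip}(\phi)+\|\phi\|_\infty\le1\}$, which metrizes weak convergence (convergence in distribution). $\tilde{\mathfrak M}_\xi$ (respectively $\tilde{\mathfrak M}^u_\xi$) is the set of all sequences $\{t_n\}\subset\mathbb R$ such that $\xi(\cdot+t_n)$ converges in distribution uniformly on every compact interval (respectively uniformly in $t\in\mathbb R$), i.e. the maps $t\mapsto\mathrm{law}(\xi(t+t_n))\in(\mathcal P(H),\beta)$ converge uniformly on every compact interval (respectively on $\mathbb R$). *)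

theory Defs
  imports "HOL-Probability.Probability"
begin

text \<open>Only the values \<open>U t\<close> with \<open>t \<ge> 0\<close> are relevant here and below.\<close>

definition C0_semigroup :: "(real \<Rightarrow> 'a::real_normed_vector \<Rightarrow>\<^sub>L 'a) \<Rightarrow> bool" where
  "C0_semigroup U \<longleftrightarrow>
     U 0 = id_blinfun \<and>
     (\<forall>s\<ge>0. \<forall>t\<ge>0. U (s + t) = U s o\<^sub>L U t) \<and>
     (\<forall>x. ((\<lambda>t. blinfun_apply (U t) x) \<longlongrightarrow> x) (at_right 0))"

text \<open>The generator is in general unbounded and only densely defined; it is represented by its graph.\<close>

definition infinitesimal_generator ::
    "(real \<Rightarrow> 'a::real_normed_vector \<Rightarrow>\<^sub>L 'a) \<Rightarrow> ('a \<times> 'a) set" where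
  "infinitesimal_generator U =
     {(x, y). ((\<lambda>h. (1 / h) *\<^sub>R (blinfun_apply (U h) x - x)) \<longlongrightarrow> y) (at_right 0)}"

text \<open>Elements of the \<open>L\<^sup>2\<close> space are represented by square integrable random variables, so that
  equality in it is almost sure equality.\<close>

definition L2_rv :: "'w measure \<Rightarrow> ('w \<Rightarrow> 'a::{real_inner, banach, second_countable_topology}) set" where
  "L2_rv M = {X \<in> borel_measurable M. integrable M (\<lambda>\<omega>. (norm (X \<omega>))\<^sup>2)}"

definition L2_norm :: "'w measure \<Rightarrow> ('w \<Rightarrow> 'a::{real_inner, banach, second_countable_topology}) \<Rightarrow> real" where
  "L2_norm M X = sqrt (\<integral>\<omega>. (norm (X \<omega>))\<^sup>2 \<partial>M)"

definition L2_ball :: "'w measure \<Rightarrow> real \<Rightarrow> ('w \<Rightarrow> 'a::{real_inner, banach, second_countable_topology}) set" where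
  "L2_ball M r = {X \<in> L2_rv M. L2_norm M X \<le> r}"

definition continuous_in_L2_ball ::
    "'w measure \<Rightarrow> real \<Rightarrow> (real \<Rightarrow> 'w \<Rightarrow> 'a::{real_inner, banach, second_countable_topology}) set" where
  "continuous_in_L2_ball M r =
     {x. (\<forall>t. x t \<in> L2_ball M r) \<and>
         (\<forall>t. ((\<lambda>s. L2_norm M (\<lambda>\<omega>. x s \<omega> - x t \<omega>)) \<longlongrightarrow> 0) (at t))}"

definition two_sided_brownian_motion :: "'w measure \<Rightarrow> (real \<Rightarrow> 'w \<Rightarrow> real) \<Rightarrow> bool" where
  "two_sided_brownian_motion M W \<longleftrightarrow>
     (\<forall>t. W t \<in> borel_measurable M) \<and>
     (AE \<omega> in M. W 0 \<omega> = 0) \<and>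
     (AE \<omega> in M. continuous_on UNIV (\<lambda>t. W t \<omega>)) \<and>
     (\<forall>s t. s < t \<longrightarrow>
        distributed M lborel (\<lambda>\<omega>. W t \<omega> - W s \<omega>) (normal_density 0 (sqrt (t - s)))) \<and>
     (\<forall>(n::nat) \<tau>::nat \<Rightarrow> real. (\<forall>i<n. \<tau> i < \<tau> (Suc i)) \<longrightarrow>
        prob_space.indep_vars M (\<lambda>_. borel) (\<lambda>i \<omega>. W (\<tau> (Suc i)) \<omega> - W (\<tau> i) \<omega>) {..<n})"

definition W_filtration :: "'w measure \<Rightarrow> (real \<Rightarrow> 'w \<Rightarrow> real) \<Rightarrow> real \<Rightarrow> 'w measure" where
  "W_filtration M W t =
     sigma (space M) (\<Union>u\<in>{..t}. {W u -` A \<inter> space M | A. A \<in> sets borel})"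

text \<open>The \<open>\<sigma>\<close>-algebra of the increments up to time \<open>t\<close>, contained in \<open>W_filtration M W t\<close>. For
  \<open>t < 0\<close> the inclusion is strict because \<open>W 0 = 0\<close>: the variable \<open>W t\<close> itself is minus the future
  increment \<open>W 0 - W t\<close>. Hence \<open>W\<close> has increments independent of the past only with
  respect to the increment filtration, and the Ito integral is built on that one.\<close>

definition increment_filtration :: "'w measure \<Rightarrow> (real \<Rightarrow> 'w \<Rightarrow> real) \<Rightarrow> real \<Rightarrow> 'w measure" where
  "increment_filtration M W t =
     sigma (space M)
       (\<Union>u\<in>{..t}. \<Union>v\<in>{..t}. {(\<lambda>\<omega>. W u \<omega> - W v \<omega>) -` A \<inter> space M | A. A \<in> sets borel})"

text \<open>A simple integrand on \<open>[a, b]\<close> consists of a partition \<open>\<tau> 0 \<le> \<dots> \<le> \<tau> n\<close> and of square integrable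
  \<open>\<zeta> i\<close>, measurable at time \<open>\<tau> i\<close>, which are its values on the intervals from \<open>\<tau> i\<close> to \<open>\<tau> (i + 1)\<close>.\<close>

definition simple_integrand ::
    "'w measure \<Rightarrow> (real \<Rightarrow> 'w \<Rightarrow> real) \<Rightarrow> real \<Rightarrow> real \<Rightarrow> nat \<Rightarrow> (nat \<Rightarrow> real) \<Rightarrow>
     (nat \<Rightarrow> 'w \<Rightarrow> 'a::{real_inner, banach, second_countable_topology}) \<Rightarrow> bool" where
  "simple_integrand M W a b n \<tau> \<zeta> \<longleftrightarrow>
     \<tau> 0 = a \<and> \<tau> n = b \<and> (\<forall>i<n. \<tau> i \<le> \<tau> (Suc i)) \<and>
     (\<forall>i<n. \<zeta> i \<in> borel_measurable (increment_filtration M W (\<tau> i)) \<and> \<zeta> i \<in> L2_rv M)"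

definition simple_process ::
    "nat \<Rightarrow> (nat \<Rightarrow> real) \<Rightarrow> (nat \<Rightarrow> 'w \<Rightarrow> 'a::real_vector) \<Rightarrow> real \<Rightarrow> 'w \<Rightarrow> 'a" where
  "simple_process n \<tau> \<zeta> s \<omega> = (\<Sum>i<n. indicat_real {\<tau> i<..\<tau> (Suc i)} s *\<^sub>R \<zeta> i \<omega>)"

definition simple_ito ::
    "(real \<Rightarrow> 'w \<Rightarrow> real) \<Rightarrow> nat \<Rightarrow> (nat \<Rightarrow> real) \<Rightarrow> (nat \<Rightarrow> 'w \<Rightarrow> 'a::real_vector) \<Rightarrow> 'w \<Rightarrow> 'a" where
  "simple_ito W n \<tau> \<zeta> \<omega> = (\<Sum>i<n. (W (\<tau> (Suc i)) \<omega> - W (\<tau> i) \<omega>) *\<^sub>R \<zeta> i \<omega>)"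

text \<open>\<open>I\<close> is (a version of) \<open>\<integral> g dW\<close> over \<open>[a, b]\<close> if it is the \<open>L\<^sup>2\<close> limit of the integrals of simple
  integrands that approximate \<open>g\<close> in \<open>L\<^sup>2([a, b] \<times> \<Omega>)\<close>.\<close>

definition has_ito_integral ::
    "'w measure \<Rightarrow> (real \<Rightarrow> 'w \<Rightarrow> real) \<Rightarrow> real \<Rightarrow> real \<Rightarrow>
     (real \<Rightarrow> 'w \<Rightarrow> 'a::{real_inner, banach, second_countable_topology}) \<Rightarrow> ('w \<Rightarrow> 'a) \<Rightarrow> bool" where
  "has_ito_integral M W a b g I \<longleftrightarrow>
     (\<lambda>(s, \<omega>). g s \<omega>) \<in> borel_measurable (restrict_space lborel {a..b} \<Otimes>\<^sub>M M) \<and>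
     I \<in> borel_measurable M \<and>
     (\<exists>n \<tau> \<zeta>.
        (\<forall>k::nat. simple_integrand M W a b (n k) (\<tau> k) (\<zeta> k)) \<and>
        ((\<lambda>k. \<integral>\<^sup>+ (s, \<omega>). ennreal ((norm (simple_process (n k) (\<tau> k) (\<zeta> k) s \<omega> - g s \<omega>))\<^sup>2)
                \<partial>(restrict_space lborel {a..b} \<Otimes>\<^sub>M M)) \<longlonglongrightarrow> 0) \<and>
        ((\<lambda>k. \<integral>\<^sup>+ \<omega>. ennreal ((norm (simple_ito W (n k) (\<tau> k) (\<zeta> k) \<omega> - I \<omega>))\<^sup>2) \<partial>M) \<longlonglongrightarrow> 0))"

text \<open>Mild solutions of \<open>dx = (A x + F(t, x)) dt + G(t, x) dW\<close>, where \<open>A\<close> generates \<open>U\<close>. Processes are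
  jointly measurable in time and \<open>\<omega>\<close>, so that the drift can be integrated path by path.\<close>

definition mild_solution ::
    "'w measure \<Rightarrow> (real \<Rightarrow> 'w \<Rightarrow> real) \<Rightarrow>
     (real \<Rightarrow> 'a::{real_inner, banach, second_countable_topology} \<Rightarrow>\<^sub>L 'a) \<Rightarrow>
     (real \<Rightarrow> 'a \<Rightarrow> 'a) \<Rightarrow> (real \<Rightarrow> 'a \<Rightarrow> 'a) \<Rightarrow> (real \<Rightarrow> 'w \<Rightarrow> 'a) \<Rightarrow> bool" where
  "mild_solution M W U F G x \<longleftrightarrow>
     (\<lambda>(t, \<omega>). x t \<omega>) \<in> borel_measurable (lborel \<Otimes>\<^sub>M M) \<and>
     (\<forall>t. x t \<in> borel_measurable (W_filtration M W t)) \<and>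
     (\<forall>t0 t. t0 \<le> t \<longrightarrow>
        (\<exists>I. has_ito_integral M W t0 t (\<lambda>s \<omega>. blinfun_apply (U (t - s)) (G s (x s \<omega>))) I \<and>
             (AE \<omega> in M.
                set_integrable lborel {t0..t} (\<lambda>s. blinfun_apply (U (t - s)) (F s (x s \<omega>))) \<and>
                x t \<omega> = blinfun_apply (U (t - t0)) (x t0 \<omega>)
                         + (LINT s:{t0..t}|lborel. blinfun_apply (U (t - s)) (F s (x s \<omega>)))
                         + I \<omega>)))"

definition continuous_in_t_uniformly ::
    "(real \<Rightarrow> 'a::real_normed_vector \<Rightarrow> 'a) \<Rightarrow> 'a set \<Rightarrow> bool" where
  "continuous_in_t_uniformly F Q \<longleftrightarrow>
     (\<forall>t0. \<forall>\<epsilon>>0. \<exists>\<delta>>0. \<forall>t. \<bar>t - t0\<bar> < \<delta> \<longrightarrow> (\<forall>x\<in>Q. norm (F t x - F t0 x) < \<epsilon>))"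

definition BUC :: "(real \<Rightarrow> 'a::real_normed_vector \<Rightarrow> 'a) set" where
  "BUC = {F. (\<forall>Q. bounded Q \<longrightarrow> continuous_in_t_uniformly F Q) \<and>
             (\<forall>B. bounded B \<longrightarrow> bounded ((\<lambda>(t, x). F t x) ` B))}"

definition coeff_seqs ::
    "(real \<Rightarrow> 'a::real_normed_vector \<Rightarrow> 'a) \<Rightarrow> (real \<Rightarrow> 'a \<Rightarrow> 'a) \<Rightarrow> (nat \<Rightarrow> real) set" where
  "coeff_seqs F G =
     {\<tau>. \<exists>F'\<in>BUC. \<exists>G'\<in>BUC. \<forall>B. bounded B \<longrightarrow>
        uniform_limit B (\<lambda>n (t, x). F (t + \<tau> n) x) (\<lambda>(t, x). F' t x) sequentially \<and>
        uniform_limit B (\<lambda>n (t, x). G (t + \<tau> n) x) (\<lambda>(t, x). G' t x) sequentially}"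

definition coeff_seqs_unif ::
    "(real \<Rightarrow> 'a::real_normed_vector \<Rightarrow> 'a) \<Rightarrow> (real \<Rightarrow> 'a \<Rightarrow> 'a) \<Rightarrow> (nat \<Rightarrow> real) set" where
  "coeff_seqs_unif F G =
     {\<tau>. \<exists>F'\<in>BUC. \<exists>G'\<in>BUC. \<forall>R>0.
        uniform_limit (UNIV \<times> cball 0 R) (\<lambda>n (t, x). F (t + \<tau> n) x) (\<lambda>(t, x). F' t x) sequentially \<and>
        uniform_limit (UNIV \<times> cball 0 R) (\<lambda>n (t, x). G (t + \<tau> n) x) (\<lambda>(t, x). G' t x) sequentially}"

definition borel_prob_measures :: "'a::topological_space measure set" where
  "borel_prob_measures = {\<mu>. prob_space \<mu> \<and> sets \<mu> = sets borel}"

text \<open>\<open>Lip \<phi> + \<parallel>\<phi>\<parallel>\<^sub>\<infinity> \<le> 1\<close> is written with upper bounds \<open>l\<close> and \<open>c\<close> of the two terms, because a real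
  supremum over an unbounded set is unspecified.\<close>

definition BL_unit_ball :: "('a::metric_space \<Rightarrow> real) set" where
  "BL_unit_ball = {\<phi>. \<exists>l c. l-lipschitz_on UNIV \<phi> \<and> (\<forall>x. \<bar>\<phi> x\<bar> \<le> c) \<and> l + c \<le> 1}"

definition BL_dist :: "'a::metric_space measure \<Rightarrow> 'a measure \<Rightarrow> real" where
  "BL_dist \<mu>1 \<mu>2 = (SUP \<phi>\<in>BL_unit_ball. \<bar>(\<integral>x. \<phi> x \<partial>\<mu>1) - (\<integral>x. \<phi> x \<partial>\<mu>2)\<bar>)"

definition law :: "'w measure \<Rightarrow> ('w \<Rightarrow> 'a::topological_space) \<Rightarrow> 'a measure" where
  "law M X = distr M borel X"

definition laws_converge_uniformly_on ::
    "real set \<Rightarrow> 'w measure \<Rightarrow> (nat \<Rightarrow> real \<Rightarrow> 'w \<Rightarrow> 'a::metric_space) \<Rightarrow> (real \<Rightarrow> 'a measure) \<Rightarrow> bool" where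
  "laws_converge_uniformly_on S M X \<mu> \<longleftrightarrow>
     (\<forall>\<epsilon>>0. \<forall>\<^sub>F n in sequentially. \<forall>t\<in>S. BL_dist (law M (X n t)) (\<mu> t) < \<epsilon>)"

definition dist_seqs ::
    "'w measure \<Rightarrow> (real \<Rightarrow> 'w \<Rightarrow> 'a::metric_space) \<Rightarrow> (nat \<Rightarrow> real) set" where
  "dist_seqs M \<xi> =
     {\<tau>. \<exists>\<mu>. (\<forall>t. \<mu> t \<in> borel_prob_measures) \<and>
        (\<forall>a b. laws_converge_uniformly_on {a..b} M (\<lambda>n t. \<xi> (t + \<tau> n)) \<mu>)}"

definition dist_seqs_unif ::
    "'w measure \<Rightarrow> (real \<Rightarrow> 'w \<Rightarrow> 'a::metric_space) \<Rightarrow> (nat \<Rightarrow> real) set" where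
  "dist_seqs_unif M \<xi> =
     {\<tau>. \<exists>\<mu>. (\<forall>t. \<mu> t \<in> borel_prob_measures) \<and>
        laws_converge_uniformly_on UNIV M (\<lambda>n t. \<xi> (t + \<tau> n)) \<mu>}"

definition uniformly_comparable_in_distribution ::
    "'w measure \<Rightarrow> (real \<Rightarrow> 'a::real_normed_vector \<Rightarrow> 'a) \<Rightarrow> (real \<Rightarrow> 'a \<Rightarrow> 'a) \<Rightarrow>
     (real \<Rightarrow> 'w \<Rightarrow> 'a) \<Rightarrow> bool" where
  "uniformly_comparable_in_distribution M F G \<xi> \<longleftrightarrow> coeff_seqs F G \<subseteq> dist_seqs M \<xi>"

end

theory Submission
  imports Defs
begin

text \<open>The solution is the fixed point of \<open>x \<mapsto> \<integral>\<^bsub>-\<infinity>\<^esub>\<^sup>t U(t - s) F(s, x(s)) ds + \<integral>\<^bsub>-\<infinity>\<^esub>\<^sup>t U(t - s) G(s, x(s)) dW(s)\<close>,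
  a contraction of the processes that are bounded and continuous in \<open>L\<^sup>2\<close>, by the Ito isometry.

  On the space of paths of \<open>W\<close> let \<open>x\<^sub>n\<close> solve the equation with the coefficients shifted by \<open>t\<^sub>n\<close>, and let \<open>y\<close>
  solve the limit equation. The increments of \<open>W\<close> are stationary, so \<open>\<xi>(t + t\<^sub>n)\<close> has the law of
  \<open>x\<^sub>n(t)\<close>, and it suffices that \<open>x\<^sub>n \<rightarrow> y\<close> in \<open>L\<^sup>2\<close>. As the coefficients converge only uniformly on
  bounded sets, this needs \<open>|y(t)|\<^sup>2\<close> to be uniformly integrable over all \<open>t\<close>: the fixed point map preserves
  bounded fourth moments, so \<open>y\<close> is a uniform \<open>L\<^sup>2\<close> limit of Picard iterates with bounded fourth moments.
  No contraction in \<open>L\<^sup>4\<close> is needed.\<close>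

section \<open>Square integrable random variables\<close>

text \<open>The quantitative core is one number. Inputs bounded by 1 in L2 produce a response of
  norm at most \<open>N (1/\<nu> + 1/sqrt (2\<nu>))\<close>: the drift through the mass of the
  kernel, the noise through its L2 norm. This is at most
  \<open>c = N sqrt (2 + \<nu>) / \<nu>\<close>, so the condition in (i) says
  \<open>c L < 1\<close>, and \<open>r\<close> solves \<open>r = c (A0 + L r)\<close>. As
  \<open>sqrt (2 + \<nu>) \<le> 2 sqrt (1 + \<nu>)\<close>, the condition in (ii) is the stronger
  one, and (ii) runs on the same contraction. Two obstacles shape the rest. A stochastic integral is
  determined only up to null sets, separately at every time, while the drift integrates along paths;
  so responses are relations, and each process built from them is replaced by a progressively
  measurable version. Secondly, \<open>\<xi>(t + t_n)\<close> is driven by a shifted motion that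
  changes with \<open>n\<close>, so on the given space the shifts need not have a common limit in
  L2; path space provides a single motion for all \<open>n\<close>. There the coefficient error is
  evaluated along the limit \<open>y\<close> alone, which is why only \<open>y\<close> needs
  moments.\<close>

lemma L2_rvD:
  assumes "X \<in> L2_rv M"
  shows L2_rv_measurable: "X \<in> borel_measurable M"
    and L2_rv_integrable: "integrable M (\<lambda>\<omega>. (norm (X \<omega>))\<^sup>2)"
  using assms by (auto simp: L2_rv_def)

lemma L2_rv_iff_nn:
  "X \<in> L2_rv M \<longleftrightarrow> X \<in> borel_measurable M \<and> (\<integral>\<^sup>+\<omega>. ennreal ((norm (X \<omega>))\<^sup>2) \<partial>M) < \<infinity>"
  by (auto simp: L2_rv_def integrable_iff_bounded)

lemma L2_norm_nonneg [simp]: "0 \<le> L2_norm M X"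
  by (simp add: L2_norm_def)

lemma L2_norm_power2: "(L2_norm M X)\<^sup>2 = (\<integral>\<omega>. (norm (X \<omega>))\<^sup>2 \<partial>M)"
  by (simp add: L2_norm_def)

lemma nn_integral_L2:
  assumes "X \<in> L2_rv M"
  shows "(\<integral>\<^sup>+\<omega>. ennreal ((norm (X \<omega>))\<^sup>2) \<partial>M) = ennreal ((L2_norm M X)\<^sup>2)"
  unfolding L2_norm_power2 by (rule nn_integral_eq_integral) (use L2_rv_integrable[OF assms] in auto)

text \<open>Estimates by Tonelli and Cauchy-Schwarz are carried out in \<open>ennreal\<close>, where
  no integrability has to be known beforehand; this brings them back to a membership together with a
  real bound.\<close>

lemma L2_norm_leI:
  assumes X: "X \<in> borel_measurable M" and c: "0 \<le> c"
    and le: "(\<integral>\<^sup>+\<omega>. ennreal ((norm (X \<omega>))\<^sup>2) \<partial>M) \<le> ennreal (c\<^sup>2)"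
  shows "X \<in> L2_rv M" "L2_norm M X \<le> c"
proof -
  show *: "X \<in> L2_rv M"
    using X le_less_trans[OF le ennreal_less_top] by (auto simp: L2_rv_iff_nn)
  have "(L2_norm M X)\<^sup>2 \<le> c\<^sup>2"
    using le unfolding nn_integral_L2[OF *] by (simp add: ennreal_le_iff)
  then show "L2_norm M X \<le> c"
    using c by (rule power2_le_imp_le)
qed

lemma L2_rv_mono:
  assumes Y: "Y \<in> L2_rv M" and X: "X \<in> borel_measurable M"
    and le: "AE \<omega> in M. norm (X \<omega>) \<le> norm (Y \<omega>)"
  shows "X \<in> L2_rv M" "L2_norm M X \<le> L2_norm M Y"
proof -
  have "(\<integral>\<^sup>+\<omega>. ennreal ((norm (X \<omega>))\<^sup>2) \<partial>M) \<le> (\<integral>\<^sup>+\<omega>. ennreal ((norm (Y \<omega>))\<^sup>2) \<partial>M)"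
    by (rule nn_integral_mono_AE) (use le in eventually_elim, auto intro!: ennreal_leI power_mono)
  also have "\<dots> = ennreal ((L2_norm M Y)\<^sup>2)"
    by (rule nn_integral_L2[OF Y])
  finally show "X \<in> L2_rv M" "L2_norm M X \<le> L2_norm M Y"
    using L2_norm_leI[OF X L2_norm_nonneg] by auto
qed

lemma L2_norm_cong_AE:
  assumes "X \<in> borel_measurable M" "Y \<in> borel_measurable M" "AE \<omega> in M. norm (X \<omega>) = norm (Y \<omega>)"
  shows "L2_norm M X = L2_norm M Y"
  unfolding L2_norm_def
  by (rule arg_cong[of _ _ sqrt], rule integral_cong_AE) (use assms in auto)

lemma L2_rv_cong_AE:
  assumes "Y \<in> L2_rv M" "X \<in> borel_measurable M" "AE \<omega> in M. X \<omega> = Y \<omega>"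
  shows "X \<in> L2_rv M"
  by (rule L2_rv_mono(1)[OF assms(1,2)]) (use assms(3) in auto)

lemma L2_rv_zero [simp]: "(\<lambda>\<omega>. 0) \<in> L2_rv M"
  by (simp add: L2_rv_def)

lemma L2_norm_zero [simp]: "L2_norm M (\<lambda>\<omega>. 0) = 0"
  by (simp add: L2_norm_def)

lemma L2_rv_norm: "X \<in> L2_rv M \<Longrightarrow> (\<lambda>\<omega>. norm (X \<omega>)) \<in> L2_rv M"
  by (auto simp: L2_rv_def)

lemma L2_norm_norm: "L2_norm M (\<lambda>\<omega>. norm (X \<omega>)) = L2_norm M X"
  by (simp add: L2_norm_def)

lemma L2_rv_add [intro]:
  assumes "X \<in> L2_rv M" "Y \<in> L2_rv M"
  shows "(\<lambda>\<omega>. X \<omega> + Y \<omega>) \<in> L2_rv M"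
proof -
  note [measurable] = L2_rv_measurable[OF assms(1)] L2_rv_measurable[OF assms(2)]
  have "integrable M (\<lambda>\<omega>. 2 * (norm (X \<omega>))\<^sup>2 + 2 * (norm (Y \<omega>))\<^sup>2)"
    using assms[THEN L2_rv_integrable] by auto
  then have "integrable M (\<lambda>\<omega>. (norm (X \<omega> + Y \<omega>))\<^sup>2)"
  proof (rule Bochner_Integration.integrable_bound)
    show "AE \<omega> in M. norm ((norm (X \<omega> + Y \<omega>))\<^sup>2) \<le> norm (2 * (norm (X \<omega>))\<^sup>2 + 2 * (norm (Y \<omega>))\<^sup>2)"
    proof (rule AE_I2)
      fix \<omega>
      have "(norm (X \<omega> + Y \<omega>))\<^sup>2 \<le> (norm (X \<omega>) + norm (Y \<omega>))\<^sup>2"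
        by (intro power_mono norm_triangle_ineq) auto
      also have "\<dots> \<le> 2 * (norm (X \<omega>))\<^sup>2 + 2 * (norm (Y \<omega>))\<^sup>2"
        using sum_squares_bound[of "norm (X \<omega>)" "norm (Y \<omega>)"] by (simp add: power2_sum)
      finally show "norm ((norm (X \<omega> + Y \<omega>))\<^sup>2) \<le> norm (2 * (norm (X \<omega>))\<^sup>2 + 2 * (norm (Y \<omega>))\<^sup>2)"
        by simp
    qed
  qed measurable
  then show ?thesis by (simp add: L2_rv_def)
qed

lemma L2_rv_scaleR [intro]: "X \<in> L2_rv M \<Longrightarrow> (\<lambda>\<omega>. c *\<^sub>R X \<omega>) \<in> L2_rv M"
  by (auto simp: L2_rv_def power_mult_distrib)

lemma L2_norm_scaleR: "L2_norm M (\<lambda>\<omega>. c *\<^sub>R X \<omega>) = \<bar>c\<bar> * L2_norm M X"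
  by (simp add: L2_norm_def power_mult_distrib real_sqrt_mult)

lemma L2_rv_uminus [intro]: "X \<in> L2_rv M \<Longrightarrow> (\<lambda>\<omega>. - X \<omega>) \<in> L2_rv M"
  by (auto simp: L2_rv_def)

lemma L2_rv_diff [intro]: "X \<in> L2_rv M \<Longrightarrow> Y \<in> L2_rv M \<Longrightarrow> (\<lambda>\<omega>. X \<omega> - Y \<omega>) \<in> L2_rv M"
  using L2_rv_add[of X M "\<lambda>\<omega>. - Y \<omega>"] by auto

lemma blinfun_measurable [measurable]:
  fixes B :: "'a::{real_inner, banach, second_countable_topology} \<Rightarrow>\<^sub>L 'b::{real_inner, banach, second_countable_topology}"
  shows "blinfun_apply B \<in> borel_measurable borel"
  by (intro borel_measurable_continuous_onI linear_continuous_on blinfun.bounded_linear_right)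

lemma
  fixes B :: "'a::{real_inner, banach, second_countable_topology} \<Rightarrow>\<^sub>L 'b::{real_inner, banach, second_countable_topology}"
  assumes X: "X \<in> L2_rv M"
  shows L2_rv_blinfun: "(\<lambda>\<omega>. blinfun_apply B (X \<omega>)) \<in> L2_rv M"
    and L2_norm_blinfun: "L2_norm M (\<lambda>\<omega>. blinfun_apply B (X \<omega>)) \<le> norm B * L2_norm M X"
proof -
  note [measurable] = L2_rv_measurable[OF X]
  have Y: "(\<lambda>\<omega>. norm B *\<^sub>R X \<omega>) \<in> L2_rv M" using X by auto
  have *: "AE \<omega> in M. norm (blinfun_apply B (X \<omega>)) \<le> norm (norm B * norm (X \<omega>))"
    by (auto simp: norm_blinfun)
  have Y: "(\<lambda>\<omega>. norm B * norm (X \<omega>)) \<in> L2_rv M" using L2_rv_scaleR[OF L2_rv_norm[OF X], of "norm B"] by simp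
  show "(\<lambda>\<omega>. blinfun_apply B (X \<omega>)) \<in> L2_rv M"
    by (rule L2_rv_mono(1)[OF Y _ *]) measurable
  have "L2_norm M (\<lambda>\<omega>. blinfun_apply B (X \<omega>)) \<le> L2_norm M (\<lambda>\<omega>. norm B * norm (X \<omega>))"
    by (rule L2_rv_mono(2)[OF Y _ *]) measurable
  also have "\<dots> = norm B * L2_norm M X"
    using L2_norm_scaleR[of M "norm B" "\<lambda>\<omega>. norm (X \<omega>)"] by (simp add: L2_norm_norm)
  finally show "L2_norm M (\<lambda>\<omega>. blinfun_apply B (X \<omega>)) \<le> norm B * L2_norm M X" .
qed

lemma
  assumes "X \<in> L2_rv M" "Y \<in> L2_rv M"
  shows L2_rv_integrable_norm_mult: "integrable M (\<lambda>\<omega>. norm (X \<omega>) * norm (Y \<omega>))"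
    and L2_rv_integrable_inner: "integrable M (\<lambda>\<omega>. inner (X \<omega>) (Y \<omega>))"
    and L2_norm_Cauchy_Schwarz: "(\<integral>\<omega>. norm (X \<omega>) * norm (Y \<omega>) \<partial>M) \<le> L2_norm M X * L2_norm M Y"
proof -
  note [measurable] = L2_rv_measurable[OF assms(1)] L2_rv_measurable[OF assms(2)]
  let ?p = "\<lambda>\<omega>. norm (X \<omega>) * norm (Y \<omega>)"
  have "(\<integral>\<^sup>+\<omega>. ennreal (?p \<omega>) \<partial>M)\<^sup>2 \<le> (\<integral>\<^sup>+\<omega>. (ennreal (norm (X \<omega>)))\<^sup>2 \<partial>M) * (\<integral>\<^sup>+\<omega>. (ennreal (norm (Y \<omega>)))\<^sup>2 \<partial>M)"
    using Cauchy_Schwarz_nn_integral[of "\<lambda>\<omega>. ennreal (norm (X \<omega>))" M "\<lambda>\<omega>. ennreal (norm (Y \<omega>))"]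
    by (simp add: ennreal_mult)
  also have "\<dots> = ennreal ((L2_norm M X * L2_norm M Y)\<^sup>2)"
    by (simp add: ennreal_power nn_integral_L2 assms flip: ennreal_mult power_mult_distrib)
  finally have le: "(\<integral>\<^sup>+\<omega>. ennreal (?p \<omega>) \<partial>M)\<^sup>2 \<le> ennreal ((L2_norm M X * L2_norm M Y)\<^sup>2)" .
  from le_less_trans[OF le ennreal_less_top] have "(\<integral>\<^sup>+\<omega>. ennreal (?p \<omega>) \<partial>M) < \<infinity>"
    by (simp add: power_less_top_ennreal)
  then show int: "integrable M ?p"
    by (simp add: integrable_iff_bounded)
  then show "integrable M (\<lambda>\<omega>. inner (X \<omega>) (Y \<omega>))"
    by (rule Bochner_Integration.integrable_bound) (auto simp: Cauchy_Schwarz_ineq2 norm_mult)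
  have "(\<integral>\<omega>. ?p \<omega> \<partial>M)\<^sup>2 \<le> (L2_norm M X * L2_norm M Y)\<^sup>2"
    using le nn_integral_eq_integral[OF int] by (simp add: ennreal_power ennreal_le_iff)
  then show "(\<integral>\<omega>. ?p \<omega> \<partial>M) \<le> L2_norm M X * L2_norm M Y"
    by (rule power2_le_imp_le) auto
qed

lemma L2_norm_add_power2:
  assumes "X \<in> L2_rv M" "Y \<in> L2_rv M"
  shows "(L2_norm M (\<lambda>\<omega>. X \<omega> + Y \<omega>))\<^sup>2 =
    (L2_norm M X)\<^sup>2 + 2 * (\<integral>\<omega>. inner (X \<omega>) (Y \<omega>) \<partial>M) + (L2_norm M Y)\<^sup>2"
proof -
  note I = assms[THEN L2_rv_integrable] L2_rv_integrable_inner[OF assms]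
  have "(\<integral>\<omega>. (norm (X \<omega> + Y \<omega>))\<^sup>2 \<partial>M)
      = (\<integral>\<omega>. (norm (X \<omega>))\<^sup>2 + 2 * inner (X \<omega>) (Y \<omega>) + (norm (Y \<omega>))\<^sup>2 \<partial>M)"
    by (simp add: power2_norm_eq_inner inner_add_left inner_add_right inner_commute algebra_simps)
  also have "\<dots> = (L2_norm M X)\<^sup>2 + 2 * (\<integral>\<omega>. inner (X \<omega>) (Y \<omega>) \<partial>M) + (L2_norm M Y)\<^sup>2"
    using I by (simp add: L2_norm_power2)
  finally show ?thesis by (simp add: L2_norm_power2)
qed

lemma L2_norm_triangle:
  assumes "X \<in> L2_rv M" "Y \<in> L2_rv M"
  shows "L2_norm M (\<lambda>\<omega>. X \<omega> + Y \<omega>) \<le> L2_norm M X + L2_norm M Y"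
proof -
  have "(\<integral>\<omega>. inner (X \<omega>) (Y \<omega>) \<partial>M) \<le> (\<integral>\<omega>. norm (X \<omega>) * norm (Y \<omega>) \<partial>M)"
    using assms by (intro integral_mono L2_rv_integrable_inner L2_rv_integrable_norm_mult norm_cauchy_schwarz)
  also have "\<dots> \<le> L2_norm M X * L2_norm M Y"
    using assms by (rule L2_norm_Cauchy_Schwarz)
  finally have "(L2_norm M (\<lambda>\<omega>. X \<omega> + Y \<omega>))\<^sup>2 \<le> (L2_norm M X + L2_norm M Y)\<^sup>2"
    using assms by (simp add: L2_norm_add_power2 power2_sum)
  then show ?thesis by (rule power2_le_imp_le) auto
qed

lemma L2_norm_uminus [simp]: "L2_norm M (\<lambda>\<omega>. - X \<omega>) = L2_norm M X"
  by (simp add: L2_norm_def)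

lemma L2_norm_minus_commute: "L2_norm M (\<lambda>\<omega>. X \<omega> - Y \<omega>) = L2_norm M (\<lambda>\<omega>. Y \<omega> - X \<omega>)"
  by (simp add: L2_norm_def norm_minus_commute)

lemma L2_norm_diff_triangle:
  assumes "X \<in> L2_rv M" "Y \<in> L2_rv M" "Z \<in> L2_rv M"
  shows "L2_norm M (\<lambda>\<omega>. X \<omega> - Z \<omega>) \<le> L2_norm M (\<lambda>\<omega>. X \<omega> - Y \<omega>) + L2_norm M (\<lambda>\<omega>. Y \<omega> - Z \<omega>)"
  using L2_norm_triangle[of "\<lambda>\<omega>. X \<omega> - Y \<omega>" M "\<lambda>\<omega>. Y \<omega> - Z \<omega>"] assms by (auto simp: L2_rv_diff)

lemma L2_norm_triangle_diff:
  assumes "X \<in> L2_rv M" "Y \<in> L2_rv M"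
  shows "L2_norm M (\<lambda>\<omega>. X \<omega> - Y \<omega>) \<le> L2_norm M X + L2_norm M Y"
  using L2_norm_triangle[of X M "\<lambda>\<omega>. - Y \<omega>"] assms by auto

lemma L2_norm_triangle_sub:
  assumes "X \<in> L2_rv M" "Y \<in> L2_rv M"
  shows "L2_norm M X \<le> L2_norm M Y + L2_norm M (\<lambda>\<omega>. X \<omega> - Y \<omega>)"
  using L2_norm_triangle[of Y M "\<lambda>\<omega>. X \<omega> - Y \<omega>"] assms by (auto simp: L2_rv_diff)

lemma L2_norm_eq_0_AE:
  assumes "X \<in> L2_rv M" "L2_norm M X = 0"
  shows "AE \<omega> in M. X \<omega> = 0"
proof -
  have "(\<integral>\<omega>. (norm (X \<omega>))\<^sup>2 \<partial>M) = 0"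
    using assms(2) by (simp add: L2_norm_def)
  then have "AE \<omega> in M. (norm (X \<omega>))\<^sup>2 = 0"
    using integral_nonneg_eq_0_iff_AE[of M "\<lambda>\<omega>. (norm (X \<omega>))\<^sup>2"] L2_rv_integrable[OF assms(1)] by auto
  then show ?thesis by simp
qed

lemma L2_norm_diff_eq_0_AE:
  assumes "X \<in> L2_rv M" "Y \<in> L2_rv M" "\<And>\<epsilon>. 0 < \<epsilon> \<Longrightarrow> L2_norm M (\<lambda>\<omega>. X \<omega> - Y \<omega>) \<le> \<epsilon>"
  shows "AE \<omega> in M. X \<omega> = Y \<omega>"
proof -
  have "L2_norm M (\<lambda>\<omega>. X \<omega> - Y \<omega>) \<le> 0"
    by (rule field_le_epsilon) (use assms(3) in auto)
  then have "L2_norm M (\<lambda>\<omega>. X \<omega> - Y \<omega>) = 0"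
    by (simp add: order_antisym)
  then show ?thesis
    using L2_norm_eq_0_AE[OF L2_rv_diff[OF assms(1,2)]] by simp
qed

text \<open>The majorant is asked of the differences rather than of \<open>X n\<close>; in the
  applications to the semigroup these are bounded by \<open>2 N\<close> times one fixed square
  integrable variable.\<close>

lemma L2_dominated_convergence:
  fixes X :: "nat \<Rightarrow> 'w \<Rightarrow> 'a::{real_inner, banach, second_countable_topology}"
  assumes X: "\<And>n. X n \<in> borel_measurable M" and Y: "Y \<in> borel_measurable M"
    and Z: "Z \<in> L2_rv M" and lim: "AE \<omega> in M. (\<lambda>n. X n \<omega>) \<longlonglongrightarrow> Y \<omega>"
    and bd: "\<And>n. AE \<omega> in M. norm (X n \<omega> - Y \<omega>) \<le> norm (Z \<omega>)"
  shows "(\<lambda>n. L2_norm M (\<lambda>\<omega>. X n \<omega> - Y \<omega>)) \<longlonglongrightarrow> 0"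
proof -
  note [measurable] = X Y
  have "(\<lambda>n. (\<integral>\<omega>. (norm (X n \<omega> - Y \<omega>))\<^sup>2 \<partial>M)) \<longlonglongrightarrow> (\<integral>\<omega>. 0 \<partial>M)"
  proof (rule integral_dominated_convergence)
    show "integrable M (\<lambda>\<omega>. (norm (Z \<omega>))\<^sup>2)" using Z by (rule L2_rv_integrable)
    show "AE \<omega> in M. (\<lambda>n. (norm (X n \<omega> - Y \<omega>))\<^sup>2) \<longlonglongrightarrow> 0"
      using lim by eventually_elim (auto simp: LIM_zero_iff intro!: tendsto_eq_intros)
    show "AE \<omega> in M. norm ((norm (X n \<omega> - Y \<omega>))\<^sup>2) \<le> (norm (Z \<omega>))\<^sup>2" for n
      using bd[of n] by eventually_elim (simp add: power_mono)
  qed auto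
  from tendsto_real_sqrt[OF this] show ?thesis by (simp add: L2_norm_def)
qed

section \<open>Completeness of L2 and limits of fourth moments\<close>

context prob_space
begin

lemma
  assumes X: "X \<in> L2_rv M"
  shows L2_rv_imp_integrable_norm: "integrable M (\<lambda>\<omega>. norm (X \<omega>))"
    and integral_norm_le_L2_norm: "(\<integral>\<omega>. norm (X \<omega>) \<partial>M) \<le> L2_norm M X"
proof -
  have 1: "(\<lambda>\<omega>. 1::real) \<in> L2_rv M" by (simp add: L2_rv_def)
  have 2: "L2_norm M (\<lambda>\<omega>. 1::real) = 1" by (simp add: L2_norm_def prob_space)
  show "integrable M (\<lambda>\<omega>. norm (X \<omega>))"
    using L2_rv_integrable_norm_mult[OF L2_rv_norm[OF X] 1] by simp
  show "(\<integral>\<omega>. norm (X \<omega>) \<partial>M) \<le> L2_norm M X"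
    using L2_norm_Cauchy_Schwarz[OF L2_rv_norm[OF X] 1] 2 by (simp add: L2_norm_norm)
qed

lemma L2_rv_const [simp]: "(\<lambda>\<omega>. c) \<in> L2_rv M"
  by (simp add: L2_rv_def)

lemma L2_norm_const [simp]: "L2_norm M (\<lambda>\<omega>. c) = norm c"
  by (simp add: L2_norm_def prob_space)

text \<open>On a probability space L2 norms dominate L1 norms, so the series of differences
  converges absolutely almost surely. The explicit tail bound is kept because limits are taken at
  each time separately and have to be uniform in time.\<close>

lemma L2_Riesz_Fischer:
  fixes X :: "nat \<Rightarrow> 'a \<Rightarrow> 'b::{real_inner, banach, second_countable_topology}"
  assumes X: "\<And>k. X k \<in> L2_rv M"
    and summ: "summable (\<lambda>k. L2_norm M (\<lambda>\<omega>. X (Suc k) \<omega> - X k \<omega>))"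
  defines "Y \<equiv> \<lambda>\<omega>. lim (\<lambda>k. X k \<omega>)"
  shows "AE \<omega> in M. (\<lambda>k. X k \<omega>) \<longlonglongrightarrow> Y \<omega>" "Y \<in> L2_rv M"
    "\<And>k. L2_norm M (\<lambda>\<omega>. Y \<omega> - X k \<omega>) \<le> (\<Sum>i. L2_norm M (\<lambda>\<omega>. X (Suc (i + k)) \<omega> - X (i + k) \<omega>))"
    "(\<lambda>k. L2_norm M (\<lambda>\<omega>. Y \<omega> - X k \<omega>)) \<longlonglongrightarrow> 0"
proof -
  let ?d = "\<lambda>k. L2_norm M (\<lambda>\<omega>. X (Suc k) \<omega> - X k \<omega>)"
  note [measurable] = L2_rv_measurable[OF X]
  have Ym[measurable]: "Y \<in> borel_measurable M" unfolding Y_def by measurable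
  have d: "(\<lambda>\<omega>. X j \<omega> - X k \<omega>) \<in> L2_rv M" for j k
    using X by auto
  have "(\<integral>\<^sup>+\<omega>. (\<Sum>k. ennreal (norm (X (Suc k) \<omega> - X k \<omega>))) \<partial>M)
      = (\<Sum>k. \<integral>\<^sup>+\<omega>. ennreal (norm (X (Suc k) \<omega> - X k \<omega>)) \<partial>M)"
    by (rule nn_integral_suminf) auto
  also have "\<dots> = (\<Sum>k. ennreal (\<integral>\<omega>. norm (X (Suc k) \<omega> - X k \<omega>) \<partial>M))"
    by (intro suminf_cong nn_integral_eq_integral L2_rv_imp_integrable_norm d) auto
  also have "\<dots> \<le> (\<Sum>k. ennreal (?d k))"
    by (intro suminf_le ennreal_leI integral_norm_le_L2_norm d) auto
  also have "\<dots> < \<infinity>"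
    using summ by (simp add: suminf_ennreal2 less_top)
  finally have "AE \<omega> in M. (\<Sum>k. ennreal (norm (X (Suc k) \<omega> - X k \<omega>))) \<noteq> \<infinity>"
    by (intro nn_integral_PInf_AE) auto
  then show lim: "AE \<omega> in M. (\<lambda>k. X k \<omega>) \<longlonglongrightarrow> Y \<omega>"
  proof eventually_elim
    fix \<omega> assume "(\<Sum>k. ennreal (norm (X (Suc k) \<omega> - X k \<omega>))) \<noteq> \<infinity>"
    then have "summable (\<lambda>k. norm (X (Suc k) \<omega> - X k \<omega>))"
      by (intro summable_suminf_not_top) auto
    then have "summable (\<lambda>k. X (Suc k) \<omega> - X k \<omega>)"
      by (rule summable_norm_cancel)
    then have "convergent (\<lambda>n. \<Sum>k<n. X (Suc k) \<omega> - X k \<omega>)"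
      by (simp add: summable_iff_convergent)
    then have "convergent (\<lambda>n. X n \<omega> - X 0 \<omega>)"
      unfolding sum_lessThan_telescope[of "\<lambda>k. X k \<omega>"] .
    then have "convergent (\<lambda>n. X n \<omega>)"
      using convergent_add[OF _ convergent_const[of "X 0 \<omega>"]] by fastforce
    then show "(\<lambda>k. X k \<omega>) \<longlonglongrightarrow> Y \<omega>"
      by (simp add: Y_def convergent_LIMSEQ_iff)
  qed
  have summ': "summable (\<lambda>i. ?d (i + k))" for k
    using summ summable_iff_shift[of ?d k] by simp
  have tail: "L2_norm M (\<lambda>\<omega>. X (k + j) \<omega> - X k \<omega>) \<le> (\<Sum>i. ?d (i + k))" for k j
  proof -
    have "L2_norm M (\<lambda>\<omega>. X (k + j) \<omega> - X k \<omega>) \<le> (\<Sum>i<j. ?d (i + k))"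
    proof (induction j)
      case (Suc j)
      have "L2_norm M (\<lambda>\<omega>. X (k + Suc j) \<omega> - X k \<omega>)
          \<le> L2_norm M (\<lambda>\<omega>. X (k + Suc j) \<omega> - X (k + j) \<omega>) + L2_norm M (\<lambda>\<omega>. X (k + j) \<omega> - X k \<omega>)"
        by (rule L2_norm_diff_triangle[OF X X X])
      with Suc show ?case by (simp add: add.commute)
    qed simp
    also have "\<dots> \<le> (\<Sum>i. ?d (i + k))"
      by (rule sum_le_suminf) (use summ' in auto)
    finally show ?thesis .
  qed
  \<comment> \<open>Fatou applied to \<open>X (k + j) - X k\<close> as \<open>j\<close> tends to
    infinity.\<close>
  have nn: "(\<integral>\<^sup>+\<omega>. ennreal ((norm (Y \<omega> - X k \<omega>))\<^sup>2) \<partial>M) \<le> ennreal ((\<Sum>i. ?d (i + k))\<^sup>2)" for k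
  proof -
    have "(\<integral>\<^sup>+\<omega>. ennreal ((norm (Y \<omega> - X k \<omega>))\<^sup>2) \<partial>M)
        = (\<integral>\<^sup>+\<omega>. liminf (\<lambda>j. ennreal ((norm (X (k + j) \<omega> - X k \<omega>))\<^sup>2)) \<partial>M)"
    proof (rule nn_integral_cong_AE, use lim in eventually_elim)
      fix \<omega> assume "(\<lambda>k. X k \<omega>) \<longlonglongrightarrow> Y \<omega>"
      then have "(\<lambda>j. X (k + j) \<omega>) \<longlonglongrightarrow> Y \<omega>"
        using LIMSEQ_ignore_initial_segment[of "\<lambda>k. X k \<omega>" _ k] by (simp add: add.commute)
      then have "(\<lambda>j. ennreal ((norm (X (k + j) \<omega> - X k \<omega>))\<^sup>2)) \<longlonglongrightarrow> ennreal ((norm (Y \<omega> - X k \<omega>))\<^sup>2)"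
        by (intro tendsto_intros)
      then show "ennreal ((norm (Y \<omega> - X k \<omega>))\<^sup>2) = liminf (\<lambda>j. ennreal ((norm (X (k + j) \<omega> - X k \<omega>))\<^sup>2))"
        by (intro lim_imp_Liminf[symmetric]) auto
    qed
    also have "\<dots> \<le> liminf (\<lambda>j. \<integral>\<^sup>+\<omega>. ennreal ((norm (X (k + j) \<omega> - X k \<omega>))\<^sup>2) \<partial>M)"
      by (rule nn_integral_liminf) auto
    also have "\<dots> \<le> liminf (\<lambda>j. ennreal ((\<Sum>i. ?d (i + k))\<^sup>2))"
      by (intro Liminf_mono always_eventually allI)
        (auto simp: nn_integral_L2[OF d] intro!: ennreal_leI power_mono tail)
    finally show ?thesis by (simp add: Liminf_const)
  qed
  have nonneg: "0 \<le> (\<Sum>i. ?d (i + k))" for k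
    by (rule suminf_nonneg) (use summ' in auto)
  show le: "L2_norm M (\<lambda>\<omega>. Y \<omega> - X k \<omega>) \<le> (\<Sum>i. ?d (i + k))" for k
    by (rule L2_norm_leI(2)[OF _ nonneg nn]) measurable
  have "(\<lambda>\<omega>. Y \<omega> - X 0 \<omega>) \<in> L2_rv M"
    by (rule L2_norm_leI(1)[OF _ nonneg nn]) measurable
  from L2_rv_add[OF this X[of 0]] show "Y \<in> L2_rv M" by simp
  have "(\<lambda>k. \<Sum>i. ?d (i + k)) \<longlonglongrightarrow> 0"
    using summ by (rule suminf_exist_split2)
  then show "(\<lambda>k. L2_norm M (\<lambda>\<omega>. Y \<omega> - X k \<omega>)) \<longlonglongrightarrow> 0"
    by (rule tendsto_sandwich[OF _ _ tendsto_const, rotated 2]) (auto intro!: always_eventually le)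
qed

text \<open>The pointwise \<open>lim\<close> is measurable for every \<sigma>-algebra that makes all
  terms measurable. Thus limits stay adapted although the filtration is not completed by null sets;
  an arbitrary L2 limit would be adapted only up to a null set.\<close>

lemma L2_limit_subalgebra:
  fixes X :: "nat \<Rightarrow> 'a \<Rightarrow> 'b::{real_inner, banach, second_countable_topology}"
  assumes G: "subalgebra M G" and X: "\<And>k. X k \<in> L2_rv M" "\<And>k. X k \<in> borel_measurable G"
    and summ: "summable (\<lambda>k. L2_norm M (\<lambda>\<omega>. X (Suc k) \<omega> - X k \<omega>))"
  obtains Y where "Y \<in> borel_measurable G" "Y \<in> L2_rv M"
    "\<And>k. L2_norm M (\<lambda>\<omega>. Y \<omega> - X k \<omega>) \<le> (\<Sum>i. L2_norm M (\<lambda>\<omega>. X (Suc (i + k)) \<omega> - X (i + k) \<omega>))"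
    "(\<lambda>k. L2_norm M (\<lambda>\<omega>. Y \<omega> - X k \<omega>)) \<longlonglongrightarrow> 0"
proof (rule that[of "\<lambda>\<omega>. lim (\<lambda>k. X k \<omega>)"])
  show "(\<lambda>\<omega>. lim (\<lambda>k. X k \<omega>)) \<in> borel_measurable G"
    using X(2) by measurable
qed (rule L2_Riesz_Fischer[OF X(1) summ])+

lemma L2_convergent_AE_subseq:
  fixes X :: "nat \<Rightarrow> 'a \<Rightarrow> 'b::{real_inner, banach, second_countable_topology}"
  assumes X: "\<And>k. X k \<in> L2_rv M" "Y \<in> L2_rv M"
    and lim: "(\<lambda>k. L2_norm M (\<lambda>\<omega>. X k \<omega> - Y \<omega>)) \<longlonglongrightarrow> 0"
  obtains r :: "nat \<Rightarrow> nat" where "strict_mono r" "AE \<omega> in M. (\<lambda>k. X (r k) \<omega>) \<longlonglongrightarrow> Y \<omega>"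
proof -
  have int: "integrable M (\<lambda>\<omega>. X k \<omega> - Y \<omega>)" for k
    using L2_rv_imp_integrable_norm[OF L2_rv_diff[OF X(1) X(2)], of k] X[THEN L2_rv_measurable]
    by (subst (asm) integrable_norm_iff) auto
  have "(\<lambda>k. \<integral>\<omega>. norm (X k \<omega> - Y \<omega>) \<partial>M) \<longlonglongrightarrow> 0"
    by (rule tendsto_sandwich[OF _ _ tendsto_const lim])
      (auto intro!: always_eventually integral_norm_le_L2_norm L2_rv_diff X)
  then have "(\<lambda>k. norm (\<integral>\<omega>. norm (X k \<omega> - Y \<omega>) \<partial>M)) \<longlonglongrightarrow> 0"
    by (rule tendsto_norm_zero)
  with tendsto_L1_AE_subseq[where u="\<lambda>k \<omega>. X k \<omega> - Y \<omega>", OF int] \<open>(\<lambda>k. \<integral>\<omega>. norm (X k \<omega> - Y \<omega>) \<partial>M) \<longlonglongrightarrow> 0\<close>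
  obtain r where "strict_mono r" "AE \<omega> in M. (\<lambda>k. X (r k) \<omega> - Y \<omega>) \<longlonglongrightarrow> 0"
    by blast
  then show thesis
    by (intro that[of r]) (auto simp: LIM_zero_iff)
qed

text \<open>Fatou along an almost surely convergent subsequence: the fourth moment is lower
  semicontinuous for convergence in L2, so moment bounds survive limits that are controlled only in
  L2.\<close>

lemma fourth_moment_L2_limit:
  fixes X :: "nat \<Rightarrow> 'a \<Rightarrow> 'b::{real_inner, banach, second_countable_topology}"
  assumes X: "\<And>k. X k \<in> L2_rv M" "Y \<in> L2_rv M"
    and lim: "(\<lambda>k. L2_norm M (\<lambda>\<omega>. X k \<omega> - Y \<omega>)) \<longlonglongrightarrow> 0"
    and bd: "\<And>k. (\<integral>\<^sup>+\<omega>. ennreal ((norm (X k \<omega>))^4) \<partial>M) \<le> C"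
  shows "(\<integral>\<^sup>+\<omega>. ennreal ((norm (Y \<omega>))^4) \<partial>M) \<le> C"
proof -
  obtain r where r: "strict_mono r" "AE \<omega> in M. (\<lambda>k. X (r k) \<omega>) \<longlonglongrightarrow> Y \<omega>"
    using L2_convergent_AE_subseq[OF X lim] by blast
  note [measurable] = X[THEN L2_rv_measurable]
  have "(\<integral>\<^sup>+\<omega>. ennreal ((norm (Y \<omega>))^4) \<partial>M) = (\<integral>\<^sup>+\<omega>. liminf (\<lambda>k. ennreal ((norm (X (r k) \<omega>))^4)) \<partial>M)"
  proof (rule nn_integral_cong_AE, use r(2) in eventually_elim)
    fix \<omega> assume "(\<lambda>k. X (r k) \<omega>) \<longlonglongrightarrow> Y \<omega>"
    then have "(\<lambda>k. ennreal ((norm (X (r k) \<omega>))^4)) \<longlonglongrightarrow> ennreal ((norm (Y \<omega>))^4)"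
      by (intro tendsto_intros)
    then show "ennreal ((norm (Y \<omega>))^4) = liminf (\<lambda>k. ennreal ((norm (X (r k) \<omega>))^4))"
      by (intro lim_imp_Liminf[symmetric]) auto
  qed
  also have "\<dots> \<le> liminf (\<lambda>k. \<integral>\<^sup>+\<omega>. ennreal ((norm (X (r k) \<omega>))^4) \<partial>M)"
    by (rule nn_integral_liminf) measurable
  also have "\<dots> \<le> liminf (\<lambda>k::nat. C)"
    by (intro Liminf_mono always_eventually allI bd)
  finally show ?thesis by (simp add: Liminf_const)
qed

end

section \<open>The Ito integral as a closed isometry\<close>

text \<open>Phrased through laws and through events in the past of the increments, the form in which
  the isometry uses independence. Both pass to image measures, so the coordinate process on path
  space qualifies as well.\<close>

locale wiener_process = prob_space M for M :: "'w measure" +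
  fixes W :: "real \<Rightarrow> 'w \<Rightarrow> real"
  assumes W_measurable [measurable]: "\<And>t. W t \<in> borel_measurable M"
    and W_increment: "\<And>s t. s < t \<Longrightarrow>
      distributed M lborel (\<lambda>\<omega>. W t \<omega> - W s \<omega>) (normal_density 0 (sqrt (t - s)))"
    and W_indep: "\<And>s t A B. s < t \<Longrightarrow> A \<in> sets (increment_filtration M W s) \<Longrightarrow> B \<in> sets borel \<Longrightarrow>
      prob (A \<inter> ((\<lambda>\<omega>. W t \<omega> - W s \<omega>) -` B \<inter> space M)) =
        prob A * prob ((\<lambda>\<omega>. W t \<omega> - W s \<omega>) -` B \<inter> space M)"

lemma space_increment_filtration [simp]: "space (increment_filtration M W t) = space M"
  by (simp add: increment_filtration_def space_measure_of_conv)

lemma sets_increment_filtration: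
  "sets (increment_filtration M W t) = sigma_sets (space M)
     (\<Union>u\<in>{..t}. \<Union>v\<in>{..t}. {(\<lambda>\<omega>. W u \<omega> - W v \<omega>) -` A \<inter> space M | A. A \<in> sets borel})"
  unfolding increment_filtration_def by (rule sets_measure_of) auto

lemma increment_filtration_mono:
  assumes "s \<le> t" shows "sets (increment_filtration M W s) \<subseteq> sets (increment_filtration M W t)"
  unfolding sets_increment_filtration by (rule sigma_sets_mono') (use assms in force)

lemma increment_measurable_filtration:
  assumes "u \<le> t" "v \<le> t"
  shows "(\<lambda>\<omega>. W u \<omega> - W v \<omega>) \<in> borel_measurable (increment_filtration M W t)"
proof (rule measurableI)
  fix A :: "real set" assume "A \<in> sets borel"
  then have "(\<lambda>\<omega>. W u \<omega> - W v \<omega>) -` A \<inter> space M \<in>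
     (\<Union>u\<in>{..t}. \<Union>v\<in>{..t}. {(\<lambda>\<omega>. W u \<omega> - W v \<omega>) -` A \<inter> space M | A. A \<in> sets borel})"
    using assms by blast
  then show "(\<lambda>\<omega>. W u \<omega> - W v \<omega>) -` A \<inter> space (increment_filtration M W t) \<in> sets (increment_filtration M W t)"
    unfolding sets_increment_filtration space_increment_filtration by (rule sigma_sets.Basic)
qed simp

lemma measurable_increment_filtration_mono:
  assumes "X \<in> borel_measurable (increment_filtration M W s)" "s \<le> t"
  shows "X \<in> borel_measurable (increment_filtration M W t)"
  using measurable_mono[of borel borel "increment_filtration M W s" "increment_filtration M W t"]
    increment_filtration_mono[OF assms(2)] assms(1) by auto

text \<open>Pairs of a step process and its Ito integral. The intervals may overlap and come in any order, so sums
  and differences need no common refinement; the isometry follows from bilinearity.\<close>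

inductive_set simple_ito_pairs ::
    "'w measure \<Rightarrow> (real \<Rightarrow> 'w \<Rightarrow> real) \<Rightarrow> real \<Rightarrow>
     ((real \<times> 'w \<Rightarrow> 'a::{real_inner, banach, second_countable_topology}) \<times> ('w \<Rightarrow> 'a)) set"
  for M W T where
  zero: "((\<lambda>_. 0), (\<lambda>_. 0)) \<in> simple_ito_pairs M W T"
| step: "(p, S) \<in> simple_ito_pairs M W T \<Longrightarrow> a \<le> b \<Longrightarrow> b \<le> T \<Longrightarrow>
    \<zeta> \<in> borel_measurable (increment_filtration M W a) \<Longrightarrow> \<zeta> \<in> L2_rv M \<Longrightarrow>
    ((\<lambda>x. indicat_real {a<..b} (fst x) *\<^sub>R \<zeta> (snd x) + p x),
     (\<lambda>\<omega>. (W b \<omega> - W a \<omega>) *\<^sub>R \<zeta> \<omega> + S \<omega>)) \<in> simple_ito_pairs M W T"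

lemma simple_ito_pairs_mono:
  assumes "(p, S) \<in> simple_ito_pairs M W T" "T \<le> T'"
  shows "(p, S) \<in> simple_ito_pairs M W T'"
  using assms by (induction rule: simple_ito_pairs.induct) (auto intro: simple_ito_pairs.intros)

lemma simple_ito_pairs_add_scaleR:
  assumes "(p', S') \<in> simple_ito_pairs M W T" "(p, S) \<in> simple_ito_pairs M W T"
  shows "((\<lambda>x. p x + c *\<^sub>R p' x), (\<lambda>\<omega>. S \<omega> + c *\<^sub>R S' \<omega>)) \<in> simple_ito_pairs M W T"
  using assms
proof (induction rule: simple_ito_pairs.induct)
  case (step p' S' a b \<zeta>)
  have "((\<lambda>x. indicat_real {a<..b} (fst x) *\<^sub>R (\<lambda>\<omega>. c *\<^sub>R \<zeta> \<omega>) (snd x) + (p x + c *\<^sub>R p' x)),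
     (\<lambda>\<omega>. (W b \<omega> - W a \<omega>) *\<^sub>R (\<lambda>\<omega>. c *\<^sub>R \<zeta> \<omega>) \<omega> + (S \<omega> + c *\<^sub>R S' \<omega>))) \<in> simple_ito_pairs M W T"
    by (rule simple_ito_pairs.step) (use step in auto)
  then show ?case by (simp add: algebra_simps)
qed simp

lemma simple_ito_pairs_diff:
  assumes "(p, S) \<in> simple_ito_pairs M W T" "(p', S') \<in> simple_ito_pairs M W T"
  shows "((\<lambda>x. p x - p' x), (\<lambda>\<omega>. S \<omega> - S' \<omega>)) \<in> simple_ito_pairs M W T"
  using simple_ito_pairs_add_scaleR[OF assms(2,1), of "-1"] by simp

text \<open>Needed to move \<open>U (t - t0)\<close> through a stochastic integral when the past up
  to \<open>t0\<close> is split off.\<close>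

lemma simple_ito_pairs_blinfun:
  fixes B :: "'a::{real_inner, banach, second_countable_topology} \<Rightarrow>\<^sub>L 'a"
  assumes "(p, S) \<in> simple_ito_pairs M W T"
  shows "((\<lambda>x. blinfun_apply B (p x)), (\<lambda>\<omega>. blinfun_apply B (S \<omega>))) \<in> simple_ito_pairs M W T"
  using assms
proof (induction rule: simple_ito_pairs.induct)
  case zero
  then show ?case by (simp add: blinfun.zero_right simple_ito_pairs.zero)
next
  case (step p S a b \<zeta>)
  have "((\<lambda>x. indicat_real {a<..b} (fst x) *\<^sub>R (\<lambda>\<omega>. blinfun_apply B (\<zeta> \<omega>)) (snd x) + blinfun_apply B (p x)),
     (\<lambda>\<omega>. (W b \<omega> - W a \<omega>) *\<^sub>R (\<lambda>\<omega>. blinfun_apply B (\<zeta> \<omega>)) \<omega> + blinfun_apply B (S \<omega>))) \<in> simple_ito_pairs M W T"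
    by (rule simple_ito_pairs.step) (use step L2_rv_blinfun in auto)
  then show ?case by (simp add: blinfun.add_right blinfun.scaleR_right)
qed

text \<open>A retraction of the line onto \<open>A\<close>, sending all other times to one point of
  \<open>A\<close>, makes \<open>f\<close> measurable on the full product; the indicator then erases
  the arbitrary values.\<close>

lemma indicator_times_measurable:
  assumes "A \<in> sets borel" "f \<in> borel_measurable (restrict_space lborel A \<Otimes>\<^sub>M M)"
  shows "(\<lambda>x. indicat_real A (fst x) *\<^sub>R f x :: 'a::{real_inner, banach, second_countable_topology})
      \<in> borel_measurable (lborel \<Otimes>\<^sub>M M)"
proof (cases "A = {}")
  case False
  then obtain a where a: "a \<in> A" by auto
  have [measurable]: "A \<in> sets lborel" using assms(1) by simp
  have "(\<lambda>s. if s \<in> A then s else a) \<in> measurable lborel (restrict_space lborel A)"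
    by (rule measurable_restrict_space2) (use a in auto)
  then have [measurable]: "(\<lambda>x. (if fst x \<in> A then fst x else a, snd x)) \<in> measurable (lborel \<Otimes>\<^sub>M M) (restrict_space lborel A \<Otimes>\<^sub>M M)"
    by (intro measurable_Pair measurable_snd measurable_compose[OF measurable_fst]) auto
  have "(\<lambda>x. indicat_real A (fst x) *\<^sub>R f (if fst x \<in> A then fst x else a, snd x)) \<in> borel_measurable (lborel \<Otimes>\<^sub>M M)"
    by (intro borel_measurable_scaleR measurable_compose[OF _ assms(2)]) measurable
  also have "(\<lambda>x. indicat_real A (fst x) *\<^sub>R f (if fst x \<in> A then fst x else a, snd x)) = (\<lambda>x. indicat_real A (fst x) *\<^sub>R f x)"
    by (auto simp: indicator_def)
  finally show ?thesis .
qed simp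

section \<open>Moments of increments and the isometry for step processes\<close>

context wiener_process
begin

abbreviation Filt :: "real \<Rightarrow> 'w measure" where "Filt \<equiv> increment_filtration M W"
abbreviation LM :: "(real \<times> 'w) measure" where "LM \<equiv> lborel \<Otimes>\<^sub>M M"

sublocale LM: pair_sigma_finite lborel M ..

lemma subalgebra_Filt: "subalgebra M (Filt t)"
proof -
  have "(\<Union>u\<in>{..t}. \<Union>v\<in>{..t}. {(\<lambda>\<omega>. W u \<omega> - W v \<omega>) -` A \<inter> space M | A. A \<in> sets borel}) \<subseteq> sets M"
    by (auto intro!: measurable_sets)
  then show ?thesis
    unfolding subalgebra_def sets_increment_filtration by (simp add: sets.sigma_sets_subset)
qed

lemma Filt_measurable_M: "X \<in> borel_measurable (Filt t) \<Longrightarrow> X \<in> borel_measurable M"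
  by (rule measurable_from_subalg[OF subalgebra_Filt])

lemma increment_moments:
  assumes "s \<le> t"
  shows "integrable M (\<lambda>\<omega>. (W t \<omega> - W s \<omega>) ^ k)"
    and "expectation (\<lambda>\<omega>. W t \<omega> - W s \<omega>) = 0"
    and "expectation (\<lambda>\<omega>. (W t \<omega> - W s \<omega>)\<^sup>2) = t - s"
    and "expectation (\<lambda>\<omega>. (W t \<omega> - W s \<omega>) ^ 3) = 0"
    and "expectation (\<lambda>\<omega>. (W t \<omega> - W s \<omega>) ^ 4) = 3 * (t - s)\<^sup>2"
proof -
  \<comment> \<open>For \<open>s = t\<close> there is no density and the increment is the constant
    0, so this case is treated apart.\<close>
  have *: "integrable M (\<lambda>\<omega>. (W t \<omega> - W s \<omega>) ^ k) \<and>
      expectation (\<lambda>\<omega>. (W t \<omega> - W s \<omega>) ^ k) = (\<integral>x. normal_density 0 (sqrt (t - s)) x * x ^ k \<partial>lborel)"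
    if "s < t" for k
  proof
    have pos: "0 < sqrt (t - s)" using that by simp
    show "integrable M (\<lambda>\<omega>. (W t \<omega> - W s \<omega>) ^ k)"
      using distributed_integrable[OF W_increment[OF that], of "\<lambda>x. x ^ k"] integrable_normal_moment[OF pos, of 0 k]
      by simp
    show "expectation (\<lambda>\<omega>. (W t \<omega> - W s \<omega>) ^ k) = (\<integral>x. normal_density 0 (sqrt (t - s)) x * x ^ k \<partial>lborel)"
      using distributed_integral[OF W_increment[OF that], of "\<lambda>x. x ^ k"] by simp
  qed
  show "integrable M (\<lambda>\<omega>. (W t \<omega> - W s \<omega>) ^ k)"
    using * assms by (cases "s = t") auto
  have pos: "0 < sqrt (t - s)" if "s < t" using that by simp
  show "expectation (\<lambda>\<omega>. W t \<omega> - W s \<omega>) = 0"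
    using *[of 1] integral_normal_moment_odd[OF pos, of 0 0] assms by (cases "s = t") auto
  show "expectation (\<lambda>\<omega>. (W t \<omega> - W s \<omega>)\<^sup>2) = t - s"
    using *[of 2] integral_normal_moment_even[OF pos, of 0 1] assms by (cases "s = t") (auto simp: power2_eq_square)
  show "expectation (\<lambda>\<omega>. (W t \<omega> - W s \<omega>) ^ 3) = 0"
    using *[of 3] integral_normal_moment_odd[OF pos, of 0 1] assms by (cases "s = t") auto
  show "expectation (\<lambda>\<omega>. (W t \<omega> - W s \<omega>) ^ 4) = 3 * (t - s)\<^sup>2"
    using *[of 4] integral_normal_moment_even[OF pos, of 0 2] assms
    by (cases "s = t") (auto simp: fact_numeral power_divide)
qed

text \<open>All orthogonality and moment relations below reduce to this: a factor known at time
  \<open>s\<close> separates from every power of the increment after \<open>s\<close>.\<close>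

lemma
  fixes X :: "'w \<Rightarrow> real"
  assumes st: "s \<le> t" and X: "X \<in> borel_measurable (Filt s)" "integrable M X"
  shows integrable_mult_increment: "integrable M (\<lambda>\<omega>. X \<omega> * (W t \<omega> - W s \<omega>) ^ k)"
    and expectation_mult_increment: "expectation (\<lambda>\<omega>. X \<omega> * (W t \<omega> - W s \<omega>) ^ k) =
      expectation X * expectation (\<lambda>\<omega>. (W t \<omega> - W s \<omega>) ^ k)"
proof -
  let ?D = "\<lambda>\<omega>. W t \<omega> - W s \<omega>"
  have *: "integrable M (\<lambda>\<omega>. X \<omega> * ?D \<omega> ^ k) \<and>
    expectation (\<lambda>\<omega>. X \<omega> * ?D \<omega> ^ k) = expectation X * expectation (\<lambda>\<omega>. ?D \<omega> ^ k)" if "s < t"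
  proof -
    have "indep_var borel X borel ?D"
      unfolding indep_var_eq
    proof (intro conjI indep_setI)
      show "random_variable borel X" by (rule Filt_measurable_M[OF X(1)])
      show "random_variable borel ?D" by simp
      have 1: "sigma_sets (space M) {X -` A \<inter> space M |A. A \<in> sets borel} \<subseteq> sets (Filt s)"
        by (rule sets.sigma_sets_subset[of _ "Filt s", unfolded space_increment_filtration])
          (use measurable_sets[OF X(1)] in auto)
      then show "sigma_sets (space M) {X -` A \<inter> space M |A. A \<in> sets borel} \<subseteq> events"
        using subalgebra_Filt[of s] unfolding subalgebra_def by blast
      \<comment> \<open>Preimages under one map already form a \<sigma>-algebra, so every event of
        the generated one is the preimage of a single Borel set, as \<open>W_indep\<close>
        demands.\<close>
      have 2: "sigma_sets (space M) {?D -` A \<inter> space M |A. A \<in> sets borel} = {?D -` A \<inter> space M |A. A \<in> sets borel}"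
        using sets_vimage_algebra[of "space M" ?D borel] sets_vimage_algebra2[of ?D "space M" borel] by simp
      show "sigma_sets (space M) {?D -` A \<inter> space M |A. A \<in> sets borel} \<subseteq> events"
        unfolding 2 by auto
      fix a b assume "a \<in> sigma_sets (space M) {X -` A \<inter> space M |A. A \<in> sets borel}"
        "b \<in> sigma_sets (space M) {?D -` A \<inter> space M |A. A \<in> sets borel}"
      then obtain B where "a \<in> sets (Filt s)" "B \<in> sets borel" "b = ?D -` B \<inter> space M"
        using subsetD[OF 1, of a] unfolding 2 by blast
      then show "prob (a \<inter> b) = prob a * prob b" using W_indep[OF that] by simp
    qed
    then have "indep_var borel (id \<circ> X) borel ((\<lambda>x. x ^ k) \<circ> ?D)"
      by (rule indep_var_compose) auto
    then have i: "indep_var borel X borel (\<lambda>\<omega>. ?D \<omega> ^ k)" by (simp add: comp_def)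
    show ?thesis
      using indep_var_integrable[OF i] indep_var_lebesgue_integral[OF i] X(2) increment_moments(1)[OF st] by auto
  qed
  \<comment> \<open>With \<open>s = t\<close> both sides vanish except for \<open>k = 0\<close>,
    where the power is 1.\<close>
  have "s = t \<Longrightarrow> integrable M (\<lambda>\<omega>. X \<omega> * ?D \<omega> ^ k) \<and>
    expectation (\<lambda>\<omega>. X \<omega> * ?D \<omega> ^ k) = expectation X * expectation (\<lambda>\<omega>. ?D \<omega> ^ k)"
    using X(2) by (cases "k = 0") (auto simp: prob_space)
  with * st show "integrable M (\<lambda>\<omega>. X \<omega> * ?D \<omega> ^ k)"
    "expectation (\<lambda>\<omega>. X \<omega> * ?D \<omega> ^ k) = expectation X * expectation (\<lambda>\<omega>. ?D \<omega> ^ k)" by force+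
qed

lemma increment_scaleR_L2:
  assumes "a \<le> b" and \<zeta>: "\<zeta> \<in> borel_measurable (Filt a)" "\<zeta> \<in> L2_rv M"
  shows "(\<lambda>\<omega>. (W b \<omega> - W a \<omega>) *\<^sub>R \<zeta> \<omega>) \<in> L2_rv M"
proof -
  note [measurable] = L2_rv_measurable[OF \<zeta>(2)]
  have "integrable M (\<lambda>\<omega>. (norm (\<zeta> \<omega>))\<^sup>2 * (W b \<omega> - W a \<omega>)\<^sup>2)"
    by (rule integrable_mult_increment[OF assms(1)]) (use \<zeta> L2_rv_integrable in auto)
  then show ?thesis
    by (simp add: L2_rv_def power_mult_distrib mult.commute)
qed

lemma increment_measurable_mono:
  assumes "a \<le> b" "b \<le> c" "\<zeta> \<in> borel_measurable (Filt a)"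
  shows "(\<lambda>\<omega>. (W b \<omega> - W a \<omega>) *\<^sub>R (\<zeta> \<omega> :: 'a::{real_inner, banach, second_countable_topology})) \<in> borel_measurable (Filt c)"
  using assms by (intro borel_measurable_scaleR increment_measurable_filtration measurable_increment_filtration_mono[OF assms(3)]) auto

text \<open>The later increment has mean 0 and is independent of both other factors.\<close>

lemma increments_orthogonal:
  fixes \<zeta> \<zeta>' :: "'w \<Rightarrow> 'a::{real_inner, banach, second_countable_topology}"
  assumes "a \<le> b" "b \<le> c" "c \<le> d"
    and X: "X \<in> borel_measurable (Filt c)" "X \<in> L2_rv M"
    and \<zeta>': "\<zeta>' \<in> borel_measurable (Filt c)" "\<zeta>' \<in> L2_rv M"
  shows "expectation (\<lambda>\<omega>. inner (X \<omega>) ((W d \<omega> - W c \<omega>) *\<^sub>R \<zeta>' \<omega>)) = 0"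
proof -
  have "expectation (\<lambda>\<omega>. inner (X \<omega>) (\<zeta>' \<omega>) * (W d \<omega> - W c \<omega>) ^ 1) =
      expectation (\<lambda>\<omega>. inner (X \<omega>) (\<zeta>' \<omega>)) * expectation (\<lambda>\<omega>. (W d \<omega> - W c \<omega>) ^ 1)"
    by (rule expectation_mult_increment[OF assms(3)]) (use X \<zeta>' L2_rv_integrable_inner in auto)
  then show ?thesis
    using increment_moments(2)[OF assms(3)] by (simp add: mult.commute)
qed

lemma same_increment_inner:
  fixes \<zeta> \<zeta>' :: "'w \<Rightarrow> 'a::{real_inner, banach, second_countable_topology}"
  assumes "a \<le> b"
    and \<zeta>: "\<zeta> \<in> borel_measurable (Filt a)" "\<zeta> \<in> L2_rv M"
    and \<zeta>': "\<zeta>' \<in> borel_measurable (Filt a)" "\<zeta>' \<in> L2_rv M"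
  shows "expectation (\<lambda>\<omega>. inner ((W b \<omega> - W a \<omega>) *\<^sub>R \<zeta> \<omega>) ((W b \<omega> - W a \<omega>) *\<^sub>R \<zeta>' \<omega>)) =
    (b - a) * expectation (\<lambda>\<omega>. inner (\<zeta> \<omega>) (\<zeta>' \<omega>))"
proof -
  have "expectation (\<lambda>\<omega>. inner (\<zeta> \<omega>) (\<zeta>' \<omega>) * (W b \<omega> - W a \<omega>)\<^sup>2) =
      expectation (\<lambda>\<omega>. inner (\<zeta> \<omega>) (\<zeta>' \<omega>)) * expectation (\<lambda>\<omega>. (W b \<omega> - W a \<omega>)\<^sup>2)"
    by (rule expectation_mult_increment[OF assms(1)]) (use \<zeta> \<zeta>' L2_rv_integrable_inner in auto)
  then show ?thesis
    using increment_moments(3)[OF assms(1)] by (simp add: mult_ac power2_eq_square)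
qed

text \<open>The intervals are cut at \<open>c\<close> and at \<open>m = min b d\<close>. Of the six
  products of pieces only the one over the common part \<open>{c<..m}\<close> survives: four vanish
  because one increment is later than everything else in the product, and the product over the two
  pieces after \<open>m\<close> because one of these pieces is empty.\<close>

lemma elementary_inner:
  fixes \<zeta> \<zeta>' :: "'w \<Rightarrow> 'a::{real_inner, banach, second_countable_topology}"
  assumes "a \<le> b" "c \<le> d" "a \<le> c"
    and \<zeta>: "\<zeta> \<in> borel_measurable (Filt a)" "\<zeta> \<in> L2_rv M"
    and \<zeta>': "\<zeta>' \<in> borel_measurable (Filt c)" "\<zeta>' \<in> L2_rv M"
  shows "expectation (\<lambda>\<omega>. inner ((W b \<omega> - W a \<omega>) *\<^sub>R \<zeta> \<omega>) ((W d \<omega> - W c \<omega>) *\<^sub>R \<zeta>' \<omega>)) =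
    measure lborel ({a<..b} \<inter> {c<..d}) * expectation (\<lambda>\<omega>. inner (\<zeta> \<omega>) (\<zeta>' \<omega>))"
proof (cases "b \<le> c")
  case True
  have "{a<..b} \<inter> {c<..d} = {}" using True by auto
  then show ?thesis
    using increments_orthogonal[OF assms(1) True assms(2) increment_measurable_mono[OF assms(1) True \<zeta>(1)]
        increment_scaleR_L2[OF assms(1) \<zeta>] \<zeta>'] by (simp del: Int_greaterThanAtMost inner_scaleR_left inner_scaleR_right)
next
  case False
  define m where "m = min b d"
  have m: "a \<le> c" "c \<le> m" "m \<le> b" "m \<le> d" "{a<..b} \<inter> {c<..d} = {c<..m}" and bd: "m = b \<or> m = d"
    using assms False by (auto simp: m_def min_def)
  define e :: "real \<Rightarrow> real \<Rightarrow> 'w \<Rightarrow> 'a" where "e = (\<lambda>u v \<omega>. (W v \<omega> - W u \<omega>) *\<^sub>R \<zeta> \<omega>)"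
  define e' :: "real \<Rightarrow> real \<Rightarrow> 'w \<Rightarrow> 'a" where "e' = (\<lambda>u v \<omega>. (W v \<omega> - W u \<omega>) *\<^sub>R \<zeta>' \<omega>)"
  have z: "\<zeta> \<in> borel_measurable (Filt u)" if "a \<le> u" for u
    using measurable_increment_filtration_mono[OF \<zeta>(1) that] .
  have z': "\<zeta>' \<in> borel_measurable (Filt u)" if "c \<le> u" for u
    using measurable_increment_filtration_mono[OF \<zeta>'(1) that] .
  have eL: "e u v \<in> L2_rv M" if "a \<le> u" "u \<le> v" for u v
    unfolding e_def using increment_scaleR_L2[OF that(2) z[OF that(1)] \<zeta>(2)] .
  have eL': "e' u v \<in> L2_rv M" if "c \<le> u" "u \<le> v" for u v
    unfolding e'_def using increment_scaleR_L2[OF that(2) z'[OF that(1)] \<zeta>'(2)] .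
  have orth: "expectation (\<lambda>\<omega>. inner (e u v \<omega>) (e' u' v' \<omega>)) = 0"
    if "a \<le> u" "u \<le> v" "v \<le> u'" "u' \<le> v'" "c \<le> u'" for u v u' v'
    using increments_orthogonal[OF that(2-4) increment_measurable_mono[OF that(2,3) z[OF that(1)]]
        eL[OF that(1,2), unfolded e_def] z'[OF that(5)] \<zeta>'(2)]
    unfolding e_def e'_def .
  have orth': "expectation (\<lambda>\<omega>. inner (e u v \<omega>) (e' u' v' \<omega>)) = 0"
    if "c \<le> u'" "u' \<le> v'" "v' \<le> u" "u \<le> v" "a \<le> u" for u v u' v'
    using increments_orthogonal[OF that(2-4) increment_measurable_mono[OF that(2,3) z'[OF that(1)]]
        eL'[OF that(1,2), unfolded e'_def] z[OF that(5)] \<zeta>(2)]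
    unfolding e_def e'_def by (simp add: inner_commute mult.commute)
  have eq: "e a b = (\<lambda>\<omega>. e a c \<omega> + (e c m \<omega> + e m b \<omega>))" "e' c d = (\<lambda>\<omega>. e' c m \<omega> + e' m d \<omega>)"
    by (auto simp: e_def e'_def algebra_simps)
  have last: "expectation (\<lambda>\<omega>. inner (e m b \<omega>) (e' m d \<omega>)) = 0"
    using bd by (auto simp: e_def e'_def)
  have "expectation (\<lambda>\<omega>. inner (e a b \<omega>) (e' c d \<omega>)) = expectation (\<lambda>\<omega>.
      inner (e a c \<omega>) (e' c m \<omega>) + inner (e c m \<omega>) (e' c m \<omega>) + inner (e m b \<omega>) (e' c m \<omega>)
      + inner (e a c \<omega>) (e' m d \<omega>) + inner (e c m \<omega>) (e' m d \<omega>) + inner (e m b \<omega>) (e' m d \<omega>))"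
    unfolding eq by (simp add: inner_add_left inner_add_right algebra_simps)
  also have "\<dots> = expectation (\<lambda>\<omega>. inner (e a c \<omega>) (e' c m \<omega>)) + expectation (\<lambda>\<omega>. inner (e c m \<omega>) (e' c m \<omega>))
     + expectation (\<lambda>\<omega>. inner (e m b \<omega>) (e' c m \<omega>)) + expectation (\<lambda>\<omega>. inner (e a c \<omega>) (e' m d \<omega>))
     + expectation (\<lambda>\<omega>. inner (e c m \<omega>) (e' m d \<omega>)) + expectation (\<lambda>\<omega>. inner (e m b \<omega>) (e' m d \<omega>))"
    using m by (simp add: L2_rv_integrable_inner eL eL')
  also have "\<dots> = expectation (\<lambda>\<omega>. inner (e c m \<omega>) (e' c m \<omega>))"
    using m last by (simp add: orth orth')
  also have "\<dots> = (m - c) * expectation (\<lambda>\<omega>. inner (\<zeta> \<omega>) (\<zeta>' \<omega>))"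
    unfolding e_def e'_def by (rule same_increment_inner[OF m(2) z[OF m(1)] \<zeta>(2) \<zeta>'])
  finally show ?thesis
    using m by (simp add: e_def e'_def)
qed

lemma elementary_process_L2:
  fixes \<zeta> :: "'w \<Rightarrow> 'a::{real_inner, banach, second_countable_topology}"
  assumes \<zeta>: "\<zeta> \<in> L2_rv M"
  shows "(\<lambda>x. indicat_real {a<..b} (fst x) *\<^sub>R \<zeta> (snd x)) \<in> L2_rv LM"
proof -
  note [measurable] = L2_rv_measurable[OF \<zeta>]
  have "(\<integral>\<^sup>+x. ennreal ((norm (indicat_real {a<..b} (fst x) *\<^sub>R \<zeta> (snd x)))\<^sup>2) \<partial>LM)
     = (\<integral>\<^sup>+s. \<integral>\<^sup>+\<omega>. indicator {a<..b} s * ennreal ((norm (\<zeta> \<omega>))\<^sup>2) \<partial>M \<partial>lborel)"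
    by (subst nn_integral_fst[symmetric]) (auto intro!: nn_integral_cong simp: indicator_def)
  also have "\<dots> = ennreal ((L2_norm M \<zeta>)\<^sup>2) * emeasure lborel {a<..b}"
    by (simp add: nn_integral_cmult nn_integral_multc nn_integral_L2[OF \<zeta>] mult.commute)
  also have "\<dots> < \<infinity>"
    by (cases "a \<le> b") (auto simp: ennreal_mult_less_top)
  finally show ?thesis by (simp add: L2_rv_iff_nn)
qed

lemma elementary_process_inner:
  fixes \<zeta> \<zeta>' :: "'w \<Rightarrow> 'a::{real_inner, banach, second_countable_topology}"
  assumes \<zeta>: "\<zeta> \<in> L2_rv M" "\<zeta>' \<in> L2_rv M"
  shows "(\<integral>x. inner (indicat_real {a<..b} (fst x) *\<^sub>R \<zeta> (snd x)) (indicat_real {c<..d} (fst x) *\<^sub>R \<zeta>' (snd x)) \<partial>LM)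
    = measure lborel ({a<..b} \<inter> {c<..d}) * expectation (\<lambda>\<omega>. inner (\<zeta> \<omega>) (\<zeta>' \<omega>))"
proof -
  have "(\<integral>x. inner (indicat_real {a<..b} (fst x) *\<^sub>R \<zeta> (snd x)) (indicat_real {c<..d} (fst x) *\<^sub>R \<zeta>' (snd x)) \<partial>LM)
    = (\<integral>s. \<integral>\<omega>. inner (indicat_real {a<..b} s *\<^sub>R \<zeta> \<omega>) (indicat_real {c<..d} s *\<^sub>R \<zeta>' \<omega>) \<partial>M \<partial>lborel)"
    by (subst LM.integral_fst'[symmetric, OF L2_rv_integrable_inner])
      (simp_all add: elementary_process_L2[OF \<zeta>(1)] elementary_process_L2[OF \<zeta>(2)])
  also have "\<dots> = (\<integral>s. expectation (\<lambda>\<omega>. inner (\<zeta> \<omega>) (\<zeta>' \<omega>)) * indicat_real ({a<..b} \<inter> {c<..d}) s \<partial>lborel)"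
    by (intro Bochner_Integration.integral_cong refl) (auto simp: indicator_def)
  finally show ?thesis by (simp add: mult.commute)
qed

lemma simple_ito_pairs_L2:
  fixes p :: "real \<times> 'w \<Rightarrow> 'a::{real_inner, banach, second_countable_topology}"
  assumes "(p, S) \<in> simple_ito_pairs M W T"
  shows "p \<in> L2_rv LM" "S \<in> L2_rv M" "S \<in> borel_measurable (Filt T)"
proof -
  have "p \<in> L2_rv LM \<and> S \<in> L2_rv M \<and> S \<in> borel_measurable (Filt T)" using assms
  proof (induction rule: simple_ito_pairs.induct)
    case (step p S a b \<zeta>)
    then show ?case
      by (auto intro!: L2_rv_add elementary_process_L2 increment_scaleR_L2 borel_measurable_add increment_measurable_mono)
  qed auto
  then show "p \<in> L2_rv LM" "S \<in> L2_rv M" "S \<in> borel_measurable (Filt T)" by auto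
qed

lemma elementary_simple_inner:
  fixes p :: "real \<times> 'w \<Rightarrow> 'a::{real_inner, banach, second_countable_topology}"
  assumes "(p, S) \<in> simple_ito_pairs M W T"
    and c: "c \<le> d" and \<zeta>': "\<zeta>' \<in> borel_measurable (Filt c)" "\<zeta>' \<in> L2_rv M"
  shows "expectation (\<lambda>\<omega>. inner (S \<omega>) ((W d \<omega> - W c \<omega>) *\<^sub>R \<zeta>' \<omega>)) =
     (\<integral>x. inner (p x) (indicat_real {c<..d} (fst x) *\<^sub>R \<zeta>' (snd x)) \<partial>LM)"
  using assms(1)
proof (induction rule: simple_ito_pairs.induct)
  case (step p S a b \<zeta>)
  have "expectation (\<lambda>\<omega>. inner ((W b \<omega> - W a \<omega>) *\<^sub>R \<zeta> \<omega>) ((W d \<omega> - W c \<omega>) *\<^sub>R \<zeta>' \<omega>)) =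
    measure lborel ({a<..b} \<inter> {c<..d}) * expectation (\<lambda>\<omega>. inner (\<zeta> \<omega>) (\<zeta>' \<omega>))"
  proof (cases "a \<le> c")
    case True
    then show ?thesis by (intro elementary_inner) (use step c \<zeta>' in auto)
  next
    case False
    \<comment> \<open>\<open>elementary_inner\<close> wants the interval that starts first on the
      left; here the two swap roles by symmetry.\<close>
    then have "expectation (\<lambda>\<omega>. inner ((W d \<omega> - W c \<omega>) *\<^sub>R \<zeta>' \<omega>) ((W b \<omega> - W a \<omega>) *\<^sub>R \<zeta> \<omega>)) =
      measure lborel ({c<..d} \<inter> {a<..b}) * expectation (\<lambda>\<omega>. inner (\<zeta>' \<omega>) (\<zeta> \<omega>))"
      by (intro elementary_inner) (use step c \<zeta>' in auto)
    then show ?thesis by (simp add: inner_commute Int_commute mult_ac)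
  qed
  also have "\<dots> = (\<integral>x. inner (indicat_real {a<..b} (fst x) *\<^sub>R \<zeta> (snd x)) (indicat_real {c<..d} (fst x) *\<^sub>R \<zeta>' (snd x)) \<partial>LM)"
    by (rule elementary_process_inner[symmetric]) (use step \<zeta>' in auto)
  finally have 1: "expectation (\<lambda>\<omega>. inner ((W b \<omega> - W a \<omega>) *\<^sub>R \<zeta> \<omega>) ((W d \<omega> - W c \<omega>) *\<^sub>R \<zeta>' \<omega>)) = \<dots>" .
  have "expectation (\<lambda>\<omega>. inner ((W b \<omega> - W a \<omega>) *\<^sub>R \<zeta> \<omega> + S \<omega>) ((W d \<omega> - W c \<omega>) *\<^sub>R \<zeta>' \<omega>)) =
    expectation (\<lambda>\<omega>. inner ((W b \<omega> - W a \<omega>) *\<^sub>R \<zeta> \<omega>) ((W d \<omega> - W c \<omega>) *\<^sub>R \<zeta>' \<omega>)) +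
    expectation (\<lambda>\<omega>. inner (S \<omega>) ((W d \<omega> - W c \<omega>) *\<^sub>R \<zeta>' \<omega>))"
    unfolding inner_add_left using step c \<zeta>' simple_ito_pairs_L2(2)[OF step(1)]
    by (intro Bochner_Integration.integral_add L2_rv_integrable_inner increment_scaleR_L2) auto
  also have "\<dots> = (\<integral>x. inner (indicat_real {a<..b} (fst x) *\<^sub>R \<zeta> (snd x)) (indicat_real {c<..d} (fst x) *\<^sub>R \<zeta>' (snd x)) \<partial>LM)
    + (\<integral>x. inner (p x) (indicat_real {c<..d} (fst x) *\<^sub>R \<zeta>' (snd x)) \<partial>LM)"
    using 1 step.IH by simp
  also have "\<dots> = (\<integral>x. inner (indicat_real {a<..b} (fst x) *\<^sub>R \<zeta> (snd x) + p x) (indicat_real {c<..d} (fst x) *\<^sub>R \<zeta>' (snd x)) \<partial>LM)"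
    unfolding inner_add_left using step \<zeta>' simple_ito_pairs_L2(1)[OF step(1)]
    by (intro Bochner_Integration.integral_add[symmetric] L2_rv_integrable_inner elementary_process_L2) auto
  finally show ?case .
qed simp

text \<open>Induction over the second pair; \<open>elementary_simple_inner\<close> has done the same
  over the first. Working with inner products rather than norms is what lets both arguments be built
  up one step at a time.\<close>

lemma simple_ito_pairs_inner:
  fixes p :: "real \<times> 'w \<Rightarrow> 'a::{real_inner, banach, second_countable_topology}"
  assumes S: "(p, S) \<in> simple_ito_pairs M W T" and "(p', S') \<in> simple_ito_pairs M W T"
  shows "expectation (\<lambda>\<omega>. inner (S \<omega>) (S' \<omega>)) = (\<integral>x. inner (p x) (p' x) \<partial>LM)"
  using assms(2)
proof (induction rule: simple_ito_pairs.induct)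
  case (step p' S' a b \<zeta>)
  note L = simple_ito_pairs_L2[OF S] simple_ito_pairs_L2[OF step(1)]
  have "expectation (\<lambda>\<omega>. inner (S \<omega>) ((W b \<omega> - W a \<omega>) *\<^sub>R \<zeta> \<omega> + S' \<omega>)) =
    expectation (\<lambda>\<omega>. inner (S \<omega>) ((W b \<omega> - W a \<omega>) *\<^sub>R \<zeta> \<omega>)) + expectation (\<lambda>\<omega>. inner (S \<omega>) (S' \<omega>))"
    unfolding inner_add_right using step L
    by (intro Bochner_Integration.integral_add L2_rv_integrable_inner increment_scaleR_L2) auto
  also have "\<dots> = (\<integral>x. inner (p x) (indicat_real {a<..b} (fst x) *\<^sub>R \<zeta> (snd x)) \<partial>LM) + (\<integral>x. inner (p x) (p' x) \<partial>LM)"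
    using elementary_simple_inner[OF S step(2,4,5)] step.IH by simp
  also have "\<dots> = (\<integral>x. inner (p x) (indicat_real {a<..b} (fst x) *\<^sub>R \<zeta> (snd x) + p' x) \<partial>LM)"
    unfolding inner_add_right using step L
    by (intro Bochner_Integration.integral_add[symmetric] L2_rv_integrable_inner elementary_process_L2) auto
  finally show ?case .
qed simp

lemma simple_ito_pairs_isometry:
  assumes "(p, S) \<in> simple_ito_pairs M W T"
  shows "L2_norm M S = L2_norm LM p"
  using simple_ito_pairs_inner[OF assms assms] by (simp add: L2_norm_def power2_norm_eq_inner)

text \<open>The closure of \<open>simple_ito_pairs\<close> in \<open>L\<^sup>2\<close>. The integrand lives on the whole time line, so unbounded
  intervals of integration need no separate treatment.\<close>

definition ito :: "real \<Rightarrow> (real \<times> 'w \<Rightarrow> 'a::{real_inner, banach, second_countable_topology}) \<Rightarrow> ('w \<Rightarrow> 'a) \<Rightarrow> bool" where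
  "ito T g I \<longleftrightarrow> g \<in> L2_rv LM \<and> I \<in> L2_rv M \<and>
    (\<forall>\<epsilon>>0. \<exists>p S. (p, S) \<in> simple_ito_pairs M W T \<and>
       L2_norm LM (\<lambda>x. p x - g x) < \<epsilon> \<and> L2_norm M (\<lambda>\<omega>. S \<omega> - I \<omega>) < \<epsilon>)"

lemma ito_L2:
  assumes "ito T g I" shows "g \<in> L2_rv LM" "I \<in> L2_rv M"
  using assms by (auto simp: ito_def)

lemma ito_simple: "(p, S) \<in> simple_ito_pairs M W T \<Longrightarrow> ito T p S"
  unfolding ito_def using simple_ito_pairs_L2[of p S T] by fastforce

lemma ito_mono:
  assumes "ito T g I" "T \<le> T'" shows "ito T' g I"
  using assms simple_ito_pairs_mono[OF _ assms(2)] unfolding ito_def by metis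

lemma ito_diff:
  assumes 1: "ito T g I" and 2: "ito T g' I'"
  shows "ito T (\<lambda>x. g x - g' x) (\<lambda>\<omega>. I \<omega> - I' \<omega>)"
  unfolding ito_def
proof (intro conjI allI impI)
  show "(\<lambda>x. g x - g' x) \<in> L2_rv LM" "(\<lambda>\<omega>. I \<omega> - I' \<omega>) \<in> L2_rv M"
    using assms[THEN ito_L2(1)] assms[THEN ito_L2(2)] by auto
  fix \<epsilon> :: real assume "0 < \<epsilon>"
  then have e: "0 < \<epsilon> / 2" by simp
  obtain p S where p: "(p, S) \<in> simple_ito_pairs M W T"
    "L2_norm LM (\<lambda>x. p x - g x) < \<epsilon> / 2" "L2_norm M (\<lambda>\<omega>. S \<omega> - I \<omega>) < \<epsilon> / 2"
    using 1 e unfolding ito_def by blast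
  obtain p' S' where p': "(p', S') \<in> simple_ito_pairs M W T"
    "L2_norm LM (\<lambda>x. p' x - g' x) < \<epsilon> / 2" "L2_norm M (\<lambda>\<omega>. S' \<omega> - I' \<omega>) < \<epsilon> / 2"
    using 2 e unfolding ito_def by blast
  note L = simple_ito_pairs_L2(1,2)[OF p(1)] simple_ito_pairs_L2(1,2)[OF p'(1)] ito_L2[OF 1] ito_L2[OF 2]
  have "L2_norm LM (\<lambda>x. (p x - g x) - (p' x - g' x)) < \<epsilon>"
    using L2_norm_triangle_diff[OF L2_rv_diff[OF L(1,5)] L2_rv_diff[OF L(3,7)]] p p' by simp
  moreover have "L2_norm M (\<lambda>\<omega>. (S \<omega> - I \<omega>) - (S' \<omega> - I' \<omega>)) < \<epsilon>"
    using L2_norm_triangle_diff[OF L2_rv_diff[OF L(2,6)] L2_rv_diff[OF L(4,8)]] p p' by simp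
  ultimately show "\<exists>p S. (p, S) \<in> simple_ito_pairs M W T \<and>
       L2_norm LM (\<lambda>x. p x - (g x - g' x)) < \<epsilon> \<and> L2_norm M (\<lambda>\<omega>. S \<omega> - (I \<omega> - I' \<omega>)) < \<epsilon>"
    using simple_ito_pairs_diff[OF p(1) p'(1)] by (intro exI[of _ "\<lambda>x. p x - p' x"] exI[of _ "\<lambda>\<omega>. S \<omega> - S' \<omega>"])
      (auto simp: algebra_simps)
qed

lemma ito_isometry:
  assumes "ito T g I" shows "L2_norm M I = L2_norm LM g"
proof -
  note L = ito_L2[OF assms]
  have *: "L2_norm M I \<le> L2_norm LM g + \<epsilon> \<and> L2_norm LM g \<le> L2_norm M I + \<epsilon>" if "0 < \<epsilon>" for \<epsilon>
  proof -
    have e: "0 < \<epsilon> / 2" using that by simp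
    obtain p S where p: "(p, S) \<in> simple_ito_pairs M W T"
      "L2_norm LM (\<lambda>x. p x - g x) < \<epsilon> / 2" "L2_norm M (\<lambda>\<omega>. S \<omega> - I \<omega>) < \<epsilon> / 2"
      using assms e unfolding ito_def by blast
    note L' = simple_ito_pairs_L2[OF p(1)]
    show ?thesis
      using L2_norm_triangle_sub[OF L(2) L'(2)] L2_norm_triangle_sub[OF L'(2) L(2)]
        L2_norm_triangle_sub[OF L(1) L'(1)] L2_norm_triangle_sub[OF L'(1) L(1)] p(2,3)
        simple_ito_pairs_isometry[OF p(1)]
      by (simp add: L2_norm_minus_commute[of M I] L2_norm_minus_commute[of LM g])
  qed
  show ?thesis
    by (rule order_antisym; rule field_le_epsilon) (simp_all add: *)
qed

lemma ito_cong:
  assumes 1: "ito T g I" and g': "g' \<in> borel_measurable LM" "AE x in LM. g' x = g x"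
    and I': "I' \<in> borel_measurable M" "AE \<omega> in M. I' \<omega> = I \<omega>"
  shows "ito T g' I'"
proof -
  note L = ito_L2[OF 1]
  have *: "L2_norm LM (\<lambda>x. p x - g' x) = L2_norm LM (\<lambda>x. p x - g x)"
    "L2_norm M (\<lambda>\<omega>. S \<omega> - I' \<omega>) = L2_norm M (\<lambda>\<omega>. S \<omega> - I \<omega>)"
    if "(p, S) \<in> simple_ito_pairs M W T" for p S
  proof -
    note [measurable] = simple_ito_pairs_L2(1,2)[OF that, THEN L2_rv_measurable] L[THEN L2_rv_measurable] g'(1) I'(1)
    show "L2_norm LM (\<lambda>x. p x - g' x) = L2_norm LM (\<lambda>x. p x - g x)"
      by (rule L2_norm_cong_AE) (use g'(2) in auto)
    show "L2_norm M (\<lambda>\<omega>. S \<omega> - I' \<omega>) = L2_norm M (\<lambda>\<omega>. S \<omega> - I \<omega>)"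
      by (rule L2_norm_cong_AE) (use I'(2) in auto)
  qed
  show ?thesis
    unfolding ito_def
  proof (intro conjI allI impI)
    fix \<epsilon> :: real assume "0 < \<epsilon>"
    then obtain p S where "(p, S) \<in> simple_ito_pairs M W T"
      "L2_norm LM (\<lambda>x. p x - g x) < \<epsilon>" "L2_norm M (\<lambda>\<omega>. S \<omega> - I \<omega>) < \<epsilon>"
      using 1 unfolding ito_def by blast
    with *[of p S] show "\<exists>p S. (p, S) \<in> simple_ito_pairs M W T \<and>
       L2_norm LM (\<lambda>x. p x - g' x) < \<epsilon> \<and> L2_norm M (\<lambda>\<omega>. S \<omega> - I' \<omega>) < \<epsilon>"
      by (intro exI[of _ p] exI[of _ S]) simp
  qed (rule L2_rv_cong_AE[OF L(1) g'] L2_rv_cong_AE[OF L(2) I'])+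
qed

lemma ito_unique:
  assumes "ito T g I" "ito T g' I'" "AE x in LM. g x = g' x"
  shows "AE \<omega> in M. I \<omega> = I' \<omega>"
proof -
  have "L2_norm M (\<lambda>\<omega>. I \<omega> - I' \<omega>) = L2_norm LM (\<lambda>x. g x - g' x)"
    by (rule ito_isometry[OF ito_diff[OF assms(1,2)]])
  also have "\<dots> = L2_norm LM (\<lambda>x. 0 :: 'a)"
    by (rule L2_norm_cong_AE) (use assms(3) L2_rv_measurable[OF L2_rv_diff[OF ito_L2(1)[OF assms(1)] ito_L2(1)[OF assms(2)]]] in auto)
  finally show ?thesis
    by (intro L2_norm_diff_eq_0_AE) (use ito_L2(2)[OF assms(1)] ito_L2(2)[OF assms(2)] in auto)
qed

lemma ito_blinfun:
  fixes g :: "real \<times> 'w \<Rightarrow> 'a::{real_inner, banach, second_countable_topology}" and B :: "'a \<Rightarrow>\<^sub>L 'a"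
  assumes 1: "ito T g I"
  shows "ito T (\<lambda>x. blinfun_apply B (g x)) (\<lambda>\<omega>. blinfun_apply B (I \<omega>))"
  unfolding ito_def
proof (intro conjI allI impI)
  note L = ito_L2[OF 1]
  show "(\<lambda>x. blinfun_apply B (g x)) \<in> L2_rv LM" "(\<lambda>\<omega>. blinfun_apply B (I \<omega>)) \<in> L2_rv M"
    using L by (auto intro: L2_rv_blinfun)
  fix \<epsilon> :: real assume "0 < \<epsilon>"
  \<comment> \<open>The summand 1 keeps the denominator positive when \<open>B\<close> is 0.\<close>
  then have "0 < \<epsilon> / (norm B + 1)" by (simp add: add_nonneg_pos)
  then obtain p S where p: "(p, S) \<in> simple_ito_pairs M W T"
    "L2_norm LM (\<lambda>x. p x - g x) < \<epsilon> / (norm B + 1)" "L2_norm M (\<lambda>\<omega>. S \<omega> - I \<omega>) < \<epsilon> / (norm B + 1)"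
    using 1 unfolding ito_def by blast
  note L' = simple_ito_pairs_L2[OF p(1)]
  have le: "norm B * e < \<epsilon>" if "e < \<epsilon> / (norm B + 1)" "0 \<le> e" for e
  proof -
    have "norm B * e \<le> (norm B + 1) * e" using that by (simp add: algebra_simps)
    also have "\<dots> < \<epsilon>" using that by (simp add: pos_less_divide_eq add_nonneg_pos mult.commute)
    finally show ?thesis .
  qed
  have "L2_norm LM (\<lambda>x. blinfun_apply B (p x - g x)) < \<epsilon>"
    using L2_norm_blinfun[OF L2_rv_diff[OF L'(1) L(1)], of B] le[OF p(2)] by simp
  moreover have "L2_norm M (\<lambda>\<omega>. blinfun_apply B (S \<omega> - I \<omega>)) < \<epsilon>"
    using L2_norm_blinfun[OF L2_rv_diff[OF L'(2) L(2)], of B] le[OF p(3)] by simp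
  ultimately show "\<exists>p S. (p, S) \<in> simple_ito_pairs M W T \<and>
     L2_norm LM (\<lambda>x. p x - blinfun_apply B (g x)) < \<epsilon> \<and> L2_norm M (\<lambda>\<omega>. S \<omega> - blinfun_apply B (I \<omega>)) < \<epsilon>"
    using simple_ito_pairs_blinfun[OF p(1), of B]
    by (intro exI[of _ "\<lambda>x. blinfun_apply B (p x)"] exI[of _ "\<lambda>\<omega>. blinfun_apply B (S \<omega>)"]) (simp add: blinfun.diff_right)
qed

text \<open>Errors \<open>(1/2)^k\<close> make the differences of the step integrals summable by the
  isometry, so these converge to a limit measurable at time \<open>T\<close>. The approximants may
  themselves be integrals from the closure, so that bounded intervals can be used to reach the half
  line.\<close>

lemma ito_exists:
  assumes g: "g \<in> L2_rv LM"
    and approx: "\<And>\<epsilon>. 0 < \<epsilon> \<Longrightarrow> \<exists>g' I'. ito T g' I' \<and> L2_norm LM (\<lambda>x. g' x - g x) < \<epsilon>"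
  obtains I where "I \<in> borel_measurable (Filt T)" "ito T g I"
proof -
  have "\<exists>pS. pS \<in> simple_ito_pairs M W T \<and> L2_norm LM (\<lambda>x. fst pS x - g x) < (1/2) ^ k" for k
  proof -
    have pos: "0 < (1/2::real) ^ k / 2" by simp
    obtain g' I' where 1: "ito T g' I'" "L2_norm LM (\<lambda>x. g' x - g x) < (1/2::real) ^ k / 2"
      using approx[OF pos] by blast
    obtain p S where 2: "(p, S) \<in> simple_ito_pairs M W T" "L2_norm LM (\<lambda>x. p x - g' x) < (1/2::real) ^ k / 2"
      using 1(1) pos unfolding ito_def by blast
    have "L2_norm LM (\<lambda>x. p x - g x) < (1/2) ^ k"
      using L2_norm_diff_triangle[OF simple_ito_pairs_L2(1)[OF 2(1)] ito_L2(1)[OF 1(1)] g] 1 2 by simp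
    with 2(1) show ?thesis by auto
  qed
  then obtain pS where pS: "\<And>k. pS k \<in> simple_ito_pairs M W T" "\<And>k. L2_norm LM (\<lambda>x. fst (pS k) x - g x) < (1/2) ^ k"
    by metis
  define p S where "p = (\<lambda>k. fst (pS k))" and "S = (\<lambda>k. snd (pS k))"
  have p: "(p k, S k) \<in> simple_ito_pairs M W T" and pg: "L2_norm LM (\<lambda>x. p k x - g x) < (1/2) ^ k" for k
    using pS by (auto simp: p_def S_def)
  note L = simple_ito_pairs_L2[OF p]
  have bd: "L2_norm M (\<lambda>\<omega>. S (Suc k) \<omega> - S k \<omega>) \<le> 2 * (1/2) ^ k" for k
  proof -
    have "L2_norm M (\<lambda>\<omega>. S (Suc k) \<omega> - S k \<omega>) = L2_norm LM (\<lambda>x. p (Suc k) x - p k x)"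
      by (rule simple_ito_pairs_isometry[OF simple_ito_pairs_diff[OF p p]])
    also have "\<dots> \<le> L2_norm LM (\<lambda>x. p (Suc k) x - g x) + L2_norm LM (\<lambda>x. g x - p k x)"
      by (rule L2_norm_diff_triangle[OF L(1) g L(1)])
    also have "\<dots> \<le> (1/2) ^ Suc k + (1/2) ^ k"
      using pg[of "Suc k"] pg[of k] by (simp add: L2_norm_minus_commute[of LM g])
    finally show ?thesis
      using zero_le_power[of "1/2::real" k] unfolding power_Suc by linarith
  qed
  have summ: "summable (\<lambda>k. L2_norm M (\<lambda>\<omega>. S (Suc k) \<omega> - S k \<omega>))"
  proof (rule summable_comparison_test'[where N=0])
    show "summable (\<lambda>k. 2 * (1/2::real) ^ k)" by (rule summable_mult[OF summable_geometric]) simp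
  qed (use bd in simp)
  obtain I where I: "I \<in> borel_measurable (Filt T)" "I \<in> L2_rv M" "(\<lambda>k. L2_norm M (\<lambda>\<omega>. I \<omega> - S k \<omega>)) \<longlonglongrightarrow> 0"
    by (rule L2_limit_subalgebra[OF subalgebra_Filt L(2,3) summ])
  have "ito T g I"
    unfolding ito_def
  proof (intro conjI allI impI g I(2))
    fix \<epsilon> :: real assume "0 < \<epsilon>"
    have "(\<lambda>k. (1/2::real) ^ k) \<longlonglongrightarrow> 0" by (rule LIMSEQ_power_zero) simp
    from order_tendstoD(2)[OF this \<open>0 < \<epsilon>\<close>] order_tendstoD(2)[OF I(3) \<open>0 < \<epsilon>\<close>]
    have "\<forall>\<^sub>F k in sequentially. (1/2::real) ^ k < \<epsilon> \<and> L2_norm M (\<lambda>\<omega>. I \<omega> - S k \<omega>) < \<epsilon>"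
      by (rule eventually_conj)
    then obtain k where "(1/2::real) ^ k < \<epsilon>" "L2_norm M (\<lambda>\<omega>. I \<omega> - S k \<omega>) < \<epsilon>"
      using eventually_happens'[OF sequentially_bot] by blast
    with p[of k] pg[of k] show "\<exists>p S. (p, S) \<in> simple_ito_pairs M W T \<and>
       L2_norm LM (\<lambda>x. p x - g x) < \<epsilon> \<and> L2_norm M (\<lambda>\<omega>. S \<omega> - I \<omega>) < \<epsilon>"
      by (intro exI[of _ "p k"] exI[of _ "S k"]) (auto simp: L2_norm_minus_commute[of M I])
  qed
  with I(1) show thesis by (rule that)
qed

end

section \<open>Riemann sums, fourth moments and progressive versions\<close>

text \<open>Square integrability of the limit is part of the conclusion:
  \<open>has_ito_integral\<close> does not state it for \<open>g\<close> and \<open>I\<close>, but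
  one finite error term forces it.\<close>

lemma L2_tendsto_nn:
  fixes X :: "nat \<Rightarrow> 'w \<Rightarrow> 'a::{real_inner, banach, second_countable_topology}"
  assumes X: "\<And>k. X k \<in> L2_rv N" and Y: "Y \<in> borel_measurable N"
    and lim: "(\<lambda>k. \<integral>\<^sup>+\<omega>. ennreal ((norm (X k \<omega> - Y \<omega>))\<^sup>2) \<partial>N) \<longlonglongrightarrow> 0"
  shows "Y \<in> L2_rv N" "(\<lambda>k. L2_norm N (\<lambda>\<omega>. X k \<omega> - Y \<omega>)) \<longlonglongrightarrow> 0"
proof -
  note [measurable] = Y L2_rv_measurable[OF X]
  have "\<forall>\<^sub>F k in sequentially. (\<integral>\<^sup>+\<omega>. ennreal ((norm (X k \<omega> - Y \<omega>))\<^sup>2) \<partial>N) < 1"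
    using lim by (rule order_tendstoD) simp
  then obtain k where "(\<integral>\<^sup>+\<omega>. ennreal ((norm (X k \<omega> - Y \<omega>))\<^sup>2) \<partial>N) < 1"
    using eventually_happens'[OF sequentially_bot] by blast
  from less_trans[OF this ennreal_one_less_top] have "(\<lambda>\<omega>. X k \<omega> - Y \<omega>) \<in> L2_rv N"
    by (simp add: L2_rv_iff_nn)
  from L2_rv_diff[OF X[of k] this] show Y2: "Y \<in> L2_rv N" by simp
  have "(\<lambda>k. ennreal ((L2_norm N (\<lambda>\<omega>. X k \<omega> - Y \<omega>))\<^sup>2)) \<longlonglongrightarrow> ennreal 0"
    using lim by (simp add: nn_integral_L2[OF L2_rv_diff[OF X Y2]])
  then have "(\<lambda>k. (L2_norm N (\<lambda>\<omega>. X k \<omega> - Y \<omega>))\<^sup>2) \<longlonglongrightarrow> 0"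
    by (subst (asm) tendsto_ennreal_iff) auto
  from tendsto_real_sqrt[OF this] show "(\<lambda>k. L2_norm N (\<lambda>\<omega>. X k \<omega> - Y \<omega>)) \<longlonglongrightarrow> 0"
    by simp
qed

lemma nn_tendsto_L2:
  assumes X: "\<And>k. X k \<in> L2_rv N" and Y: "Y \<in> L2_rv N"
    and lim: "(\<lambda>k. L2_norm N (\<lambda>\<omega>. X k \<omega> - Y \<omega>)) \<longlonglongrightarrow> 0"
  shows "(\<lambda>k. \<integral>\<^sup>+\<omega>. ennreal ((norm (X k \<omega> - Y \<omega>))\<^sup>2) \<partial>N) \<longlonglongrightarrow> 0"
proof -
  have "(\<lambda>k. ennreal ((L2_norm N (\<lambda>\<omega>. X k \<omega> - Y \<omega>))\<^sup>2)) \<longlonglongrightarrow> ennreal (0\<^sup>2)"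
    by (intro tendsto_ennrealI tendsto_power lim)
  then show ?thesis
    by (simp add: nn_integral_L2[OF L2_rv_diff[OF X Y]])
qed

lemma measurable_restrict_pair:
  "(\<lambda>x. x) \<in> measurable (restrict_space lborel A \<Otimes>\<^sub>M M) (lborel \<Otimes>\<^sub>M M)"
proof -
  have "fst \<in> measurable (restrict_space lborel A \<Otimes>\<^sub>M M) lborel"
    by (rule measurable_compose[OF measurable_fst]) (rule measurable_restrict_space1, simp)
  then have "(\<lambda>x. (fst x, snd x)) \<in> measurable (restrict_space lborel A \<Otimes>\<^sub>M M) (lborel \<Otimes>\<^sub>M M)"
    by (intro measurable_Pair measurable_snd) simp
  then show ?thesis by simp
qed

lemma partition_mono:
  fixes \<tau> :: "nat \<Rightarrow> real"
  assumes mono: "\<And>i. i < n \<Longrightarrow> \<tau> i \<le> \<tau> (Suc i)" and "j \<le> k" "k \<le> n"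
  shows "\<tau> j \<le> \<tau> k"
  using assms(2,3)
proof (induction k rule: dec_induct)
  case (step m)
  then show ?case using mono[of m] by simp
qed simp

lemma simple_process_eq:
  assumes mono: "\<And>i. i < n \<Longrightarrow> \<tau> i \<le> \<tau> (Suc i)" and i: "i < n" "\<tau> i < s" "s \<le> \<tau> (Suc i)"
  shows "simple_process n \<tau> \<zeta> s \<omega> = \<zeta> i \<omega>"
proof -
  have le: "\<tau> j \<le> \<tau> k" if "j \<le> k" "k \<le> n" for j k
    by (rule partition_mono[of n]) (use that in \<open>auto intro: mono\<close>)
  have z: "indicat_real {\<tau> j<..\<tau> (Suc j)} s *\<^sub>R \<zeta> j \<omega> = 0" if "j \<in> {..<n} - {i}" for j
  proof -
    have "s \<notin> {\<tau> j<..\<tau> (Suc j)}"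
    proof (cases "j < i")
      case True
      then show ?thesis using le[of "Suc j" i] i by auto
    next
      case False
      then show ?thesis using le[of "Suc i" j] i that by auto
    qed
    then show ?thesis by simp
  qed
  have "simple_process n \<tau> \<zeta> s \<omega> = indicat_real {\<tau> i<..\<tau> (Suc i)} s *\<^sub>R \<zeta> i \<omega> +
      (\<Sum>j\<in>{..<n} - {i}. indicat_real {\<tau> j<..\<tau> (Suc j)} s *\<^sub>R \<zeta> j \<omega>)"
    unfolding simple_process_def by (rule sum.remove) (use i in auto)
  also have "(\<Sum>j\<in>{..<n} - {i}. indicat_real {\<tau> j<..\<tau> (Suc j)} s *\<^sub>R \<zeta> j \<omega>) = 0"
    by (rule sum.neutral) (use z in blast)
  finally show ?thesis using i by simp
qed

lemma simple_process_outside: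
  assumes "\<And>i. i < n \<Longrightarrow> \<tau> i \<le> \<tau> (Suc i)" "s \<notin> {\<tau> 0<..\<tau> n}"
  shows "simple_process n \<tau> \<zeta> s \<omega> = 0"
proof -
  have le: "\<tau> j \<le> \<tau> k" if "j \<le> k" "k \<le> n" for j k
    by (rule partition_mono[of n]) (use that in \<open>auto intro: assms(1)\<close>)
  have "s \<notin> {\<tau> j<..\<tau> (Suc j)}" if "j < n" for j
    using le[of 0 j] le[of "Suc j" n] that assms(2) by auto
  then show ?thesis unfolding simple_process_def by (intro sum.neutral ballI) (simp add: indicator_def)
qed

lemma partition_interval:
  fixes \<tau> :: "nat \<Rightarrow> real"
  assumes "\<tau> 0 < s" "s \<le> \<tau> n"
  obtains i where "i < n" "\<tau> i < s" "s \<le> \<tau> (Suc i)"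
proof -
  have "\<exists>i<n. \<tau> i < s \<and> s \<le> \<tau> (Suc i)" using assms(2)
  proof (induction n)
    case (Suc n)
    then show ?case by (cases "s \<le> \<tau> n") (auto simp: less_Suc_eq not_le)
  qed (use assms(1) in auto)
  with that show thesis by blast
qed

section \<open>Sums over left end points, their moments, and progressive processes\<close>

context wiener_process
begin

lemma nn_integral_restrict_pair:
  fixes h :: "real \<times> 'w \<Rightarrow> 'a::{real_inner, banach, second_countable_topology}"
  assumes A: "A \<in> sets borel" and h: "h \<in> borel_measurable (restrict_space lborel A \<Otimes>\<^sub>M M)"
  shows "(\<integral>\<^sup>+x. ennreal ((norm (h x))\<^sup>2) \<partial>(restrict_space lborel A \<Otimes>\<^sub>M M)) =
    (\<integral>\<^sup>+x. ennreal ((norm (indicat_real A (fst x) *\<^sub>R h x))\<^sup>2) \<partial>LM)"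
proof -
  note [measurable] = h indicator_times_measurable[OF A h]
  have "(\<integral>\<^sup>+x. ennreal ((norm (h x))\<^sup>2) \<partial>(restrict_space lborel A \<Otimes>\<^sub>M M)) =
    (\<integral>\<^sup>+s. \<integral>\<^sup>+\<omega>. ennreal ((norm (h (s, \<omega>)))\<^sup>2) \<partial>M \<partial>restrict_space lborel A)"
    by (subst nn_integral_fst[symmetric]) auto
  also have "\<dots> = (\<integral>\<^sup>+s. (\<integral>\<^sup>+\<omega>. ennreal ((norm (h (s, \<omega>)))\<^sup>2) \<partial>M) * indicator A s \<partial>lborel)"
    by (rule nn_integral_restrict_space) (use A in simp)
  also have "\<dots> = (\<integral>\<^sup>+s. \<integral>\<^sup>+\<omega>. ennreal ((norm (indicat_real A s *\<^sub>R h (s, \<omega>)))\<^sup>2) \<partial>M \<partial>lborel)"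
    by (intro nn_integral_cong) (auto simp: indicator_def)
  also have "\<dots> = (\<integral>\<^sup>+x. ennreal ((norm (indicat_real A (fst x) *\<^sub>R h x))\<^sup>2) \<partial>LM)"
  proof -
    have "(\<lambda>x. ennreal ((norm (indicat_real A (fst x) *\<^sub>R h x))\<^sup>2)) \<in> borel_measurable LM"
      by measurable
    from nn_integral_fst[OF this] show ?thesis by simp
  qed
  finally show ?thesis .
qed

lemma simple_integrand_pairs:
  fixes \<zeta> :: "nat \<Rightarrow> 'w \<Rightarrow> 'a::{real_inner, banach, second_countable_topology}"
  assumes "simple_integrand M W a b n \<tau> \<zeta>"
  shows "((\<lambda>x. simple_process n \<tau> \<zeta> (fst x) (snd x)), simple_ito W n \<tau> \<zeta>) \<in> simple_ito_pairs M W b"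
proof -
  have le: "\<tau> j \<le> \<tau> k" if "j \<le> k" "k \<le> n" for j k
    by (rule partition_mono[of n]) (use that assms in \<open>auto simp: simple_integrand_def\<close>)
  have "((\<lambda>x. simple_process k \<tau> \<zeta> (fst x) (snd x)), simple_ito W k \<tau> \<zeta>) \<in> simple_ito_pairs M W b" if "k \<le> n" for k
    using that
  proof (induction k)
    case 0
    have "simple_ito W 0 \<tau> \<zeta> = (\<lambda>\<omega>. 0)" by (auto simp: simple_ito_def)
    then show ?case using simple_ito_pairs.zero by (simp add: simple_process_def)
  next
    case (Suc k)
    have "((\<lambda>x. indicat_real {\<tau> k<..\<tau> (Suc k)} (fst x) *\<^sub>R \<zeta> k (snd x) + simple_process k \<tau> \<zeta> (fst x) (snd x)),
      (\<lambda>\<omega>. (W (\<tau> (Suc k)) \<omega> - W (\<tau> k) \<omega>) *\<^sub>R \<zeta> k \<omega> + simple_ito W k \<tau> \<zeta> \<omega>)) \<in> simple_ito_pairs M W b"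
      by (rule simple_ito_pairs.step) (use Suc assms le[of "Suc k" n] in \<open>auto simp: simple_integrand_def\<close>)
    also have "(\<lambda>\<omega>. (W (\<tau> (Suc k)) \<omega> - W (\<tau> k) \<omega>) *\<^sub>R \<zeta> k \<omega> + simple_ito W k \<tau> \<zeta> \<omega>) = simple_ito W (Suc k) \<tau> \<zeta>"
      by (auto simp: simple_ito_def add.commute)
    finally show ?case by (simp add: simple_process_def add.commute)
  qed
  then show ?thesis by simp
qed

text \<open>Uniqueness and the isometry are proved for \<open>ito\<close>, so every integral met in
  the equation is first moved there, its integrand extended by 0 outside
  \<open>{a..b}\<close>.\<close>

lemma has_ito_integral_imp_ito:
  fixes g :: "real \<Rightarrow> 'w \<Rightarrow> 'a::{real_inner, banach, second_countable_topology}"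
  assumes "has_ito_integral M W a b g I"
  shows "ito b (\<lambda>x. indicat_real {a..b} (fst x) *\<^sub>R g (fst x) (snd x)) I"
proof -
  let ?R = "restrict_space lborel {a..b} \<Otimes>\<^sub>M M"
  let ?g = "\<lambda>x. indicat_real {a..b} (fst x) *\<^sub>R g (fst x) (snd x)"
  obtain n \<tau> \<zeta> where gm: "(\<lambda>(s, \<omega>). g s \<omega>) \<in> borel_measurable ?R" and Im: "I \<in> borel_measurable M"
    and si: "\<And>k. simple_integrand M W a b (n k) (\<tau> k) (\<zeta> k)"
    and l1: "(\<lambda>k. \<integral>\<^sup>+ (s, \<omega>). ennreal ((norm (simple_process (n k) (\<tau> k) (\<zeta> k) s \<omega> - g s \<omega>))\<^sup>2) \<partial>?R) \<longlonglongrightarrow> 0"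
    and l2: "(\<lambda>k. \<integral>\<^sup>+ \<omega>. ennreal ((norm (simple_ito W (n k) (\<tau> k) (\<zeta> k) \<omega> - I \<omega>))\<^sup>2) \<partial>M) \<longlonglongrightarrow> 0"
    using assms unfolding has_ito_integral_def by blast
  define p where "p = (\<lambda>k x. simple_process (n k) (\<tau> k) (\<zeta> k) (fst x) (snd x))"
  define S where "S = (\<lambda>k. simple_ito W (n k) (\<tau> k) (\<zeta> k))"
  have p: "(p k, S k) \<in> simple_ito_pairs M W b" for k
    unfolding p_def S_def by (rule simple_integrand_pairs[OF si])
  note L = simple_ito_pairs_L2[OF p]
  have g': "(\<lambda>x. g (fst x) (snd x)) \<in> borel_measurable ?R"
    using gm by (simp add: case_prod_beta')
  have gL: "?g \<in> borel_measurable LM"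
    by (rule indicator_times_measurable[OF _ g']) simp
  have pR: "p k \<in> borel_measurable ?R" for k
    by (rule measurable_compose[OF measurable_restrict_pair L2_rv_measurable[OF L(1)]])
  \<comment> \<open>Outside \<open>{a..b}\<close> the step process vanishes as well, so the
    indicator may be put in front of the whole difference.\<close>
  have eq: "p k x - ?g x = indicat_real {a..b} (fst x) *\<^sub>R (p k x - g (fst x) (snd x))" for k x
    using simple_process_outside[of "n k" "\<tau> k" "fst x" "\<zeta> k" "snd x"] si[of k]
    by (auto simp: p_def simple_integrand_def indicator_def)
  have "(\<lambda>k. \<integral>\<^sup>+ x. ennreal ((norm (p k x - ?g x))\<^sup>2) \<partial>LM) \<longlonglongrightarrow> 0"
    using l1 unfolding eq
    by (subst nn_integral_restrict_pair[symmetric]) (use pR g' in \<open>auto simp: p_def case_prod_beta'\<close>)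
  from L2_tendsto_nn[OF L(1) gL this] have 1: "?g \<in> L2_rv LM" "(\<lambda>k. L2_norm LM (\<lambda>x. p k x - ?g x)) \<longlonglongrightarrow> 0" .
  from L2_tendsto_nn[OF L(2) Im, unfolded S_def, OF l2]
  have 2: "I \<in> L2_rv M" "(\<lambda>k. L2_norm M (\<lambda>x. S k x - I x)) \<longlonglongrightarrow> 0" by (auto simp: S_def)
  show ?thesis
    unfolding ito_def
  proof (intro conjI allI impI 1(1) 2(1))
    fix \<epsilon> :: real assume "0 < \<epsilon>"
    from order_tendstoD(2)[OF 1(2) this] order_tendstoD(2)[OF 2(2) this]
    have "\<forall>\<^sub>F k in sequentially. L2_norm LM (\<lambda>x. p k x - ?g x) < \<epsilon> \<and> L2_norm M (\<lambda>x. S k x - I x) < \<epsilon>"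
      by (rule eventually_conj)
    then obtain k where "L2_norm LM (\<lambda>x. p k x - ?g x) < \<epsilon>" "L2_norm M (\<lambda>x. S k x - I x) < \<epsilon>"
      using eventually_happens'[OF sequentially_bot] by blast
    with p[of k] show "\<exists>p S. (p, S) \<in> simple_ito_pairs M W b \<and>
      L2_norm LM (\<lambda>x. p x - ?g x) < \<epsilon> \<and> L2_norm M (\<lambda>\<omega>. S \<omega> - I \<omega>) < \<epsilon>" by blast
  qed
qed

text \<open>Index \<open>n\<close> stands for \<open>Suc n\<close> pieces, which avoids a division
  by 0 at \<open>n = 0\<close>.\<close>

definition uniform_partition :: "real \<Rightarrow> real \<Rightarrow> nat \<Rightarrow> nat \<Rightarrow> real" where
  "uniform_partition a b n i = a + real i * (b - a) / real (Suc n)"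

definition ito_sum :: "real \<Rightarrow> real \<Rightarrow> (real \<Rightarrow> 'w \<Rightarrow> 'a::{real_inner, banach, second_countable_topology}) \<Rightarrow> nat \<Rightarrow> 'w \<Rightarrow> 'a" where
  "ito_sum a b g n = simple_ito W (Suc n) (uniform_partition a b n) (\<lambda>i. g (uniform_partition a b n i))"

lemma uniform_partition:
  assumes "a \<le> b"
  shows "uniform_partition a b n 0 = a" "uniform_partition a b n (Suc n) = b"
    "uniform_partition a b n i \<le> uniform_partition a b n (Suc i)"
    "uniform_partition a b n (Suc i) - uniform_partition a b n i = (b - a) / real (Suc n)"
    "i \<le> Suc n \<Longrightarrow> uniform_partition a b n i \<in> {a..b}"
proof -
  show "uniform_partition a b n 0 = a" "uniform_partition a b n (Suc n) = b"
    by (simp_all add: uniform_partition_def)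
  show *: "uniform_partition a b n (Suc i) - uniform_partition a b n i = (b - a) / real (Suc n)" for i
    by (simp add: uniform_partition_def add_divide_distrib[symmetric] diff_divide_distrib[symmetric] algebra_simps)
  have "0 \<le> (b - a) / real (Suc n)" using assms by simp
  with * show "uniform_partition a b n i \<le> uniform_partition a b n (Suc i)" by (simp add: algebra_simps)
  assume "i \<le> Suc n"
  then have "real i * (b - a) / real (Suc n) \<le> real (Suc n) * (b - a) / real (Suc n)"
    using assms by (intro divide_right_mono mult_right_mono) auto
  then show "uniform_partition a b n i \<in> {a..b}"
    using assms by (simp add: uniform_partition_def)
qed

text \<open>For integrands continuous in L2 the sums over left end points of uniform partitions
  converge. They remain in the conclusion because fourth moments are estimated on them. Continuity
  is required only along sequences inside \<open>{a..b}\<close>: the kernel used later is cut off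
  after the upper end point and jumps there.\<close>

lemma has_ito_integral_exists:
  fixes g :: "real \<Rightarrow> 'w \<Rightarrow> 'a::{real_inner, banach, second_countable_topology}"
  assumes ab: "a \<le> b"
    and gm: "(\<lambda>(s, \<omega>). g s \<omega>) \<in> borel_measurable (restrict_space lborel {a..b} \<Otimes>\<^sub>M M)"
    and g: "\<And>s. s \<in> {a..b} \<Longrightarrow> g s \<in> borel_measurable (Filt s)" "\<And>s. s \<in> {a..b} \<Longrightarrow> g s \<in> L2_rv M"
    and bound: "\<And>s. s \<in> {a..b} \<Longrightarrow> L2_norm M (g s) \<le> K"
    and cont: "\<And>s f. s \<in> {a..b} \<Longrightarrow> (\<And>n::nat. f n \<in> {a..b}) \<Longrightarrow> f \<longlonglongrightarrow> s \<Longrightarrow>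
        (\<lambda>n. L2_norm M (\<lambda>\<omega>. g (f n) \<omega> - g s \<omega>)) \<longlonglongrightarrow> 0"
  obtains I where "I \<in> borel_measurable (Filt b)" "has_ito_integral M W a b g I"
    "\<And>n. ito_sum a b g n \<in> L2_rv M"
    "(\<lambda>n. L2_norm M (\<lambda>\<omega>. ito_sum a b g n \<omega> - I \<omega>)) \<longlonglongrightarrow> 0"
proof -
  let ?R = "restrict_space lborel {a..b} \<Otimes>\<^sub>M M"
  let ?g = "\<lambda>x. indicat_real {a..b} (fst x) *\<^sub>R g (fst x) (snd x)"
  let ?\<tau> = "uniform_partition a b"
  define p where "p = (\<lambda>n x. simple_process (Suc n) (?\<tau> n) (\<lambda>i. g (?\<tau> n i)) (fst x) (snd x))"
  note up = uniform_partition[OF ab]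
  have si: "simple_integrand M W a b (Suc n) (?\<tau> n) (\<lambda>i. g (?\<tau> n i))" for n
    unfolding simple_integrand_def using up g by (metis less_imp_le)
  have p: "(p n, ito_sum a b g n) \<in> simple_ito_pairs M W b" for n
    unfolding p_def ito_sum_def by (rule simple_integrand_pairs[OF si])
  note L = simple_ito_pairs_L2[OF p]
  have g': "(\<lambda>x. g (fst x) (snd x)) \<in> borel_measurable ?R"
    using gm by (simp add: case_prod_beta')
  have gL[measurable]: "?g \<in> borel_measurable LM"
    by (rule indicator_times_measurable[OF _ g']) simp
  note [measurable] = L2_rv_measurable[OF L(1)]
  have bound': "0 \<le> K" using order_trans[OF L2_norm_nonneg bound[of a]] ab by simp
  have left: "\<exists>l\<in>{a..b}. \<bar>l - s\<bar> \<le> (b - a) / real (Suc n) \<and> (\<forall>\<omega>. p n (s, \<omega>) = g l \<omega>)" if s: "s \<in> {a<..b}" for s n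
  proof -
    obtain i where i: "i < Suc n" "?\<tau> n i < s" "s \<le> ?\<tau> n (Suc i)"
      by (rule partition_interval[of "?\<tau> n" s "Suc n"]) (use s up in auto)
    have "p n (s, \<omega>) = g (?\<tau> n i) \<omega>" for \<omega>
      unfolding p_def by (subst simple_process_eq[of "Suc n" "?\<tau> n" i]) (use i up in auto)
    moreover have "\<bar>?\<tau> n i - s\<bar> \<le> (b - a) / real (Suc n)"
      using i up(4)[of n i] by linarith
    ultimately show ?thesis using up(5)[of i n] i by (intro bexI[of _ "?\<tau> n i"]) auto
  qed
  then obtain l where l: "\<And>s n. s \<in> {a<..b} \<Longrightarrow> l s n \<in> {a..b}"
    "\<And>s n. s \<in> {a<..b} \<Longrightarrow> \<bar>l s n - s\<bar> \<le> (b - a) / real (Suc n)"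
    "\<And>s n \<omega>. s \<in> {a<..b} \<Longrightarrow> p n (s, \<omega>) = g (l s n) \<omega>" by metis
  have ll: "l s \<longlonglongrightarrow> s" if "s \<in> {a<..b}" for s
  proof -
    have "(\<lambda>n. (b - a) / real (Suc n)) \<longlonglongrightarrow> 0"
      by (rule LIMSEQ_Suc[OF lim_const_over_n])
    then have "(\<lambda>n. l s n - s) \<longlonglongrightarrow> 0"
      by (rule Lim_null_comparison[rotated]) (use l(2)[OF that] in auto)
    then show ?thesis by (rule LIM_zero_cancel)
  qed
  \<comment> \<open>The error is integrated over \<omega> first. As a function of time it tends to 0
    by continuity of \<open>g\<close> in L2 and is dominated by \<open>(2 * K)^2\<close> on the
    interval.\<close>
  define u where "u = (\<lambda>n s. \<integral>\<^sup>+\<omega>. ennreal ((norm (p n (s, \<omega>) - ?g (s, \<omega>)))\<^sup>2) \<partial>M)"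
  have u_eq: "u n s = ennreal ((L2_norm M (\<lambda>\<omega>. g (l s n) \<omega> - g s \<omega>))\<^sup>2)" if "s \<in> {a<..b}" for n s
    unfolding u_def using that l(1,3)[OF that, of n]
    by (subst nn_integral_L2[symmetric]) (auto intro!: nn_integral_cong L2_rv_diff g)
  have u_0: "u n s = 0" if "s \<notin> {a..b}" for n s
  proof -
    have "p n (s, \<omega>) = 0" for \<omega>
      unfolding p_def fst_conv snd_conv by (rule simple_process_outside) (use up that in auto)
    with that show ?thesis by (simp add: u_def)
  qed
  \<comment> \<open>No half open interval of the partition contains \<open>a\<close>, so at this one
    time the step process is 0 whatever \<open>g a\<close> is.\<close>
  have AE_a: "AE s in lborel. s \<noteq> a" by (rule AE_lborel_singleton)
  have "(\<lambda>n. \<integral>\<^sup>+s. u n s \<partial>lborel) \<longlonglongrightarrow> (\<integral>\<^sup>+(s::real). 0 \<partial>lborel)"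
  proof (rule nn_integral_dominated_convergence)
    show "u n \<in> borel_measurable lborel" for n
      unfolding u_def by measurable
    show "(\<lambda>s. ennreal ((2 * K)\<^sup>2) * indicator {a..b} s) \<in> borel_measurable lborel" by simp
    show "AE s in lborel. u n s \<le> ennreal ((2 * K)\<^sup>2) * indicator {a..b} s" for n
      using AE_a
    proof eventually_elim
      fix s assume "s \<noteq> a"
      show "u n s \<le> ennreal ((2 * K)\<^sup>2) * indicator {a..b} s"
      proof (cases "s \<in> {a..b}")
        case True
        with \<open>s \<noteq> a\<close> have s: "s \<in> {a<..b}" by auto
        have "L2_norm M (\<lambda>\<omega>. g (l s n) \<omega> - g s \<omega>) \<le> L2_norm M (g (l s n)) + L2_norm M (g s)"
          by (rule L2_norm_triangle_diff) (use g l(1)[OF s] s in auto)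
        also have "\<dots> \<le> 2 * K" using bound[OF l(1)[OF s, of n]] bound[of s] s by simp
        finally have "(L2_norm M (\<lambda>\<omega>. g (l s n) \<omega> - g s \<omega>))\<^sup>2 \<le> (2 * K)\<^sup>2" by (rule power_mono) simp
        then show ?thesis using True by (simp add: u_eq[OF s] ennreal_leI)
      qed (simp add: u_0)
    qed
    show "(\<integral>\<^sup>+s. ennreal ((2 * K)\<^sup>2) * indicator {a..b} s \<partial>lborel) < \<infinity>"
      using ab by (simp add: nn_integral_cmult ennreal_mult_less_top)
    show "AE s in lborel. (\<lambda>n. u n s) \<longlonglongrightarrow> 0"
      using AE_a
    proof eventually_elim
      fix s assume "s \<noteq> a"
      show "(\<lambda>n. u n s) \<longlonglongrightarrow> 0"
      proof (cases "s \<in> {a..b}")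
        case True
        with \<open>s \<noteq> a\<close> have s: "s \<in> {a<..b}" by auto
        have "(\<lambda>n. ennreal ((L2_norm M (\<lambda>\<omega>. g (l s n) \<omega> - g s \<omega>))\<^sup>2)) \<longlonglongrightarrow> ennreal (0\<^sup>2)"
          by (intro tendsto_ennrealI tendsto_power cont) (use True l(1)[OF s] ll[OF s] in auto)
        then show ?thesis by (simp add: u_eq[OF s])
      qed (simp add: u_0)
    qed
  qed auto
  then have lim: "(\<lambda>n. \<integral>\<^sup>+x. ennreal ((norm (p n x - ?g x))\<^sup>2) \<partial>LM) \<longlonglongrightarrow> 0"
    unfolding u_def by (subst nn_integral_fst[symmetric]) auto
  from L2_tendsto_nn[OF L(1) gL lim]
  have g2: "?g \<in> L2_rv LM" and lim2: "(\<lambda>n. L2_norm LM (\<lambda>x. p n x - ?g x)) \<longlonglongrightarrow> 0" .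
  obtain I where I: "I \<in> borel_measurable (Filt b)" "ito b ?g I"
  proof (rule ito_exists[OF g2])
    fix \<epsilon> :: real assume "0 < \<epsilon>"
    from order_tendstoD(2)[OF lim2 this]
    obtain n where "L2_norm LM (\<lambda>x. p n x - ?g x) < \<epsilon>"
      using eventually_happens'[OF sequentially_bot] by blast
    with ito_simple[OF p[of n]] show "\<exists>g' I'. ito b g' I' \<and> L2_norm LM (\<lambda>x. g' x - ?g x) < \<epsilon>" by blast
  qed
  have limI: "(\<lambda>n. L2_norm M (\<lambda>\<omega>. ito_sum a b g n \<omega> - I \<omega>)) \<longlonglongrightarrow> 0"
    using lim2 ito_isometry[OF ito_diff[OF ito_simple[OF p] I(2)]] by simp
  have pR: "p n \<in> borel_measurable ?R" for n
    by (rule measurable_compose[OF measurable_restrict_pair L2_rv_measurable[OF L(1)]])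
  have eq: "p n x - ?g x = indicat_real {a..b} (fst x) *\<^sub>R (p n x - g (fst x) (snd x))" for n x
  proof (cases "fst x \<in> {a..b}")
    case False
    then have "p n x = 0"
      unfolding p_def by (intro simple_process_outside) (use up in auto)
    with False show ?thesis by simp
  qed simp
  have "(\<lambda>n. \<integral>\<^sup>+x. ennreal ((norm (p n x - g (fst x) (snd x)))\<^sup>2) \<partial>?R) \<longlonglongrightarrow> 0"
    using lim unfolding eq by (subst nn_integral_restrict_pair) (use pR g' in auto)
  then have lim': "(\<lambda>n. \<integral>\<^sup>+(s, \<omega>). ennreal ((norm (simple_process (Suc n) (?\<tau> n) (\<lambda>i. g (?\<tau> n i)) s \<omega> - g s \<omega>))\<^sup>2) \<partial>?R) \<longlonglongrightarrow> 0"
    by (simp add: p_def case_prod_beta')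
  have "has_ito_integral M W a b g I"
    unfolding has_ito_integral_def
    using gm Filt_measurable_M[OF I(1)] si lim' nn_tendsto_L2[OF L(2) ito_L2(2)[OF I(2)] limI, unfolded ito_sum_def]
    by (intro conjI exI[of _ Suc] exI[of _ ?\<tau>] exI[of _ "\<lambda>n i. g (?\<tau> n i)"]) auto
  with I(1) L(2) limI show thesis by (intro that[of I])
qed

text \<open>The odd moments of the increment vanish, and in this form the bound telescopes along a partition: the
  square root of the fourth moment grows by at most \<open>3 (b - a) c\<^sup>2\<close> in one step.\<close>

lemma fourth_moment_step:
  fixes S \<zeta> :: "'w \<Rightarrow> 'a::{real_inner, banach, second_countable_topology}"
  assumes ab: "a \<le> b"
    and S: "S \<in> borel_measurable (Filt a)" "integrable M (\<lambda>\<omega>. norm (S \<omega>) ^ 4)" "expectation (\<lambda>\<omega>. norm (S \<omega>) ^ 4) \<le> s\<^sup>2" "0 \<le> s"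
    and \<zeta>: "\<zeta> \<in> borel_measurable (Filt a)" "integrable M (\<lambda>\<omega>. norm (\<zeta> \<omega>) ^ 4)" "expectation (\<lambda>\<omega>. norm (\<zeta> \<omega>) ^ 4) \<le> c ^ 4"
  defines "S' \<equiv> \<lambda>\<omega>. S \<omega> + (W b \<omega> - W a \<omega>) *\<^sub>R \<zeta> \<omega>"
  shows "integrable M (\<lambda>\<omega>. norm (S' \<omega>) ^ 4)" "expectation (\<lambda>\<omega>. norm (S' \<omega>) ^ 4) \<le> (s + 3 * (b - a) * c\<^sup>2)\<^sup>2"
proof -
  let ?D = "\<lambda>\<omega>. W b \<omega> - W a \<omega>"
  let ?i = "\<lambda>\<omega>. inner (S \<omega>) (\<zeta> \<omega>)"
  note [measurable] = Filt_measurable_M[OF S(1)] Filt_measurable_M[OF \<zeta>(1)]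
  have p4: "(x\<^sup>2)\<^sup>2 = x ^ 4" for x :: real by (simp flip: power_mult)
  have SL: "(\<lambda>\<omega>. (norm (S \<omega>))\<^sup>2) \<in> L2_rv M" and zL: "(\<lambda>\<omega>. (norm (\<zeta> \<omega>))\<^sup>2) \<in> L2_rv M"
    using S(2) \<zeta>(2) by (simp_all add: L2_rv_def p4)
  have mix: "integrable M (\<lambda>\<omega>. (norm (S \<omega>))\<^sup>2 * (norm (\<zeta> \<omega>))\<^sup>2)"
    using L2_rv_integrable_norm_mult[OF SL zL] by simp
  have L2S: "L2_norm M (\<lambda>\<omega>. (norm (S \<omega>))\<^sup>2) \<le> s"
    using S(3,4) by (simp add: L2_norm_def p4 real_le_lsqrt)
  have L2z: "L2_norm M (\<lambda>\<omega>. (norm (\<zeta> \<omega>))\<^sup>2) \<le> c\<^sup>2"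
  proof -
    have "L2_norm M (\<lambda>\<omega>. (norm (\<zeta> \<omega>))\<^sup>2) = sqrt (expectation (\<lambda>\<omega>. norm (\<zeta> \<omega>) ^ 4))"
      by (simp add: L2_norm_def p4)
    also have "\<dots> \<le> sqrt (c ^ 4)" by (rule real_sqrt_le_mono[OF \<zeta>(3)])
    also have "sqrt (c ^ 4) = c\<^sup>2" by (rule real_sqrt_unique[OF p4]) simp
    finally show ?thesis .
  qed
  have mixle: "expectation (\<lambda>\<omega>. (norm (S \<omega>))\<^sup>2 * (norm (\<zeta> \<omega>))\<^sup>2) \<le> s * c\<^sup>2"
    using order_trans[OF L2_norm_Cauchy_Schwarz[OF SL zL] mult_mono[OF L2S L2z]] S(4) by simp
  have i2: "integrable M (\<lambda>\<omega>. (?i \<omega>)\<^sup>2)"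
  proof (rule Bochner_Integration.integrable_bound[OF mix])
    show "AE \<omega> in M. norm ((?i \<omega>)\<^sup>2) \<le> norm ((norm (S \<omega>))\<^sup>2 * (norm (\<zeta> \<omega>))\<^sup>2)"
      using Cauchy_Schwarz_ineq[of "S _" "\<zeta> _"] by (intro AE_I2) (simp add: power2_norm_eq_inner)
  qed measurable
  have iL: "?i \<in> L2_rv M" using i2 by (simp add: L2_rv_def)
  have ile: "expectation (\<lambda>\<omega>. (?i \<omega>)\<^sup>2) \<le> s * c\<^sup>2"
  proof (rule order_trans[OF integral_mono[OF i2 mix] mixle])
    show "(?i \<omega>)\<^sup>2 \<le> (norm (S \<omega>))\<^sup>2 * (norm (\<zeta> \<omega>))\<^sup>2" for \<omega>
      using Cauchy_Schwarz_ineq[of "S \<omega>" "\<zeta> \<omega>"] by (simp add: power2_norm_eq_inner)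
  qed
  have Si: "integrable M (\<lambda>\<omega>. (norm (S \<omega>))\<^sup>2 * ?i \<omega>)" and zi: "integrable M (\<lambda>\<omega>. (norm (\<zeta> \<omega>))\<^sup>2 * ?i \<omega>)"
    using L2_rv_integrable_inner[OF SL iL] L2_rv_integrable_inner[OF zL iL] by (simp_all add: inner_real_def)
  have F: "(\<lambda>\<omega>. (norm (S \<omega>))\<^sup>2 * ?i \<omega>) \<in> borel_measurable (Filt a)" "(\<lambda>\<omega>. (norm (\<zeta> \<omega>))\<^sup>2 * ?i \<omega>) \<in> borel_measurable (Filt a)"
    "(\<lambda>\<omega>. (?i \<omega>)\<^sup>2) \<in> borel_measurable (Filt a)" "(\<lambda>\<omega>. (norm (S \<omega>))\<^sup>2 * (norm (\<zeta> \<omega>))\<^sup>2) \<in> borel_measurable (Filt a)"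
    "(\<lambda>\<omega>. norm (\<zeta> \<omega>) ^ 4) \<in> borel_measurable (Filt a)"
    using S(1) \<zeta>(1) by measurable
  note IM = integrable_mult_increment[OF ab] and EM = expectation_mult_increment[OF ab]
  note mom = increment_moments(2-5)[OF ab]
  \<comment> \<open>The square of \<open>|S|^2 + 2 D i + D^2 |\<zeta>|^2\<close>, with
    \<open>D\<close> the increment and \<open>i\<close> the inner product. The two terms with an odd
    power of \<open>D\<close> have expectation 0.\<close>
  have expand: "norm (S' \<omega>) ^ 4 = norm (S \<omega>) ^ 4 + 4 * ((?i \<omega>)\<^sup>2 * (?D \<omega>)\<^sup>2) + norm (\<zeta> \<omega>) ^ 4 * (?D \<omega>) ^ 4
      + 4 * (((norm (S \<omega>))\<^sup>2 * ?i \<omega>) * (?D \<omega>) ^ 1) + 2 * (((norm (S \<omega>))\<^sup>2 * (norm (\<zeta> \<omega>))\<^sup>2) * (?D \<omega>)\<^sup>2)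
      + 4 * (((norm (\<zeta> \<omega>))\<^sup>2 * ?i \<omega>) * (?D \<omega>) ^ 3)" for \<omega>
  proof -
    have "norm (S' \<omega>) ^ 4 = ((norm (S \<omega>))\<^sup>2 + 2 * ?D \<omega> * ?i \<omega> + (?D \<omega>)\<^sup>2 * (norm (\<zeta> \<omega>))\<^sup>2)\<^sup>2"
      unfolding p4[symmetric] S'_def power2_norm_eq_inner
      by (simp add: inner_add_left inner_add_right inner_commute algebra_simps power2_eq_square)
    then show ?thesis by (simp add: p4[symmetric] power2_eq_square power3_eq_cube algebra_simps)
  qed
  have "has_bochner_integral M (\<lambda>\<omega>. norm (S' \<omega>) ^ 4)
     (expectation (\<lambda>\<omega>. norm (S \<omega>) ^ 4) + 4 * (expectation (\<lambda>\<omega>. (?i \<omega>)\<^sup>2) * (b - a)) + expectation (\<lambda>\<omega>. norm (\<zeta> \<omega>) ^ 4) * (3 * (b - a)\<^sup>2)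
      + 4 * (expectation (\<lambda>\<omega>. (norm (S \<omega>))\<^sup>2 * ?i \<omega>) * 0)
      + 2 * (expectation (\<lambda>\<omega>. (norm (S \<omega>))\<^sup>2 * (norm (\<zeta> \<omega>))\<^sup>2) * (b - a))
      + 4 * (expectation (\<lambda>\<omega>. (norm (\<zeta> \<omega>))\<^sup>2 * ?i \<omega>) * 0))"
    unfolding expand
  proof (intro has_bochner_integral_add has_bochner_integral_mult_right)
    show "has_bochner_integral M (\<lambda>\<omega>. norm (S \<omega>) ^ 4) (expectation (\<lambda>\<omega>. norm (S \<omega>) ^ 4))"
      using S(2) by (rule has_bochner_integral_integrable)
    show "has_bochner_integral M (\<lambda>\<omega>. (?i \<omega>)\<^sup>2 * (?D \<omega>)\<^sup>2) (expectation (\<lambda>\<omega>. (?i \<omega>)\<^sup>2) * (b - a))"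
      using IM[OF F(3) i2, of 2] EM[OF F(3) i2, of 2] mom by (simp add: has_bochner_integral_iff)
    show "has_bochner_integral M (\<lambda>\<omega>. norm (\<zeta> \<omega>) ^ 4 * (?D \<omega>) ^ 4) (expectation (\<lambda>\<omega>. norm (\<zeta> \<omega>) ^ 4) * (3 * (b - a)\<^sup>2))"
      using IM[OF F(5) \<zeta>(2), of 4] EM[OF F(5) \<zeta>(2), of 4] mom by (simp add: has_bochner_integral_iff)
    show "has_bochner_integral M (\<lambda>\<omega>. ((norm (S \<omega>))\<^sup>2 * ?i \<omega>) * (?D \<omega>) ^ 1) (expectation (\<lambda>\<omega>. (norm (S \<omega>))\<^sup>2 * ?i \<omega>) * 0)"
      using IM[OF F(1) Si, of 1] EM[OF F(1) Si, of 1] mom by (simp add: has_bochner_integral_iff)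
    show "has_bochner_integral M (\<lambda>\<omega>. ((norm (S \<omega>))\<^sup>2 * (norm (\<zeta> \<omega>))\<^sup>2) * (?D \<omega>)\<^sup>2)
      (expectation (\<lambda>\<omega>. (norm (S \<omega>))\<^sup>2 * (norm (\<zeta> \<omega>))\<^sup>2) * (b - a))"
      using IM[OF F(4) mix, of 2] EM[OF F(4) mix, of 2] mom by (simp add: has_bochner_integral_iff)
    show "has_bochner_integral M (\<lambda>\<omega>. ((norm (\<zeta> \<omega>))\<^sup>2 * ?i \<omega>) * (?D \<omega>) ^ 3) (expectation (\<lambda>\<omega>. (norm (\<zeta> \<omega>))\<^sup>2 * ?i \<omega>) * 0)"
      using IM[OF F(2) zi, of 3] EM[OF F(2) zi, of 3] mom by (simp add: has_bochner_integral_iff)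
  qed
  then show "integrable M (\<lambda>\<omega>. norm (S' \<omega>) ^ 4)"
    and "expectation (\<lambda>\<omega>. norm (S' \<omega>) ^ 4) \<le> (s + 3 * (b - a) * c\<^sup>2)\<^sup>2"
  proof (simp_all only: has_bochner_integral_iff)
    \<comment> \<open>Both mixed moments are at most \<open>s c^2\<close> by Cauchy-Schwarz, and
      their coefficients add up to 6. The Gaussian factor 3 in front of \<open>(b - a)^2\<close> is
      enlarged to 9 so that the sum becomes a perfect square.\<close>
    have "expectation (\<lambda>\<omega>. norm (S \<omega>) ^ 4) + 4 * (expectation (\<lambda>\<omega>. (?i \<omega>)\<^sup>2) * (b - a)) + expectation (\<lambda>\<omega>. norm (\<zeta> \<omega>) ^ 4) * (3 * (b - a)\<^sup>2)
      + 2 * (expectation (\<lambda>\<omega>. (norm (S \<omega>))\<^sup>2 * (norm (\<zeta> \<omega>))\<^sup>2) * (b - a))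
      \<le> s\<^sup>2 + 4 * (s * c\<^sup>2 * (b - a)) + c ^ 4 * (9 * (b - a)\<^sup>2) + 2 * (s * c\<^sup>2 * (b - a))"
      using S(3) ile mixle \<zeta>(3) ab by (intro add_mono mult_left_mono mult_right_mono mult_mono) auto
    also have "\<dots> = (s + 3 * (b - a) * c\<^sup>2)\<^sup>2"
      by (simp add: p4[symmetric] power2_eq_square algebra_simps)
    finally show "expectation (\<lambda>\<omega>. norm (S \<omega>) ^ 4) + 4 * (expectation (\<lambda>\<omega>. (?i \<omega>)\<^sup>2) * (b - a)) + expectation (\<lambda>\<omega>. norm (\<zeta> \<omega>) ^ 4) * (3 * (b - a)\<^sup>2)
      + 4 * (expectation (\<lambda>\<omega>. (norm (S \<omega>))\<^sup>2 * ?i \<omega>) * 0)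
      + 2 * (expectation (\<lambda>\<omega>. (norm (S \<omega>))\<^sup>2 * (norm (\<zeta> \<omega>))\<^sup>2) * (b - a))
      + 4 * (expectation (\<lambda>\<omega>. (norm (\<zeta> \<omega>))\<^sup>2 * ?i \<omega>) * 0) \<le> (s + 3 * (b - a) * c\<^sup>2)\<^sup>2" by simp
  qed
qed

text \<open>Each interval has its own bound \<open>c i\<close>: with exponentially decaying bounds
  the sum stays bounded however long the interval of integration is.\<close>

lemma fourth_moment_simple_ito:
  fixes \<zeta> :: "nat \<Rightarrow> 'w \<Rightarrow> 'a::{real_inner, banach, second_countable_topology}"
  assumes mono: "\<And>i. i < n \<Longrightarrow> \<tau> i \<le> \<tau> (Suc i)"
    and \<zeta>: "\<And>i. i < n \<Longrightarrow> \<zeta> i \<in> borel_measurable (Filt (\<tau> i))"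
      "\<And>i. i < n \<Longrightarrow> integrable M (\<lambda>\<omega>. norm (\<zeta> i \<omega>) ^ 4)"
      "\<And>i. i < n \<Longrightarrow> expectation (\<lambda>\<omega>. norm (\<zeta> i \<omega>) ^ 4) \<le> c i ^ 4"
  shows "integrable M (\<lambda>\<omega>. norm (simple_ito W n \<tau> \<zeta> \<omega>) ^ 4)"
    "expectation (\<lambda>\<omega>. norm (simple_ito W n \<tau> \<zeta> \<omega>) ^ 4) \<le> (3 * (\<Sum>i<n. (\<tau> (Suc i) - \<tau> i) * (c i)\<^sup>2))\<^sup>2"
proof -
  let ?\<sigma> = "\<lambda>k. 3 * (\<Sum>i<k. (\<tau> (Suc i) - \<tau> i) * (c i)\<^sup>2)"
  have "simple_ito W k \<tau> \<zeta> \<in> borel_measurable (Filt (\<tau> k)) \<and> integrable M (\<lambda>\<omega>. norm (simple_ito W k \<tau> \<zeta> \<omega>) ^ 4) \<and>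
    expectation (\<lambda>\<omega>. norm (simple_ito W k \<tau> \<zeta> \<omega>) ^ 4) \<le> (?\<sigma> k)\<^sup>2 \<and> 0 \<le> ?\<sigma> k" if "k \<le> n" for k
    using that
  proof (induction k)
    case (Suc k)
    then have IH: "simple_ito W k \<tau> \<zeta> \<in> borel_measurable (Filt (\<tau> k))" "integrable M (\<lambda>\<omega>. norm (simple_ito W k \<tau> \<zeta> \<omega>) ^ 4)"
      "expectation (\<lambda>\<omega>. norm (simple_ito W k \<tau> \<zeta> \<omega>) ^ 4) \<le> (?\<sigma> k)\<^sup>2" "0 \<le> ?\<sigma> k" and k: "k < n" by auto
    have eq: "simple_ito W (Suc k) \<tau> \<zeta> = (\<lambda>\<omega>. simple_ito W k \<tau> \<zeta> \<omega> + (W (\<tau> (Suc k)) \<omega> - W (\<tau> k) \<omega>) *\<^sub>R \<zeta> k \<omega>)"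
      by (auto simp: simple_ito_def)
    note st = fourth_moment_step[OF mono[OF k] IH \<zeta>[OF k]]
    have \<sigma>: "?\<sigma> k + 3 * (\<tau> (Suc k) - \<tau> k) * (c k)\<^sup>2 = ?\<sigma> (Suc k)" by (simp add: algebra_simps)
    have "0 \<le> 3 * (\<tau> (Suc k) - \<tau> k) * (c k)\<^sup>2" using mono[OF k] by simp
    moreover have "simple_ito W (Suc k) \<tau> \<zeta> \<in> borel_measurable (Filt (\<tau> (Suc k)))"
      unfolding eq using measurable_increment_filtration_mono[OF IH(1) mono[OF k]] increment_measurable_mono[OF mono[OF k] order_refl \<zeta>(1)[OF k]]
      by (rule borel_measurable_add)
    moreover have "0 \<le> ?\<sigma> (Suc k)" using \<sigma> IH(4) calculation(1) by linarith
    ultimately show ?case using st unfolding eq \<sigma> by blast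
  next
    case 0
    have "simple_ito W 0 \<tau> \<zeta> = (\<lambda>\<omega>. 0)" by (auto simp: simple_ito_def)
    then show ?case by simp
  qed
  from this[of n] show "integrable M (\<lambda>\<omega>. norm (simple_ito W n \<tau> \<zeta> \<omega>) ^ 4)"
    "expectation (\<lambda>\<omega>. norm (simple_ito W n \<tau> \<zeta> \<omega>) ^ 4) \<le> (?\<sigma> n)\<^sup>2" by auto
qed

text \<open>Progressive measurability, the restriction to times up to \<open>T\<close> being
  replaced by an indicator. It is what makes pathwise time integrals up to \<open>T\<close>
  measurable at time \<open>T\<close>; adaptedness of each single \<open>x t\<close> would not
  suffice.\<close>

definition progressive :: "(real \<Rightarrow> 'w \<Rightarrow> 'a::{real_inner, banach, second_countable_topology}) \<Rightarrow> bool" where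
  "progressive x \<longleftrightarrow> (\<forall>T. (\<lambda>z. indicat_real {..T} (fst z) *\<^sub>R x (fst z) (snd z)) \<in> borel_measurable (lborel \<Otimes>\<^sub>M Filt T))"

definition L2_continuous :: "(real \<Rightarrow> 'w \<Rightarrow> 'a::{real_inner, banach, second_countable_topology}) \<Rightarrow> bool" where
  "L2_continuous x \<longleftrightarrow> (\<forall>t. x t \<in> L2_rv M) \<and>
     (\<forall>t f. f \<longlonglongrightarrow> t \<longrightarrow> (\<lambda>n::nat. L2_norm M (\<lambda>\<omega>. x (f n) \<omega> - x t \<omega>)) \<longlonglongrightarrow> 0)"

lemma progressive_adapted:
  assumes "progressive x" shows "x t \<in> borel_measurable (Filt t)"
proof -
  have "(\<lambda>\<omega>. (t, \<omega>)) \<in> measurable (Filt t) (lborel \<Otimes>\<^sub>M Filt t)" by simp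
  from measurable_compose[OF this assms[unfolded progressive_def, rule_format, of t]]
  show ?thesis by simp
qed

text \<open>Each truncated process is measurable for a smaller product \<sigma>-algebra; letting
  \<open>T\<close> run through the natural numbers exhausts the line.\<close>

lemma progressive_measurable:
  assumes "progressive x" shows "(\<lambda>z. x (fst z) (snd z)) \<in> borel_measurable LM"
proof -
  have "(\<lambda>z. (fst z, snd z)) \<in> measurable LM (lborel \<Otimes>\<^sub>M Filt T)" for T
  proof -
    have "(\<lambda>\<omega>. \<omega>) \<in> measurable M (Filt T)"
      using subalgebra_Filt[of T] unfolding subalgebra_def measurable_def by auto
    then show ?thesis
      by (intro measurable_Pair measurable_fst measurable_compose[OF measurable_snd])
  qed
  from measurable_compose[OF this assms[unfolded progressive_def, rule_format]]
  have [measurable]: "(\<lambda>z. indicat_real {..real n} (fst z) *\<^sub>R x (fst z) (snd z)) \<in> borel_measurable LM" for n :: nat by simp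
  show ?thesis
  proof (rule borel_measurable_LIMSEQ_metric)
    fix z :: "real \<times> 'w"
    obtain n0 :: nat where "fst z \<le> real n0" using real_arch_simple by blast
    then have "\<forall>\<^sub>F n in sequentially. indicat_real {..real n} (fst z) *\<^sub>R x (fst z) (snd z) = x (fst z) (snd z)"
      by (intro eventually_sequentiallyI[of n0]) auto
    then show "(\<lambda>n. indicat_real {..real n} (fst z) *\<^sub>R x (fst z) (snd z)) \<longlonglongrightarrow> x (fst z) (snd z)"
      by (rule tendsto_eventually)
  qed measurable
qed

text \<open>Heine-Cantor on \<open>[-K, K]\<close> by sequential compactness: pairs of times at
  distance at most \<open>1 / Suc n\<close> whose values stay \<epsilon> apart in L2 would have a
  common limit along a subsequence.\<close>

lemma L2_continuous_uniform:
  assumes x: "L2_continuous x" and e: "0 < \<epsilon>"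
  obtains h where "0 < h" "\<And>s s'. \<bar>s\<bar> \<le> K \<Longrightarrow> \<bar>s'\<bar> \<le> K \<Longrightarrow> \<bar>s - s'\<bar> \<le> h \<Longrightarrow> L2_norm M (\<lambda>\<omega>. x s \<omega> - x s' \<omega>) < \<epsilon>"
proof (rule ccontr)
  note small = that
  assume contra: "\<not> thesis"
  have "\<exists>s s'. \<bar>s\<bar> \<le> K \<and> \<bar>s'\<bar> \<le> K \<and> \<bar>s - s'\<bar> \<le> h \<and> \<epsilon> \<le> L2_norm M (\<lambda>\<omega>. x s \<omega> - x s' \<omega>)" if "0 < h" for h
  proof (rule ccontr)
    assume *: "\<not> (\<exists>s s'. \<bar>s\<bar> \<le> K \<and> \<bar>s'\<bar> \<le> K \<and> \<bar>s - s'\<bar> \<le> h \<and> \<epsilon> \<le> L2_norm M (\<lambda>\<omega>. x s \<omega> - x s' \<omega>))"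
    have thesis
      by (rule small[OF that]) (use * not_less in blast)
    with contra show False by simp
  qed
  then have "\<exists>s s'. \<bar>s\<bar> \<le> K \<and> \<bar>s'\<bar> \<le> K \<and> \<bar>s - s'\<bar> \<le> 1 / real (Suc n) \<and> \<epsilon> \<le> L2_norm M (\<lambda>\<omega>. x s \<omega> - x s' \<omega>)" for n
    by simp
  then obtain s s' where s: "\<And>n. \<bar>s n\<bar> \<le> K" "\<And>n. \<bar>s n - s' n\<bar> \<le> 1 / real (Suc n)" "\<And>n. \<epsilon> \<le> L2_norm M (\<lambda>\<omega>. x (s n) \<omega> - x (s' n) \<omega>)"
    by metis
  have "seq_compact {-K..K}" by (simp add: compact_imp_seq_compact)
  moreover have "\<forall>n. s n \<in> {-K..K}" using s(1) by (auto simp: abs_le_iff minus_le_iff)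
  ultimately obtain l r where r: "strict_mono r" "(s \<circ> r) \<longlonglongrightarrow> l"
    unfolding seq_compact_def by blast
  have "(\<lambda>n. 1 / real (Suc n)) \<longlonglongrightarrow> 0" by (rule LIMSEQ_Suc[OF lim_const_over_n])
  then have "(\<lambda>n. s n - s' n) \<longlonglongrightarrow> 0"
    by (rule Lim_null_comparison[rotated]) (use s(2) in auto)
  from LIMSEQ_subseq_LIMSEQ[OF this r(1)] have "(\<lambda>n. (s \<circ> r) n - (s' \<circ> r) n) \<longlonglongrightarrow> 0" by (simp add: comp_def)
  from tendsto_diff[OF r(2) this] have r': "(s' \<circ> r) \<longlonglongrightarrow> l" by (simp add: comp_def)
  have L: "x t \<in> L2_rv M" for t using x by (simp add: L2_continuous_def)
  have 1: "(\<lambda>n. L2_norm M (\<lambda>\<omega>. x ((s \<circ> r) n) \<omega> - x l \<omega>)) \<longlonglongrightarrow> 0" "(\<lambda>n. L2_norm M (\<lambda>\<omega>. x ((s' \<circ> r) n) \<omega> - x l \<omega>)) \<longlonglongrightarrow> 0"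
    using x r(2) r' unfolding L2_continuous_def by blast+
  have "(\<lambda>n. \<epsilon>) \<longlonglongrightarrow> 0"
  proof (rule tendsto_sandwich[OF _ _ tendsto_const tendsto_add_zero[OF 1]])
    show "\<forall>\<^sub>F n in sequentially. \<epsilon> \<le> L2_norm M (\<lambda>\<omega>. x ((s \<circ> r) n) \<omega> - x l \<omega>) + L2_norm M (\<lambda>\<omega>. x ((s' \<circ> r) n) \<omega> - x l \<omega>)"
    proof (intro always_eventually allI)
      fix n
      show "\<epsilon> \<le> L2_norm M (\<lambda>\<omega>. x ((s \<circ> r) n) \<omega> - x l \<omega>) + L2_norm M (\<lambda>\<omega>. x ((s' \<circ> r) n) \<omega> - x l \<omega>)"
        using s(3)[of "r n"] L2_norm_diff_triangle[OF L[of "s (r n)"] L[of l] L[of "s' (r n)"]]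
        by (simp add: L2_norm_minus_commute[of M "x l"])
    qed
  qed (use e in auto)
  then show False using e by (simp add: LIMSEQ_const_iff)
qed

text \<open>Sampling at the left end points of ever finer grids keeps adaptedness, and the limit is taken for every
  \<open>t\<close> almost surely rather than for almost every \<open>t\<close>.\<close>

lemma progressive_version:
  assumes x: "L2_continuous x" and ad: "\<And>t. x t \<in> borel_measurable (Filt t)"
  obtains y where "progressive y" "\<And>t. AE \<omega> in M. y t \<omega> = x t \<omega>"
proof -
  have L: "x t \<in> L2_rv M" for t using x by (simp add: L2_continuous_def)
  \<comment> \<open>Mesh \<open>h k\<close> gives an L2 error below \<open>(1/2)^k\<close>, so the
    samples at a fixed time form a sequence with summable differences and converge almost surely.
    The window reaches one unit beyond \<open>k\<close> because the grid point left of a time may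
    lie up to \<open>h k \<le> 1\<close> further out.\<close>
  define P where "P = (\<lambda>k h. 0 < h \<and> h \<le> 1 \<and> (\<forall>s s'. \<bar>s\<bar> \<le> real k + 1 \<longrightarrow> \<bar>s'\<bar> \<le> real k + 1 \<longrightarrow>
    \<bar>s - s'\<bar> \<le> h \<longrightarrow> L2_norm M (\<lambda>\<omega>. x s \<omega> - x s' \<omega>) < (1/2) ^ k))"
  have "\<exists>h. P k h" for k
  proof -
    obtain h where "0 < h" "\<And>s s'. \<bar>s\<bar> \<le> real k + 1 \<Longrightarrow> \<bar>s'\<bar> \<le> real k + 1 \<Longrightarrow> \<bar>s - s'\<bar> \<le> h \<Longrightarrow> L2_norm M (\<lambda>\<omega>. x s \<omega> - x s' \<omega>) < (1/2) ^ k"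
      by (rule L2_continuous_uniform[OF x, of "(1/2) ^ k" "real k + 1"]) auto
    then show ?thesis by (intro exI[of _ "min h 1"]) (auto simp: P_def)
  qed
  then obtain h where Ph: "\<And>k. P k (h k)" by metis
  have h: "0 < h k" "h k \<le> 1"
    "\<bar>s\<bar> \<le> real k + 1 \<Longrightarrow> \<bar>s'\<bar> \<le> real k + 1 \<Longrightarrow> \<bar>s - s'\<bar> \<le> h k \<Longrightarrow> L2_norm M (\<lambda>\<omega>. x s \<omega> - x s' \<omega>) < (1/2) ^ k" for k s s'
    using Ph[of k] by (auto simp: P_def)
  define G where "G = (\<lambda>k s. of_int \<lfloor>s / h k\<rfloor> * h k)"
  have G: "G k s \<le> s \<and> s - h k \<le> G k s" for k s
  proof -
    have "of_int \<lfloor>s / h k\<rfloor> * h k \<le> (s / h k) * h k" using h(1)[of k] by (intro mult_right_mono) auto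
    moreover have "(s / h k - 1) * h k \<le> of_int \<lfloor>s / h k\<rfloor> * h k" using h(1)[of k] by (intro mult_right_mono) linarith+
    ultimately show ?thesis using h(1)[of k] by (simp add: G_def algebra_simps)
  qed
  define y where "y = (\<lambda>s \<omega>. lim (\<lambda>k. x (G k s) \<omega>))"
  have "progressive y"
    unfolding progressive_def
  proof
    fix T
    define V where "V = (\<lambda>k i. if of_int i * h k \<le> T then x (of_int i * h k) else (\<lambda>\<omega>. 0))"
    have [measurable]: "V k i \<in> borel_measurable (Filt T)" for k and i :: int
      unfolding V_def by (auto intro: measurable_increment_filtration_mono[OF ad])
    have [measurable]: "(\<lambda>z. V k \<lfloor>fst z / h k\<rfloor> (snd z)) \<in> borel_measurable (lborel \<Otimes>\<^sub>M Filt T)" for k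
      by (rule measurable_compose_countable[where f="\<lambda>i z. V k i (snd z)"]) measurable
    have "(\<lambda>z. indicat_real {..T} (fst z) *\<^sub>R lim (\<lambda>k. V k \<lfloor>fst z / h k\<rfloor> (snd z))) \<in> borel_measurable (lborel \<Otimes>\<^sub>M Filt T)"
      by measurable
    also have "(\<lambda>z. indicat_real {..T} (fst z) *\<^sub>R lim (\<lambda>k. V k \<lfloor>fst z / h k\<rfloor> (snd z))) =
      (\<lambda>z. indicat_real {..T} (fst z) *\<^sub>R y (fst z) (snd z))"
    proof
      fix z :: "real \<times> 'w"
      have "V k \<lfloor>fst z / h k\<rfloor> = x (G k (fst z))" if "fst z \<le> T" for k
        using G[of k "fst z"] that by (auto simp: V_def G_def)
      then show "indicat_real {..T} (fst z) *\<^sub>R lim (\<lambda>k. V k \<lfloor>fst z / h k\<rfloor> (snd z)) = indicat_real {..T} (fst z) *\<^sub>R y (fst z) (snd z)"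
        by (cases "fst z \<le> T") (auto simp: y_def)
    qed
    finally show "(\<lambda>z. indicat_real {..T} (fst z) *\<^sub>R y (fst z) (snd z)) \<in> borel_measurable (lborel \<Otimes>\<^sub>M Filt T)" .
  qed
  moreover have "AE \<omega> in M. y t \<omega> = x t \<omega>" for t
  proof -
    \<comment> \<open>Only the windows with \<open>k \<ge> |t|\<close> are known to contain
      \<open>t\<close>, hence the offset \<open>k0\<close>.\<close>
    obtain k0 :: nat where k0: "\<bar>t\<bar> \<le> real k0" using real_arch_simple by blast
    have le: "L2_norm M (\<lambda>\<omega>. x (G (k + k0) t) \<omega> - x t \<omega>) \<le> (1/2) ^ k" for k
    proof -
      have "L2_norm M (\<lambda>\<omega>. x (G (k + k0) t) \<omega> - x t \<omega>) < (1/2) ^ (k + k0)"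
        using G[of "k + k0" t] h(1,2)[of "k + k0"] k0 by (intro h(3)) auto
      also have "\<dots> \<le> (1/2) ^ k" by (rule power_decreasing) auto
      finally show ?thesis by simp
    qed
    let ?X = "\<lambda>k. x (G (k + k0) t)"
    have "summable (\<lambda>k. L2_norm M (\<lambda>\<omega>. ?X (Suc k) \<omega> - ?X k \<omega>))"
    proof (rule summable_comparison_test'[where N=0])
      show "summable (\<lambda>k. 2 * (1/2::real) ^ k)" by (rule summable_mult[OF summable_geometric]) simp
      show "norm (L2_norm M (\<lambda>\<omega>. ?X (Suc k) \<omega> - ?X k \<omega>)) \<le> 2 * (1/2) ^ k" for k
      proof -
        have "L2_norm M (\<lambda>\<omega>. ?X (Suc k) \<omega> - ?X k \<omega>) \<le> L2_norm M (\<lambda>\<omega>. ?X (Suc k) \<omega> - x t \<omega>) + L2_norm M (\<lambda>\<omega>. x t \<omega> - ?X k \<omega>)"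
          by (rule L2_norm_diff_triangle[OF L L L])
        also have "\<dots> \<le> (1/2) ^ Suc k + (1/2) ^ k"
          using le[of "Suc k"] le[of k] by (intro add_mono) (auto simp: L2_norm_minus_commute[of M "x t"])
        also have "\<dots> \<le> 2 * (1/2) ^ k" by simp
        finally show ?thesis by simp
      qed
    qed
    from L2_Riesz_Fischer[OF L this] have
      1: "AE \<omega> in M. (\<lambda>k. ?X k \<omega>) \<longlonglongrightarrow> lim (\<lambda>k. ?X k \<omega>)" and 2: "(\<lambda>\<omega>. lim (\<lambda>k. ?X k \<omega>)) \<in> L2_rv M"
      and 3: "(\<lambda>k. L2_norm M (\<lambda>\<omega>. lim (\<lambda>k. ?X k \<omega>) - ?X k \<omega>)) \<longlonglongrightarrow> 0" by blast+
    have "(\<lambda>k. L2_norm M (\<lambda>\<omega>. lim (\<lambda>k. ?X k \<omega>) - ?X k \<omega>) + (1/2) ^ k) \<longlonglongrightarrow> 0"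
      by (intro tendsto_add_zero 3 LIMSEQ_power_zero) simp
    moreover have "L2_norm M (\<lambda>\<omega>. lim (\<lambda>k. ?X k \<omega>) - x t \<omega>) \<le> L2_norm M (\<lambda>\<omega>. lim (\<lambda>k. ?X k \<omega>) - ?X k \<omega>) + (1/2) ^ k" for k
      using L2_norm_diff_triangle[OF 2 L[of "G (k + k0) t"] L[of t]] le[of k] by linarith
    ultimately have "L2_norm M (\<lambda>\<omega>. lim (\<lambda>k. ?X k \<omega>) - x t \<omega>) \<le> 0"
      by (intro LIMSEQ_le_const) auto
    then have "AE \<omega> in M. lim (\<lambda>k. ?X k \<omega>) = x t \<omega>"
      by (intro L2_norm_diff_eq_0_AE[OF 2 L]) auto
    with 1 show ?thesis
    proof eventually_elim
      fix \<omega> assume "(\<lambda>k. ?X k \<omega>) \<longlonglongrightarrow> lim (\<lambda>k. ?X k \<omega>)" "lim (\<lambda>k. ?X k \<omega>) = x t \<omega>"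
      then have "(\<lambda>k. x (G k t) \<omega>) \<longlonglongrightarrow> x t \<omega>"
        using LIMSEQ_offset[of "\<lambda>k. x (G k t) \<omega>" k0] by simp
      then show "y t \<omega> = x t \<omega>" unfolding y_def by (rule limI)
    qed
  qed
  ultimately show thesis by (rule that)
qed

end

section \<open>Response of the stable semigroup to drift and noise\<close>

text \<open>Applied with rate \<nu> for the drift and \<open>2 * \<nu>\<close> for the noise, where
  the isometry squares the kernel.\<close>

lemma nn_integral_exp_atMost:
  fixes c t :: real
  assumes c: "0 < c"
  shows "(\<integral>\<^sup>+s. ennreal (exp (- c * (t - s)) * indicat_real {..t} s) \<partial>lborel) = ennreal (1 / c)"
proof -
  have "(\<integral>\<^sup>+s. ennreal (exp (- c * (t - s)) * indicat_real {..t} s) \<partial>lborel)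
     = (\<integral>\<^sup>+x. ennreal (exp (- c * (t - (t + (-1) * x))) * indicat_real {..t} (t + (-1) * x)) \<partial>lborel)"
    by (subst nn_integral_real_affine[where c="-1" and t=t]) auto
  also have "\<dots> = (\<integral>\<^sup>+x. ennreal (exp (- c * x)) * indicator {0..} x \<partial>lborel)"
    by (intro nn_integral_cong) (auto simp: indicator_def)
  also have "\<dots> = ennreal (0 - (- (exp (- c * 0) / c)))"
  proof (rule nn_integral_FTC_atLeast)
    show "((\<lambda>x. - (exp (- c * x) / c)) has_real_derivative exp (- c * x)) (at x)" for x
      using c by (auto intro!: derivative_eq_intros)
    have "((\<lambda>x. exp (- c * x)) \<longlongrightarrow> 0) at_top"
      using filterlim_tendsto_pos_mult_at_top[OF tendsto_const c filterlim_ident]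
      by (intro filterlim_compose[OF exp_at_bot]) (simp add: filterlim_uminus_at_top)
    then have "((\<lambda>x. - (exp (- c * x) / c)) \<longlongrightarrow> - (0 / c)) at_top"
      by (intro tendsto_minus tendsto_divide tendsto_const) (use c in auto)
    then show "((\<lambda>x. - (exp (- c * x) / c)) \<longlongrightarrow> 0) at_top" by simp
  qed auto
  finally show ?thesis by simp
qed

text \<open>Cauchy-Schwarz after writing \<open>w f\<close> as the product of \<open>sqrt w\<close>
  and \<open>sqrt w f\<close>. Applied to \<open>f\<close> and then to \<open>f^2\<close> it also
  yields the fourth power.\<close>

lemma weighted_Jensen_nn:
  fixes w f :: "'b \<Rightarrow> real"
  assumes [measurable]: "w \<in> borel_measurable N" "f \<in> borel_measurable N"
    and nonneg: "\<And>s. 0 \<le> w s" "\<And>s. 0 \<le> f s" and c: "(\<integral>\<^sup>+s. ennreal (w s) \<partial>N) \<le> ennreal c"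
  shows "(\<integral>\<^sup>+s. ennreal (w s * f s) \<partial>N)\<^sup>2 \<le> ennreal c * (\<integral>\<^sup>+s. ennreal (w s * (f s)\<^sup>2) \<partial>N)"
proof -
  have "(\<integral>\<^sup>+s. ennreal (w s * f s) \<partial>N)\<^sup>2 = (\<integral>\<^sup>+s. ennreal (sqrt (w s)) * ennreal (sqrt (w s) * f s) \<partial>N)\<^sup>2"
    by (intro arg_cong[of _ _ "\<lambda>x. x\<^sup>2"] nn_integral_cong) (simp add: nonneg flip: ennreal_mult mult.assoc)
  also have "\<dots> \<le> (\<integral>\<^sup>+s. (ennreal (sqrt (w s)))\<^sup>2 \<partial>N) * (\<integral>\<^sup>+s. (ennreal (sqrt (w s) * f s))\<^sup>2 \<partial>N)"
    by (rule Cauchy_Schwarz_nn_integral) measurable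
  also have "\<dots> = (\<integral>\<^sup>+s. ennreal (w s) \<partial>N) * (\<integral>\<^sup>+s. ennreal (w s * (f s)\<^sup>2) \<partial>N)"
    by (simp add: ennreal_power nonneg power_mult_distrib)
  also have "\<dots> \<le> ennreal c * (\<integral>\<^sup>+s. ennreal (w s * (f s)\<^sup>2) \<partial>N)"
    by (intro mult_right_mono c) simp
  finally show ?thesis .
qed

section \<open>The semigroup and its convolution kernel\<close>

locale stable_semigroup =
  fixes U :: "real \<Rightarrow> 'a::{real_inner, banach, second_countable_topology} \<Rightarrow>\<^sub>L 'a" and N \<nu> :: real
  assumes C0: "C0_semigroup U" and N_pos: "0 < N" and \<nu>_pos: "0 < \<nu>"
    and U_norm: "\<And>t. 0 \<le> t \<Longrightarrow> norm (U t) \<le> N * exp (- \<nu> * t)"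
begin

lemma U_zero: "U 0 x = x"
  using C0 by (simp add: C0_semigroup_def)

lemma U_add: "0 \<le> s \<Longrightarrow> 0 \<le> t \<Longrightarrow> U (s + t) x = U s (U t x)"
  using C0 by (simp add: C0_semigroup_def)

lemma U_bound: "0 \<le> t \<Longrightarrow> norm (U t x) \<le> N * exp (- \<nu> * t) * norm x"
  by (rule order_trans[OF norm_blinfun mult_right_mono[OF U_norm]]) auto

lemma U_bound': assumes "0 \<le> t" shows "norm (U t x) \<le> N * norm x"
proof -
  have "N * exp (- \<nu> * t) * norm x \<le> N * 1 * norm x"
    using assms N_pos \<nu>_pos by (intro mult_right_mono mult_left_mono) auto
  with U_bound[OF assms, of x] show ?thesis by simp
qed

text \<open>Factoring out the smaller time reduces strong continuity at any time to that at 0, at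
  the price of the uniform bound \<open>N\<close>.\<close>

lemma U_diff_bound:
  assumes "0 \<le> s" "0 \<le> t"
  shows "norm (U t x - U s x) \<le> N * norm (U \<bar>t - s\<bar> x - x)"
proof -
  have *: "norm (U t x - U s x) \<le> N * norm (U (t - s) x - x)" if "0 \<le> s" "s \<le> t" for s t
  proof -
    have "U t x - U s x = U s (U (t - s) x - x)"
      using U_add[of s "t - s" x] that by (simp add: blinfun.diff_right)
    then show ?thesis using U_bound'[OF that(1)] by simp
  qed
  show ?thesis
    using *[of s t] *[of t s] assms by (cases "s \<le> t") (auto simp: norm_minus_commute abs_minus_commute)
qed

text \<open>The uniform bound lets time and vector vary together: the error in the vector costs a
  factor \<open>N\<close>, and the error in time is read off at the fixed vector
  \<open>y\<close>.\<close>

lemma U_tendsto: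
  fixes f :: "nat \<Rightarrow> real"
  assumes f: "f \<longlonglongrightarrow> t" "\<And>n. 0 \<le> f n" "0 \<le> t" and x: "x \<longlonglongrightarrow> y"
  shows "(\<lambda>n. U (f n) (x n)) \<longlonglongrightarrow> U t y"
proof -
  have "((\<lambda>h. U h y) \<longlongrightarrow> U 0 y) (at_right 0)"
    using C0 by (simp add: C0_semigroup_def)
  moreover have "{0<..} - {0} = {0..} - {0::real}" by auto
  ultimately have c: "((\<lambda>h. U h y) \<longlongrightarrow> U 0 y) (at 0 within {0..})"
    by (simp add: at_within_def)
  have z: "(\<lambda>n. U \<bar>f n - t\<bar> y) \<longlonglongrightarrow> U 0 y"
  proof -
    have "continuous (at 0 within {0..}) (\<lambda>h. U h y)" using c by (simp add: continuous_within)
    moreover have "(\<lambda>n. \<bar>f n - t\<bar>) \<longlonglongrightarrow> 0"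
      using tendsto_rabs[OF LIM_zero[OF f(1)]] by simp
    ultimately show ?thesis
      unfolding continuous_within_sequentially by (auto simp: comp_def)
  qed
  have "(\<lambda>n. N * norm (x n - y) + N * norm (U \<bar>f n - t\<bar> y - y)) \<longlonglongrightarrow> N * norm (y - y) + N * norm (U 0 y - y)"
    by (intro tendsto_intros x z)
  then have l: "(\<lambda>n. N * norm (x n - y) + N * norm (U \<bar>f n - t\<bar> y - y)) \<longlonglongrightarrow> 0" by (simp add: U_zero)
  have "(\<lambda>n. U (f n) (x n) - U t y) \<longlonglongrightarrow> 0"
  proof (rule Lim_null_comparison[OF always_eventually l], intro allI)
    fix n
    have eq: "U (f n) (x n) - U t y = U (f n) (x n - y) + (U (f n) y - U t y)"
      by (simp add: blinfun.diff_right)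
    show "norm (U (f n) (x n) - U t y) \<le> N * norm (x n - y) + N * norm (U \<bar>f n - t\<bar> y - y)"
      unfolding eq
      using U_bound'[OF f(2)[of n], of "x n - y"] U_diff_bound[OF f(3) f(2)[of n], of y]
        norm_triangle_ineq[of "U (f n) (x n - y)" "U (f n) y - U t y"] by linarith
  qed
  then show ?thesis by (rule LIM_zero_cancel)
qed

text \<open>The kernel of the variation of constants formula, set to 0 for \<open>s > t\<close>
  because the values of \<open>U\<close> at negative times are unspecified.\<close>

definition conv :: "real \<Rightarrow> real \<Rightarrow> 'a \<Rightarrow> 'a" where
  "conv t s h = indicat_real {..t} s *\<^sub>R U (t - s) h"

lemma conv_measurable [measurable]: "(\<lambda>z. conv t (fst z) (snd z)) \<in> borel_measurable (borel \<Otimes>\<^sub>M borel)"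
proof -
  \<comment> \<open>On the closed half space \<open>s \<le> t\<close> the kernel is jointly
    continuous, and extending it by 0 keeps it Borel.\<close>
  have "continuous_on ({..t} \<times> UNIV) (\<lambda>z. U (t - fst z) (snd z))"
  proof (unfold continuous_on_sequentially, intro ballI allI impI)
    fix z :: "real \<times> 'a" and f assume z: "z \<in> {..t} \<times> UNIV" and f: "(\<forall>n. f n \<in> {..t} \<times> UNIV) \<and> f \<longlonglongrightarrow> z"
    have "0 \<le> t - fst (f n)" for n
    proof -
      have "f n \<in> {..t} \<times> UNIV" using f by blast
      then show ?thesis by auto
    qed
    then show "((\<lambda>z. U (t - fst z) (snd z)) \<circ> f) \<longlonglongrightarrow> U (t - fst z) (snd z)"
      unfolding comp_def using z f by (intro U_tendsto tendsto_intros tendsto_fst tendsto_snd) auto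
  qed
  then have "(\<lambda>z. indicator ({..t} \<times> UNIV) z *\<^sub>R U (t - fst z) (snd z)) \<in> borel_measurable borel"
    by (intro borel_measurable_continuous_on_indicator) (auto intro!: borel_closed closed_Times)
  also have "(\<lambda>z. indicator ({..t} \<times> UNIV) z *\<^sub>R U (t - fst z) (snd z)) = (\<lambda>z. conv t (fst z) (snd z))"
    by (auto simp: conv_def indicator_def)
  finally show ?thesis by (simp add: borel_prod)
qed

lemma conv_measurable_compose:
  assumes "f \<in> borel_measurable K" "g \<in> borel_measurable K"
  shows "(\<lambda>z. conv t (f z) (g z)) \<in> borel_measurable K"
  using measurable_compose[OF measurable_Pair[OF assms] conv_measurable] by simp

lemma norm_conv: "norm (conv t s h) \<le> N * (exp (- \<nu> * (t - s)) * indicat_real {..t} s) * norm h"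
  using U_bound[of "t - s" h] by (auto simp: conv_def indicator_def mult.assoc)

lemma norm_conv_le: "norm (conv t s h) \<le> N * norm h"
  using U_bound'[of "t - s" h] N_pos by (auto simp: conv_def indicator_def)

lemma conv_diff: "conv t s (h - h') = conv t s h - conv t s h'"
  by (simp add: conv_def blinfun.diff_right algebra_simps)

text \<open>By the semigroup law the contributions from times up to \<open>t0\<close> cancel. This
  is how the equation over the infinite past yields the mild equation between \<open>t0\<close> and
  \<open>t\<close>.\<close>

lemma conv_shift:
  assumes "t0 \<le> t"
  shows "conv t s h - U (t - t0) (conv t0 s h) = indicat_real {t0<..t} s *\<^sub>R conv t s h"
proof (cases "s \<le> t0")
  case True
  then have "U (t - s) h = U (t - t0) (U (t0 - s) h)"
    using U_add[of "t - t0" "t0 - s" h] assms by simp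
  then show ?thesis using True assms by (simp add: conv_def)
qed (simp add: conv_def indicator_def blinfun.zero_right)

end

section \<open>Drift and noise driven by inputs bounded in L2\<close>

locale stable_wiener = wiener_process M W + stable_semigroup U N \<nu>
  for M :: "'w measure" and W and U :: "real \<Rightarrow> 'a::{real_inner, banach, second_countable_topology} \<Rightarrow>\<^sub>L 'a" and N \<nu>
begin

text \<open>Measurability is global while the bound concerns \<open>J\<close> alone, so an input
  known to be small only during \<open>J\<close> can be used without being changed
  elsewhere.\<close>

definition field_bounded :: "real set \<Rightarrow> real \<Rightarrow> (real \<times> 'w \<Rightarrow> 'a) \<Rightarrow> bool" where
  "field_bounded J D f \<longleftrightarrow> f \<in> borel_measurable LM \<and> 0 \<le> D \<and>
     (\<forall>s\<in>J. (\<lambda>\<omega>. f (s, \<omega>)) \<in> L2_rv M \<and> L2_norm M (\<lambda>\<omega>. f (s, \<omega>)) \<le> D)"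

text \<open>A total function: paths that fail to be integrable get the value 0, and for inputs
  bounded in L2 such paths almost surely do not occur.\<close>

definition drift :: "real set \<Rightarrow> real \<Rightarrow> (real \<times> 'w \<Rightarrow> 'a) \<Rightarrow> 'w \<Rightarrow> 'a" where
  "drift J t f \<omega> = (\<integral>s. indicat_real J s *\<^sub>R conv t s (f (s, \<omega>)) \<partial>lborel)"

text \<open>The output at time \<open>t\<close> of the linear system with drift input
  \<open>f\<close> and noise input \<open>g\<close> acting during \<open>J\<close>. It is a
  relation, since a stochastic integral is determined only up to null sets; \<open>J\<close> is the
  whole line for the fixed point equation and \<open>{t0..t}\<close> for the mild one.\<close>

definition response :: "real set \<Rightarrow> real \<Rightarrow> (real \<times> 'w \<Rightarrow> 'a) \<Rightarrow> (real \<times> 'w \<Rightarrow> 'a) \<Rightarrow> ('w \<Rightarrow> 'a) \<Rightarrow> bool" where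
  "response J t f g X \<longleftrightarrow> X \<in> borel_measurable M \<and>
     (\<exists>I. ito t (\<lambda>z. indicat_real J (fst z) *\<^sub>R conv t (fst z) (g z)) I \<and>
        (AE \<omega> in M. X \<omega> = drift J t f \<omega> + I \<omega>))"

lemma field_integrand_measurable:
  assumes [measurable]: "f \<in> borel_measurable LM" "J \<in> sets borel"
  shows "(\<lambda>z. indicat_real J (fst z) *\<^sub>R conv t (fst z) (f z)) \<in> borel_measurable LM"
proof -
  have [measurable]: "(\<lambda>z. conv t (fst z) (f z)) \<in> borel_measurable LM"
    by (rule conv_measurable_compose) measurable
  show ?thesis by measurable
qed

lemma drift_measurable:
  assumes "f \<in> borel_measurable LM" "J \<in> sets borel"
  shows "drift J t f \<in> borel_measurable M"
proof -
  have [measurable]: "(\<lambda>x. (snd x, fst x)) \<in> measurable (M \<Otimes>\<^sub>M lborel) LM" by measurable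
  have "(\<lambda>(\<omega>, s). indicat_real J s *\<^sub>R conv t s (f (s, \<omega>))) \<in> borel_measurable (M \<Otimes>\<^sub>M lborel)"
    using measurable_compose[OF \<open>(\<lambda>x. (snd x, fst x)) \<in> _\<close> field_integrand_measurable[OF assms, of t]]
    by (simp add: case_prod_beta')
  from lborel.borel_measurable_lebesgue_integral[OF this] show ?thesis
    by (simp add: drift_def[abs_def])
qed

definition weight :: "real set \<Rightarrow> real \<Rightarrow> real \<Rightarrow> real" where
  "weight J t s = exp (- \<nu> * (t - s)) * indicat_real ({..t} \<inter> J) s"

lemma weight_nonneg: "0 \<le> weight J t s" by (simp add: weight_def)

lemma weight_measurable:
  assumes [measurable]: "J \<in> sets borel"
  shows "weight J t \<in> borel_measurable borel"
  unfolding weight_def[abs_def] by measurable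

lemma integrand_le_weight:
  "norm (indicat_real J s *\<^sub>R conv t s h) \<le> N * (weight J t s * norm h)"
  using norm_conv[of t s h] by (auto simp: weight_def indicator_def mult_ac)

lemma drift_nn_bound:
  assumes f: "f \<in> borel_measurable LM" and J: "J \<in> sets borel" and \<omega>: "\<omega> \<in> space M"
  shows "ennreal (norm (drift J t f \<omega>)) \<le> ennreal N * (\<integral>\<^sup>+s. ennreal (weight J t s * norm (f (s, \<omega>))) \<partial>lborel)"
    and "(\<integral>\<^sup>+s. ennreal (weight J t s * norm (f (s, \<omega>))) \<partial>lborel) < \<infinity> \<Longrightarrow>
      integrable lborel (\<lambda>s. indicat_real J s *\<^sub>R conv t s (f (s, \<omega>)))"
proof -
  have [measurable]: "(\<lambda>s. (s, \<omega>)) \<in> measurable lborel LM" using \<omega> by simp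
  note [measurable] = measurable_compose[OF \<open>(\<lambda>s. (s, \<omega>)) \<in> measurable lborel LM\<close> f] weight_measurable[OF J, of t]
  have m: "(\<lambda>s. indicat_real J s *\<^sub>R conv t s (f (s, \<omega>))) \<in> borel_measurable lborel"
    using measurable_compose[OF \<open>(\<lambda>s. (s, \<omega>)) \<in> measurable lborel LM\<close> field_integrand_measurable[OF f J, of t]] by simp
  have "(\<integral>\<^sup>+s. ennreal (norm (indicat_real J s *\<^sub>R conv t s (f (s, \<omega>)))) \<partial>lborel)
      \<le> (\<integral>\<^sup>+s. ennreal (N * (weight J t s * norm (f (s, \<omega>)))) \<partial>lborel)"
    by (intro nn_integral_mono ennreal_leI integrand_le_weight)
  also have "\<dots> = (\<integral>\<^sup>+s. ennreal N * ennreal (weight J t s * norm (f (s, \<omega>))) \<partial>lborel)"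
    using N_pos by (intro nn_integral_cong ennreal_mult) (auto simp: weight_nonneg)
  also have "\<dots> = ennreal N * (\<integral>\<^sup>+s. ennreal (weight J t s * norm (f (s, \<omega>))) \<partial>lborel)"
    by (rule nn_integral_cmult) measurable
  finally have le: "(\<integral>\<^sup>+s. ennreal (norm (indicat_real J s *\<^sub>R conv t s (f (s, \<omega>)))) \<partial>lborel)
      \<le> ennreal N * (\<integral>\<^sup>+s. ennreal (weight J t s * norm (f (s, \<omega>))) \<partial>lborel)" .
  \<comment> \<open>If the integrand is not integrable, \<open>drift\<close> is 0 and the bound is
    trivial.\<close>
  show "ennreal (norm (drift J t f \<omega>)) \<le> ennreal N * (\<integral>\<^sup>+s. ennreal (weight J t s * norm (f (s, \<omega>))) \<partial>lborel)"
    using order_trans[OF _ le] integral_norm_bound_ennreal[of lborel "\<lambda>s. indicat_real J s *\<^sub>R conv t s (f (s, \<omega>))"]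
    by (cases "integrable lborel (\<lambda>s. indicat_real J s *\<^sub>R conv t s (f (s, \<omega>)))")
      (auto simp: drift_def not_integrable_integral_eq)
  assume "(\<integral>\<^sup>+s. ennreal (weight J t s * norm (f (s, \<omega>))) \<partial>lborel) < \<infinity>"
  then have "ennreal N * (\<integral>\<^sup>+s. ennreal (weight J t s * norm (f (s, \<omega>))) \<partial>lborel) < \<infinity>"
    by (simp add: ennreal_mult_less_top)
  with le have "(\<integral>\<^sup>+s. ennreal (norm (indicat_real J s *\<^sub>R conv t s (f (s, \<omega>)))) \<partial>lborel) < \<infinity>"
    by (rule le_less_trans)
  with m show "integrable lborel (\<lambda>s. indicat_real J s *\<^sub>R conv t s (f (s, \<omega>)))"
    by (simp add: integrable_iff_bounded)
qed

text \<open>Moments are controlled on \<open>J\<close> only, which is enough because the weight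
  vanishes elsewhere.\<close>

lemma weighted_moment_Tonelli:
  fixes h :: "real \<times> 'w \<Rightarrow> real"
  assumes [measurable]: "h \<in> borel_measurable LM" "J \<in> sets borel"
    and bd: "\<And>s. s \<in> J \<Longrightarrow> (\<integral>\<^sup>+\<omega>. ennreal (h (s, \<omega>)) \<partial>M) \<le> ennreal D"
    and c: "(\<integral>\<^sup>+s. ennreal (weight J t s) \<partial>lborel) \<le> ennreal c"
  shows "(\<integral>\<^sup>+\<omega>. \<integral>\<^sup>+s. ennreal (weight J t s * h (s, \<omega>)) \<partial>lborel \<partial>M) \<le> ennreal c * ennreal D"
proof -
  note [measurable] = weight_measurable[OF assms(2), of t]
  have "(\<integral>\<^sup>+\<omega>. \<integral>\<^sup>+s. ennreal (weight J t s * h (s, \<omega>)) \<partial>lborel \<partial>M) =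
     (\<integral>\<^sup>+s. \<integral>\<^sup>+\<omega>. ennreal (weight J t s * h (s, \<omega>)) \<partial>M \<partial>lborel)"
    by (rule LM.Fubini') (simp add: case_prod_beta')
  also have "\<dots> = (\<integral>\<^sup>+s. ennreal (weight J t s) * (\<integral>\<^sup>+\<omega>. ennreal (h (s, \<omega>)) \<partial>M) \<partial>lborel)"
    by (intro nn_integral_cong) (simp add: ennreal_mult' weight_nonneg nn_integral_cmult)
  also have "\<dots> \<le> (\<integral>\<^sup>+s. ennreal (weight J t s) * ennreal D \<partial>lborel)"
  proof (intro nn_integral_mono)
    fix s
    show "ennreal (weight J t s) * (\<integral>\<^sup>+\<omega>. ennreal (h (s, \<omega>)) \<partial>M) \<le> ennreal (weight J t s) * ennreal D"
      by (cases "s \<in> J") (auto intro!: mult_left_mono bd simp: weight_def)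
  qed
  also have "\<dots> = (\<integral>\<^sup>+s. ennreal (weight J t s) \<partial>lborel) * ennreal D"
    by (rule nn_integral_multc) simp
  also have "\<dots> \<le> ennreal c * ennreal D" by (intro mult_right_mono c) simp
  finally show ?thesis .
qed

text \<open>Jensen for the weight followed by Tonelli. Each of the two contributes a factor
  \<open>c\<close> to the square, so the norm carries \<open>c\<close> itself, as Minkowski's
  inequality for integrals would give.\<close>

lemma
  assumes f: "field_bounded J D f" and J: "J \<in> sets borel"
    and c: "(\<integral>\<^sup>+s. ennreal (weight J t s) \<partial>lborel) \<le> ennreal c" "0 \<le> c"
  shows drift_integrable: "AE \<omega> in M. integrable lborel (\<lambda>s. indicat_real J s *\<^sub>R conv t s (f (s, \<omega>)))"
    and drift_L2: "drift J t f \<in> L2_rv M"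
    and drift_L2_norm: "L2_norm M (drift J t f) \<le> N * D * c"
proof -
  have fm[measurable]: "f \<in> borel_measurable LM" and D: "0 \<le> D" using f by (auto simp: field_bounded_def)
  note [measurable] = drift_measurable[OF fm J, of t] weight_measurable[OF J, of t]
  let ?v = "\<lambda>\<omega>. \<integral>\<^sup>+s. ennreal (weight J t s * norm (f (s, \<omega>))) \<partial>lborel"
  have [measurable]: "?v \<in> borel_measurable M" by measurable
  have v2: "(\<integral>\<^sup>+\<omega>. (?v \<omega>)\<^sup>2 \<partial>M) \<le> ennreal ((D * c)\<^sup>2)"
  proof -
    have "(\<integral>\<^sup>+\<omega>. (?v \<omega>)\<^sup>2 \<partial>M) \<le> (\<integral>\<^sup>+\<omega>. ennreal c * (\<integral>\<^sup>+s. ennreal (weight J t s * (norm (f (s, \<omega>)))\<^sup>2) \<partial>lborel) \<partial>M)"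
      by (intro nn_integral_mono weighted_Jensen_nn weight_nonneg c(1)) auto
    also have "\<dots> = ennreal c * (\<integral>\<^sup>+\<omega>. (\<integral>\<^sup>+s. ennreal (weight J t s * (norm (f (s, \<omega>)))\<^sup>2) \<partial>lborel) \<partial>M)"
      by (rule nn_integral_cmult) measurable
    also have "\<dots> \<le> ennreal c * (ennreal c * ennreal (D\<^sup>2))"
    proof (intro mult_left_mono weighted_moment_Tonelli[where h="\<lambda>z. (norm (f z))\<^sup>2"] c(1) J)
      fix s assume s: "s \<in> J"
      then have "(\<integral>\<^sup>+\<omega>. ennreal ((norm (f (s, \<omega>)))\<^sup>2) \<partial>M) = ennreal ((L2_norm M (\<lambda>\<omega>. f (s, \<omega>)))\<^sup>2)"
        using f by (intro nn_integral_L2) (auto simp: field_bounded_def)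
      also have "\<dots> \<le> ennreal (D\<^sup>2)"
        using f s by (intro ennreal_leI power_mono) (auto simp: field_bounded_def)
      finally show "(\<integral>\<^sup>+\<omega>. ennreal ((norm (f (s, \<omega>)))\<^sup>2) \<partial>M) \<le> ennreal (D\<^sup>2)" .
    qed auto
    also have "\<dots> = ennreal ((D * c)\<^sup>2)"
      using c(2) D by (simp add: power2_eq_square mult_ac flip: ennreal_mult)
    finally show ?thesis .
  qed
  have "(\<integral>\<^sup>+\<omega>. (?v \<omega>)\<^sup>2 \<partial>M) \<noteq> \<infinity>" using le_less_trans[OF v2 ennreal_less_top] by simp
  then have "AE \<omega> in M. (?v \<omega>)\<^sup>2 \<noteq> \<infinity>" by (intro nn_integral_PInf_AE) measurable
  moreover have "AE \<omega> in M. \<omega> \<in> space M" by (rule AE_space)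
  ultimately show "AE \<omega> in M. integrable lborel (\<lambda>s. indicat_real J s *\<^sub>R conv t s (f (s, \<omega>)))"
  proof eventually_elim
    fix \<omega> assume \<omega>: "(?v \<omega>)\<^sup>2 \<noteq> \<infinity>" "\<omega> \<in> space M"
    then have "?v \<omega> < \<infinity>" by (auto simp: power_eq_top_ennreal less_top)
    from drift_nn_bound(2)[OF fm J \<omega>(2) this] show "integrable lborel (\<lambda>s. indicat_real J s *\<^sub>R conv t s (f (s, \<omega>)))" .
  qed
  have "(\<integral>\<^sup>+\<omega>. ennreal ((norm (drift J t f \<omega>))\<^sup>2) \<partial>M) \<le> (\<integral>\<^sup>+\<omega>. (ennreal N)\<^sup>2 * (?v \<omega>)\<^sup>2 \<partial>M)"
  proof (intro nn_integral_mono)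
    fix \<omega> assume "\<omega> \<in> space M"
    from power_mono[OF drift_nn_bound(1)[OF fm J this, of t] zero_le, of 2]
    show "ennreal ((norm (drift J t f \<omega>))\<^sup>2) \<le> (ennreal N)\<^sup>2 * (?v \<omega>)\<^sup>2"
      by (simp add: ennreal_power power_mult_distrib)
  qed
  also have "\<dots> = (ennreal N)\<^sup>2 * (\<integral>\<^sup>+\<omega>. (?v \<omega>)\<^sup>2 \<partial>M)" by (rule nn_integral_cmult) measurable
  also have "\<dots> \<le> (ennreal N)\<^sup>2 * ennreal ((D * c)\<^sup>2)" by (intro mult_left_mono v2) simp
  also have "\<dots> = ennreal ((N * D * c)\<^sup>2)"
    using N_pos D c(2) by (simp add: ennreal_power power_mult_distrib mult_ac flip: ennreal_mult)
  finally have le: "(\<integral>\<^sup>+\<omega>. ennreal ((norm (drift J t f \<omega>))\<^sup>2) \<partial>M) \<le> ennreal ((N * D * c)\<^sup>2)" .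
  have nonneg: "0 \<le> N * D * c" using N_pos D c(2) by simp
  show "drift J t f \<in> L2_rv M" "L2_norm M (drift J t f) \<le> N * D * c"
    by (rule L2_norm_leI[OF drift_measurable[OF fm J] nonneg le])+
qed

text \<open>Jensen twice turns the fourth power of the time integral into \<open>c^3\<close> times
  the integral of the fourth power; Tonelli contributes the last factor \<open>c\<close>.\<close>

lemma drift_fourth_moment:
  assumes fm[measurable]: "f \<in> borel_measurable LM" and J: "J \<in> sets borel"
    and C: "\<And>s. s \<in> J \<Longrightarrow> (\<integral>\<^sup>+\<omega>. ennreal (norm (f (s, \<omega>)) ^ 4) \<partial>M) \<le> ennreal C" "0 \<le> C"
    and c: "(\<integral>\<^sup>+s. ennreal (weight J t s) \<partial>lborel) \<le> ennreal c" "0 \<le> c"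
  shows "(\<integral>\<^sup>+\<omega>. ennreal (norm (drift J t f \<omega>) ^ 4) \<partial>M) \<le> ennreal ((N * c) ^ 4 * C)"
proof -
  note [measurable] = drift_measurable[OF fm J, of t] weight_measurable[OF J, of t]
  let ?v = "\<lambda>\<omega>. \<integral>\<^sup>+s. ennreal (weight J t s * norm (f (s, \<omega>))) \<partial>lborel"
  let ?v4 = "\<lambda>\<omega>. \<integral>\<^sup>+s. ennreal (weight J t s * norm (f (s, \<omega>)) ^ 4) \<partial>lborel"
  have "(\<integral>\<^sup>+\<omega>. ennreal (norm (drift J t f \<omega>) ^ 4) \<partial>M) \<le> (\<integral>\<^sup>+\<omega>. (ennreal N ^ 4 * ennreal c ^ 3) * ?v4 \<omega> \<partial>M)"
  proof (intro nn_integral_mono)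
    fix \<omega> assume \<omega>: "\<omega> \<in> space M"
    have [measurable]: "(\<lambda>s. f (s, \<omega>)) \<in> borel_measurable lborel"
      using \<omega> by (intro measurable_compose[OF _ fm]) simp
    have "(?v \<omega>)\<^sup>2 \<le> ennreal c * (\<integral>\<^sup>+s. ennreal (weight J t s * (norm (f (s, \<omega>)))\<^sup>2) \<partial>lborel)"
      by (rule weighted_Jensen_nn[OF _ _ weight_nonneg _ c(1)]) auto
    then have "((?v \<omega>)\<^sup>2)\<^sup>2 \<le> (ennreal c * (\<integral>\<^sup>+s. ennreal (weight J t s * (norm (f (s, \<omega>)))\<^sup>2) \<partial>lborel))\<^sup>2"
      by (rule power_mono) simp
    also have "\<dots> = (ennreal c)\<^sup>2 * (\<integral>\<^sup>+s. ennreal (weight J t s * (norm (f (s, \<omega>)))\<^sup>2) \<partial>lborel)\<^sup>2"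
      by (simp add: power_mult_distrib)
    also have "\<dots> \<le> (ennreal c)\<^sup>2 * (ennreal c * (\<integral>\<^sup>+s. ennreal (weight J t s * ((norm (f (s, \<omega>)))\<^sup>2)\<^sup>2) \<partial>lborel))"
      by (intro mult_left_mono weighted_Jensen_nn[OF _ _ weight_nonneg _ c(1)]) auto
    also have "\<dots> = ennreal c ^ 3 * ?v4 \<omega>"
      by (simp add: power3_eq_cube power2_eq_square mult_ac power4_eq_xxxx)
    finally have *: "(?v \<omega>) ^ 4 \<le> ennreal c ^ 3 * ?v4 \<omega>" by (simp flip: power_mult)
    have "ennreal (norm (drift J t f \<omega>)) ^ 4 \<le> (ennreal N * ?v \<omega>) ^ 4"
      by (rule power_mono[OF drift_nn_bound(1)[OF fm J \<omega>]]) simp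
    also have "\<dots> \<le> ennreal N ^ 4 * (ennreal c ^ 3 * ?v4 \<omega>)"
      unfolding power_mult_distrib by (intro mult_left_mono *) simp
    finally show "ennreal (norm (drift J t f \<omega>) ^ 4) \<le> (ennreal N ^ 4 * ennreal c ^ 3) * ?v4 \<omega>"
      by (simp add: ennreal_power mult.assoc)
  qed
  also have "\<dots> = (ennreal N ^ 4 * ennreal c ^ 3) * (\<integral>\<^sup>+\<omega>. ?v4 \<omega> \<partial>M)" by (rule nn_integral_cmult) measurable
  also have "\<dots> \<le> (ennreal N ^ 4 * ennreal c ^ 3) * (ennreal c * ennreal C)"
    by (intro mult_left_mono weighted_moment_Tonelli[where h="\<lambda>z. norm (f z) ^ 4"] c(1) J C) auto
  also have "\<dots> = ennreal ((N * c) ^ 4 * C)"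
  proof -
    have "N ^ 4 * c ^ 3 * (c * C) = (N * c) ^ 4 * C"
      by (simp add: power_mult_distrib eval_nat_numeral mult_ac)
    moreover have "(ennreal N ^ 4 * ennreal c ^ 3) * (ennreal c * ennreal C) = ennreal (N ^ 4 * c ^ 3 * (c * C))"
      using N_pos c(2) C(2) by (simp add: ennreal_power ennreal_mult)
    ultimately show ?thesis by (simp only:)
  qed
  finally show ?thesis .
qed

lemma weight_integral_UNIV:
  "(\<integral>\<^sup>+s. ennreal (weight J t s) \<partial>lborel) \<le> ennreal (1 / \<nu>)"
  "(\<integral>\<^sup>+s. ennreal ((weight J t s)\<^sup>2) \<partial>lborel) \<le> ennreal ((1 / sqrt (2 * \<nu>))\<^sup>2)"
proof -
  have "(\<integral>\<^sup>+s. ennreal (weight J t s) \<partial>lborel) \<le> (\<integral>\<^sup>+s. ennreal (exp (- \<nu> * (t - s)) * indicat_real {..t} s) \<partial>lborel)"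
    by (intro nn_integral_mono ennreal_leI) (auto simp: weight_def indicator_def)
  then show "(\<integral>\<^sup>+s. ennreal (weight J t s) \<partial>lborel) \<le> ennreal (1 / \<nu>)"
    using nn_integral_exp_atMost[OF \<nu>_pos] by simp
  have "(\<integral>\<^sup>+s. ennreal ((weight J t s)\<^sup>2) \<partial>lborel) \<le> (\<integral>\<^sup>+s. ennreal (exp (- (2 * \<nu>) * (t - s)) * indicat_real {..t} s) \<partial>lborel)"
    by (intro nn_integral_mono ennreal_leI) (auto simp: weight_def indicator_def power2_eq_square algebra_simps simp flip: exp_add)
  also have "\<dots> = ennreal (1 / (2 * \<nu>))"
    using nn_integral_exp_atMost[of "2 * \<nu>" t] \<nu>_pos by simp
  finally show "(\<integral>\<^sup>+s. ennreal ((weight J t s)\<^sup>2) \<partial>lborel) \<le> ennreal ((1 / sqrt (2 * \<nu>))\<^sup>2)"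
    using \<nu>_pos by (simp add: power_divide)
qed

text \<open>Bounds that vanish as the interval shrinks: the drift contributes \<open>t - t0\<close>
  and the noise \<open>sqrt (t - t0)\<close>, the modulus of continuity used in
  \<open>response_exists\<close>.\<close>

lemma weight_integral_interval:
  assumes "t0 \<le> t"
  shows "(\<integral>\<^sup>+s. ennreal (weight {t0..t} t s) \<partial>lborel) \<le> ennreal (t - t0)"
  "(\<integral>\<^sup>+s. ennreal ((weight {t0..t} t s)\<^sup>2) \<partial>lborel) \<le> ennreal ((sqrt (t - t0))\<^sup>2)"
proof -
  have w: "weight {t0..t} t s \<le> indicat_real {t0..t} s" "(weight {t0..t} t s)\<^sup>2 \<le> indicat_real {t0..t} s" for s
    using \<nu>_pos by (auto simp: weight_def indicator_def power_le_one)
  have i: "(\<integral>\<^sup>+s. ennreal (indicat_real {t0..t} s) \<partial>lborel) = ennreal (t - t0)"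
    using assms by (simp add: ennreal_indicator)
  show "(\<integral>\<^sup>+s. ennreal (weight {t0..t} t s) \<partial>lborel) \<le> ennreal (t - t0)"
    unfolding i[symmetric] by (intro nn_integral_mono ennreal_leI w)
  have "(\<integral>\<^sup>+s. ennreal ((weight {t0..t} t s)\<^sup>2) \<partial>lborel) \<le> ennreal (t - t0)"
    unfolding i[symmetric] by (intro nn_integral_mono ennreal_leI w)
  then show "(\<integral>\<^sup>+s. ennreal ((weight {t0..t} t s)\<^sup>2) \<partial>lborel) \<le> ennreal ((sqrt (t - t0))\<^sup>2)"
    using assms by simp
qed

lemma noise_L2:
  assumes f: "field_bounded J D f" and J: "J \<in> sets borel"
    and c: "(\<integral>\<^sup>+s. ennreal ((weight J t s)\<^sup>2) \<partial>lborel) \<le> ennreal (c\<^sup>2)" "0 \<le> c"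
  shows "(\<lambda>z. indicat_real J (fst z) *\<^sub>R conv t (fst z) (f z)) \<in> L2_rv LM"
    "L2_norm LM (\<lambda>z. indicat_real J (fst z) *\<^sub>R conv t (fst z) (f z)) \<le> N * D * c"
proof -
  have fm[measurable]: "f \<in> borel_measurable LM" and D: "0 \<le> D" using f by (auto simp: field_bounded_def)
  let ?h = "\<lambda>z. indicat_real J (fst z) *\<^sub>R conv t (fst z) (f z)"
  note [measurable] = field_integrand_measurable[OF fm J, of t] weight_measurable[OF J, of t]
  have "(\<integral>\<^sup>+z. ennreal ((norm (?h z))\<^sup>2) \<partial>LM) \<le> (\<integral>\<^sup>+z. ennreal ((N * (weight J t (fst z) * norm (f z)))\<^sup>2) \<partial>LM)"
    by (intro nn_integral_mono ennreal_leI power_mono integrand_le_weight) auto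
  also have "\<dots> = (\<integral>\<^sup>+s. \<integral>\<^sup>+\<omega>. ennreal ((N * (weight J t s * norm (f (s, \<omega>))))\<^sup>2) \<partial>M \<partial>lborel)"
    by (subst nn_integral_fst[symmetric]) auto
  also have "\<dots> = (\<integral>\<^sup>+s. ennreal (N\<^sup>2 * (weight J t s)\<^sup>2) * (\<integral>\<^sup>+\<omega>. ennreal ((norm (f (s, \<omega>)))\<^sup>2) \<partial>M) \<partial>lborel)"
    by (intro nn_integral_cong) (simp add: power_mult_distrib ennreal_mult mult.assoc nn_integral_cmult flip: mult.assoc)
  also have "\<dots> \<le> (\<integral>\<^sup>+s. ennreal ((weight J t s)\<^sup>2) * ennreal (N\<^sup>2 * D\<^sup>2) \<partial>lborel)"
  proof (intro nn_integral_mono)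
    fix s
    show "ennreal (N\<^sup>2 * (weight J t s)\<^sup>2) * (\<integral>\<^sup>+\<omega>. ennreal ((norm (f (s, \<omega>)))\<^sup>2) \<partial>M)
      \<le> ennreal ((weight J t s)\<^sup>2) * ennreal (N\<^sup>2 * D\<^sup>2)"
    proof (cases "s \<in> J")
      case True
      then have "(\<integral>\<^sup>+\<omega>. ennreal ((norm (f (s, \<omega>)))\<^sup>2) \<partial>M) = ennreal ((L2_norm M (\<lambda>\<omega>. f (s, \<omega>)))\<^sup>2)"
        using f by (intro nn_integral_L2) (auto simp: field_bounded_def)
      also have "\<dots> \<le> ennreal (D\<^sup>2)"
        using f True by (intro ennreal_leI power_mono) (auto simp: field_bounded_def)
      finally have "ennreal (N\<^sup>2 * (weight J t s)\<^sup>2) * (\<integral>\<^sup>+\<omega>. ennreal ((norm (f (s, \<omega>)))\<^sup>2) \<partial>M)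
        \<le> ennreal (N\<^sup>2 * (weight J t s)\<^sup>2) * ennreal (D\<^sup>2)" by (rule mult_left_mono) simp
      then show ?thesis by (simp add: mult_ac flip: ennreal_mult)
    qed (simp add: weight_def)
  qed
  also have "\<dots> = (\<integral>\<^sup>+s. ennreal ((weight J t s)\<^sup>2) \<partial>lborel) * ennreal (N\<^sup>2 * D\<^sup>2)"
    by (rule nn_integral_multc) measurable
  also have "\<dots> \<le> ennreal (c\<^sup>2) * ennreal (N\<^sup>2 * D\<^sup>2)" by (intro mult_right_mono c(1)) simp
  also have "\<dots> = ennreal ((N * D * c)\<^sup>2)"
    by (simp add: power_mult_distrib mult_ac flip: ennreal_mult)
  finally have le: "(\<integral>\<^sup>+z. ennreal ((norm (?h z))\<^sup>2) \<partial>LM) \<le> ennreal ((N * D * c)\<^sup>2)" .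
  have nonneg: "0 \<le> N * D * c" using N_pos D c(2) by simp
  show "?h \<in> L2_rv LM" "L2_norm LM ?h \<le> N * D * c"
    by (rule L2_norm_leI[OF field_integrand_measurable[OF fm J] nonneg le])+
qed

lemma response_L2:
  assumes r: "response J t f g X" and f: "field_bounded J D f" and g: "field_bounded J D g" and J: "J \<in> sets borel"
    and c1: "(\<integral>\<^sup>+s. ennreal (weight J t s) \<partial>lborel) \<le> ennreal c1" "0 \<le> c1"
    and c2: "(\<integral>\<^sup>+s. ennreal ((weight J t s)\<^sup>2) \<partial>lborel) \<le> ennreal (c2\<^sup>2)" "0 \<le> c2"
  shows "X \<in> L2_rv M" "L2_norm M X \<le> N * D * (c1 + c2)"
proof -
  obtain I where I: "ito t (\<lambda>z. indicat_real J (fst z) *\<^sub>R conv t (fst z) (g z)) I"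
    and X: "AE \<omega> in M. X \<omega> = drift J t f \<omega> + I \<omega>" and Xm: "X \<in> borel_measurable M"
    using r unfolding response_def by blast
  have sum: "(\<lambda>\<omega>. drift J t f \<omega> + I \<omega>) \<in> L2_rv M"
    using drift_L2[OF f J c1] ito_L2(2)[OF I] by auto
  show "X \<in> L2_rv M" by (rule L2_rv_cong_AE[OF sum Xm X])
  have "L2_norm M X = L2_norm M (\<lambda>\<omega>. drift J t f \<omega> + I \<omega>)"
    by (rule L2_norm_cong_AE[OF Xm L2_rv_measurable[OF sum]]) (use X in auto)
  also have "\<dots> \<le> L2_norm M (drift J t f) + L2_norm M I"
    by (rule L2_norm_triangle[OF drift_L2[OF f J c1] ito_L2(2)[OF I]])
  also have "\<dots> \<le> N * D * c1 + N * D * c2"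
    using drift_L2_norm[OF f J c1] noise_L2(2)[OF g J c2] ito_isometry[OF I] by simp
  finally show "L2_norm M X \<le> N * D * (c1 + c2)" by (simp add: algebra_simps)
qed

text \<open>Norm bound for the response as a map on processes bounded in L2:
  \<open>N / \<nu>\<close> is the mass of the exponential bound on the kernel, and
  \<open>N / sqrt (2 * \<nu>)\<close> is its L2 norm, which enters through the isometry.\<close>

definition gain :: real where "gain = N * (1 / \<nu> + 1 / sqrt (2 * \<nu>))"

lemma response_gain:
  assumes r: "response J t f g X" and f: "field_bounded J D f" and g: "field_bounded J D g" and J: "J \<in> sets borel"
  shows "X \<in> L2_rv M" "L2_norm M X \<le> gain * D"
proof -
  have "0 \<le> 1 / \<nu>" "0 \<le> 1 / sqrt (2 * \<nu>)" using \<nu>_pos by auto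
  from response_L2[OF r f g J weight_integral_UNIV(1) this(1) weight_integral_UNIV(2) this(2)]
  show "X \<in> L2_rv M" "L2_norm M X \<le> gain * D" by (auto simp: gain_def algebra_simps)
qed

text \<open>The two bounds may differ; they serve to make both drift integrals finite, so that the
  integral of the difference splits.\<close>

lemma response_diff:
  assumes r: "response J t f g X" "response J t f' g' X'"
    and f: "field_bounded J D f" "field_bounded J D' f'" and J: "J \<in> sets borel"
  shows "response J t (\<lambda>z. f z - f' z) (\<lambda>z. g z - g' z) (\<lambda>\<omega>. X \<omega> - X' \<omega>)"
proof -
  obtain I where I: "ito t (\<lambda>z. indicat_real J (fst z) *\<^sub>R conv t (fst z) (g z)) I"
    and X: "AE \<omega> in M. X \<omega> = drift J t f \<omega> + I \<omega>" and Xm[measurable]: "X \<in> borel_measurable M"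
    using r(1) unfolding response_def by blast
  obtain I' where I': "ito t (\<lambda>z. indicat_real J (fst z) *\<^sub>R conv t (fst z) (g' z)) I'"
    and X': "AE \<omega> in M. X' \<omega> = drift J t f' \<omega> + I' \<omega>" and Xm'[measurable]: "X' \<in> borel_measurable M"
    using r(2) unfolding response_def by blast
  have pos: "0 \<le> 1 / \<nu>" using \<nu>_pos by simp
  have i: "ito t (\<lambda>z. indicat_real J (fst z) *\<^sub>R conv t (fst z) (g z - g' z)) (\<lambda>\<omega>. I \<omega> - I' \<omega>)"
    using ito_diff[OF I I'] by (simp add: conv_diff scaleR_diff_right)
  have "AE \<omega> in M. X \<omega> - X' \<omega> = drift J t (\<lambda>z. f z - f' z) \<omega> + (I \<omega> - I' \<omega>)"
    using X X' drift_integrable[OF f(1) J weight_integral_UNIV(1) pos, of t] drift_integrable[OF f(2) J weight_integral_UNIV(1) pos, of t]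
    by eventually_elim (simp add: drift_def conv_diff scaleR_diff_right)
  with i show ?thesis unfolding response_def by auto
qed

text \<open>\<open>U (t - t0)\<close> passes through both integrals, and \<open>conv_shift\<close>
  removes the past of \<open>t0\<close>. This leaves integrals over \<open>{t0<..t}\<close>, from
  which the closed interval of the mild equation differs by a null set.\<close>

lemma response_shift:
  assumes t: "t0 \<le> t" and r0: "response UNIV t0 f g X0" and r: "response UNIV t f g X"
    and f: "field_bounded UNIV D f" and gm: "g \<in> borel_measurable LM"
  shows "response {t0..t} t f g (\<lambda>\<omega>. X \<omega> - U (t - t0) (X0 \<omega>))"
proof -
  obtain I where I: "ito t (\<lambda>z. conv t (fst z) (g z)) I"
    and X: "AE \<omega> in M. X \<omega> = drift UNIV t f \<omega> + I \<omega>" and Xm[measurable]: "X \<in> borel_measurable M"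
    using r unfolding response_def by auto
  obtain I0 where I0: "ito t0 (\<lambda>z. conv t0 (fst z) (g z)) I0"
    and X0: "AE \<omega> in M. X0 \<omega> = drift UNIV t0 f \<omega> + I0 \<omega>" and Xm0[measurable]: "X0 \<in> borel_measurable M"
    using r0 unfolding response_def by auto
  have pos: "0 \<le> 1 / \<nu>" using \<nu>_pos by simp
  have i: "ito t (\<lambda>z. indicat_real {t0<..t} (fst z) *\<^sub>R conv t (fst z) (g z)) (\<lambda>\<omega>. I \<omega> - U (t - t0) (I0 \<omega>))"
    using ito_diff[OF I ito_blinfun[OF ito_mono[OF I0 t], of "U (t - t0)"]] by (simp add: conv_shift[OF t])
  have UNIV_borel: "UNIV \<in> sets (borel :: real measure)" by simp
  have AEt: "AE z in LM. fst z \<noteq> t0"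
  proof -
    have "AE s in lborel. AE \<omega> in M. fst (s, \<omega>) \<noteq> t0"
      using AE_lborel_singleton[of t0] by eventually_elim simp
    then show ?thesis by (intro LM.AE_pair_measure) measurable
  qed
  have i': "ito t (\<lambda>z. indicat_real {t0..t} (fst z) *\<^sub>R conv t (fst z) (g z)) (\<lambda>\<omega>. I \<omega> - U (t - t0) (I0 \<omega>))"
  proof (rule ito_cong[OF i field_integrand_measurable[OF gm]])
    show "AE z in LM. indicat_real {t0..t} (fst z) *\<^sub>R conv t (fst z) (g z) = indicat_real {t0<..t} (fst z) *\<^sub>R conv t (fst z) (g z)"
      using AEt by eventually_elim (auto simp: indicator_def)
  qed (use L2_rv_measurable[OF ito_L2(2)[OF i]] in auto)
  have "AE \<omega> in M. X \<omega> - U (t - t0) (X0 \<omega>) = drift {t0..t} t f \<omega> + (I \<omega> - U (t - t0) (I0 \<omega>))"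
    using X X0 drift_integrable[OF f UNIV_borel weight_integral_UNIV(1) pos, of t] drift_integrable[OF f UNIV_borel weight_integral_UNIV(1) pos, of t0] AE_space
  proof eventually_elim
    fix \<omega> assume *: "X \<omega> = drift UNIV t f \<omega> + I \<omega>" "X0 \<omega> = drift UNIV t0 f \<omega> + I0 \<omega>"
      "integrable lborel (\<lambda>s. indicat_real UNIV s *\<^sub>R conv t s (f (s, \<omega>)))"
      "integrable lborel (\<lambda>s. indicat_real UNIV s *\<^sub>R conv t0 s (f (s, \<omega>)))" "\<omega> \<in> space M"
    have [measurable]: "(\<lambda>s. conv t s (f (s, \<omega>))) \<in> borel_measurable lborel"
      using borel_measurable_integrable[OF *(3)] by simp
    have "drift UNIV t f \<omega> - U (t - t0) (drift UNIV t0 f \<omega>) = (\<integral>s. conv t s (f (s, \<omega>)) \<partial>lborel) - (\<integral>s. U (t - t0) (conv t0 s (f (s, \<omega>))) \<partial>lborel)"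
      unfolding drift_def using *(4) by (subst integral_bounded_linear[OF blinfun.bounded_linear_right]) auto
    also have "\<dots> = (\<integral>s. conv t s (f (s, \<omega>)) - U (t - t0) (conv t0 s (f (s, \<omega>))) \<partial>lborel)"
      using *(3,4) by (subst Bochner_Integration.integral_diff) (auto intro: integrable_bounded_linear[OF blinfun.bounded_linear_right])
    also have "\<dots> = (\<integral>s. indicat_real {t0..t} s *\<^sub>R conv t s (f (s, \<omega>)) \<partial>lborel)"
      unfolding conv_shift[OF t]
    proof (rule integral_cong_AE)
      show "AE s in lborel. indicat_real {t0<..t} s *\<^sub>R conv t s (f (s, \<omega>)) = indicat_real {t0..t} s *\<^sub>R conv t s (f (s, \<omega>))"
        using AE_lborel_singleton[of t0] by eventually_elim (auto simp: indicator_def)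
    qed measurable
    finally show "X \<omega> - U (t - t0) (X0 \<omega>) = drift {t0..t} t f \<omega> + (I \<omega> - U (t - t0) (I0 \<omega>))"
      unfolding *(1,2) by (simp add: drift_def blinfun.add_right)
  qed
  with i' show ?thesis unfolding response_def by auto
qed

end

section \<open>Lipschitz coefficients\<close>

text \<open>The class is stable under time shifts and under the limits of shifts that occur, so the
  same \<open>A0\<close> and \<open>L\<close>, and hence the same radius and contraction factor,
  serve all equations to be compared.\<close>

definition lipschitz_coefficient :: "real \<Rightarrow> real \<Rightarrow> (real \<Rightarrow> 'a::real_normed_vector \<Rightarrow> 'a) \<Rightarrow> bool" where
  "lipschitz_coefficient A0 L F \<longleftrightarrow> continuous_on UNIV (\<lambda>(t, x). F t x) \<and> 0 \<le> A0 \<and> 0 \<le> L \<and>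
     (\<forall>t. norm (F t 0) \<le> A0) \<and> (\<forall>t x y. norm (F t x - F t y) \<le> L * norm (x - y))"

lemma lipschitz_coefficient_growth:
  assumes "lipschitz_coefficient A0 L F" shows "norm (F t x) \<le> A0 + L * norm x"
proof -
  have "norm (F t x) \<le> norm (F t 0) + norm (F t x - F t 0)"
    using norm_triangle_ineq[of "F t 0" "F t x - F t 0"] by simp
  moreover have "norm (F t 0) \<le> A0" "norm (F t x - F t 0) \<le> L * norm (x - 0)"
    using assms unfolding lipschitz_coefficient_def by blast+
  ultimately show ?thesis by simp
qed

text \<open>A left sum of an increasing function lies below its integral; here this comes from
  \<open>1 + x \<le> exp x\<close>, after which the sum telescopes. The bound depends neither on the
  partition nor on its length.\<close>

lemma riemann_sum_exp_le:
  fixes \<tau> :: "nat \<Rightarrow> real"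
  assumes c: "0 < c" and mono: "\<And>i. i < n \<Longrightarrow> \<tau> i \<le> \<tau> (Suc i)" and le: "\<tau> n \<le> t"
  shows "(\<Sum>i<n. (\<tau> (Suc i) - \<tau> i) * exp (- c * (t - \<tau> i))) \<le> 1 / c"
proof -
  have "(\<Sum>i<n. (\<tau> (Suc i) - \<tau> i) * exp (- c * (t - \<tau> i))) \<le> (\<Sum>i<n. exp (- c * (t - \<tau> (Suc i))) / c - exp (- c * (t - \<tau> i)) / c)"
  proof (rule sum_mono)
    fix i assume "i \<in> {..<n}"
    have "exp (- c * (t - \<tau> (Suc i))) = exp (c * (\<tau> (Suc i) - \<tau> i)) * exp (- c * (t - \<tau> i))"
      by (simp add: algebra_simps flip: exp_add)
    moreover have "(1 + c * (\<tau> (Suc i) - \<tau> i)) * exp (- c * (t - \<tau> i)) \<le> exp (c * (\<tau> (Suc i) - \<tau> i)) * exp (- c * (t - \<tau> i))"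
      by (intro mult_right_mono exp_ge_add_one_self) simp
    ultimately have "c * ((\<tau> (Suc i) - \<tau> i) * exp (- c * (t - \<tau> i))) \<le> exp (- c * (t - \<tau> (Suc i))) - exp (- c * (t - \<tau> i))"
      by (simp add: algebra_simps)
    then show "(\<tau> (Suc i) - \<tau> i) * exp (- c * (t - \<tau> i)) \<le> exp (- c * (t - \<tau> (Suc i))) / c - exp (- c * (t - \<tau> i)) / c"
      using c by (simp add: pos_le_divide_eq mult.commute flip: diff_divide_distrib)
  qed
  also have "\<dots> = exp (- c * (t - \<tau> n)) / c - exp (- c * (t - \<tau> 0)) / c"
    by (rule sum_lessThan_telescope[of "\<lambda>i. exp (- c * (t - \<tau> i)) / c"])
  also have "\<dots> \<le> 1 / c"
  proof -
    have "exp (- c * (t - \<tau> n)) \<le> 1" using c le by simp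
    then have "exp (- c * (t - \<tau> n)) / c \<le> 1 / c" using c by (simp add: divide_right_mono)
    moreover have "0 \<le> exp (- c * (t - \<tau> 0)) / c" using c by simp
    ultimately show ?thesis by linarith
  qed
  finally show ?thesis .
qed

lemma has_ito_integral_cong:
  assumes "has_ito_integral M W a b g I" "\<And>s \<omega>. s \<in> {a..b} \<Longrightarrow> g s \<omega> = g' s \<omega>"
  shows "has_ito_integral M W a b g' I"
proof -
  let ?R = "restrict_space lborel {a..b} \<Otimes>\<^sub>M M"
  have sp: "z \<in> space ?R \<Longrightarrow> fst z \<in> {a..b}" for z
    by (auto simp: space_pair_measure space_restrict_space)
  have 1: "(\<lambda>(s, \<omega>). g s \<omega>) \<in> borel_measurable ?R \<longleftrightarrow> (\<lambda>(s, \<omega>). g' s \<omega>) \<in> borel_measurable ?R"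
    by (rule measurable_cong) (simp add: case_prod_beta' assms(2)[OF sp])
  have 2: "(\<integral>\<^sup>+ (s, \<omega>). ennreal ((norm (p s \<omega> - g s \<omega>))\<^sup>2) \<partial>?R) = (\<integral>\<^sup>+ (s, \<omega>). ennreal ((norm (p s \<omega> - g' s \<omega>))\<^sup>2) \<partial>?R)" for p
    by (rule nn_integral_cong) (simp add: case_prod_beta' assms(2)[OF sp])
  show ?thesis using assms(1) unfolding has_ito_integral_def 1 2 .
qed

lemma fourth_power_sum_le:
  fixes a b :: real shows "(a + b) ^ 4 \<le> 8 * (a ^ 4 + b ^ 4)"
proof -
  have sq: "(x + y)\<^sup>2 \<le> 2 * (x\<^sup>2 + y\<^sup>2)" for x y :: real
    using sum_squares_bound[of x y] by (simp add: power2_sum)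
  have "((a + b)\<^sup>2)\<^sup>2 \<le> (2 * (a\<^sup>2 + b\<^sup>2))\<^sup>2" by (intro power_mono sq) simp
  also have "\<dots> = 4 * (a\<^sup>2 + b\<^sup>2)\<^sup>2" unfolding power_mult_distrib by simp
  also have "\<dots> \<le> 4 * (2 * ((a\<^sup>2)\<^sup>2 + (b\<^sup>2)\<^sup>2))" by (intro mult_left_mono sq) simp
  finally show ?thesis by simp
qed

section \<open>Regularity, existence and moments of the response\<close>

context stable_wiener
begin

text \<open>\<open>inc\<close> compares a later time with an earlier one, and the semigroup is
  continuous only strongly. To cover times on both sides of \<open>t\<close>, everything is compared
  with the evolution from one common earlier time \<open>t - \<delta>\<close>; this acts on a fixed
  random variable, so dominated convergence applies.\<close>

lemma evolution_L2_continuous: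
  assumes L: "\<And>t. y t \<in> L2_rv M"
    and inc: "\<And>t0 t. t0 \<le> t \<Longrightarrow> L2_norm M (\<lambda>\<omega>. y t \<omega> - U (t - t0) (y t0 \<omega>)) \<le> C * ((t - t0) + sqrt (t - t0))"
    and C: "0 \<le> C"
  shows "L2_continuous y"
  unfolding L2_continuous_def
proof (intro conjI allI impI L)
  fix t and f :: "nat \<Rightarrow> real" assume f: "f \<longlonglongrightarrow> t"
  show "(\<lambda>n. L2_norm M (\<lambda>\<omega>. y (f n) \<omega> - y t \<omega>)) \<longlonglongrightarrow> 0"
  proof (rule order_tendstoI)
    fix \<epsilon> :: real assume "0 < \<epsilon>"
    \<comment> \<open>All times considered lie within \<open>2 * \<delta>\<close> after
      \<open>t - \<delta>\<close>, hence this argument of the modulus.\<close>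
    have "((\<lambda>\<delta>. C * (2 * \<delta> + sqrt (2 * \<delta>))) \<longlongrightarrow> C * (2 * 0 + sqrt (2 * 0))) (at_right 0)"
      by (intro tendsto_intros)
    then have "\<forall>\<^sub>F \<delta> in at_right 0. C * (2 * \<delta> + sqrt (2 * \<delta>)) < \<epsilon> / 4"
      using \<open>0 < \<epsilon>\<close> by (intro order_tendstoD(2)) auto
    moreover have "\<forall>\<^sub>F \<delta> in at_right (0::real). 0 < \<delta>" by (rule eventually_at_right_less)
    ultimately have "\<forall>\<^sub>F \<delta> in at_right 0. C * (2 * \<delta> + sqrt (2 * \<delta>)) < \<epsilon> / 4 \<and> 0 < \<delta>"
      by (rule eventually_conj)
    then obtain \<delta> where \<delta>: "C * (2 * \<delta> + sqrt (2 * \<delta>)) < \<epsilon> / 4" "0 < \<delta>"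
      using eventually_happens'[OF trivial_limit_at_right_real] by blast
    let ?t = "t - \<delta>"
    note [measurable] = L2_rv_measurable[OF L]
    have near: "L2_norm M (\<lambda>\<omega>. y s \<omega> - U (s - ?t) (y ?t \<omega>)) < \<epsilon> / 4" if "?t \<le> s" "s \<le> t + \<delta>" for s
    proof -
      have "(s - ?t) + sqrt (s - ?t) \<le> 2 * \<delta> + sqrt (2 * \<delta>)" using that by (intro add_mono real_sqrt_le_mono) auto
      from mult_left_mono[OF this C] inc[OF that(1)] \<delta>(1) show ?thesis by linarith
    qed
    \<comment> \<open>The maximum with 0 keeps the semigroup time admissible for the finitely many
      \<open>n\<close> with \<open>f n < t - \<delta>\<close>.\<close>
    let ?V = "\<lambda>n \<omega>. U (max 0 (f n - ?t)) (y ?t \<omega>)"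
    have VL: "(\<lambda>\<omega>. U h (y ?t \<omega>)) \<in> L2_rv M" for h by (rule L2_rv_blinfun[OF L])
    have "(\<lambda>n. L2_norm M (\<lambda>\<omega>. ?V n \<omega> - U \<delta> (y ?t \<omega>))) \<longlonglongrightarrow> 0"
    proof (rule L2_dominated_convergence)
      show "(\<lambda>\<omega>. (2 * N) *\<^sub>R y ?t \<omega>) \<in> L2_rv M" using L by auto
      have "(\<lambda>n. max 0 (f n - ?t)) \<longlonglongrightarrow> max 0 (t - ?t)" by (intro tendsto_intros f)
      then have "(\<lambda>n. max 0 (f n - ?t)) \<longlonglongrightarrow> \<delta>" using \<delta>(2) by simp
      from U_tendsto[OF this _ _ tendsto_const] show "AE \<omega> in M. (\<lambda>n. ?V n \<omega>) \<longlonglongrightarrow> U \<delta> (y ?t \<omega>)"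
        using \<delta>(2) by (intro AE_I2) auto
      show "AE \<omega> in M. norm (?V n \<omega> - U \<delta> (y ?t \<omega>)) \<le> norm ((2 * N) *\<^sub>R y ?t \<omega>)" for n
      proof (intro AE_I2)
        fix \<omega>
        have "norm (?V n \<omega> - U \<delta> (y ?t \<omega>)) \<le> norm (?V n \<omega>) + norm (U \<delta> (y ?t \<omega>))" by (rule norm_triangle_ineq4)
        also have "\<dots> \<le> N * norm (y ?t \<omega>) + N * norm (y ?t \<omega>)"
          using \<delta>(2) by (intro add_mono U_bound') auto
        finally show "norm (?V n \<omega> - U \<delta> (y ?t \<omega>)) \<le> norm ((2 * N) *\<^sub>R y ?t \<omega>)" using N_pos by simp
      qed
    qed measurable
    then have "\<forall>\<^sub>F n in sequentially. L2_norm M (\<lambda>\<omega>. ?V n \<omega> - U \<delta> (y ?t \<omega>)) < \<epsilon> / 4"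
      using \<open>0 < \<epsilon>\<close> by (intro order_tendstoD(2)) auto
    moreover have "\<forall>\<^sub>F n in sequentially. ?t < f n" "\<forall>\<^sub>F n in sequentially. f n < t + \<delta>"
      using order_tendstoD[OF f] \<delta>(2) by auto
    ultimately show "\<forall>\<^sub>F n in sequentially. L2_norm M (\<lambda>\<omega>. y (f n) \<omega> - y t \<omega>) < \<epsilon>"
    proof eventually_elim
      fix n assume n: "L2_norm M (\<lambda>\<omega>. ?V n \<omega> - U \<delta> (y ?t \<omega>)) < \<epsilon> / 4" "?t < f n" "f n < t + \<delta>"
      have max: "max 0 (f n - ?t) = f n - ?t" using n by simp
      have "L2_norm M (\<lambda>\<omega>. y (f n) \<omega> - y t \<omega>) \<le> L2_norm M (\<lambda>\<omega>. y (f n) \<omega> - U (f n - ?t) (y ?t \<omega>)) + L2_norm M (\<lambda>\<omega>. U (f n - ?t) (y ?t \<omega>) - y t \<omega>)"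
        by (rule L2_norm_diff_triangle[OF L VL L])
      also have "L2_norm M (\<lambda>\<omega>. U (f n - ?t) (y ?t \<omega>) - y t \<omega>) \<le> L2_norm M (\<lambda>\<omega>. U (f n - ?t) (y ?t \<omega>) - U \<delta> (y ?t \<omega>)) + L2_norm M (\<lambda>\<omega>. U \<delta> (y ?t \<omega>) - y t \<omega>)"
        by (rule L2_norm_diff_triangle[OF VL VL L])
      also have "L2_norm M (\<lambda>\<omega>. U \<delta> (y ?t \<omega>) - y t \<omega>) = L2_norm M (\<lambda>\<omega>. y t \<omega> - U (t - ?t) (y ?t \<omega>))"
        by (subst L2_norm_minus_commute) simp
      finally show "L2_norm M (\<lambda>\<omega>. y (f n) \<omega> - y t \<omega>) < \<epsilon>"
        using near[of "f n"] near[of t] n \<delta>(2) \<open>0 < \<epsilon>\<close> unfolding max by linarith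
    qed
  qed (auto intro!: always_eventually intro: less_le_trans)
qed

abbreviation curried :: "(real \<times> 'w \<Rightarrow> 'a) \<Rightarrow> real \<Rightarrow> 'w \<Rightarrow> 'a" where
  "curried g \<equiv> \<lambda>s \<omega>. g (s, \<omega>)"

lemma conv_adapted:
  assumes "progressive (curried g)"
  shows "(\<lambda>\<omega>. conv t s (g (s, \<omega>))) \<in> borel_measurable (Filt s)"
  using progressive_adapted[OF assms, of s] unfolding conv_def by measurable

lemma conv_L2:
  assumes "X \<in> L2_rv M"
  shows "(\<lambda>\<omega>. conv t s (X \<omega>)) \<in> L2_rv M" "L2_norm M (\<lambda>\<omega>. conv t s (X \<omega>)) \<le> N * L2_norm M X"
proof -
  have le: "AE \<omega> in M. norm (conv t s (X \<omega>)) \<le> norm (N *\<^sub>R X \<omega>)"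
    using norm_conv_le[of t s] N_pos by (intro AE_I2) simp
  have m: "(\<lambda>\<omega>. conv t s (X \<omega>)) \<in> borel_measurable M"
    unfolding conv_def using L2_rv_measurable[OF assms] by measurable
  show "(\<lambda>\<omega>. conv t s (X \<omega>)) \<in> L2_rv M" "L2_norm M (\<lambda>\<omega>. conv t s (X \<omega>)) \<le> N * L2_norm M X"
    using L2_rv_mono[OF L2_rv_scaleR[OF assms] m le] N_pos by (auto simp: L2_norm_scaleR)
qed

text \<open>The error splits into one from \<open>y\<close>, amplified by at most \<open>N\<close>,
  and one from the kernel at the fixed variable \<open>y s\<close>, for which strong continuity and
  domination suffice.\<close>

lemma conv_L2_continuous:
  assumes g: "L2_continuous y" and s: "s \<le> t" "\<And>n. f n \<le> t" "f \<longlonglongrightarrow> s"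
  shows "(\<lambda>n. L2_norm M (\<lambda>\<omega>. conv t (f n) (y (f n) \<omega>) - conv t s (y s \<omega>))) \<longlonglongrightarrow> 0"
proof -
  have L: "y s \<in> L2_rv M" for s using g by (simp add: L2_continuous_def)
  note [measurable] = L2_rv_measurable[OF L] L2_rv_measurable[OF conv_L2(1)[OF L]]
  have c: "conv t s h = U (t - s) h" "conv t (f n) h = U (t - f n) h" for n h using s by (auto simp: conv_def)
  have 1: "(\<lambda>n. L2_norm M (\<lambda>\<omega>. conv t (f n) (y s \<omega>) - conv t s (y s \<omega>))) \<longlonglongrightarrow> 0"
  proof (rule L2_dominated_convergence)
    show "(\<lambda>\<omega>. (2 * N) *\<^sub>R y s \<omega>) \<in> L2_rv M" using L by auto
    have "(\<lambda>n. t - f n) \<longlonglongrightarrow> t - s" by (intro tendsto_intros s)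
    from U_tendsto[OF this _ _ tendsto_const] show "AE \<omega> in M. (\<lambda>n. conv t (f n) (y s \<omega>)) \<longlonglongrightarrow> conv t s (y s \<omega>)"
      unfolding c using s by (intro AE_I2) auto
    show "AE \<omega> in M. norm (conv t (f n) (y s \<omega>) - conv t s (y s \<omega>)) \<le> norm ((2 * N) *\<^sub>R y s \<omega>)" for n
    proof (intro AE_I2)
      fix \<omega>
      have "norm (conv t (f n) (y s \<omega>) - conv t s (y s \<omega>)) \<le> norm (conv t (f n) (y s \<omega>)) + norm (conv t s (y s \<omega>))" by (rule norm_triangle_ineq4)
      also have "\<dots> \<le> N * norm (y s \<omega>) + N * norm (y s \<omega>)"
        by (intro add_mono norm_conv_le)
      finally show "norm (conv t (f n) (y s \<omega>) - conv t s (y s \<omega>)) \<le> norm ((2 * N) *\<^sub>R y s \<omega>)" using N_pos by simp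
    qed
  qed measurable
  have "(\<lambda>n. L2_norm M (\<lambda>\<omega>. y (f n) \<omega> - y s \<omega>)) \<longlonglongrightarrow> 0"
    using g s(3) unfolding L2_continuous_def by blast
  from tendsto_add_zero[OF tendsto_mult_right_zero[OF this, of N] 1]
  have 2: "(\<lambda>n. N * L2_norm M (\<lambda>\<omega>. y (f n) \<omega> - y s \<omega>) + L2_norm M (\<lambda>\<omega>. conv t (f n) (y s \<omega>) - conv t s (y s \<omega>))) \<longlonglongrightarrow> 0" .
  show ?thesis
  proof (rule tendsto_sandwich[OF _ _ tendsto_const 2]; intro always_eventually allI)
    fix n
    have "L2_norm M (\<lambda>\<omega>. conv t (f n) (y (f n) \<omega>) - conv t s (y s \<omega>)) \<le>
      L2_norm M (\<lambda>\<omega>. conv t (f n) (y (f n) \<omega>) - conv t (f n) (y s \<omega>)) + L2_norm M (\<lambda>\<omega>. conv t (f n) (y s \<omega>) - conv t s (y s \<omega>))"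
      by (intro L2_norm_diff_triangle conv_L2 L)
    moreover have "L2_norm M (\<lambda>\<omega>. conv t (f n) (y (f n) \<omega>) - conv t (f n) (y s \<omega>)) \<le> N * L2_norm M (\<lambda>\<omega>. y (f n) \<omega> - y s \<omega>)"
      using conv_L2(2)[OF L2_rv_diff[OF L[of "f n"] L[of s]], of t "f n"] by (simp add: conv_diff)
    ultimately show "L2_norm M (\<lambda>\<omega>. conv t (f n) (y (f n) \<omega>) - conv t s (y s \<omega>)) \<le> N * L2_norm M (\<lambda>\<omega>. y (f n) \<omega> - y s \<omega>) + L2_norm M (\<lambda>\<omega>. conv t (f n) (y s \<omega>) - conv t s (y s \<omega>))"
      by linarith
  qed simp
qed

lemma noise_interval:
  assumes g: "progressive (curried g)" "L2_continuous (curried g)" "field_bounded UNIV D g" and a: "a \<le> t"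
  obtains I where "I \<in> borel_measurable (Filt t)" "has_ito_integral M W a t (\<lambda>s \<omega>. conv t s (g (s, \<omega>))) I"
    "\<And>n. ito_sum a t (\<lambda>s \<omega>. conv t s (g (s, \<omega>))) n \<in> L2_rv M"
    "(\<lambda>n. L2_norm M (\<lambda>\<omega>. ito_sum a t (\<lambda>s \<omega>. conv t s (g (s, \<omega>))) n \<omega> - I \<omega>)) \<longlonglongrightarrow> 0"
proof (rule has_ito_integral_exists[OF a])
  have gm: "g \<in> borel_measurable LM" and gL: "\<And>s. (\<lambda>\<omega>. g (s, \<omega>)) \<in> L2_rv M" "\<And>s. L2_norm M (\<lambda>\<omega>. g (s, \<omega>)) \<le> D"
    using g(3) by (auto simp: field_bounded_def)
  let ?R = "restrict_space lborel {a..t} \<Otimes>\<^sub>M M"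
  have "(\<lambda>z. conv t (fst z) (g z)) \<in> borel_measurable LM"
    using field_integrand_measurable[OF gm, of UNIV t] by simp
  from measurable_compose[OF measurable_restrict_pair this]
  show "(\<lambda>(s, \<omega>). conv t s (g (s, \<omega>))) \<in> borel_measurable ?R"
    by (simp add: case_prod_beta')
  show "(\<lambda>\<omega>. conv t s (g (s, \<omega>))) \<in> borel_measurable (Filt s)" for s by (rule conv_adapted[OF g(1)])
  show "(\<lambda>\<omega>. conv t s (g (s, \<omega>))) \<in> L2_rv M" for s by (rule conv_L2(1)[OF gL(1)])
  show "L2_norm M (\<lambda>\<omega>. conv t s (g (s, \<omega>))) \<le> N * D" for s
    using order_trans[OF conv_L2(2)[OF gL(1)] mult_left_mono[OF gL(2)]] N_pos by simp
  show "(\<lambda>n. L2_norm M (\<lambda>\<omega>. conv t (f n) (g (f n, \<omega>)) - conv t s (g (s, \<omega>)))) \<longlonglongrightarrow> 0"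
    if "s \<in> {a..t}" "\<And>n. f n \<in> {a..t}" "f \<longlonglongrightarrow> s" for s f
    using conv_L2_continuous[OF g(2) _ _ that(3)] that by simp
qed (rule that)

text \<open>Intervals of integer length exhaust the half line, and the full integrand is its own
  majorant.\<close>

lemma noise_truncation:
  assumes g: "field_bounded UNIV D g"
  shows "(\<lambda>n. L2_norm LM (\<lambda>z. indicat_real {t - real n..t} (fst z) *\<^sub>R conv t (fst z) (g z) - conv t (fst z) (g z))) \<longlonglongrightarrow> 0"
    "(\<lambda>z. conv t (fst z) (g z)) \<in> L2_rv LM"
proof -
  have gm: "g \<in> borel_measurable LM" using g by (simp add: field_bounded_def)
  have nu: "0 \<le> 1 / sqrt (2 * \<nu>)" using \<nu>_pos by simp
  show L: "(\<lambda>z. conv t (fst z) (g z)) \<in> L2_rv LM"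
    using noise_L2(1)[OF g _ weight_integral_UNIV(2) nu, of t] by simp
  show "(\<lambda>n. L2_norm LM (\<lambda>z. indicat_real {t - real n..t} (fst z) *\<^sub>R conv t (fst z) (g z) - conv t (fst z) (g z))) \<longlonglongrightarrow> 0"
  proof (rule L2_dominated_convergence)
    show "(\<lambda>z. conv t (fst z) (g z)) \<in> L2_rv LM" by (rule L)
    show "(\<lambda>z. indicat_real {t - real n..t} (fst z) *\<^sub>R conv t (fst z) (g z)) \<in> borel_measurable LM" for n
      by (rule field_integrand_measurable[OF gm]) simp
    show "AE z in LM. (\<lambda>n. indicat_real {t - real n..t} (fst z) *\<^sub>R conv t (fst z) (g z)) \<longlonglongrightarrow> conv t (fst z) (g z)"
    proof (intro AE_I2)
      fix z :: "real \<times> 'w"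
      obtain n0 :: nat where n0: "t - fst z \<le> real n0" using real_arch_simple by blast
      have "\<forall>\<^sub>F n in sequentially. indicat_real {t - real n..t} (fst z) *\<^sub>R conv t (fst z) (g z) = conv t (fst z) (g z)"
        using n0 by (intro eventually_sequentiallyI[of n0]) (auto simp: conv_def indicator_def)
      then show "(\<lambda>n. indicat_real {t - real n..t} (fst z) *\<^sub>R conv t (fst z) (g z)) \<longlonglongrightarrow> conv t (fst z) (g z)"
        by (rule tendsto_eventually)
    qed
    show "AE z in LM. norm (indicat_real {t - real n..t} (fst z) *\<^sub>R conv t (fst z) (g z) - conv t (fst z) (g z)) \<le> norm (conv t (fst z) (g z))" for n
      by (intro AE_I2) (auto simp: indicator_def)
  qed (rule L2_rv_measurable[OF L])
qed

lemma noise_exists: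
  assumes g: "progressive (curried g)" "L2_continuous (curried g)" "field_bounded UNIV D g"
  obtains I where "I \<in> borel_measurable (Filt t)" "ito t (\<lambda>z. conv t (fst z) (g z)) I"
proof (rule ito_exists[OF noise_truncation(2)[OF g(3)]])
  fix \<epsilon> :: real assume "0 < \<epsilon>"
  from order_tendstoD(2)[OF noise_truncation(1)[OF g(3)] this]
  obtain n where n: "L2_norm LM (\<lambda>z. indicat_real {t - real n..t} (fst z) *\<^sub>R conv t (fst z) (g z) - conv t (fst z) (g z)) < \<epsilon>"
    using eventually_happens'[OF sequentially_bot] by blast
  obtain I where "has_ito_integral M W (t - real n) t (\<lambda>s \<omega>. conv t s (g (s, \<omega>))) I"
    by (rule noise_interval[OF g, of "t - real n" t]) auto
  from has_ito_integral_imp_ito[OF this]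
  have "ito t (\<lambda>z. indicat_real {t - real n..t} (fst z) *\<^sub>R conv t (fst z) (g z)) I" by simp
  with n show "\<exists>g' I'. ito t g' I' \<and> L2_norm LM (\<lambda>x. g' x - conv t (fst x) (g x)) < \<epsilon>" by blast
qed (rule that)

text \<open>Two limits in L2, from sums to integrals over bounded intervals and from these to the
  half line, each preserving the bound by Fatou. The second is possible because the exponential
  weights make the bound independent of the length \<open>n\<close>.\<close>

lemma noise_fourth_moment:
  assumes g: "progressive (curried g)" "L2_continuous (curried g)" "field_bounded UNIV D g"
    and K: "0 \<le> K" "\<And>s. (\<integral>\<^sup>+\<omega>. ennreal (norm (g (s, \<omega>)) ^ 4) \<partial>M) \<le> ennreal (K ^ 4)"
    and I: "ito t (\<lambda>z. conv t (fst z) (g z)) I"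
  shows "(\<integral>\<^sup>+\<omega>. ennreal (norm (I \<omega>) ^ 4) \<partial>M) \<le> ennreal ((3 * ((N * K)\<^sup>2 * (1 / (2 * \<nu>))))\<^sup>2)"
proof -
  let ?C = "(3 * ((N * K)\<^sup>2 * (1 / (2 * \<nu>))))\<^sup>2"
  let ?h = "\<lambda>s \<omega>. conv t s (g (s, \<omega>))"
  have gL: "\<And>s. (\<lambda>\<omega>. g (s, \<omega>)) \<in> L2_rv M"
    using g(3) by (auto simp: field_bounded_def)
  have h4: "integrable M (\<lambda>\<omega>. norm (?h s \<omega>) ^ 4) \<and> expectation (\<lambda>\<omega>. norm (?h s \<omega>) ^ 4) \<le> (N * exp (- \<nu> * (t - s)) * K) ^ 4" for s
  proof -
    let ?w = "N * exp (- \<nu> * (t - s))"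
    note [measurable] = L2_rv_measurable[OF conv_L2(1)[OF gL[of s], of t s]] L2_rv_measurable[OF gL[of s]]
    have w: "norm (conv t s h) \<le> ?w * norm h" for h
    proof -
      have "N * (exp (- \<nu> * (t - s)) * indicat_real {..t} s) * norm h \<le> ?w * norm h"
        using N_pos by (intro mult_right_mono mult_left_mono) (auto simp: indicator_def)
      with norm_conv[of t s h] show ?thesis by linarith
    qed
    have "(\<integral>\<^sup>+\<omega>. ennreal (norm (?h s \<omega>) ^ 4) \<partial>M) \<le> (\<integral>\<^sup>+\<omega>. ennreal (?w ^ 4) * ennreal (norm (g (s, \<omega>)) ^ 4) \<partial>M)"
    proof (rule nn_integral_mono)
      fix \<omega>
      have "norm (?h s \<omega>) ^ 4 \<le> (?w * norm (g (s, \<omega>))) ^ 4" by (intro power_mono w) simp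
      then have "ennreal (norm (?h s \<omega>) ^ 4) \<le> ennreal (?w ^ 4 * norm (g (s, \<omega>)) ^ 4)"
        unfolding power_mult_distrib by (rule ennreal_leI)
      then show "ennreal (norm (?h s \<omega>) ^ 4) \<le> ennreal (?w ^ 4) * ennreal (norm (g (s, \<omega>)) ^ 4)"
        by (subst ennreal_mult[symmetric]) auto
    qed
    also have "\<dots> = ennreal (?w ^ 4) * (\<integral>\<^sup>+\<omega>. ennreal (norm (g (s, \<omega>)) ^ 4) \<partial>M)"
      by (rule nn_integral_cmult) measurable
    also have "\<dots> \<le> ennreal (?w ^ 4) * ennreal (K ^ 4)" by (intro mult_left_mono K) simp
    also have "\<dots> = ennreal ((?w * K) ^ 4)"
      by (simp add: power_mult_distrib flip: ennreal_mult)
    finally have le: "(\<integral>\<^sup>+\<omega>. ennreal (norm (?h s \<omega>) ^ 4) \<partial>M) \<le> ennreal ((?w * K) ^ 4)" .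
    from le_less_trans[OF le ennreal_less_top]
    have int: "integrable M (\<lambda>\<omega>. norm (?h s \<omega>) ^ 4)" by (intro integrableI_bounded) auto
    with le show ?thesis by (subst (asm) nn_integral_eq_integral) (auto simp: ennreal_le_iff)
  qed
  have trunc: "\<exists>In. ito t (\<lambda>z. indicat_real {t - real n..t} (fst z) *\<^sub>R conv t (fst z) (g z)) In \<and>
      (\<integral>\<^sup>+\<omega>. ennreal (norm (In \<omega>) ^ 4) \<partial>M) \<le> ennreal ?C" for n
  proof -
    let ?a = "t - real n"
    obtain In where In: "has_ito_integral M W ?a t ?h In" "\<And>k. ito_sum ?a t ?h k \<in> L2_rv M"
      "(\<lambda>k. L2_norm M (\<lambda>\<omega>. ito_sum ?a t ?h k \<omega> - In \<omega>)) \<longlonglongrightarrow> 0"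
      by (rule noise_interval[OF g, of ?a t]) auto
    have at: "?a \<le> t" by simp
    from has_ito_integral_imp_ito[OF In(1)]
    have ito: "ito t (\<lambda>z. indicat_real {?a..t} (fst z) *\<^sub>R conv t (fst z) (g z)) In" by simp
    have "(\<integral>\<^sup>+\<omega>. ennreal (norm (ito_sum ?a t ?h k \<omega>) ^ 4) \<partial>M) \<le> ennreal ?C" for k
    proof -
      let ?\<tau> = "uniform_partition ?a t k"
      note up = uniform_partition[OF at, where n=k]
      note fm = fourth_moment_simple_ito[of "Suc k" ?\<tau> "\<lambda>i. ?h (?\<tau> i)" "\<lambda>i. N * exp (- \<nu> * (t - ?\<tau> i)) * K"]
      have int: "integrable M (\<lambda>\<omega>. norm (ito_sum ?a t ?h k \<omega>) ^ 4)"
        unfolding ito_sum_def by (rule fm(1)) (use up h4 conv_adapted[OF g(1)] in auto)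
      \<comment> \<open>Squaring the bounds doubles the rate, so \<open>riemann_sum_exp_le\<close>
        applies with \<open>2 * \<nu>\<close> and yields the factor
        \<open>1 / (2 * \<nu>)\<close>.\<close>
      have "(\<Sum>i<Suc k. (?\<tau> (Suc i) - ?\<tau> i) * (N * exp (- \<nu> * (t - ?\<tau> i)) * K)\<^sup>2)
        = (N * K)\<^sup>2 * (\<Sum>i<Suc k. (?\<tau> (Suc i) - ?\<tau> i) * exp (- (2 * \<nu>) * (t - ?\<tau> i)))"
        unfolding sum_distrib_left
      proof (rule sum.cong[OF refl])
        fix i
        have "(exp (- \<nu> * (t - ?\<tau> i)))\<^sup>2 = exp (- (2 * \<nu>) * (t - ?\<tau> i))"
          by (simp add: power2_eq_square algebra_simps flip: exp_add)
        then show "(?\<tau> (Suc i) - ?\<tau> i) * (N * exp (- \<nu> * (t - ?\<tau> i)) * K)\<^sup>2 = (N * K)\<^sup>2 * ((?\<tau> (Suc i) - ?\<tau> i) * exp (- (2 * \<nu>) * (t - ?\<tau> i)))"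
          by (simp only: power_mult_distrib mult_ac)
      qed
      also have "\<dots> \<le> (N * K)\<^sup>2 * (1 / (2 * \<nu>))"
        by (intro mult_left_mono riemann_sum_exp_le) (use up \<nu>_pos in auto)
      finally have sum: "(\<Sum>i<Suc k. (?\<tau> (Suc i) - ?\<tau> i) * (N * exp (- \<nu> * (t - ?\<tau> i)) * K)\<^sup>2) \<le> (N * K)\<^sup>2 * (1 / (2 * \<nu>))" .
      have sum0: "0 \<le> (\<Sum>i<Suc k. (?\<tau> (Suc i) - ?\<tau> i) * (N * exp (- \<nu> * (t - ?\<tau> i)) * K)\<^sup>2)"
        by (intro sum_nonneg mult_nonneg_nonneg) (use up in auto)
      have "expectation (\<lambda>\<omega>. norm (ito_sum ?a t ?h k \<omega>) ^ 4) \<le> (3 * (\<Sum>i<Suc k. (?\<tau> (Suc i) - ?\<tau> i) * (N * exp (- \<nu> * (t - ?\<tau> i)) * K)\<^sup>2))\<^sup>2"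
        unfolding ito_sum_def by (rule fm(2)) (use up h4 conv_adapted[OF g(1)] in auto)
      also have "\<dots> \<le> ?C" using sum sum0 by (intro power_mono mult_left_mono mult_nonneg_nonneg) auto
      finally show ?thesis using int by (subst nn_integral_eq_integral) (auto intro: ennreal_leI)
    qed
    from fourth_moment_L2_limit[OF In(2) ito_L2(2)[OF ito] In(3) this] ito show ?thesis by blast
  qed
  from choice[OF allI[OF trunc]] obtain In where "\<forall>n. ito t (\<lambda>z. indicat_real {t - real n..t} (fst z) *\<^sub>R conv t (fst z) (g z)) (In n) \<and>
      (\<integral>\<^sup>+\<omega>. ennreal (norm (In n \<omega>) ^ 4) \<partial>M) \<le> ennreal ?C" ..
  then have In: "ito t (\<lambda>z. indicat_real {t - real n..t} (fst z) *\<^sub>R conv t (fst z) (g z)) (In n)"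
      "(\<integral>\<^sup>+\<omega>. ennreal (norm (In n \<omega>) ^ 4) \<partial>M) \<le> ennreal ?C" for n by blast+
  have "(\<lambda>n. L2_norm M (\<lambda>\<omega>. In n \<omega> - I \<omega>)) \<longlonglongrightarrow> 0"
    using noise_truncation(1)[OF g(3), of t] ito_isometry[OF ito_diff[OF In(1) I]] by simp
  from fourth_moment_L2_limit[OF ito_L2(2)[OF In(1)] ito_L2(2)[OF I] this In(2)] show ?thesis .
qed

text \<open>The kernel ignores inputs after \<open>t\<close>, so \<open>f\<close> may be cut off
  there, and progressive measurability applies to the truncated field.\<close>

lemma drift_adapted:
  assumes f: "progressive (curried f)"
  shows "drift UNIV t f \<in> borel_measurable (Filt t)"
proof -
  have 1: "(\<lambda>z. conv t (fst z) (indicat_real {..t} (fst z) *\<^sub>R f z)) \<in> borel_measurable (lborel \<Otimes>\<^sub>M Filt t)"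
    using f[unfolded progressive_def, rule_format, of t] by (intro conv_measurable_compose) (auto simp: measurable_fst)
  have 2: "(\<lambda>x. (snd x, fst x)) \<in> measurable (Filt t \<Otimes>\<^sub>M lborel) (lborel \<Otimes>\<^sub>M Filt t)"
    by measurable
  have "(\<lambda>(\<omega>, s). conv t s (indicat_real {..t} s *\<^sub>R f (s, \<omega>))) \<in> borel_measurable (Filt t \<Otimes>\<^sub>M lborel)"
    using measurable_compose[OF 2 1] by (simp add: case_prod_beta')
  from lborel.borel_measurable_lebesgue_integral[OF this]
  have "(\<lambda>\<omega>. \<integral>s. conv t s (indicat_real {..t} s *\<^sub>R f (s, \<omega>)) \<partial>lborel) \<in> borel_measurable (Filt t)" .
  also have "(\<lambda>\<omega>. \<integral>s. conv t s (indicat_real {..t} s *\<^sub>R f (s, \<omega>)) \<partial>lborel) = drift UNIV t f"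
    unfolding drift_def by (intro ext Bochner_Integration.integral_cong) (auto simp: conv_def indicator_def)
  finally show ?thesis .
qed

text \<open>The integral is chosen for each \<open>t\<close> on its own, so nothing is known about
  joint measurability of the choice. Continuity in L2 follows from the increments over short
  intervals and then permits a progressive version, which changes each value only on a null
  set.\<close>

lemma response_exists:
  assumes f: "progressive (curried f)" "field_bounded UNIV D f"
    and g: "progressive (curried g)" "L2_continuous (curried g)" "field_bounded UNIV D g"
  obtains y where "progressive y" "L2_continuous y" "\<And>t. response UNIV t f g (y t)"
proof -
  have gm: "g \<in> borel_measurable LM" and D: "0 \<le> D" using g(3) by (auto simp: field_bounded_def)
  have "\<exists>I. I \<in> borel_measurable (Filt t) \<and> ito t (\<lambda>z. conv t (fst z) (g z)) I" for t
    by (rule noise_exists[OF g, of t]) blast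
  then obtain I where I: "\<And>t. I t \<in> borel_measurable (Filt t)" "\<And>t. ito t (\<lambda>z. conv t (fst z) (g z)) (I t)"
    using choice[of "\<lambda>t I. I \<in> borel_measurable (Filt t) \<and> ito t (\<lambda>z. conv t (fst z) (g z)) I"] by blast
  define X where "X = (\<lambda>t \<omega>. drift UNIV t f \<omega> + I t \<omega>)"
  have Xad: "X t \<in> borel_measurable (Filt t)" for t
    unfolding X_def using drift_adapted[OF f(1)] I(1) by measurable
  have r: "response UNIV t f g (X t)" for t
    unfolding response_def using I(2)[of t] Filt_measurable_M[OF Xad] by (auto simp: X_def)
  have cont: "L2_continuous X"
  proof (rule evolution_L2_continuous)
    show "X t \<in> L2_rv M" for t by (rule response_gain(1)[OF r f(2) g(3)]) simp
    show "L2_norm M (\<lambda>\<omega>. X t \<omega> - U (t - t0) (X t0 \<omega>)) \<le> (N * D) * ((t - t0) + sqrt (t - t0))" if "t0 \<le> t" for t0 t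
      by (rule response_L2(2)[OF response_shift[OF that r r f(2) gm] _ _ _ weight_integral_interval(1)[OF that] _ weight_integral_interval(2)[OF that]])
        (use f g that in \<open>auto simp: field_bounded_def\<close>)
  qed (use N_pos D in simp)
  obtain y where y: "progressive y" "\<And>t. AE \<omega> in M. y t \<omega> = X t \<omega>"
    by (rule progressive_version[OF cont Xad]; rule that)
  have ym: "y t \<in> borel_measurable M" for t by (rule Filt_measurable_M[OF progressive_adapted[OF y(1)]])
  have yL: "y t \<in> L2_rv M" for t
    using cont by (intro L2_rv_cong_AE[OF _ ym y(2)]) (simp add: L2_continuous_def)
  show thesis
  proof (rule that[OF y(1)])
    show "L2_continuous y"
      unfolding L2_continuous_def
    proof (intro conjI allI impI yL)
      fix t and fn :: "nat \<Rightarrow> real" assume "fn \<longlonglongrightarrow> t"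
      then have "(\<lambda>n. L2_norm M (\<lambda>\<omega>. X (fn n) \<omega> - X t \<omega>)) \<longlonglongrightarrow> 0"
        using cont unfolding L2_continuous_def by blast
      moreover have "L2_norm M (\<lambda>\<omega>. y (fn n) \<omega> - y t \<omega>) = L2_norm M (\<lambda>\<omega>. X (fn n) \<omega> - X t \<omega>)" for n
      proof (rule L2_norm_cong_AE)
        show "AE \<omega> in M. norm (y (fn n) \<omega> - y t \<omega>) = norm (X (fn n) \<omega> - X t \<omega>)"
          using y(2)[of "fn n"] y(2)[of t] by eventually_elim simp
      qed (use ym Filt_measurable_M[OF Xad] in measurable)
      ultimately show "(\<lambda>n. L2_norm M (\<lambda>\<omega>. y (fn n) \<omega> - y t \<omega>)) \<longlonglongrightarrow> 0" by simp
    qed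
    show "response UNIV t f g (y t)" for t
    proof -
      have "AE \<omega> in M. y t \<omega> = drift UNIV t f \<omega> + I t \<omega>"
        using y(2)[of t] by eventually_elim (simp add: X_def)
      then show ?thesis unfolding response_def using ym I(2)[of t] by auto
    qed
  qed
qed

text \<open>\<open>C\<close> is fixed before \<open>t\<close> and \<open>X\<close>: it depends
  neither on the time nor on the version of the response.\<close>

lemma response_fourth_moment:
  assumes f: "field_bounded UNIV D f"
    and g: "progressive (curried g)" "L2_continuous (curried g)" "field_bounded UNIV D g"
    and K: "0 \<le> K" "\<And>s. (\<integral>\<^sup>+\<omega>. ennreal (norm (f (s, \<omega>)) ^ 4) \<partial>M) \<le> ennreal (K ^ 4)"
      "\<And>s. (\<integral>\<^sup>+\<omega>. ennreal (norm (g (s, \<omega>)) ^ 4) \<partial>M) \<le> ennreal (K ^ 4)"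
  obtains C where "0 \<le> C" "\<And>t X. response UNIV t f g X \<Longrightarrow> (\<integral>\<^sup>+\<omega>. ennreal (norm (X \<omega>) ^ 4) \<partial>M) \<le> ennreal C"
proof -
  \<comment> \<open>Drift bound with mass \<open>1 / \<nu>\<close> of the weight, and noise bound
    from the Riemann sums; the factor 8 below comes from \<open>fourth_power_sum_le\<close>.\<close>
  let ?C1 = "(N * (1 / \<nu>)) ^ 4 * K ^ 4" and ?C2 = "(3 * ((N * K)\<^sup>2 * (1 / (2 * \<nu>))))\<^sup>2"
  have fm: "f \<in> borel_measurable LM" using f by (simp add: field_bounded_def)
  have "(\<integral>\<^sup>+\<omega>. ennreal (norm (X \<omega>) ^ 4) \<partial>M) \<le> ennreal (8 * (?C1 + ?C2))" if r: "response UNIV t f g X" for t X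
  proof -
    obtain I where I: "ito t (\<lambda>z. conv t (fst z) (g z)) I"
      and X: "AE \<omega> in M. X \<omega> = drift UNIV t f \<omega> + I \<omega>" and Xm[measurable]: "X \<in> borel_measurable M"
      using r unfolding response_def by auto
    have [measurable]: "drift UNIV t f \<in> borel_measurable M" by (rule drift_measurable[OF fm]) simp
    note [measurable] = L2_rv_measurable[OF ito_L2(2)[OF I]]
    have pos: "0 \<le> 1 / \<nu>" using \<nu>_pos by simp
    have 1: "(\<integral>\<^sup>+\<omega>. ennreal (norm (drift UNIV t f \<omega>) ^ 4) \<partial>M) \<le> ennreal ?C1"
      by (rule drift_fourth_moment[OF fm _ _ _ weight_integral_UNIV(1) pos]) (use K in auto)
    have 2: "(\<integral>\<^sup>+\<omega>. ennreal (norm (I \<omega>) ^ 4) \<partial>M) \<le> ennreal ?C2"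
      by (rule noise_fourth_moment[OF g K(1,3) I])
    have "(\<integral>\<^sup>+\<omega>. ennreal (norm (X \<omega>) ^ 4) \<partial>M) \<le> (\<integral>\<^sup>+\<omega>. ennreal 8 * (ennreal (norm (drift UNIV t f \<omega>) ^ 4) + ennreal (norm (I \<omega>) ^ 4)) \<partial>M)"
    proof (rule nn_integral_mono_AE, use X in eventually_elim)
      fix \<omega> assume eq: "X \<omega> = drift UNIV t f \<omega> + I \<omega>"
      have "norm (X \<omega>) ^ 4 \<le> (norm (drift UNIV t f \<omega>) + norm (I \<omega>)) ^ 4"
        unfolding eq by (intro power_mono norm_triangle_ineq) simp
      also have "\<dots> \<le> 8 * (norm (drift UNIV t f \<omega>) ^ 4 + norm (I \<omega>) ^ 4)" by (rule fourth_power_sum_le)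
      finally have "ennreal (norm (X \<omega>) ^ 4) \<le> ennreal (8 * (norm (drift UNIV t f \<omega>) ^ 4 + norm (I \<omega>) ^ 4))" by (rule ennreal_leI)
      also have "\<dots> = ennreal 8 * (ennreal (norm (drift UNIV t f \<omega>) ^ 4) + ennreal (norm (I \<omega>) ^ 4))"
        by (subst ennreal_mult) auto
      finally show "ennreal (norm (X \<omega>) ^ 4) \<le> ennreal 8 * (ennreal (norm (drift UNIV t f \<omega>) ^ 4) + ennreal (norm (I \<omega>) ^ 4))" .
    qed
    also have "\<dots> = ennreal 8 * ((\<integral>\<^sup>+\<omega>. ennreal (norm (drift UNIV t f \<omega>) ^ 4) \<partial>M) + (\<integral>\<^sup>+\<omega>. ennreal (norm (I \<omega>) ^ 4) \<partial>M))"
      by (subst nn_integral_cmult) (auto simp: nn_integral_add)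
    also have "\<dots> \<le> ennreal 8 * (ennreal ?C1 + ennreal ?C2)" by (intro mult_left_mono add_mono 1 2) simp
    also have "\<dots> = ennreal (8 * (?C1 + ?C2))" by (subst ennreal_mult) auto
    finally show ?thesis .
  qed
  moreover have "0 \<le> 8 * (?C1 + ?C2)" by simp
  ultimately show thesis using that by blast
qed

section \<open>Superposition operators of the coefficients\<close>

abbreviation nemytskii :: "(real \<Rightarrow> 'a \<Rightarrow> 'a) \<Rightarrow> (real \<Rightarrow> 'w \<Rightarrow> 'a) \<Rightarrow> real \<times> 'w \<Rightarrow> 'a" where
  "nemytskii F x \<equiv> \<lambda>z. F (fst z) (x (fst z) (snd z))"

lemma coefficient_measurable:
  fixes F :: "real \<Rightarrow> 'a \<Rightarrow> 'a"
  assumes F: "lipschitz_coefficient A0 L F" and f: "f \<in> borel_measurable K" "h \<in> borel_measurable K"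
  shows "(\<lambda>z. F (f z) (h z)) \<in> borel_measurable K"
proof -
  have "(\<lambda>(t, x). F t x) \<in> borel_measurable borel"
    using F by (intro borel_measurable_continuous_onI) (simp add: lipschitz_coefficient_def)
  then have "(\<lambda>(t, x). F t x) \<in> borel_measurable (borel \<Otimes>\<^sub>M borel)" unfolding borel_prod .
  from measurable_compose[OF measurable_Pair[OF f] this] show ?thesis by simp
qed

lemma nemytskii_measurable:
  fixes F :: "real \<Rightarrow> 'a \<Rightarrow> 'a"
  assumes F: "lipschitz_coefficient A0 L F" and x: "(\<lambda>z. x (fst z) (snd z)) \<in> borel_measurable LM"
  shows "nemytskii F x \<in> borel_measurable LM"
  by (rule coefficient_measurable[OF F _ x]) simp

lemma nemytskii_progressive:
  fixes F :: "real \<Rightarrow> 'a \<Rightarrow> 'a"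
  assumes F: "lipschitz_coefficient A0 L F" and x: "progressive x"
  shows "progressive (curried (nemytskii F x))"
  unfolding progressive_def
proof
  fix T
  have [measurable]: "fst \<in> borel_measurable (lborel \<Otimes>\<^sub>M Filt T)" by (simp add: measurable_fst)
  \<comment> \<open>The inner indicator makes the argument measurable at time \<open>T\<close>; the
    outer one, added next, removes the value \<open>F s 0\<close> that is left at later
    times.\<close>
  have [measurable]: "(\<lambda>z. F (fst z) (indicat_real {..T} (fst z) *\<^sub>R x (fst z) (snd z))) \<in> borel_measurable (lborel \<Otimes>\<^sub>M Filt T)"
    using x unfolding progressive_def by (intro coefficient_measurable[OF F]) (auto simp: measurable_fst)
  have "(\<lambda>z. indicat_real {..T} (fst z) *\<^sub>R F (fst z) (indicat_real {..T} (fst z) *\<^sub>R x (fst z) (snd z))) \<in> borel_measurable (lborel \<Otimes>\<^sub>M Filt T)"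
    by measurable
  also have "(\<lambda>z. indicat_real {..T} (fst z) *\<^sub>R F (fst z) (indicat_real {..T} (fst z) *\<^sub>R x (fst z) (snd z))) =
     (\<lambda>z. indicat_real {..T} (fst z) *\<^sub>R curried (nemytskii F x) (fst z) (snd z))"
    by (auto simp: indicator_def)
  finally show "(\<lambda>z. indicat_real {..T} (fst z) *\<^sub>R curried (nemytskii F x) (fst z) (snd z)) \<in> borel_measurable (lborel \<Otimes>\<^sub>M Filt T)" .
qed

lemma coefficient_L2:
  fixes F :: "real \<Rightarrow> 'a \<Rightarrow> 'a"
  assumes F: "lipschitz_coefficient A0 L F" and X: "X \<in> L2_rv M"
  shows "(\<lambda>\<omega>. F s (X \<omega>)) \<in> L2_rv M" "L2_norm M (\<lambda>\<omega>. F s (X \<omega>)) \<le> A0 + L * L2_norm M X"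
proof -
  have A: "0 \<le> A0" "0 \<le> L" using F by (auto simp: lipschitz_coefficient_def)
  have m: "(\<lambda>\<omega>. F s (X \<omega>)) \<in> borel_measurable M"
    by (rule coefficient_measurable[OF F _ L2_rv_measurable[OF X]]) simp
  have c: "(\<lambda>\<omega>. A0) \<in> L2_rv M" and n: "(\<lambda>\<omega>. L *\<^sub>R norm (X \<omega>)) \<in> L2_rv M"
    using L2_rv_scaleR[OF L2_rv_norm[OF X]] by auto
  have le: "AE \<omega> in M. norm (F s (X \<omega>)) \<le> norm (A0 + L *\<^sub>R norm (X \<omega>))"
    using lipschitz_coefficient_growth[OF F] A by (intro AE_I2) simp
  show "(\<lambda>\<omega>. F s (X \<omega>)) \<in> L2_rv M" by (rule L2_rv_mono(1)[OF L2_rv_add[OF c n] m le])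
  have "L2_norm M (\<lambda>\<omega>. F s (X \<omega>)) \<le> L2_norm M (\<lambda>\<omega>. A0 + L *\<^sub>R norm (X \<omega>))"
    by (rule L2_rv_mono(2)[OF L2_rv_add[OF c n] m le])
  also have "\<dots> \<le> A0 + L * L2_norm M X"
    using L2_norm_triangle[OF c n] A by (simp add: L2_norm_scaleR L2_norm_norm del: real_scaleR_def)
  finally show "L2_norm M (\<lambda>\<omega>. F s (X \<omega>)) \<le> A0 + L * L2_norm M X" .
qed

lemma coefficient_L2_diff:
  fixes F :: "real \<Rightarrow> 'a \<Rightarrow> 'a"
  assumes F: "lipschitz_coefficient A0 L F" and X: "X \<in> L2_rv M" "Y \<in> L2_rv M"
  shows "L2_norm M (\<lambda>\<omega>. F s (X \<omega>) - F s (Y \<omega>)) \<le> L * L2_norm M (\<lambda>\<omega>. X \<omega> - Y \<omega>)"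
proof -
  have A: "0 \<le> L" using F by (auto simp: lipschitz_coefficient_def)
  have "L2_norm M (\<lambda>\<omega>. F s (X \<omega>) - F s (Y \<omega>)) \<le> L2_norm M (\<lambda>\<omega>. L *\<^sub>R (X \<omega> - Y \<omega>))"
  proof (rule L2_rv_mono(2))
    show "(\<lambda>\<omega>. L *\<^sub>R (X \<omega> - Y \<omega>)) \<in> L2_rv M" using X by auto
    show "(\<lambda>\<omega>. F s (X \<omega>) - F s (Y \<omega>)) \<in> borel_measurable M"
      by (rule L2_rv_measurable[OF L2_rv_diff[OF coefficient_L2(1)[OF F X(1)] coefficient_L2(1)[OF F X(2)]]])
    show "AE \<omega> in M. norm (F s (X \<omega>) - F s (Y \<omega>)) \<le> norm (L *\<^sub>R (X \<omega> - Y \<omega>))"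
      using F A by (intro AE_I2) (simp add: lipschitz_coefficient_def)
  qed
  then show ?thesis using A by (simp add: L2_norm_scaleR)
qed

lemma nemytskii_field_bounded:
  fixes F :: "real \<Rightarrow> 'a \<Rightarrow> 'a"
  assumes F: "lipschitz_coefficient A0 L F" and x: "(\<lambda>z. x (fst z) (snd z)) \<in> borel_measurable LM"
    and R: "0 \<le> R" "\<And>s. s \<in> J \<Longrightarrow> x s \<in> L2_rv M" "\<And>s. s \<in> J \<Longrightarrow> L2_norm M (x s) \<le> R"
  shows "field_bounded J (A0 + L * R) (nemytskii F x)"
  unfolding field_bounded_def
proof (intro conjI ballI)
  have A: "0 \<le> A0" "0 \<le> L" using F by (auto simp: lipschitz_coefficient_def)
  then show "0 \<le> A0 + L * R" using R(1) by simp
  fix s assume s: "s \<in> J"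
  show "(\<lambda>\<omega>. nemytskii F x (s, \<omega>)) \<in> L2_rv M" using coefficient_L2(1)[OF F R(2)[OF s]] by simp
  show "L2_norm M (\<lambda>\<omega>. nemytskii F x (s, \<omega>)) \<le> A0 + L * R"
    using order_trans[OF coefficient_L2(2)[OF F R(2)[OF s]] add_left_mono[OF mult_left_mono[OF R(3)[OF s] A(2)]]] by simp
qed (rule nemytskii_measurable[OF F x])

lemma nemytskii_diff_field_bounded:
  fixes F :: "real \<Rightarrow> 'a \<Rightarrow> 'a"
  assumes F: "lipschitz_coefficient A0 L F"
    and x: "(\<lambda>z. x (fst z) (snd z)) \<in> borel_measurable LM" "(\<lambda>z. y (fst z) (snd z)) \<in> borel_measurable LM"
    and d: "0 \<le> d" "\<And>s. s \<in> J \<Longrightarrow> x s \<in> L2_rv M" "\<And>s. s \<in> J \<Longrightarrow> y s \<in> L2_rv M"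
      "\<And>s. s \<in> J \<Longrightarrow> L2_norm M (\<lambda>\<omega>. x s \<omega> - y s \<omega>) \<le> d"
  shows "field_bounded J (L * d) (\<lambda>z. nemytskii F x z - nemytskii F y z)"
  unfolding field_bounded_def
proof (intro conjI ballI)
  have A: "0 \<le> L" using F by (auto simp: lipschitz_coefficient_def)
  then show "0 \<le> L * d" using d(1) by simp
  show "(\<lambda>z. nemytskii F x z - nemytskii F y z) \<in> borel_measurable LM"
    using nemytskii_measurable[OF F x(1)] nemytskii_measurable[OF F x(2)] by measurable
  fix s assume s: "s \<in> J"
  show "(\<lambda>\<omega>. nemytskii F x (s, \<omega>) - nemytskii F y (s, \<omega>)) \<in> L2_rv M"
    using coefficient_L2(1)[OF F d(2)[OF s]] coefficient_L2(1)[OF F d(3)[OF s]] by auto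
  show "L2_norm M (\<lambda>\<omega>. nemytskii F x (s, \<omega>) - nemytskii F y (s, \<omega>)) \<le> L * d"
    using order_trans[OF coefficient_L2_diff[OF F d(2,3)[OF s]] mult_left_mono[OF d(4)[OF s] A]] by simp
qed

text \<open>In time the coefficient is continuous only pointwise, so its variation is taken at the
  fixed variable \<open>x t\<close>, with linear growth as majorant; the variation of the process is
  absorbed by the Lipschitz bound.\<close>

lemma nemytskii_L2_continuous:
  fixes F :: "real \<Rightarrow> 'a \<Rightarrow> 'a"
  assumes F: "lipschitz_coefficient A0 L F" and x: "L2_continuous x"
  shows "L2_continuous (curried (nemytskii F x))"
  unfolding L2_continuous_def
proof (intro conjI allI impI)
  have L: "x s \<in> L2_rv M" for s using x by (simp add: L2_continuous_def)
  have A: "0 \<le> A0" "0 \<le> L" using F by (auto simp: lipschitz_coefficient_def)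
  show "(\<lambda>\<omega>. nemytskii F x (t, \<omega>)) \<in> L2_rv M" for t using coefficient_L2(1)[OF F L] by simp
  fix t and f :: "nat \<Rightarrow> real" assume f: "f \<longlonglongrightarrow> t"
  note [measurable] = L2_rv_measurable[OF coefficient_L2(1)[OF F L]]
  have 1: "(\<lambda>n. L2_norm M (\<lambda>\<omega>. F (f n) (x t \<omega>) - F t (x t \<omega>))) \<longlonglongrightarrow> 0"
  proof (rule L2_dominated_convergence)
    show "(\<lambda>\<omega>. 2 *\<^sub>R (A0 + L *\<^sub>R norm (x t \<omega>))) \<in> L2_rv M"
      using L2_rv_norm[OF L] by (intro L2_rv_scaleR L2_rv_add L2_rv_const) auto
    have "(\<lambda>n. F (f n) h) \<longlonglongrightarrow> F t h" for h
    proof -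
      have "continuous_on UNIV (\<lambda>(t, x). F t x)" using F by (simp add: lipschitz_coefficient_def)
      then have "isCont (\<lambda>(t, x). F t x) (t, h)" by (simp add: continuous_on_eq_continuous_at)
      from isCont_tendsto_compose[OF this tendsto_Pair[OF f tendsto_const]] show ?thesis by simp
    qed
    then show "AE \<omega> in M. (\<lambda>n. F (f n) (x t \<omega>)) \<longlonglongrightarrow> F t (x t \<omega>)" by simp
    show "AE \<omega> in M. norm (F (f n) (x t \<omega>) - F t (x t \<omega>)) \<le> norm (2 *\<^sub>R (A0 + L *\<^sub>R norm (x t \<omega>)))" for n
    proof (intro AE_I2)
      fix \<omega>
      have "norm (F (f n) (x t \<omega>) - F t (x t \<omega>)) \<le> norm (F (f n) (x t \<omega>)) + norm (F t (x t \<omega>))" by (rule norm_triangle_ineq4)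
      also have "\<dots> \<le> (A0 + L * norm (x t \<omega>)) + (A0 + L * norm (x t \<omega>))"
        by (intro add_mono lipschitz_coefficient_growth[OF F])
      finally show "norm (F (f n) (x t \<omega>) - F t (x t \<omega>)) \<le> norm (2 *\<^sub>R (A0 + L *\<^sub>R norm (x t \<omega>)))" using A by simp
    qed
  qed measurable
  have "(\<lambda>n. L2_norm M (\<lambda>\<omega>. x (f n) \<omega> - x t \<omega>)) \<longlonglongrightarrow> 0"
    using x f unfolding L2_continuous_def by blast
  from tendsto_add_zero[OF tendsto_mult_right_zero[OF this, of L] 1]
  have 2: "(\<lambda>n. L * L2_norm M (\<lambda>\<omega>. x (f n) \<omega> - x t \<omega>) + L2_norm M (\<lambda>\<omega>. F (f n) (x t \<omega>) - F t (x t \<omega>))) \<longlonglongrightarrow> 0" .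
  have "(\<lambda>n. L2_norm M (\<lambda>\<omega>. F (f n) (x (f n) \<omega>) - F t (x t \<omega>))) \<longlonglongrightarrow> 0"
  proof (rule tendsto_sandwich[OF _ _ tendsto_const 2]; intro always_eventually allI)
    fix n
    have "L2_norm M (\<lambda>\<omega>. F (f n) (x (f n) \<omega>) - F t (x t \<omega>)) \<le>
      L2_norm M (\<lambda>\<omega>. F (f n) (x (f n) \<omega>) - F (f n) (x t \<omega>)) + L2_norm M (\<lambda>\<omega>. F (f n) (x t \<omega>) - F t (x t \<omega>))"
      by (intro L2_norm_diff_triangle coefficient_L2(1)[OF F] L)
    with coefficient_L2_diff[OF F L[of "f n"] L[of t], of "f n"]
    show "L2_norm M (\<lambda>\<omega>. F (f n) (x (f n) \<omega>) - F t (x t \<omega>)) \<le> L * L2_norm M (\<lambda>\<omega>. x (f n) \<omega> - x t \<omega>) + L2_norm M (\<lambda>\<omega>. F (f n) (x t \<omega>) - F t (x t \<omega>))"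
      by linarith
  qed simp
  then show "(\<lambda>n. L2_norm M (\<lambda>\<omega>. nemytskii F x (f n, \<omega>) - nemytskii F x (t, \<omega>))) \<longlonglongrightarrow> 0" by simp
qed

lemma coefficient_fourth_moment:
  fixes F :: "real \<Rightarrow> 'a \<Rightarrow> 'a"
  assumes F: "lipschitz_coefficient A0 L F" and X: "X \<in> borel_measurable M"
    and C: "0 \<le> C" "(\<integral>\<^sup>+\<omega>. ennreal (norm (X \<omega>) ^ 4) \<partial>M) \<le> ennreal C"
  shows "(\<integral>\<^sup>+\<omega>. ennreal (norm (F s (X \<omega>)) ^ 4) \<partial>M) \<le> ennreal (8 * (A0 ^ 4 + L ^ 4 * C))"
proof -
  note [measurable] = X
  have A: "0 \<le> A0" "0 \<le> L" using F by (auto simp: lipschitz_coefficient_def)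
  have "(\<integral>\<^sup>+\<omega>. ennreal (norm (F s (X \<omega>)) ^ 4) \<partial>M) \<le> (\<integral>\<^sup>+\<omega>. ennreal (8 * A0 ^ 4) + ennreal (8 * L ^ 4) * ennreal (norm (X \<omega>) ^ 4) \<partial>M)"
  proof (rule nn_integral_mono)
    fix \<omega>
    have "norm (F s (X \<omega>)) ^ 4 \<le> (A0 + L * norm (X \<omega>)) ^ 4"
      by (intro power_mono lipschitz_coefficient_growth[OF F]) simp
    also have "\<dots> \<le> 8 * (A0 ^ 4 + (L * norm (X \<omega>)) ^ 4)" by (rule fourth_power_sum_le)
    finally have "ennreal (norm (F s (X \<omega>)) ^ 4) \<le> ennreal (8 * A0 ^ 4 + 8 * L ^ 4 * norm (X \<omega>) ^ 4)"
      by (intro ennreal_leI) (simp add: power_mult_distrib algebra_simps)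
    also have "\<dots> = ennreal (8 * A0 ^ 4) + ennreal (8 * L ^ 4) * ennreal (norm (X \<omega>) ^ 4)"
      by (simp flip: ennreal_mult)
    finally show "ennreal (norm (F s (X \<omega>)) ^ 4) \<le> ennreal (8 * A0 ^ 4) + ennreal (8 * L ^ 4) * ennreal (norm (X \<omega>) ^ 4)" .
  qed
  also have "\<dots> = ennreal (8 * A0 ^ 4) + ennreal (8 * L ^ 4) * (\<integral>\<^sup>+\<omega>. ennreal (norm (X \<omega>) ^ 4) \<partial>M)"
    by (subst nn_integral_add) (auto simp: nn_integral_cmult emeasure_space_1)
  also have "\<dots> \<le> ennreal (8 * A0 ^ 4) + ennreal (8 * L ^ 4) * ennreal C"
    by (intro add_left_mono mult_left_mono C) simp
  also have "\<dots> = ennreal (8 * (A0 ^ 4 + L ^ 4 * C))"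
    using C(1) by (simp add: algebra_simps flip: ennreal_mult ennreal_plus)
  finally show ?thesis .
qed

end

section \<open>Solutions: existence, uniqueness and stability\<close>

text \<open>Solutions are built adapted to the increments, whereas a mild solution is asked to be
  adapted to \<open>W\<close> itself.\<close>

lemma W_filtration_measurable:
  assumes "X \<in> borel_measurable (increment_filtration M W t)"
  shows "X \<in> borel_measurable (W_filtration M W t)"
proof -
  let ?G = "\<Union>u\<in>{..t}. {W u -` A \<inter> space M | A. A \<in> sets borel}"
  have sp: "space (W_filtration M W t) = space M"
    by (simp add: W_filtration_def space_measure_of_conv)
  have se: "sets (W_filtration M W t) = sigma_sets (space M) ?G"
    unfolding W_filtration_def by (rule sets_measure_of) auto
  have W: "W u \<in> borel_measurable (W_filtration M W t)" if "u \<le> t" for u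
  proof (rule measurableI)
    fix A :: "real set" assume "A \<in> sets borel"
    then have "W u -` A \<inter> space M \<in> ?G" using that by blast
    then show "W u -` A \<inter> space (W_filtration M W t) \<in> sets (W_filtration M W t)"
      unfolding se sp by (rule sigma_sets.Basic)
  qed simp
  have "(\<Union>u\<in>{..t}. \<Union>v\<in>{..t}. {(\<lambda>\<omega>. W u \<omega> - W v \<omega>) -` A \<inter> space M | A. A \<in> sets borel}) \<subseteq> sets (W_filtration M W t)"
  proof clarify
    fix u v and A :: "real set" assume "u \<le> t" "v \<le> t" "A \<in> sets borel"
    then show "(\<lambda>\<omega>. W u \<omega> - W v \<omega>) -` A \<inter> space M \<in> sets (W_filtration M W t)"
      using measurable_sets[OF borel_measurable_diff[OF W W], of u v A] sp by simp
  qed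
  then have "sets (increment_filtration M W t) \<subseteq> sets (W_filtration M W t)"
    unfolding sets_increment_filtration using sets.sigma_sets_subset[of _ "W_filtration M W t"] sp by simp
  then show ?thesis
    using assms measurable_mono[of borel borel "increment_filtration M W t" "W_filtration M W t"] sp by auto
qed

context stable_wiener
begin

lemma L2_continuous_uniform_limit:
  assumes z: "\<And>n. L2_continuous (z n)" and X: "\<And>t. X t \<in> L2_rv M"
    and le: "\<And>n t. L2_norm M (\<lambda>\<omega>. X t \<omega> - z n t \<omega>) \<le> B n" and B: "B \<longlonglongrightarrow> 0"
  shows "L2_continuous X"
  unfolding L2_continuous_def
proof (intro conjI allI impI X)
  have zL: "z n t \<in> L2_rv M" for n t using z by (simp add: L2_continuous_def)
  fix t and f :: "nat \<Rightarrow> real" assume f: "f \<longlonglongrightarrow> t"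
  show "(\<lambda>m. L2_norm M (\<lambda>\<omega>. X (f m) \<omega> - X t \<omega>)) \<longlonglongrightarrow> 0"
  proof (rule order_tendstoI)
    fix \<epsilon> :: real assume e: "0 < \<epsilon>"
    then have "\<forall>\<^sub>F n in sequentially. B n < \<epsilon> / 3" using B by (intro order_tendstoD(2)) auto
    then obtain n where n: "B n < \<epsilon> / 3" using eventually_happens'[OF sequentially_bot] by blast
    have "(\<lambda>m. L2_norm M (\<lambda>\<omega>. z n (f m) \<omega> - z n t \<omega>)) \<longlonglongrightarrow> 0"
      using z[of n] f unfolding L2_continuous_def by blast
    then have "\<forall>\<^sub>F m in sequentially. L2_norm M (\<lambda>\<omega>. z n (f m) \<omega> - z n t \<omega>) < \<epsilon> / 3"
      using e by (intro order_tendstoD(2)) auto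
    then show "\<forall>\<^sub>F m in sequentially. L2_norm M (\<lambda>\<omega>. X (f m) \<omega> - X t \<omega>) < \<epsilon>"
    proof eventually_elim
      fix m assume m: "L2_norm M (\<lambda>\<omega>. z n (f m) \<omega> - z n t \<omega>) < \<epsilon> / 3"
      show "L2_norm M (\<lambda>\<omega>. X (f m) \<omega> - X t \<omega>) < \<epsilon>"
        using L2_norm_diff_triangle[OF X[of "f m"] zL[of n "f m"] X[of t]] L2_norm_diff_triangle[OF zL[of n "f m"] zL[of n t] X[of t]]
          le[of "f m" n] le[of t n] n m by (simp add: L2_norm_minus_commute[of M "z n t"])
    qed
  qed (auto intro!: always_eventually intro: less_le_trans)
qed

lemma response_cong_AE:
  assumes "response J t f g X" "X' \<in> borel_measurable M" "AE \<omega> in M. X' \<omega> = X \<omega>"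
  shows "response J t f g X'"
proof -
  obtain I where I: "ito t (\<lambda>z. indicat_real J (fst z) *\<^sub>R conv t (fst z) (g z)) I" "AE \<omega> in M. X \<omega> = drift J t f \<omega> + I \<omega>"
    using assms(1) unfolding response_def by blast
  have "AE \<omega> in M. X' \<omega> = drift J t f \<omega> + I \<omega>" using I(2) assms(3) by eventually_elim simp
  with I(1) assms(2) show ?thesis unfolding response_def by blast
qed

lemma gain_pos: "0 < gain"
  unfolding gain_def using N_pos \<nu>_pos by (intro mult_pos_pos add_pos_pos) auto

text \<open>The mild equation with initial time sent to minus infinity: for processes bounded in L2
  the term \<open>U (t - t0) (x t0)\<close> fades out exponentially.\<close>

definition global_solution :: "(real \<Rightarrow> 'a \<Rightarrow> 'a) \<Rightarrow> (real \<Rightarrow> 'a \<Rightarrow> 'a) \<Rightarrow> (real \<Rightarrow> 'w \<Rightarrow> 'a) \<Rightarrow> bool" where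
  "global_solution F G x \<longleftrightarrow> progressive x \<and> L2_continuous x \<and>
     (\<forall>t. response UNIV t (nemytskii F x) (nemytskii G x) (x t))"

text \<open>Picard iteration for a map that is only a relation, as each image is a choice of
  versions. \<open>R\<close> solves \<open>R = c (A0 + L R)\<close>, so the ball of radius
  \<open>R\<close> is mapped into itself. The last claim comes from the iterates themselves:
  starting at 0, each has bounded fourth moments, and they approach \<open>x\<close> uniformly in
  time.\<close>

lemma solution_exists:
  assumes F: "lipschitz_coefficient A0 L F" and G: "lipschitz_coefficient A0 L G"
    and c: "gain \<le> c" "c * L < 1" and R: "R = c * A0 / (1 - c * L)"
  obtains x where "global_solution F G x" "\<And>t. L2_norm M (x t) \<le> R"
    "\<And>\<epsilon>. 0 < \<epsilon> \<Longrightarrow> \<exists>C Y. 0 \<le> C \<and> (\<forall>t. Y t \<in> L2_rv M \<and> L2_norm M (\<lambda>\<omega>. x t \<omega> - Y t \<omega>) \<le> \<epsilon> \<and>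
       (\<integral>\<^sup>+\<omega>. ennreal (norm (Y t \<omega>) ^ 4) \<partial>M) \<le> ennreal C)"
proof -
  have A: "0 \<le> A0" "0 \<le> L" using F by (auto simp: lipschitz_coefficient_def)
  have c0: "0 < c" using gain_pos c(1) by simp
  have R0: "0 \<le> R" using A c c0 by (simp add: R)
  have R_eq: "c * (A0 + L * R) = R" using c(2) by (simp add: R field_simps)
  let ?\<kappa> = "c * L"
  have \<kappa>: "0 \<le> ?\<kappa>" using c0 A by simp
  define adm where "adm = (\<lambda>x :: real \<Rightarrow> 'w \<Rightarrow> 'a. progressive x \<and> L2_continuous x \<and> (\<forall>t. L2_norm M (x t) \<le> R))"
  define resp where "resp = (\<lambda>x y. \<forall>t. response UNIV t (nemytskii F x) (nemytskii G x) (y t))"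
  have admD: "progressive x" "L2_continuous x" "L2_norm M (x t) \<le> R" "x t \<in> L2_rv M"
    "(\<lambda>z. x (fst z) (snd z)) \<in> borel_measurable LM" if "adm x" for x t
    using that progressive_measurable[of x] by (auto simp: adm_def L2_continuous_def)
  have fb: "field_bounded UNIV (A0 + L * R) (nemytskii F x)" "field_bounded UNIV (A0 + L * R) (nemytskii G x)" if "adm x" for x
    using nemytskii_field_bounded[OF F admD(5)[OF that] R0 admD(4)[OF that] admD(3)[OF that]]
      nemytskii_field_bounded[OF G admD(5)[OF that] R0 admD(4)[OF that] admD(3)[OF that]] by auto
  have step: "\<exists>y. adm y \<and> resp x y" if x: "adm x" for x
  proof -
    obtain y where y: "progressive y" "L2_continuous y" "\<And>t. response UNIV t (nemytskii F x) (nemytskii G x) (y t)"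
      by (rule response_exists[OF nemytskii_progressive[OF F admD(1)[OF x]] fb(1)[OF x]
        nemytskii_progressive[OF G admD(1)[OF x]] nemytskii_L2_continuous[OF G admD(2)[OF x]] fb(2)[OF x]]) blast
    have "L2_norm M (y t) \<le> R" for t
    proof -
      have "L2_norm M (y t) \<le> gain * (A0 + L * R)"
        by (rule response_gain(2)[OF y(3) fb[OF x]]) simp
      also have "\<dots> \<le> c * (A0 + L * R)" using A R0 c by (intro mult_right_mono) auto
      finally show ?thesis by (simp add: R_eq)
    qed
    with y show ?thesis unfolding adm_def resp_def by blast
  qed
  have contr: "L2_norm M (\<lambda>\<omega>. y t \<omega> - y' t \<omega>) \<le> ?\<kappa> * d"
    if x: "adm x" "adm x'" and y: "resp x y" "resp x' y'" and d: "0 \<le> d" "\<And>s. L2_norm M (\<lambda>\<omega>. x s \<omega> - x' s \<omega>) \<le> d" for x x' y y' d t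
  proof -
    have "response UNIV t (\<lambda>z. nemytskii F x z - nemytskii F x' z) (\<lambda>z. nemytskii G x z - nemytskii G x' z) (\<lambda>\<omega>. y t \<omega> - y' t \<omega>)"
      by (rule response_diff[OF _ _ fb(1)[OF x(1)] fb(1)[OF x(2)]]) (use y in \<open>auto simp: resp_def\<close>)
    then have "L2_norm M (\<lambda>\<omega>. y t \<omega> - y' t \<omega>) \<le> gain * (L * d)"
      by (rule response_gain(2)[OF _ nemytskii_diff_field_bounded[OF F] nemytskii_diff_field_bounded[OF G]])
        (use admD x d in auto)
    also have "\<dots> \<le> c * (L * d)" using A d(1) c by (intro mult_right_mono) auto
    finally show ?thesis by (simp add: mult.assoc)
  qed
  \<comment> \<open>The bound is uniform in time but may grow from one iterate to the next.\<close>
  define m4 where "m4 = (\<lambda>x :: real \<Rightarrow> 'w \<Rightarrow> 'a. \<exists>C. 0 \<le> C \<and> (\<forall>t. (\<integral>\<^sup>+\<omega>. ennreal (norm (x t \<omega>) ^ 4) \<partial>M) \<le> ennreal C))"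
  have m4_step: "m4 y" if x: "adm x" "m4 x" "resp x y" for x y
  proof -
    obtain C where C: "0 \<le> C" "\<And>t. (\<integral>\<^sup>+\<omega>. ennreal (norm (x t \<omega>) ^ 4) \<partial>M) \<le> ennreal C"
      using x(2) unfolding m4_def by blast
    \<comment> \<open>A fourth root because \<open>response_fourth_moment\<close> takes its bound in
      the form \<open>K ^ 4\<close>.\<close>
    define K where "K = root 4 (8 * (A0 ^ 4 + L ^ 4 * C))"
    have K: "0 \<le> K" "K ^ 4 = 8 * (A0 ^ 4 + L ^ 4 * C)"
      unfolding K_def using C(1) A by (auto intro!: real_root_ge_zero)
    have K4: "(\<integral>\<^sup>+\<omega>. ennreal (norm (nemytskii F x (s, \<omega>)) ^ 4) \<partial>M) \<le> ennreal (K ^ 4)"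
      "(\<integral>\<^sup>+\<omega>. ennreal (norm (nemytskii G x (s, \<omega>)) ^ 4) \<partial>M) \<le> ennreal (K ^ 4)" for s
      unfolding K(2) using coefficient_fourth_moment[OF F L2_rv_measurable[OF admD(4)[OF x(1)]] C] coefficient_fourth_moment[OF G L2_rv_measurable[OF admD(4)[OF x(1)]] C] by auto
    obtain C' where "0 \<le> C'" "\<And>t X. response UNIV t (nemytskii F x) (nemytskii G x) X \<Longrightarrow> (\<integral>\<^sup>+\<omega>. ennreal (norm (X \<omega>) ^ 4) \<partial>M) \<le> ennreal C'"
      by (rule response_fourth_moment[OF fb(1)[OF x(1)] nemytskii_progressive[OF G admD(1)[OF x(1)]]
        nemytskii_L2_continuous[OF G admD(2)[OF x(1)]] fb(2)[OF x(1)] K(1) K4]; rule that)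
    with x(3) show ?thesis unfolding m4_def resp_def by blast
  qed
  have "\<exists>z. \<forall>n. (adm (z n) \<and> m4 (z n)) \<and> resp (z n) (z (Suc n))"
  proof (rule dependent_nat_choice[where P="\<lambda>_ x. adm x \<and> m4 x" and Q="\<lambda>_ x y. resp x y"])
    have "progressive (\<lambda>_ _. 0)" unfolding progressive_def by simp
    moreover have "L2_continuous (\<lambda>_ _. 0)" unfolding L2_continuous_def by simp
    moreover have "m4 (\<lambda>_ _. 0)" unfolding m4_def by (intro exI[of _ 0]) simp
    ultimately show "\<exists>x. adm x \<and> m4 x" using R0 unfolding adm_def by (intro exI[of _ "\<lambda>_ _. 0"]) simp
    show "\<exists>y. (adm y \<and> m4 y) \<and> resp x y" if "adm x \<and> m4 x" for x and n :: nat
      using step[of x] m4_step[of x] that by blast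
  qed
  then obtain z where z: "\<And>n. adm (z n)" "\<And>n. m4 (z n)" "\<And>n. resp (z n) (z (Suc n))" by blast
  note zL = admD(4)[OF z(1)]
  have diff: "L2_norm M (\<lambda>\<omega>. z (Suc n) t \<omega> - z n t \<omega>) \<le> ?\<kappa> ^ n * (2 * R)" for n t
  proof (induction n arbitrary: t)
    case 0
    show ?case using L2_norm_triangle_diff[OF zL[of "Suc 0" t] zL[of 0 t]] admD(3)[OF z(1), of "Suc 0" t] admD(3)[OF z(1), of 0 t] by simp
  next
    case (Suc n)
    have "L2_norm M (\<lambda>\<omega>. z (Suc (Suc n)) t \<omega> - z (Suc n) t \<omega>) \<le> ?\<kappa> * (?\<kappa> ^ n * (2 * R))"
      by (rule contr[OF z(1) z(1) z(3) z(3) _ Suc]) (use \<kappa> R0 in simp)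
    then show ?case by (simp add: mult.assoc)
  qed
  \<comment> \<open>The tail of the geometric series that starts from the difference
    \<open>2 * R\<close>. Being independent of \<open>t\<close>, it makes the convergence uniform in
    time and the limit continuous in L2.\<close>
  define B where "B = (\<lambda>n. ?\<kappa> ^ n * (2 * R / (1 - ?\<kappa>)))"
  have B: "B \<longlonglongrightarrow> 0"
    unfolding B_def by (rule tendsto_mult_left_zero, rule LIMSEQ_power_zero) (use \<kappa> c(2) in simp)
  have geo: "summable (\<lambda>i. ?\<kappa> ^ (i + n) * (2 * R))" "(\<Sum>i. ?\<kappa> ^ (i + n) * (2 * R)) = B n" for n
  proof -
    have "(\<lambda>i. ?\<kappa> ^ i) sums (1 / (1 - ?\<kappa>))" by (rule geometric_sums) (use \<kappa> c(2) in simp)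
    from sums_mult2[OF this, of "?\<kappa> ^ n * (2 * R)"] have "(\<lambda>i. ?\<kappa> ^ (i + n) * (2 * R)) sums B n"
      by (simp add: B_def power_add mult_ac)
    then show "summable (\<lambda>i. ?\<kappa> ^ (i + n) * (2 * R))" "(\<Sum>i. ?\<kappa> ^ (i + n) * (2 * R)) = B n"
      by (auto simp: sums_iff)
  qed
  have "\<exists>Y. Y \<in> borel_measurable (Filt t) \<and> Y \<in> L2_rv M \<and> (\<forall>n. L2_norm M (\<lambda>\<omega>. Y \<omega> - z n t \<omega>) \<le> B n)" for t
  proof -
    have summ: "summable (\<lambda>n. L2_norm M (\<lambda>\<omega>. z (Suc n) t \<omega> - z n t \<omega>))"
      by (rule summable_comparison_test'[where N=0, OF geo(1)[of 0]]) (use diff in simp)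
    obtain Y where Y: "Y \<in> borel_measurable (Filt t)" "Y \<in> L2_rv M"
      "\<And>n. L2_norm M (\<lambda>\<omega>. Y \<omega> - z n t \<omega>) \<le> (\<Sum>i. L2_norm M (\<lambda>\<omega>. z (Suc (i + n)) t \<omega> - z (i + n) t \<omega>))"
      by (rule L2_limit_subalgebra[where X="\<lambda>n. z n t", OF subalgebra_Filt[of t] zL progressive_adapted[OF admD(1)[OF z(1)]] summ]; rule that)
    have "(\<Sum>i. L2_norm M (\<lambda>\<omega>. z (Suc (i + n)) t \<omega> - z (i + n) t \<omega>)) \<le> B n" for n
      unfolding geo(2)[symmetric]
    proof (intro suminf_le diff geo(1))
      show "summable (\<lambda>i. L2_norm M (\<lambda>\<omega>. z (Suc (i + n)) t \<omega> - z (i + n) t \<omega>))"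
        using summ summable_iff_shift[of "\<lambda>n. L2_norm M (\<lambda>\<omega>. z (Suc n) t \<omega> - z n t \<omega>)" n] by simp
    qed
    with Y(3) have "L2_norm M (\<lambda>\<omega>. Y \<omega> - z n t \<omega>) \<le> B n" for n by (rule order_trans)
    with Y(1,2) show ?thesis by blast
  qed
  from choice[OF allI[OF this]] obtain X where "\<forall>t. X t \<in> borel_measurable (Filt t) \<and> X t \<in> L2_rv M \<and> (\<forall>n. L2_norm M (\<lambda>\<omega>. X t \<omega> - z n t \<omega>) \<le> B n)" ..
  then have X: "X t \<in> borel_measurable (Filt t)" "X t \<in> L2_rv M" "L2_norm M (\<lambda>\<omega>. X t \<omega> - z n t \<omega>) \<le> B n" for n t
    by blast+
  have Xc: "L2_continuous X"
    by (rule L2_continuous_uniform_limit[OF admD(2)[OF z(1)] X(2,3) B])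
  obtain x where x: "progressive x" "\<And>t. AE \<omega> in M. x t \<omega> = X t \<omega>"
    by (rule progressive_version[OF Xc X(1)]; rule that)
  have xm: "x t \<in> borel_measurable M" for t by (rule Filt_measurable_M[OF progressive_adapted[OF x(1)]])
  have xL: "x t \<in> L2_rv M" for t by (rule L2_rv_cong_AE[OF X(2) xm x(2)])
  have xz: "L2_norm M (\<lambda>\<omega>. x t \<omega> - z n t \<omega>) \<le> B n" for n t
  proof -
    have "L2_norm M (\<lambda>\<omega>. x t \<omega> - z n t \<omega>) = L2_norm M (\<lambda>\<omega>. X t \<omega> - z n t \<omega>)"
      by (rule L2_norm_cong_AE[OF L2_rv_measurable[OF L2_rv_diff[OF xL zL]] L2_rv_measurable[OF L2_rv_diff[OF X(2) zL]]])
        (use x(2)[of t] in eventually_elim, simp)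
    with X(3)[of t n] show ?thesis by simp
  qed
  have xc: "L2_continuous x"
    by (rule L2_continuous_uniform_limit[OF admD(2)[OF z(1)] xL xz B])
  have xR: "L2_norm M (x t) \<le> R" for t
  proof -
    have "(\<lambda>n. R + B n) \<longlonglongrightarrow> R + 0" by (intro tendsto_intros B)
    moreover have "L2_norm M (x t) \<le> R + B n" for n
      using L2_norm_triangle_sub[OF xL zL, of t n t] admD(3)[OF z(1), of n t] xz[of t n] by linarith
    ultimately show ?thesis by (intro LIMSEQ_le_const[of "\<lambda>n. R + B n" R]) auto
  qed
  have adm_x: "adm x" using x(1) xc xR unfolding adm_def by blast
  \<comment> \<open>To see that the limit solves the equation, the map is applied once more. Its
    value \<open>y\<close> at \<open>x\<close> is at distance at most \<open>c * L * B n\<close>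
    from \<open>z (Suc n)\<close>, which in turn tends to \<open>x\<close>.\<close>
  obtain y where y: "adm y" "resp x y" using step[OF adm_x] by blast
  have "AE \<omega> in M. x t \<omega> = y t \<omega>" for t
  proof (rule L2_norm_diff_eq_0_AE[OF xL admD(4)[OF y(1)]])
    fix \<epsilon> :: real assume "0 < \<epsilon>"
    have Bpos: "0 \<le> B n" for n using order_trans[OF L2_norm_nonneg xz] .
    have yz: "L2_norm M (\<lambda>\<omega>. y t \<omega> - z (Suc n) t \<omega>) \<le> ?\<kappa> * B n" for n
      by (rule contr[OF adm_x z(1) y(2) z(3) Bpos xz])
    have "(\<lambda>n. B (Suc n) + ?\<kappa> * B n) \<longlonglongrightarrow> 0 + ?\<kappa> * 0" by (intro tendsto_intros B LIMSEQ_Suc)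
    moreover have "L2_norm M (\<lambda>\<omega>. x t \<omega> - y t \<omega>) \<le> B (Suc n) + ?\<kappa> * B n" for n
      using L2_norm_diff_triangle[OF xL[of t] zL[of "Suc n" t] admD(4)[OF y(1), of t]] xz[of t "Suc n"] yz[of n]
      by (simp add: L2_norm_minus_commute[of M "z (Suc n) t"])
    ultimately have "L2_norm M (\<lambda>\<omega>. x t \<omega> - y t \<omega>) \<le> 0"
      by (intro LIMSEQ_le_const[of "\<lambda>n. B (Suc n) + ?\<kappa> * B n"]) auto
    with \<open>0 < \<epsilon>\<close> show "L2_norm M (\<lambda>\<omega>. x t \<omega> - y t \<omega>) \<le> \<epsilon>" by simp
  qed
  then have "response UNIV t (nemytskii F x) (nemytskii G x) (x t)" for t
    using y(2) by (intro response_cong_AE[OF _ xm]) (auto simp: resp_def)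
  with x(1) xc have "global_solution F G x" unfolding global_solution_def by blast
  moreover have "\<exists>C Y. 0 \<le> C \<and> (\<forall>t. Y t \<in> L2_rv M \<and> L2_norm M (\<lambda>\<omega>. x t \<omega> - Y t \<omega>) \<le> \<epsilon> \<and>
       (\<integral>\<^sup>+\<omega>. ennreal (norm (Y t \<omega>) ^ 4) \<partial>M) \<le> ennreal C)" if e: "0 < \<epsilon>" for \<epsilon>
  proof -
    obtain n where n: "B n < \<epsilon>"
      using eventually_happens'[OF sequentially_bot order_tendstoD(2)[OF B e]] by blast
    obtain C where "0 \<le> C" "\<And>t. (\<integral>\<^sup>+\<omega>. ennreal (norm (z n t \<omega>) ^ 4) \<partial>M) \<le> ennreal C"
      using z(2)[of n] unfolding m4_def by blast
    moreover have "L2_norm M (\<lambda>\<omega>. x t \<omega> - z n t \<omega>) \<le> \<epsilon>" for t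
      using xz[of t n] n by linarith
    ultimately show ?thesis using zL[of n] by blast
  qed
  ultimately show thesis using xR that by blast
qed

text \<open>A mild solution without its adaptedness, which uniqueness does not need: what matters of it is contained in
  the existence of the Ito integral.\<close>

definition increment_solution :: "(real \<Rightarrow> 'a \<Rightarrow> 'a) \<Rightarrow> (real \<Rightarrow> 'a \<Rightarrow> 'a) \<Rightarrow> (real \<Rightarrow> 'w \<Rightarrow> 'a) \<Rightarrow> bool" where
  "increment_solution F G x \<longleftrightarrow> (\<lambda>z. x (fst z) (snd z)) \<in> borel_measurable LM \<and> (\<forall>t. x t \<in> L2_rv M) \<and>
     (\<forall>t0 t. t0 \<le> t \<longrightarrow> response {t0..t} t (nemytskii F x) (nemytskii G x) (\<lambda>\<omega>. x t \<omega> - U (t - t0) (x t0 \<omega>)))"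

lemma global_imp_increment_solution:
  assumes F: "lipschitz_coefficient A0 L F" and G: "lipschitz_coefficient A0 L G"
    and x: "global_solution F G x" and R: "\<And>t. L2_norm M (x t) \<le> R"
  shows "increment_solution F G x"
proof -
  have xm: "(\<lambda>z. x (fst z) (snd z)) \<in> borel_measurable LM" and xL: "\<And>t. x t \<in> L2_rv M"
    and r: "\<And>t. response UNIV t (nemytskii F x) (nemytskii G x) (x t)"
    using x progressive_measurable[of x] by (auto simp: global_solution_def L2_continuous_def)
  have R0: "0 \<le> R" using order_trans[OF L2_norm_nonneg R] .
  show ?thesis
    unfolding increment_solution_def
    using xm xL response_shift[OF _ r r nemytskii_field_bounded[OF F xm R0 xL R] nemytskii_measurable[OF G xm]] by blast
qed

lemma global_imp_mild_solution:
  assumes F: "lipschitz_coefficient A0 L F" and G: "lipschitz_coefficient A0 L G"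
    and x: "global_solution F G x" and R: "\<And>t. L2_norm M (x t) \<le> R"
  shows "mild_solution M W U F G x"
proof -
  have xp: "progressive x" and xc: "L2_continuous x" and xm: "(\<lambda>z. x (fst z) (snd z)) \<in> borel_measurable LM" and xL: "\<And>t. x t \<in> L2_rv M"
    using x progressive_measurable[of x] by (auto simp: global_solution_def L2_continuous_def)
  have R0: "0 \<le> R" using order_trans[OF L2_norm_nonneg R] .
  note fF = nemytskii_field_bounded[OF F xm R0 xL R] and fG = nemytskii_field_bounded[OF G xm R0 xL R]
  have pos: "0 \<le> 1 / \<nu>" using \<nu>_pos by simp
  show ?thesis
    unfolding mild_solution_def
  proof (intro conjI allI impI)
    show "(\<lambda>(t, \<omega>). x t \<omega>) \<in> borel_measurable LM" using xm by (simp add: case_prod_beta')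
    show "x t \<in> borel_measurable (W_filtration M W t)" for t
      by (rule W_filtration_measurable[OF progressive_adapted[OF xp]])
    fix t0 t :: real assume t: "t0 \<le> t"
    obtain I where I: "ito t (\<lambda>z. indicat_real {t0..t} (fst z) *\<^sub>R conv t (fst z) (nemytskii G x z)) I"
      "AE \<omega> in M. x t \<omega> - U (t - t0) (x t0 \<omega>) = drift {t0..t} t (nemytskii F x) \<omega> + I \<omega>"
      using global_imp_increment_solution[OF assms] t unfolding increment_solution_def response_def by blast
    \<comment> \<open>\<open>mild_solution\<close> asks for an integral in the sense of
      \<open>has_ito_integral\<close>; it is constructed from left sums and then identified with the
      abstract \<open>I\<close> by uniqueness.\<close>
    obtain I' where I': "has_ito_integral M W t0 t (\<lambda>s \<omega>. conv t s (nemytskii G x (s, \<omega>))) I'"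
      by (rule noise_interval[OF nemytskii_progressive[OF G xp] nemytskii_L2_continuous[OF G xc] fG t])
    have eq: "AE \<omega> in M. I \<omega> = I' \<omega>"
      by (rule ito_unique[OF I(1) has_ito_integral_imp_ito[OF I']]) simp
    have 1: "has_ito_integral M W t0 t (\<lambda>s \<omega>. U (t - s) (G s (x s \<omega>))) I'"
      by (rule has_ito_integral_cong[OF I']) (simp add: conv_def)
    have c: "indicat_real {t0..t} s *\<^sub>R conv t s h = indicat_real {t0..t} s *\<^sub>R U (t - s) h" for s h
      by (auto simp: conv_def indicator_def)
    have fF': "field_bounded {t0..t} (A0 + L * R) (nemytskii F x)" using fF by (auto simp: field_bounded_def)
    have b: "{t0..t} \<in> sets borel" by simp
    from drift_integrable[OF fF' b weight_integral_UNIV(1) pos, of t]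
    have "AE \<omega> in M. set_integrable lborel {t0..t} (\<lambda>s. U (t - s) (F s (x s \<omega>)))"
      by eventually_elim (simp add: set_integrable_def c)
    with I(2) eq have "AE \<omega> in M. set_integrable lborel {t0..t} (\<lambda>s. U (t - s) (F s (x s \<omega>))) \<and>
      x t \<omega> = U (t - t0) (x t0 \<omega>) + (LINT s:{t0..t}|lborel. U (t - s) (F s (x s \<omega>))) + I' \<omega>"
    proof eventually_elim
      fix \<omega> assume *: "x t \<omega> - U (t - t0) (x t0 \<omega>) = drift {t0..t} t (nemytskii F x) \<omega> + I \<omega>" "I \<omega> = I' \<omega>"
        "set_integrable lborel {t0..t} (\<lambda>s. U (t - s) (F s (x s \<omega>)))"
      have "drift {t0..t} t (nemytskii F x) \<omega> = (LINT s:{t0..t}|lborel. U (t - s) (F s (x s \<omega>)))"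
        by (simp add: drift_def set_lebesgue_integral_def c)
      with * show "set_integrable lborel {t0..t} (\<lambda>s. U (t - s) (F s (x s \<omega>))) \<and>
        x t \<omega> = U (t - t0) (x t0 \<omega>) + (LINT s:{t0..t}|lborel. U (t - s) (F s (x s \<omega>))) + I' \<omega>"
        by (simp add: algebra_simps)
    qed
    with 1 show "\<exists>I. has_ito_integral M W t0 t (\<lambda>s \<omega>. U (t - s) (G s (x s \<omega>))) I \<and>
      (AE \<omega> in M. set_integrable lborel {t0..t} (\<lambda>s. U (t - s) (F s (x s \<omega>))) \<and>
        x t \<omega> = U (t - t0) (x t0 \<omega>) + (LINT s:{t0..t}|lborel. U (t - s) (F s (x s \<omega>))) + I \<omega>)" by blast
  qed
qed

lemma mild_imp_increment_solution:
  assumes x: "mild_solution M W U F G x" and xL: "\<And>t. x t \<in> L2_rv M"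
  shows "increment_solution F G x"
  unfolding increment_solution_def
proof (intro conjI allI impI xL)
  show "(\<lambda>z. x (fst z) (snd z)) \<in> borel_measurable LM"
    using x by (simp add: mild_solution_def case_prod_beta')
  fix t0 t :: real assume t: "t0 \<le> t"
  obtain I where I: "has_ito_integral M W t0 t (\<lambda>s \<omega>. U (t - s) (G s (x s \<omega>))) I"
    "AE \<omega> in M. set_integrable lborel {t0..t} (\<lambda>s. U (t - s) (F s (x s \<omega>))) \<and>
        x t \<omega> = U (t - t0) (x t0 \<omega>) + (LINT s:{t0..t}|lborel. U (t - s) (F s (x s \<omega>))) + I \<omega>"
    using x t unfolding mild_solution_def by blast
  have c: "indicat_real {t0..t} s *\<^sub>R conv t s h = indicat_real {t0..t} s *\<^sub>R U (t - s) h" for s h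
    by (auto simp: conv_def indicator_def)
  have 1: "ito t (\<lambda>z. indicat_real {t0..t} (fst z) *\<^sub>R conv t (fst z) (nemytskii G x z)) I"
    using has_ito_integral_imp_ito[OF I(1)] by (simp add: c)
  have 2: "AE \<omega> in M. x t \<omega> - U (t - t0) (x t0 \<omega>) = drift {t0..t} t (nemytskii F x) \<omega> + I \<omega>"
    using I(2) by eventually_elim (simp add: drift_def set_lebesgue_integral_def c)
  have "(\<lambda>\<omega>. x t \<omega> - U (t - t0) (x t0 \<omega>)) \<in> borel_measurable M"
    by (rule L2_rv_measurable[OF L2_rv_diff[OF xL L2_rv_blinfun[OF xL]]])
  with 1 2 show "response {t0..t} t (nemytskii F x) (nemytskii G x) (\<lambda>\<omega>. x t \<omega> - U (t - t0) (x t0 \<omega>))"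
    unfolding response_def by blast
qed

text \<open>The difference of \<open>F\<close> along \<open>x\<close> and \<open>F'\<close> along
  \<open>y\<close> is split at \<open>F\<close> along \<open>y\<close>: the Lipschitz part costs
  \<open>L * d\<close>, and the rest is a perturbation evaluated along \<open>y\<close> alone. The
  difference at \<open>t0\<close> decays exponentially.\<close>

lemma solution_comparison:
  assumes F: "lipschitz_coefficient A0 L F" "lipschitz_coefficient A0 L F'"
    and G: "lipschitz_coefficient A0 L G" "lipschitz_coefficient A0 L G'"
    and x: "increment_solution F G x" "\<And>t. L2_norm M (x t) \<le> R"
    and y: "increment_solution F' G' y" "\<And>t. L2_norm M (y t) \<le> R"
    and t: "t0 \<le> t" and d: "0 \<le> d" "\<And>s. s \<in> {t0..t} \<Longrightarrow> L2_norm M (\<lambda>\<omega>. x s \<omega> - y s \<omega>) \<le> d"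
    and e: "0 \<le> e" "\<And>s. s \<in> {t0..t} \<Longrightarrow> L2_norm M (\<lambda>\<omega>. F s (y s \<omega>) - F' s (y s \<omega>)) \<le> e"
      "\<And>s. s \<in> {t0..t} \<Longrightarrow> L2_norm M (\<lambda>\<omega>. G s (y s \<omega>) - G' s (y s \<omega>)) \<le> e"
    and c: "gain \<le> c"
  shows "L2_norm M (\<lambda>\<omega>. x t \<omega> - y t \<omega>) \<le> N * exp (- \<nu> * (t - t0)) * (2 * R) + c * (L * d + e)"
proof -
  have R0: "0 \<le> R" using order_trans[OF L2_norm_nonneg x(2)] .
  have A: "0 \<le> L" using F by (auto simp: lipschitz_coefficient_def)
  have xm: "(\<lambda>z. x (fst z) (snd z)) \<in> borel_measurable LM" and xL: "\<And>t. x t \<in> L2_rv M"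
    and ym: "(\<lambda>z. y (fst z) (snd z)) \<in> borel_measurable LM" and yL: "\<And>t. y t \<in> L2_rv M"
    and rx: "response {t0..t} t (nemytskii F x) (nemytskii G x) (\<lambda>\<omega>. x t \<omega> - U (t - t0) (x t0 \<omega>))"
    and ry: "response {t0..t} t (nemytskii F' y) (nemytskii G' y) (\<lambda>\<omega>. y t \<omega> - U (t - t0) (y t0 \<omega>))"
    using x(1) y(1) t unfolding increment_solution_def by auto
  have fd: "field_bounded {t0..t} (L * d + e) (\<lambda>z. nemytskii H x z - nemytskii H' y z)"
    if H: "lipschitz_coefficient A0 L H" "lipschitz_coefficient A0 L H'"
      and He: "\<And>s. s \<in> {t0..t} \<Longrightarrow> L2_norm M (\<lambda>\<omega>. H s (y s \<omega>) - H' s (y s \<omega>)) \<le> e" for H H'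
    unfolding field_bounded_def
  proof (intro conjI ballI)
    show "0 \<le> L * d + e" using A d e by simp
    show "(\<lambda>z. nemytskii H x z - nemytskii H' y z) \<in> borel_measurable LM"
      using nemytskii_measurable[OF H(1) xm] nemytskii_measurable[OF H(2) ym] by measurable
    fix s assume s: "s \<in> {t0..t}"
    note HL = coefficient_L2(1)[OF H(1) xL[of s], of s] coefficient_L2(1)[OF H(1) yL[of s], of s] coefficient_L2(1)[OF H(2) yL[of s], of s]
    show "(\<lambda>\<omega>. nemytskii H x (s, \<omega>) - nemytskii H' y (s, \<omega>)) \<in> L2_rv M" using HL by auto
    show "L2_norm M (\<lambda>\<omega>. nemytskii H x (s, \<omega>) - nemytskii H' y (s, \<omega>)) \<le> L * d + e"
      using L2_norm_diff_triangle[OF HL] coefficient_L2_diff[OF H(1) xL[of s] yL[of s], of s] mult_left_mono[OF d(2)[OF s] A] He[OF s]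
      by simp
  qed
  have b: "{t0..t} \<in> sets borel" by simp
  note r = response_diff[OF rx ry nemytskii_field_bounded[OF F(1) xm R0 xL x(2)] nemytskii_field_bounded[OF F(2) ym R0 yL y(2)] b]
  have L: "(\<lambda>\<omega>. (x t \<omega> - U (t - t0) (x t0 \<omega>)) - (y t \<omega> - U (t - t0) (y t0 \<omega>))) \<in> L2_rv M"
    and le: "L2_norm M (\<lambda>\<omega>. (x t \<omega> - U (t - t0) (x t0 \<omega>)) - (y t \<omega> - U (t - t0) (y t0 \<omega>))) \<le> gain * (L * d + e)"
    using response_gain[OF r fd[OF F e(2)] fd[OF G e(3)] b] by auto
  have "L2_norm M (\<lambda>\<omega>. x t \<omega> - y t \<omega>) = L2_norm M (\<lambda>\<omega>. U (t - t0) (x t0 \<omega> - y t0 \<omega>) + ((x t \<omega> - U (t - t0) (x t0 \<omega>)) - (y t \<omega> - U (t - t0) (y t0 \<omega>))))"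
    by (simp add: blinfun.diff_right algebra_simps)
  also have "\<dots> \<le> L2_norm M (\<lambda>\<omega>. U (t - t0) (x t0 \<omega> - y t0 \<omega>)) + L2_norm M (\<lambda>\<omega>. (x t \<omega> - U (t - t0) (x t0 \<omega>)) - (y t \<omega> - U (t - t0) (y t0 \<omega>)))"
    by (rule L2_norm_triangle[OF L2_rv_blinfun[OF L2_rv_diff[OF xL yL]] L])
  also have "\<dots> \<le> N * exp (- \<nu> * (t - t0)) * (2 * R) + c * (L * d + e)"
  proof (rule add_mono)
    have "L2_norm M (\<lambda>\<omega>. U (t - t0) (x t0 \<omega> - y t0 \<omega>)) \<le> norm (U (t - t0)) * L2_norm M (\<lambda>\<omega>. x t0 \<omega> - y t0 \<omega>)"
      by (rule L2_norm_blinfun[OF L2_rv_diff[OF xL yL]])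
    also have "\<dots> \<le> N * exp (- \<nu> * (t - t0)) * (2 * R)"
      using U_norm[of "t - t0"] t L2_norm_triangle_diff[OF xL[of t0] yL[of t0]] x(2)[of t0] y(2)[of t0] N_pos
      by (intro mult_mono) auto
    finally show "L2_norm M (\<lambda>\<omega>. U (t - t0) (x t0 \<omega> - y t0 \<omega>)) \<le> N * exp (- \<nu> * (t - t0)) * (2 * R)" .
    have "gain * (L * d + e) \<le> c * (L * d + e)" using A d e c by (intro mult_right_mono) auto
    with le show "L2_norm M (\<lambda>\<omega>. (x t \<omega> - U (t - t0) (x t0 \<omega>)) - (y t \<omega> - U (t - t0) (y t0 \<omega>))) \<le> c * (L * d + e)"
      by linarith
  qed
  finally show ?thesis .
qed

lemma exp_decay_small:
  assumes "0 < \<epsilon>"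
  obtains l where "0 \<le> l" "N * exp (- \<nu> * l) * K \<le> \<epsilon>"
proof -
  have "(\<lambda>n. exp (- \<nu> * real n)) = (\<lambda>n. exp (- \<nu>) ^ n)"
    by (simp add: exp_of_nat_mult[symmetric] mult.commute)
  moreover have "(\<lambda>n. exp (- \<nu>) ^ n) \<longlonglongrightarrow> 0" by (rule LIMSEQ_power_zero) (use \<nu>_pos in simp)
  ultimately have "(\<lambda>n. exp (- \<nu> * real n)) \<longlonglongrightarrow> 0" by simp
  then have "(\<lambda>n. N * exp (- \<nu> * real n) * K) \<longlonglongrightarrow> N * 0 * K" by (intro tendsto_intros)
  then have "\<forall>\<^sub>F n in sequentially. N * exp (- \<nu> * real n) * K < \<epsilon>" using assms by (intro order_tendstoD(2)) auto
  then obtain n where "N * exp (- \<nu> * real n) * K < \<epsilon>" using eventually_happens'[OF sequentially_bot] by blast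
  with that[of "real n"] show thesis by simp
qed

text \<open>The error on a time set \<open>S\<close> is controlled by the error on a set \<open>S'\<close> that contains the past of \<open>S\<close> up to
  a large time lag, contracted by the factor \<open>c L\<close>; hence the two cases of uniform convergence on the line
  and on compact intervals are instances of the same iteration over a class \<open>\<T>\<close> of time sets.\<close>

lemma solution_stability:
  fixes Fn Gn :: "nat \<Rightarrow> real \<Rightarrow> 'a \<Rightarrow> 'a"
  assumes Fn: "\<And>n. lipschitz_coefficient A0 L (Fn n)" and Gn: "\<And>n. lipschitz_coefficient A0 L (Gn n)"
    and F: "lipschitz_coefficient A0 L F" and G: "lipschitz_coefficient A0 L G"
    and c: "gain \<le> c" "c * L < 1"
    and x: "\<And>n. increment_solution (Fn n) (Gn n) (x n)" "\<And>n t. L2_norm M (x n t) \<le> R"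
    and y: "increment_solution F G y" "\<And>t. L2_norm M (y t) \<le> R"
    and \<T>: "\<And>S l. S \<in> \<T> \<Longrightarrow> 0 \<le> l \<Longrightarrow> \<exists>S'\<in>\<T>. \<forall>t\<in>S. {t - l..t} \<subseteq> S'"
    and eF: "\<And>S \<epsilon>. S \<in> \<T> \<Longrightarrow> 0 < \<epsilon> \<Longrightarrow> \<forall>\<^sub>F n in sequentially. \<forall>s\<in>S. L2_norm M (\<lambda>\<omega>. Fn n s (y s \<omega>) - F s (y s \<omega>)) \<le> \<epsilon>"
    and eG: "\<And>S \<epsilon>. S \<in> \<T> \<Longrightarrow> 0 < \<epsilon> \<Longrightarrow> \<forall>\<^sub>F n in sequentially. \<forall>s\<in>S. L2_norm M (\<lambda>\<omega>. Gn n s (y s \<omega>) - G s (y s \<omega>)) \<le> \<epsilon>"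
    and S: "S \<in> \<T>" and \<epsilon>: "0 < \<epsilon>"
  shows "\<forall>\<^sub>F n in sequentially. \<forall>t\<in>S. L2_norm M (\<lambda>\<omega>. x n t \<omega> - y t \<omega>) < \<epsilon>"
proof -
  have A: "0 \<le> L" using F by (auto simp: lipschitz_coefficient_def)
  have c0: "0 < c" using gain_pos c(1) by simp
  let ?\<kappa> = "c * L"
  have \<kappa>: "0 \<le> ?\<kappa>" using c0 A by simp
  have R0: "0 \<le> R" using order_trans[OF L2_norm_nonneg y(2)] .
  have xL: "x n t \<in> L2_rv M" and yL: "y t \<in> L2_rv M" for n t
    using x(1) y(1) unfolding increment_solution_def by auto
  \<comment> \<open>Stage 0 is the triangle inequality. Each further stage gains a factor
    \<open>c * L\<close> and uses the previous one on the larger set \<open>S'\<close> with a third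
    of the tolerance, so \<open>S\<close> and \<epsilon> must vary in the induction.\<close>
  have iter: "\<forall>\<^sub>F n in sequentially. \<forall>t\<in>S. L2_norm M (\<lambda>\<omega>. x n t \<omega> - y t \<omega>) \<le> ?\<kappa> ^ k * (2 * R) + \<epsilon>"
    if "S \<in> \<T>" "0 < \<epsilon>" for k S \<epsilon>
    using that
  proof (induction k arbitrary: S \<epsilon>)
    case 0
    have "L2_norm M (\<lambda>\<omega>. x n t \<omega> - y t \<omega>) \<le> ?\<kappa> ^ 0 * (2 * R) + \<epsilon>" for n t
      using L2_norm_triangle_diff[OF xL[of n t] yL[of t]] x(2)[of n t] y(2)[of t] 0 by simp
    then show ?case by simp
  next
    case (Suc k)
    have e3: "0 < \<epsilon> / 3" using Suc.prems by simp
    obtain l where l: "0 \<le> l" "N * exp (- \<nu> * l) * (2 * R) \<le> \<epsilon> / 3" by (rule exp_decay_small[OF e3])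
    obtain S' where S': "S' \<in> \<T>" "\<And>t. t \<in> S \<Longrightarrow> {t - l..t} \<subseteq> S'" using \<T>[OF Suc.prems(1) l(1)] by blast
    define \<epsilon>2 where "\<epsilon>2 = \<epsilon> / 3 / c"
    have \<epsilon>2: "0 < \<epsilon>2" "c * \<epsilon>2 = \<epsilon> / 3" using e3 c0 by (auto simp: \<epsilon>2_def)
    from Suc.IH[OF S'(1) e3] eF[OF S'(1) \<epsilon>2(1)] eG[OF S'(1) \<epsilon>2(1)] show ?case
    proof eventually_elim
      fix n assume n: "\<forall>t\<in>S'. L2_norm M (\<lambda>\<omega>. x n t \<omega> - y t \<omega>) \<le> ?\<kappa> ^ k * (2 * R) + \<epsilon> / 3"
        "\<forall>s\<in>S'. L2_norm M (\<lambda>\<omega>. Fn n s (y s \<omega>) - F s (y s \<omega>)) \<le> \<epsilon>2"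
        "\<forall>s\<in>S'. L2_norm M (\<lambda>\<omega>. Gn n s (y s \<omega>) - G s (y s \<omega>)) \<le> \<epsilon>2"
      show "\<forall>t\<in>S. L2_norm M (\<lambda>\<omega>. x n t \<omega> - y t \<omega>) \<le> ?\<kappa> ^ Suc k * (2 * R) + \<epsilon>"
      proof
        fix t assume "t \<in> S"
        note sub = S'(2)[OF this]
        have "L2_norm M (\<lambda>\<omega>. x n t \<omega> - y t \<omega>) \<le> N * exp (- \<nu> * (t - (t - l))) * (2 * R) + c * (L * (?\<kappa> ^ k * (2 * R) + \<epsilon> / 3) + \<epsilon>2)"
          by (rule solution_comparison[OF Fn[of n] F Gn[of n] G x(1)[of n] x(2) y _ _ _ _ _ _ c(1)])
            (use l sub n \<epsilon>2 \<kappa> R0 e3 in \<open>auto intro!: add_nonneg_nonneg mult_nonneg_nonneg\<close>)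
        also have "\<dots> = N * exp (- \<nu> * l) * (2 * R) + (?\<kappa> ^ Suc k * (2 * R) + ?\<kappa> * (\<epsilon> / 3) + c * \<epsilon>2)"
          by (simp add: algebra_simps)
        \<comment> \<open>The thirds come from the difference at time \<open>t - l\<close>, the
          remainder of the previous stage and the coefficient error.\<close>
        also have "\<dots> \<le> \<epsilon> / 3 + (?\<kappa> ^ Suc k * (2 * R) + 1 * (\<epsilon> / 3) + \<epsilon> / 3)"
          unfolding \<epsilon>2(2) using l(2) c(2) e3 by (intro add_mono mult_right_mono order_refl) auto
        finally show "L2_norm M (\<lambda>\<omega>. x n t \<omega> - y t \<omega>) \<le> ?\<kappa> ^ Suc k * (2 * R) + \<epsilon>" by simp
      qed
    qed
  qed
  have "(\<lambda>k. ?\<kappa> ^ k * (2 * R)) \<longlonglongrightarrow> 0"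
    by (rule tendsto_mult_left_zero, rule LIMSEQ_power_zero) (use \<kappa> c(2) in simp)
  then have "\<forall>\<^sub>F k in sequentially. ?\<kappa> ^ k * (2 * R) < \<epsilon> / 2" using \<epsilon> by (intro order_tendstoD(2)) auto
  then obtain k where k: "?\<kappa> ^ k * (2 * R) < \<epsilon> / 2" using eventually_happens'[OF sequentially_bot] by blast
  have e2: "0 < \<epsilon> / 2" using \<epsilon> by simp
  from iter[OF S e2, of k] show ?thesis
    by eventually_elim (use k in fastforce)
qed

text \<open>Stability without perturbation of the coefficients, for the class of time sets that
  contains only the whole line.\<close>

lemma solution_unique:
  assumes F: "lipschitz_coefficient A0 L F" and G: "lipschitz_coefficient A0 L G"
    and c: "gain \<le> c" "c * L < 1"
    and x: "increment_solution F G x" "\<And>t. L2_norm M (x t) \<le> R"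
    and y: "increment_solution F G y" "\<And>t. L2_norm M (y t) \<le> R"
  shows "AE \<omega> in M. x t \<omega> = y t \<omega>"
proof (rule L2_norm_diff_eq_0_AE)
  show "x t \<in> L2_rv M" "y t \<in> L2_rv M" using x(1) y(1) unfolding increment_solution_def by auto
  fix \<epsilon> :: real assume \<epsilon>: "0 < \<epsilon>"
  have "\<forall>\<^sub>F n in sequentially. \<forall>t\<in>UNIV. L2_norm M (\<lambda>\<omega>. x t \<omega> - y t \<omega>) < \<epsilon>"
    by (rule solution_stability[where \<T>="{UNIV}", OF F G F G c x y]) (use \<epsilon> in auto)
  then show "L2_norm M (\<lambda>\<omega>. x t \<omega> - y t \<omega>) \<le> \<epsilon>" by (simp add: less_imp_le)
qed

text \<open>Outside the ball of radius \<rho> only linear growth is available. There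
  \<open>K |h|\<close> is at most \<open>(K / \<rho>) |h|^2\<close>, whose L2 norm involves a fourth
  moment; hence the detour through \<open>Y\<close>, which replaces \<open>y\<close> at the price of
  \<open>L\<close> times a small L2 distance.\<close>

lemma coefficient_error:
  fixes Fn :: "nat \<Rightarrow> real \<Rightarrow> 'a \<Rightarrow> 'a"
  assumes Fn: "\<And>n. lipschitz_coefficient A0 L (Fn n)" and F: "lipschitz_coefficient A0 L F"
    and y: "\<And>t. y t \<in> L2_rv M"
      "\<And>\<epsilon>. 0 < \<epsilon> \<Longrightarrow> \<exists>C Y. 0 \<le> C \<and> (\<forall>t. Y t \<in> L2_rv M \<and> L2_norm M (\<lambda>\<omega>. y t \<omega> - Y t \<omega>) \<le> \<epsilon> \<and>
         (\<integral>\<^sup>+\<omega>. ennreal (norm (Y t \<omega>) ^ 4) \<partial>M) \<le> ennreal C)"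
    and conv: "\<And>\<rho> \<epsilon>. 0 < \<epsilon> \<Longrightarrow> \<forall>\<^sub>F n in sequentially. \<forall>s\<in>S. \<forall>h\<in>cball 0 \<rho>. norm (Fn n s h - F s h) \<le> \<epsilon>"
    and \<epsilon>: "0 < \<epsilon>"
  shows "\<forall>\<^sub>F n in sequentially. \<forall>s\<in>S. L2_norm M (\<lambda>\<omega>. Fn n s (y s \<omega>) - F s (y s \<omega>)) \<le> \<epsilon>"
proof -
  have A: "0 \<le> A0" "0 \<le> L" using F by (auto simp: lipschitz_coefficient_def)
  \<comment> \<open>\<open>y\<close> is replaced by \<open>Y\<close> in both coefficients, each time
    with an error of at most \<open>L * \<epsilon>1 \<le> \<epsilon> / 4\<close>; the denominator
    \<open>L + 1\<close> admits \<open>L = 0\<close>.\<close>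
  define \<epsilon>1 where "\<epsilon>1 = \<epsilon> / 4 / (L + 1)"
  have \<epsilon>1: "0 < \<epsilon>1" "L * \<epsilon>1 \<le> \<epsilon> / 4"
    using \<epsilon> A(2) by (auto simp: \<epsilon>1_def field_simps)
  obtain C Y where C: "0 \<le> C" and Y: "\<And>t. Y t \<in> L2_rv M" "\<And>t. L2_norm M (\<lambda>\<omega>. y t \<omega> - Y t \<omega>) \<le> \<epsilon>1"
    "\<And>t. (\<integral>\<^sup>+\<omega>. ennreal (norm (Y t \<omega>) ^ 4) \<partial>M) \<le> ennreal C"
    using y(2)[OF \<epsilon>1(1)] by blast
  \<comment> \<open>The two coefficients together grow at most like \<open>2 A0 + 2 L |h|\<close>,
    which is at most \<open>K |h|\<close> once \<open>|h| \<ge> 1\<close>; this is why \<rho> is at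
    least 1. The other part of \<rho> brings \<open>K / \<rho> * sqrt C\<close> down to
    \<open>\<epsilon> / 4\<close>.\<close>
  define K where "K = 2 * A0 + 2 * L"
  define \<rho> where "\<rho> = max 1 (K * sqrt C / (\<epsilon> / 4))"
  have \<rho>: "1 \<le> \<rho>" "K / \<rho> * sqrt C \<le> \<epsilon> / 4"
  proof -
    show "1 \<le> \<rho>" by (simp add: \<rho>_def)
    have "K * sqrt C / (\<epsilon> / 4) \<le> \<rho>" by (simp add: \<rho>_def)
    then have "K * sqrt C \<le> \<epsilon> / 4 * \<rho>" using \<epsilon> by (simp add: pos_divide_le_eq mult.commute)
    then show "K / \<rho> * sqrt C \<le> \<epsilon> / 4" using \<open>1 \<le> \<rho>\<close> by (simp add: divide_simps mult.commute)
  qed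
  have K0: "0 \<le> K" using A by (simp add: K_def)
  have "0 < \<epsilon> / 4" using \<epsilon> by simp
  from conv[OF this, of \<rho>] show ?thesis
  proof eventually_elim
    fix n assume n: "\<forall>s\<in>S. \<forall>h\<in>cball 0 \<rho>. norm (Fn n s h - F s h) \<le> \<epsilon> / 4"
    show "\<forall>s\<in>S. L2_norm M (\<lambda>\<omega>. Fn n s (y s \<omega>) - F s (y s \<omega>)) \<le> \<epsilon>"
    proof
      fix s assume s: "s \<in> S"
      have pt: "norm (Fn n s h - F s h) \<le> \<epsilon> / 4 + K / \<rho> * (norm h)\<^sup>2" for h
      proof (cases "norm h \<le> \<rho>")
        case True
        then have "norm (Fn n s h - F s h) \<le> \<epsilon> / 4" using n s by simp
        moreover have "0 \<le> K / \<rho> * (norm h)\<^sup>2" using K0 \<rho>(1) by simp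
        ultimately show ?thesis by linarith
      next
        case False
        then have h: "\<rho> \<le> norm h" "1 \<le> norm h" using \<rho>(1) by auto
        have "norm (Fn n s h - F s h) \<le> norm (Fn n s h) + norm (F s h)" by (rule norm_triangle_ineq4)
        also have "\<dots> \<le> (A0 + L * norm h) + (A0 + L * norm h)"
          by (intro add_mono lipschitz_coefficient_growth[OF Fn] lipschitz_coefficient_growth[OF F])
        also have "\<dots> \<le> K * norm h"
          using mult_left_mono[OF h(2) A(1)] by (simp add: K_def algebra_simps)
        also have "\<dots> \<le> K / \<rho> * (norm h)\<^sup>2"
        proof -
          have "K / \<rho> * (\<rho> * norm h) \<le> K / \<rho> * (norm h * norm h)"
            using K0 \<rho>(1) h by (intro mult_left_mono mult_right_mono) auto
          then show ?thesis using \<rho>(1) by (simp add: power2_eq_square)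
        qed
        finally show ?thesis using \<epsilon> by linarith
      qed
      note L = coefficient_L2(1)[OF Fn[of n] y(1)[of s], of s] coefficient_L2(1)[OF F y(1)[of s], of s]
        coefficient_L2(1)[OF Fn[of n] Y(1)[of s], of s] coefficient_L2(1)[OF F Y(1)[of s], of s]
      have Y2: "(\<lambda>\<omega>. (norm (Y s \<omega>))\<^sup>2) \<in> L2_rv M" "L2_norm M (\<lambda>\<omega>. (norm (Y s \<omega>))\<^sup>2) \<le> sqrt C"
      proof -
        have m: "(\<lambda>\<omega>. (norm (Y s \<omega>))\<^sup>2) \<in> borel_measurable M" using L2_rv_measurable[OF Y(1)[of s]] by measurable
        have le: "(\<integral>\<^sup>+\<omega>. ennreal ((norm ((norm (Y s \<omega>))\<^sup>2))\<^sup>2) \<partial>M) \<le> ennreal ((sqrt C)\<^sup>2)"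
          using Y(3)[of s] C by simp
        show "(\<lambda>\<omega>. (norm (Y s \<omega>))\<^sup>2) \<in> L2_rv M" "L2_norm M (\<lambda>\<omega>. (norm (Y s \<omega>))\<^sup>2) \<le> sqrt C"
          using L2_norm_leI[OF m _ le] C by auto
      qed
      have cL: "(\<lambda>\<omega>. \<epsilon> / 4) \<in> L2_rv M" by simp
      have YL: "(\<lambda>\<omega>. (K / \<rho>) *\<^sub>R (norm (Y s \<omega>))\<^sup>2) \<in> L2_rv M" using Y2(1) by (rule L2_rv_scaleR)
      have "L2_norm M (\<lambda>\<omega>. Fn n s (Y s \<omega>) - F s (Y s \<omega>)) \<le> L2_norm M (\<lambda>\<omega>. \<epsilon> / 4 + (K / \<rho>) *\<^sub>R (norm (Y s \<omega>))\<^sup>2)"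
      proof (rule L2_rv_mono(2)[OF L2_rv_add[OF cL YL] L2_rv_measurable[OF L2_rv_diff[OF L(3,4)]]])
        show "AE \<omega> in M. norm (Fn n s (Y s \<omega>) - F s (Y s \<omega>)) \<le> norm (\<epsilon> / 4 + (K / \<rho>) *\<^sub>R (norm (Y s \<omega>))\<^sup>2)"
          by (intro AE_I2 order_trans[OF pt]) simp
      qed
      also have "\<dots> \<le> \<epsilon> / 4 + K / \<rho> * sqrt C"
      proof -
        have "L2_norm M (\<lambda>\<omega>. (K / \<rho>) *\<^sub>R (norm (Y s \<omega>))\<^sup>2) = K / \<rho> * L2_norm M (\<lambda>\<omega>. (norm (Y s \<omega>))\<^sup>2)"
          unfolding L2_norm_scaleR using K0 \<rho>(1) by simp
        also have "\<dots> \<le> K / \<rho> * sqrt C" using Y2(2) K0 \<rho>(1) by (intro mult_left_mono) auto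
        finally show ?thesis using L2_norm_triangle[OF cL YL] \<epsilon> by simp
      qed
      also have "\<dots> \<le> \<epsilon> / 2" using \<rho>(2) by linarith
      finally have 2: "L2_norm M (\<lambda>\<omega>. Fn n s (Y s \<omega>) - F s (Y s \<omega>)) \<le> \<epsilon> / 2" .
      have 1: "L2_norm M (\<lambda>\<omega>. Fn n s (y s \<omega>) - Fn n s (Y s \<omega>)) \<le> \<epsilon> / 4"
        using order_trans[OF coefficient_L2_diff[OF Fn[of n] y(1)[of s] Y(1)[of s]] mult_left_mono[OF Y(2)[of s] A(2)]] \<epsilon>1(2) by (rule order_trans)
      have 3: "L2_norm M (\<lambda>\<omega>. F s (y s \<omega>) - F s (Y s \<omega>)) \<le> \<epsilon> / 4"
        using order_trans[OF coefficient_L2_diff[OF F y(1)[of s] Y(1)[of s]] mult_left_mono[OF Y(2)[of s] A(2)]] \<epsilon>1(2) by (rule order_trans)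
      show "L2_norm M (\<lambda>\<omega>. Fn n s (y s \<omega>) - F s (y s \<omega>)) \<le> \<epsilon>"
        using L2_norm_diff_triangle[OF L(1) L(3) L(2)] L2_norm_diff_triangle[OF L(3) L(4) L(2)] 1 2 3
        by (simp add: L2_norm_minus_commute[of M "\<lambda>\<omega>. F s (Y s \<omega>)"])
    qed
  qed
qed

end

section \<open>Brownian motion and its path space\<close>

lemma finite_set_enumeration:
  fixes T :: "real set"
  assumes "finite T" "T \<noteq> {}"
  obtains n \<tau> where "\<And>i. i < n \<Longrightarrow> \<tau> i < \<tau> (Suc i)" "\<tau> ` {..n} = T"
proof -
  let ?xs = "sorted_list_of_set T"
  define n where "n = card T - 1"
  have len: "length ?xs = Suc n" using assms by (simp add: n_def card_gt_0_iff)
  have 1: "?xs ! i < ?xs ! Suc i" if "i < n" for i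
    using sorted_wrt_nth_less[OF strict_sorted_list_of_set, of i "Suc i" T] that len by simp
  have 2: "(!) ?xs ` {..n} = T"
  proof -
    have "(!) ?xs ` {..n} = set ?xs" unfolding set_conv_nth len by (auto simp: less_Suc_eq_le image_iff)
    then show ?thesis using assms(1) by simp
  qed
  show thesis by (rule that[of n "(!) ?xs", OF 1 2])
qed

text \<open>For recovering an increment between any two partition points from the consecutive
  ones.\<close>

lemma partial_sum_difference_measurable:
  fixes j k n :: nat
  assumes "j \<le> n" "k \<le> n"
  shows "(\<lambda>d. (\<Sum>i<j. d i) - (\<Sum>i<k. d i :: real)) \<in> borel_measurable (PiM {..<n} (\<lambda>_. borel))"
  by (intro borel_measurable_diff borel_measurable_sum measurable_component_singleton)
    (use assms in \<open>auto intro: less_le_trans\<close>)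

section \<open>Stationary increments and independence of the past\<close>

locale two_sided_brownian = prob_space M for M :: "'w measure" +
  fixes W :: "real \<Rightarrow> 'w \<Rightarrow> real"
  assumes two_sided: "two_sided_brownian_motion M W"
begin

lemma W_measurable [measurable]: "W t \<in> borel_measurable M"
  using two_sided by (simp add: two_sided_brownian_motion_def)

lemma W_distributed:
  "s < t \<Longrightarrow> distributed M lborel (\<lambda>\<omega>. W t \<omega> - W s \<omega>) (normal_density 0 (sqrt (t - s)))"
  using two_sided by (simp add: two_sided_brownian_motion_def)

lemma W_indep_increments:
  assumes "\<forall>i<n. \<tau> i < \<tau> (Suc i)"
  shows "indep_vars (\<lambda>_. borel) (\<lambda>i \<omega>. W (\<tau> (Suc i) + h) \<omega> - W (\<tau> i + h) \<omega>) {..<n}"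
proof -
  note two_sided[unfolded two_sided_brownian_motion_def, THEN conjunct2, THEN conjunct2, THEN conjunct2, THEN conjunct2,
    THEN spec[of _ n], THEN spec[of _ "\<lambda>i. \<tau> i + h"]]
  moreover have "\<forall>i<n. \<tau> i + h < \<tau> (Suc i) + h" using assms by simp
  ultimately show ?thesis by (rule mp)
qed

lemma W_difference:
  "W (\<tau> j + h) \<omega> - W (\<tau> k + h) \<omega> = (\<Sum>i<j. W (\<tau> (Suc i) + h) \<omega> - W (\<tau> i + h) \<omega>) - (\<Sum>i<k. W (\<tau> (Suc i) + h) \<omega> - W (\<tau> i + h) \<omega>)"
  by (simp add: sum_lessThan_telescope[of "\<lambda>i. W (\<tau> i + h) \<omega>"])

text \<open>The right-hand side is free of \<open>h\<close>: this is the stationarity on which all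
  shifts rest.\<close>

lemma increments_law:
  assumes \<tau>: "\<forall>i<n. \<tau> i < \<tau> (Suc i)" and n: "0 < n"
  shows "distr M (PiM {..<n} (\<lambda>_. borel)) (\<lambda>\<omega>. \<lambda>i\<in>{..<n}. W (\<tau> (Suc i) + h) \<omega> - W (\<tau> i + h) \<omega>) =
    PiM {..<n} (\<lambda>i. density lborel (normal_density 0 (sqrt (\<tau> (Suc i) - \<tau> i))))"
proof -
  have "distr M (PiM {..<n} (\<lambda>_. borel)) (\<lambda>\<omega>. \<lambda>i\<in>{..<n}. W (\<tau> (Suc i) + h) \<omega> - W (\<tau> i + h) \<omega>) =
      PiM {..<n} (\<lambda>i. distr M borel (\<lambda>\<omega>. W (\<tau> (Suc i) + h) \<omega> - W (\<tau> i + h) \<omega>))"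
    using W_indep_increments[OF \<tau>, of h] n by (subst (asm) indep_vars_iff_distr_eq_PiM') auto
  also have "\<dots> = PiM {..<n} (\<lambda>i. density lborel (normal_density 0 (sqrt (\<tau> (Suc i) - \<tau> i))))"
  proof (rule PiM_cong[OF refl])
    fix i assume "i \<in> {..<n}"
    then have "\<tau> i + h < \<tau> (Suc i) + h" using \<tau> by simp
    from distributed_distr_eq_density[OF W_distributed[OF this]]
    show "distr M borel (\<lambda>\<omega>. W (\<tau> (Suc i) + h) \<omega> - W (\<tau> i + h) \<omega>) = density lborel (normal_density 0 (sqrt (\<tau> (Suc i) - \<tau> i)))"
      by (simp cong: distr_cong)
  qed
  finally show ?thesis .
qed

text \<open>Normalised to vanish at time 0: only the increments are stationary, while the law of
  \<open>W (t + h)\<close> itself depends on \<open>h\<close>.\<close>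

definition shifted_path :: "real \<Rightarrow> 'w \<Rightarrow> real \<Rightarrow> real" where
  "shifted_path h \<omega> = (\<lambda>t. W (t + h) \<omega> - W h \<omega>)"

lemma shifted_path_measurable [measurable]: "shifted_path h \<in> measurable M (PiM UNIV (\<lambda>_. borel))"
  unfolding shifted_path_def[abs_def] by (rule measurable_PiM_single') auto

text \<open>Cylinder sets determine a law on path space, and each of them is an event about finitely
  many consecutive increments.\<close>

lemma shifted_path_law: "distr M (PiM UNIV (\<lambda>_. borel)) (shifted_path h) = distr M (PiM UNIV (\<lambda>_. borel)) (shifted_path 0)"
proof (rule measure_eqI_PiM_infinite)
  fix A :: "real \<Rightarrow> real set" and J :: "real set"
  assume J: "finite J" and A: "\<And>i. i \<in> J \<Longrightarrow> A i \<in> sets borel"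
  \<comment> \<open>The time 0 enters because the shifted path is measured from its value there. The
    time 1 guarantees at least one interval even if \<open>J\<close> contains nothing besides 0, as
    \<open>increments_law\<close> needs \<open>0 < n\<close>.\<close>
  obtain n \<tau> where \<tau>: "\<And>i. i < n \<Longrightarrow> \<tau> i < \<tau> (Suc i)" "\<tau> ` {..n} = insert 0 (insert 1 J)"
    using finite_set_enumeration[of "insert 0 (insert 1 J)"] J by blast
  then have \<tau>': "\<forall>i<n. \<tau> i < \<tau> (Suc i)" by blast
  have n: "0 < n"
  proof (rule ccontr)
    assume "\<not> 0 < n"
    then have "insert 0 (insert 1 J) = {\<tau> 0}" using \<tau>(2) by auto
    then have "(0::real) = 1" by (metis insertCI singletonD)
    then show False by simp
  qed
  have "\<exists>j\<le>n. \<tau> j = t" if "t \<in> insert 0 (insert 1 J)" for t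
    using that unfolding \<tau>(2)[symmetric] by auto
  then obtain idx where idx: "\<And>t. t \<in> insert 0 (insert 1 J) \<Longrightarrow> idx t \<le> n" "\<And>t. t \<in> insert 0 (insert 1 J) \<Longrightarrow> \<tau> (idx t) = t"
    by metis
  let ?N = "PiM {..<n} (\<lambda>_::nat. borel :: real measure)"
  \<comment> \<open>The same set of increment vectors describes the cylinder for every shift
    \<open>h\<close>.\<close>
  define E where "E = {d \<in> space ?N. \<forall>t\<in>J. (\<Sum>i<idx t. d i) - (\<Sum>i<idx 0. d i) \<in> A t}"
  have E: "E \<in> sets ?N"
  proof -
    have "{d \<in> space ?N. (\<Sum>i<idx t. d i) - (\<Sum>i<idx 0. d i) \<in> A t} \<in> sets ?N" if "t \<in> J" for t
      using measurable_sets[OF partial_sum_difference_measurable A[OF that], of "idx t" n "idx 0"] idx that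
      by (simp add: vimage_def Int_def conj_commute)
    then show ?thesis
      unfolding E_def by (intro sets.sets_Collect_finite_All J) auto
  qed
  let ?D = "\<lambda>h \<omega>. \<lambda>i\<in>{..<n}. W (\<tau> (Suc i) + h) \<omega> - W (\<tau> i + h) \<omega>"
  have D: "?D h \<in> measurable M ?N" for h by measurable
  have emb: "prod_emb UNIV (\<lambda>_. borel) J (Pi\<^sub>E J A) = {p. \<forall>t\<in>J. p t \<in> A t}"
    by (auto simp: prod_emb_def PiE_iff restrict_def)
  have embs: "{p. \<forall>t\<in>J. p t \<in> A t} \<in> sets (PiM UNIV (\<lambda>_::real. borel))"
    unfolding emb[symmetric] by (rule sets_PiM_I) (use J A in auto)
  have "emeasure (distr M (PiM UNIV (\<lambda>_. borel)) (shifted_path h)) {p. \<forall>t\<in>J. p t \<in> A t} =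
     emeasure (PiM {..<n} (\<lambda>i. density lborel (normal_density 0 (sqrt (\<tau> (Suc i) - \<tau> i))))) E" for h
  proof -
    have "shifted_path h \<omega> t = (\<Sum>i<idx t. ?D h \<omega> i) - (\<Sum>i<idx 0. ?D h \<omega> i)" if t: "t \<in> J" for \<omega> t
    proof -
      have s: "(\<Sum>i<j. ?D h \<omega> i) = (\<Sum>i<j. W (\<tau> (Suc i) + h) \<omega> - W (\<tau> i + h) \<omega>)" if "j \<le> n" for j
        by (rule sum.cong) (use that in auto)
      have t1: "t \<in> insert 0 (insert 1 J)" and t0: "0 \<in> insert 0 (insert 1 J)" using t by auto
      show ?thesis
        unfolding shifted_path_def s[OF idx(1)[OF t1]] s[OF idx(1)[OF t0]]
        using W_difference[of \<tau> "idx t" h \<omega> "idx 0"] idx(2)[OF t1] idx(2)[OF t0] by simp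
    qed
    then have "shifted_path h -` {p. \<forall>t\<in>J. p t \<in> A t} \<inter> space M = ?D h -` E \<inter> space M"
      using measurable_space[OF D] by (auto simp: E_def)
    then have "emeasure (distr M (PiM UNIV (\<lambda>_. borel)) (shifted_path h)) {p. \<forall>t\<in>J. p t \<in> A t} = emeasure (distr M ?N (?D h)) E"
      using emeasure_distr[OF shifted_path_measurable embs] emeasure_distr[OF D E] by simp
    then show ?thesis unfolding increments_law[OF \<tau>' n] .
  qed
  then show "emeasure (distr M (PiM UNIV (\<lambda>_. borel)) (shifted_path h)) (prod_emb UNIV (\<lambda>_. borel) J (Pi\<^sub>E J A)) =
     emeasure (distr M (PiM UNIV (\<lambda>_. borel)) (shifted_path 0)) (prod_emb UNIV (\<lambda>_. borel) J (Pi\<^sub>E J A))"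
    unfolding emb by simp
qed (auto intro!: finite_measure_distr)

text \<open>The definition gives independence of consecutive increments along a partition. Finite
  intersections of increment events form an intersection stable generator of the past, and for each
  of them a partition ending in \<open>s\<close> and continued by \<open>t\<close> separates past
  from future.\<close>

lemma W_indep_past:
  assumes st: "s < t" and A: "A \<in> sets (increment_filtration M W s)" and B: "B \<in> sets borel"
  shows "prob (A \<inter> ((\<lambda>\<omega>. W t \<omega> - W s \<omega>) -` B \<inter> space M)) =
     prob A * prob ((\<lambda>\<omega>. W t \<omega> - W s \<omega>) -` B \<inter> space M)"
proof -
  define ev where "ev = (\<lambda>K C. {\<omega> \<in> space M. \<forall>p\<in>K. W (fst p) \<omega> - W (snd p) \<omega> \<in> (C p :: real set)})"
  define \<E> where "\<E> = {ev K C | K C. finite K \<and> K \<subseteq> {..s} \<times> {..s} \<and> (\<forall>p\<in>K. C p \<in> sets borel)}"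
  define \<B> where "\<B> = {(\<lambda>\<omega>. W t \<omega> - W s \<omega>) -` B \<inter> space M | B. B \<in> sets borel}"
  have ev_sets: "ev K C \<in> events" if "finite K" "\<forall>p\<in>K. C p \<in> sets borel" for K C
    unfolding ev_def using that by (intro sets.sets_Collect_finite_All) auto
  have "indep_set \<E> \<B>"
  proof (rule indep_setI)
    show "\<E> \<subseteq> events" unfolding \<E>_def using ev_sets by auto
    show "\<B> \<subseteq> events" unfolding \<B>_def by auto
    fix a b assume "a \<in> \<E>" "b \<in> \<B>"
    then obtain K C B where K: "finite K" "K \<subseteq> {..s} \<times> {..s}" "\<And>p. p \<in> K \<Longrightarrow> C p \<in> sets borel" and a: "a = ev K C"
      and B: "B \<in> sets borel" and b: "b = (\<lambda>\<omega>. W t \<omega> - W s \<omega>) -` B \<inter> space M"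
      unfolding \<E>_def \<B>_def by blast
    \<comment> \<open>With \<open>s\<close> inserted, the last point of the partition is
      \<open>s\<close>, so the final increment of the partition extended by \<open>t\<close> is
      exactly \<open>W t - W s\<close>.\<close>
    obtain n \<tau> where \<tau>: "\<And>i. i < n \<Longrightarrow> \<tau> i < \<tau> (Suc i)" "\<tau> ` {..n} = insert s (fst ` K \<union> snd ` K)"
      using finite_set_enumeration[of "insert s (fst ` K \<union> snd ` K)"] K(1) by blast
    have le: "\<tau> i \<le> \<tau> n" if "i \<le> n" for i
      by (rule partition_mono[of n]) (use \<tau>(1) that in \<open>auto intro: less_imp_le\<close>)
    have \<tau>n: "\<tau> n = s"
    proof (rule antisym)
      have "\<tau> n \<in> insert s (fst ` K \<union> snd ` K)" unfolding \<tau>(2)[symmetric] by simp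
      then show "\<tau> n \<le> s" using K(2) by auto
      have "s \<in> \<tau> ` {..n}" unfolding \<tau>(2) by simp
      then show "s \<le> \<tau> n" using le by auto
    qed
    define \<sigma> where "\<sigma> = (\<lambda>i. if i \<le> n then \<tau> i else t)"
    have \<sigma>: "\<sigma> i < \<sigma> (Suc i)" if "i < Suc n" for i
      using that \<tau>(1)[of i] \<tau>n st by (cases "i = n") (auto simp: \<sigma>_def)
    then have \<sigma>': "\<forall>i<Suc n. \<sigma> i < \<sigma> (Suc i)" by blast
    have "\<exists>j\<le>n. \<sigma> j = u" if "u \<in> fst ` K \<union> snd ` K" for u
    proof -
      have "u \<in> \<tau> ` {..n}" unfolding \<tau>(2) using that by simp
      then show ?thesis by (auto simp: \<sigma>_def)
    qed
    then obtain idx where idx: "\<And>u. u \<in> fst ` K \<union> snd ` K \<Longrightarrow> idx u \<le> n" "\<And>u. u \<in> fst ` K \<union> snd ` K \<Longrightarrow> \<sigma> (idx u) = u"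
      by metis
    let ?X = "\<lambda>i \<omega>. W (\<sigma> (Suc i) + 0) \<omega> - W (\<sigma> i + 0) \<omega>"
    let ?N = "PiM {..<n} (\<lambda>_::nat. borel :: real measure)" and ?N' = "PiM {n} (\<lambda>_::nat. borel :: real measure)"
    \<comment> \<open>The increments up to \<open>s\<close> and the one from \<open>s\<close> to
      \<open>t\<close> occupy disjoint sets of indices.\<close>
    have ind: "indep_var ?N (\<lambda>\<omega>. \<lambda>i\<in>{..<n}. ?X i \<omega>) ?N' (\<lambda>\<omega>. \<lambda>i\<in>{n}. ?X i \<omega>)"
      by (rule indep_var_restrict[OF W_indep_increments[OF \<sigma>', of 0]]) auto
    define E where "E = {d \<in> space ?N. \<forall>p\<in>K. (\<Sum>i<idx (fst p). d i) - (\<Sum>i<idx (snd p). d i) \<in> C p}"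
    have E: "E \<in> sets ?N"
    proof -
      have "{d \<in> space ?N. (\<Sum>i<idx (fst p). d i) - (\<Sum>i<idx (snd p). d i) \<in> C p} \<in> sets ?N" if "p \<in> K" for p
        using measurable_sets[OF partial_sum_difference_measurable K(3)[OF that], of "idx (fst p)" n "idx (snd p)"] idx(1) that
        by (simp add: vimage_def Int_def conj_commute)
      then show ?thesis
        unfolding E_def by (intro sets.sets_Collect_finite_All K) auto
    qed
    define E' where "E' = {d \<in> space ?N'. d n \<in> B}"
    have E': "E' \<in> sets ?N'"
      unfolding E'_def using measurable_sets[OF measurable_component_singleton[of n "{n}" "\<lambda>_. borel"] B]
      by (simp add: vimage_def Int_def conj_commute)
    have Xs: "(\<lambda>\<omega>. \<lambda>i\<in>{..<n}. ?X i \<omega>) \<in> measurable M ?N" "(\<lambda>\<omega>. \<lambda>i\<in>{n}. ?X i \<omega>) \<in> measurable M ?N'" by measurable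
    have eq1: "(\<lambda>\<omega>. \<lambda>i\<in>{..<n}. ?X i \<omega>) -` E \<inter> space M = a"
    proof -
      have "W (fst p) \<omega> - W (snd p) \<omega> = (\<Sum>i<idx (fst p). (\<lambda>i\<in>{..<n}. ?X i \<omega>) i) - (\<Sum>i<idx (snd p). (\<lambda>i\<in>{..<n}. ?X i \<omega>) i)" if "p \<in> K" for p \<omega>
      proof -
        have u: "fst p \<in> fst ` K \<union> snd ` K" "snd p \<in> fst ` K \<union> snd ` K" using that by auto
        have s: "(\<Sum>i<j. (\<lambda>i\<in>{..<n}. ?X i \<omega>) i) = (\<Sum>i<j. ?X i \<omega>)" if "j \<le> n" for j
          by (rule sum.cong) (use that in auto)
        show ?thesis
          unfolding s[OF idx(1)[OF u(1)]] s[OF idx(1)[OF u(2)]]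
          using W_difference[of \<sigma> "idx (fst p)" 0 \<omega> "idx (snd p)"] idx(2)[OF u(1)] idx(2)[OF u(2)] by simp
      qed
      then show ?thesis unfolding a ev_def E_def using measurable_space[OF Xs(1)] by auto
    qed
    have eq2: "(\<lambda>\<omega>. \<lambda>i\<in>{n}. ?X i \<omega>) -` E' \<inter> space M = b"
    proof -
      have "\<sigma> n = s" "\<sigma> (Suc n) = t" using \<tau>n by (auto simp: \<sigma>_def)
      then show ?thesis unfolding b E'_def using measurable_space[OF Xs(2)] by auto
    qed
    from indep_varD[OF ind E E'] have "prob ((\<lambda>\<omega>. (\<lambda>i\<in>{..<n}. ?X i \<omega>, \<lambda>i\<in>{n}. ?X i \<omega>)) -` (E \<times> E') \<inter> space M) = prob a * prob b"
      unfolding eq1 eq2 .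
    also have "(\<lambda>\<omega>. (\<lambda>i\<in>{..<n}. ?X i \<omega>, \<lambda>i\<in>{n}. ?X i \<omega>)) -` (E \<times> E') \<inter> space M = a \<inter> b"
      unfolding eq1[symmetric] eq2[symmetric] by auto
    finally show "prob (a \<inter> b) = prob a * prob b" .
  qed
  moreover have "Int_stable \<E>"
  proof (rule Int_stableI)
    fix a b assume a: "a \<in> \<E>" and b: "b \<in> \<E>"
    from a obtain K C where K: "a = ev K C \<and> finite K \<and> K \<subseteq> {..s} \<times> {..s} \<and> (\<forall>p\<in>K. C p \<in> sets borel)"
      unfolding \<E>_def mem_Collect_eq by (elim exE)
    from b obtain K' C' where K': "b = ev K' C' \<and> finite K' \<and> K' \<subseteq> {..s} \<times> {..s} \<and> (\<forall>p\<in>K'. C' p \<in> sets borel)"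
      unfolding \<E>_def mem_Collect_eq by (elim exE)
    \<comment> \<open>A pair that belongs to only one of the families gets no condition from the
      other, hence the default \<open>UNIV\<close>.\<close>
    define C2 where "C2 = (\<lambda>p. (if p \<in> K then C p else UNIV) \<inter> (if p \<in> K' then C' p else UNIV))"
    have "a \<inter> b = ev (K \<union> K') C2" using K K' unfolding ev_def C2_def by auto
    moreover have "\<forall>p\<in>K \<union> K'. C2 p \<in> sets borel" unfolding C2_def using K K' by auto
    ultimately show "a \<inter> b \<in> \<E>"
      unfolding \<E>_def using K K' by (intro CollectI exI[of _ "K \<union> K'"] exI[of _ C2]) auto
  qed
  moreover have "Int_stable \<B>"
  proof (rule Int_stableI)
    fix a b assume "a \<in> \<B>" "b \<in> \<B>"
    then obtain B B' where "B \<in> sets borel" "B' \<in> sets borel" "a = (\<lambda>\<omega>. W t \<omega> - W s \<omega>) -` B \<inter> space M"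
      "b = (\<lambda>\<omega>. W t \<omega> - W s \<omega>) -` B' \<inter> space M" unfolding \<B>_def mem_Collect_eq by (elim exE conjE)
    then show "a \<inter> b \<in> \<B>" unfolding \<B>_def by (intro CollectI exI[of _ "B \<inter> B'"]) auto
  qed
  ultimately have ind: "indep_set (sigma_sets (space M) \<E>) (sigma_sets (space M) \<B>)"
    by (rule indep_set_sigma_sets)
  have "(\<Union>u\<in>{..s}. \<Union>v\<in>{..s}. {(\<lambda>\<omega>. W u \<omega> - W v \<omega>) -` A \<inter> space M | A. A \<in> sets borel}) \<subseteq> \<E>"
  proof clarify
    fix u v and A :: "real set" assume "u \<le> s" "v \<le> s" "A \<in> sets borel"
    moreover have "(\<lambda>\<omega>. W u \<omega> - W v \<omega>) -` A \<inter> space M = ev {(u, v)} (\<lambda>_. A)" by (auto simp: ev_def)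
    ultimately show "(\<lambda>\<omega>. W u \<omega> - W v \<omega>) -` A \<inter> space M \<in> \<E>" unfolding \<E>_def by force
  qed
  then have "A \<in> sigma_sets (space M) \<E>"
    using A sigma_sets_mono'[of _ \<E> "space M"] unfolding sets_increment_filtration by blast
  moreover have "(\<lambda>\<omega>. W t \<omega> - W s \<omega>) -` B \<inter> space M \<in> sigma_sets (space M) \<B>"
    using B by (intro sigma_sets.Basic) (auto simp: \<B>_def)
  ultimately show ?thesis by (rule indep_setD[OF ind])
qed

sublocale wiener_process M W
  by unfold_locales (auto intro: W_distributed W_indep_past)

end

text \<open>The \<sigma>-algebras are generated by increments, and an increment up to time
  \<open>s\<close> pulls back to one up to time \<open>s + h\<close>.\<close>

lemma filtration_measurable_map:
  assumes \<phi>: "\<phi> \<in> measurable M M'"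
    and inc: "\<And>u v \<omega>. \<omega> \<in> space M \<Longrightarrow> W' u (\<phi> \<omega>) - W' v (\<phi> \<omega>) = W (u + h) \<omega> - W (v + h) \<omega>"
  shows "\<phi> \<in> measurable (increment_filtration M W (s + h)) (increment_filtration M' W' s)"
proof (rule measurable_sigma_sets[OF sets_increment_filtration])
  let ?G = "\<Union>u\<in>{..s}. \<Union>v\<in>{..s}. {(\<lambda>\<omega>. W' u \<omega> - W' v \<omega>) -` A \<inter> space M' | A. A \<in> sets borel}"
  show "?G \<subseteq> Pow (space M')" by auto
  show "\<phi> \<in> space (increment_filtration M W (s + h)) \<rightarrow> space M'" using measurable_space[OF \<phi>] by auto
  fix y assume "y \<in> ?G"
  then obtain u v and A :: "real set" where y: "u \<le> s" "v \<le> s" "A \<in> sets borel" "y = (\<lambda>\<omega>. W' u \<omega> - W' v \<omega>) -` A \<inter> space M'"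
    by blast
  have "\<phi> -` y \<inter> space M = (\<lambda>\<omega>. W (u + h) \<omega> - W (v + h) \<omega>) -` A \<inter> space (increment_filtration M W (s + h))"
    using measurable_space[OF \<phi>] inc by (auto simp: y(4))
  also have "\<dots> \<in> sets (increment_filtration M W (s + h))"
    by (rule measurable_sets[OF increment_measurable_filtration y(3)]) (use y in auto)
  finally show "\<phi> -` y \<inter> space (increment_filtration M W (s + h)) \<in> sets (increment_filtration M W (s + h))" by simp
qed

lemma wiener_process_factor:
  assumes W: "wiener_process M W" and \<phi>: "\<phi> \<in> measurable M M'" and distr: "distr M M' \<phi> = M'"
    and W': "\<And>t. W' t \<in> borel_measurable M'"
    and inc: "\<And>u v \<omega>. \<omega> \<in> space M \<Longrightarrow> W' u (\<phi> \<omega>) - W' v (\<phi> \<omega>) = W (u + h) \<omega> - W (v + h) \<omega>"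
  shows "wiener_process M' W'"
proof -
  interpret A: wiener_process M W by fact
  interpret B: prob_space M' using A.prob_space_distr[OF \<phi>] unfolding distr .
  note [measurable] = W' \<phi>
  have meas: "measure M' X = A.prob (\<phi> -` X \<inter> space M)" if "X \<in> sets M'" for X
    using measure_distr[OF \<phi> that] unfolding distr .
  show ?thesis
  proof (rule wiener_process.intro[OF B.prob_space_axioms])
    show "wiener_process_axioms M' W'"
    proof (rule wiener_process_axioms.intro)
      show "W' t \<in> borel_measurable M'" for t by fact
      fix s t :: real assume st: "s < t"
      then have sh: "s + h < t + h" by simp
      have "distr M' lborel (\<lambda>\<omega>. W' t \<omega> - W' s \<omega>) = distr M lborel (\<lambda>\<omega>. W' t (\<phi> \<omega>) - W' s (\<phi> \<omega>))"
        using distr_distr[of "\<lambda>\<omega>. W' t \<omega> - W' s \<omega>" M' lborel \<phi> M] unfolding distr by (simp add: comp_def)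
      also have "\<dots> = distr M lborel (\<lambda>\<omega>. W (t + h) \<omega> - W (s + h) \<omega>)"
        by (rule distr_cong) (auto simp: inc)
      also have "\<dots> = density lborel (normal_density 0 (sqrt (t - s)))"
        using distributed_distr_eq_density[OF A.W_increment[OF sh]] by simp
      finally show "distributed M' lborel (\<lambda>\<omega>. W' t \<omega> - W' s \<omega>) (normal_density 0 (sqrt (t - s)))"
        unfolding distributed_def by simp
      fix X B assume X: "X \<in> sets (increment_filtration M' W' s)" and B: "B \<in> sets (borel :: real measure)"
      have XM: "X \<in> sets M'"
      proof -
        have "(\<Union>u\<in>{..s}. \<Union>v\<in>{..s}. {(\<lambda>\<omega>. W' u \<omega> - W' v \<omega>) -` A \<inter> space M' | A. A \<in> sets borel}) \<subseteq> sets M'"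
          by (auto intro!: measurable_sets)
        from sets.sigma_sets_subset[OF this] X show ?thesis unfolding sets_increment_filtration by blast
      qed
      have EM: "(\<lambda>\<omega>. W' t \<omega> - W' s \<omega>) -` B \<inter> space M' \<in> sets M'" using B by measurable
      have eqE: "\<phi> -` ((\<lambda>\<omega>. W' t \<omega> - W' s \<omega>) -` B \<inter> space M') \<inter> space M = (\<lambda>\<omega>. W (t + h) \<omega> - W (s + h) \<omega>) -` B \<inter> space M"
        using measurable_space[OF \<phi>] by (auto simp: inc)
      have X': "\<phi> -` X \<inter> space M \<in> sets (increment_filtration M W (s + h))"
        using measurable_sets[OF filtration_measurable_map[where W=W and W'=W' and h=h, OF \<phi> inc] X] by simp
      have "measure M' (X \<inter> ((\<lambda>\<omega>. W' t \<omega> - W' s \<omega>) -` B \<inter> space M')) =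
        A.prob ((\<phi> -` X \<inter> space M) \<inter> ((\<lambda>\<omega>. W (t + h) \<omega> - W (s + h) \<omega>) -` B \<inter> space M))"
        unfolding meas[OF sets.Int[OF XM EM]] eqE[symmetric] by (rule arg_cong[of _ _ A.prob]) auto
      also have "\<dots> = A.prob (\<phi> -` X \<inter> space M) * A.prob ((\<lambda>\<omega>. W (t + h) \<omega> - W (s + h) \<omega>) -` B \<inter> space M)"
        by (rule A.W_indep[OF sh X' B])
      also have "\<dots> = measure M' X * measure M' ((\<lambda>\<omega>. W' t \<omega> - W' s \<omega>) -` B \<inter> space M')"
        unfolding meas[OF XM] meas[OF EM] eqE ..
      finally show "measure M' (X \<inter> ((\<lambda>\<omega>. W' t \<omega> - W' s \<omega>) -` B \<inter> space M')) =
        measure M' X * measure M' ((\<lambda>\<omega>. W' t \<omega> - W' s \<omega>) -` B \<inter> space M')" .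
    qed
  qed
qed

section \<open>Laws of shifted solutions\<close>

lemma
  fixes X :: "'v \<Rightarrow> 'a::{real_inner, banach, second_countable_topology}"
  assumes f: "f \<in> measurable K K'" and distr: "distr K K' f = K'" and X: "X \<in> L2_rv K'"
  shows L2_rv_measure_preserving: "(\<lambda>z. X (f z)) \<in> L2_rv K"
    and L2_norm_measure_preserving: "L2_norm K (\<lambda>z. X (f z)) = L2_norm K' X"
proof -
  note [measurable] = f L2_rv_measurable[OF X]
  have "integrable (distr K K' f) (\<lambda>z. (norm (X z))\<^sup>2)" unfolding distr by (rule L2_rv_integrable[OF X])
  then have "integrable K (\<lambda>z. (norm (X (f z)))\<^sup>2)" by (subst (asm) integrable_distr_eq) auto
  then show "(\<lambda>z. X (f z)) \<in> L2_rv K" by (simp add: L2_rv_def)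
  have "(\<integral>z. (norm (X z))\<^sup>2 \<partial>distr K K' f) = (\<integral>z. (norm (X (f z)))\<^sup>2 \<partial>K)" by (rule integral_distr) auto
  then show "L2_norm K (\<lambda>z. X (f z)) = L2_norm K' X" unfolding distr by (simp add: L2_norm_def)
qed

lemma (in stable_semigroup) conv_translate: "conv (t + h) s k = conv t (s - h) k"
proof -
  have "indicat_real {..t + h} s = indicat_real {..t} (s - h)" by (auto simp: indicator_def)
  moreover have "t + h - s = t - (s - h)" by simp
  ultimately show ?thesis by (simp only: conv_def)
qed

text \<open>With the space of paths as \<open>M'\<close>, all time shifts of \<open>W\<close> factor through one and the same Brownian motion
  \<open>W'\<close>, and uniqueness of solutions turns this into equality in law.\<close>

locale shifted_factor = stable_wiener M W U N \<nu> + target: stable_wiener M' W' U N \<nu>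
  for M :: "'w measure" and W and U :: "real \<Rightarrow> 'a::{real_inner, banach, second_countable_topology} \<Rightarrow>\<^sub>L 'a" and N \<nu>
    and M' :: "'v measure" and W' +
  fixes \<phi> :: "'w \<Rightarrow> 'v" and h :: real
  assumes \<phi>: "\<phi> \<in> measurable M M'" and distr_\<phi>: "distr M M' \<phi> = M'"
    and increments: "\<And>u v \<omega>. \<omega> \<in> space M \<Longrightarrow> W' u (\<phi> \<omega>) - W' v (\<phi> \<omega>) = W (u + h) \<omega> - W (v + h) \<omega>"
begin

definition \<Theta> :: "real \<times> 'w \<Rightarrow> real \<times> 'v" where
  "\<Theta> z = (fst z - h, \<phi> (snd z))"

lemma \<Theta>_measurable: "\<Theta> \<in> measurable LM (lborel \<Otimes>\<^sub>M M')"
  unfolding \<Theta>_def[abs_def] using \<phi> by measurable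

lemma distr_\<Theta>: "distr LM (lborel \<Otimes>\<^sub>M M') \<Theta> = lborel \<Otimes>\<^sub>M M'"
proof -
  have 1: "distr lborel lborel (\<lambda>s. s - h) = lborel"
    using lborel_distr_plus[of "- h"] by (simp cong: distr_cong)
  have "lborel \<Otimes>\<^sub>M M' = distr lborel lborel (\<lambda>s. s - h) \<Otimes>\<^sub>M distr M M' \<phi>"
    unfolding 1 distr_\<phi> ..
  also have "\<dots> = distr LM (lborel \<Otimes>\<^sub>M M') (\<lambda>(s, \<omega>). (s - h, \<phi> \<omega>))"
    by (rule pair_measure_distr) (use \<phi> target.sigma_finite_measure_axioms in \<open>auto simp: distr_\<phi>\<close>)
  finally show ?thesis by (simp add: \<Theta>_def[abs_def] case_prod_beta')
qed

lemmas L2_\<phi> = L2_rv_measure_preserving[OF \<phi> distr_\<phi>] L2_norm_measure_preserving[OF \<phi> distr_\<phi>]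
lemmas L2_\<Theta> = L2_rv_measure_preserving[OF \<Theta>_measurable distr_\<Theta>] L2_norm_measure_preserving[OF \<Theta>_measurable distr_\<Theta>]

lemma AE_\<phi>: "AE x in M'. P x \<Longrightarrow> AE \<omega> in M. P (\<phi> \<omega>)"
  using AE_distrD[OF \<phi>, of P] unfolding distr_\<phi> .

text \<open>The integrals agree only on \<open>space M\<close>, where \<open>increments\<close>
  holds, while membership in the inductive set fixes functions everywhere; hence the separate
  \<open>S'\<close>.\<close>

lemma simple_ito_pairs_factor:
  fixes p :: "real \<times> 'v \<Rightarrow> 'a"
  assumes "(p, S) \<in> simple_ito_pairs M' W' T"
  shows "\<exists>S'. ((\<lambda>z. p (\<Theta> z)), S') \<in> simple_ito_pairs M W (T + h) \<and> (\<forall>\<omega>\<in>space M. S' \<omega> = S (\<phi> \<omega>))"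
  using assms
proof (induction rule: simple_ito_pairs.induct)
  case zero
  then show ?case using simple_ito_pairs.zero by blast
next
  case (step p S a b \<zeta>)
  then obtain S' where S': "((\<lambda>z. p (\<Theta> z)), S') \<in> simple_ito_pairs M W (T + h)" "\<forall>\<omega>\<in>space M. S' \<omega> = S (\<phi> \<omega>)"
    by blast
  have z: "(\<lambda>\<omega>. \<zeta> (\<phi> \<omega>)) \<in> borel_measurable (Filt (a + h))"
    by (rule measurable_compose[OF filtration_measurable_map[where W=W and W'=W' and h=h, OF \<phi> increments] step(4)])
  have "((\<lambda>x. indicat_real {a + h<..b + h} (fst x) *\<^sub>R (\<lambda>\<omega>. \<zeta> (\<phi> \<omega>)) (snd x) + (\<lambda>z. p (\<Theta> z)) x),
     (\<lambda>\<omega>. (W (b + h) \<omega> - W (a + h) \<omega>) *\<^sub>R (\<lambda>\<omega>. \<zeta> (\<phi> \<omega>)) \<omega> + S' \<omega>)) \<in> simple_ito_pairs M W (T + h)"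
    by (rule simple_ito_pairs.step[OF S'(1)]) (use step z L2_\<phi>(1) in auto)
  also have "(\<lambda>x. indicat_real {a + h<..b + h} (fst x) *\<^sub>R (\<lambda>\<omega>. \<zeta> (\<phi> \<omega>)) (snd x) + (\<lambda>z. p (\<Theta> z)) x) =
    (\<lambda>z. indicat_real {a<..b} (fst (\<Theta> z)) *\<^sub>R \<zeta> (snd (\<Theta> z)) + p (\<Theta> z))"
    by (auto simp: \<Theta>_def indicator_def fun_eq_iff)
  finally have "((\<lambda>z. indicat_real {a<..b} (fst (\<Theta> z)) *\<^sub>R \<zeta> (snd (\<Theta> z)) + p (\<Theta> z)),
     (\<lambda>\<omega>. (W (b + h) \<omega> - W (a + h) \<omega>) *\<^sub>R \<zeta> (\<phi> \<omega>) + S' \<omega>)) \<in> simple_ito_pairs M W (T + h)" .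
  then show ?case
    using S'(2) increments by (intro exI[of _ "\<lambda>\<omega>. (W (b + h) \<omega> - W (a + h) \<omega>) *\<^sub>R \<zeta> (\<phi> \<omega>) + S' \<omega>"] conjI) auto
qed

lemma ito_factor:
  fixes g :: "real \<times> 'v \<Rightarrow> 'a"
  assumes "target.ito T g I"
  shows "ito (T + h) (\<lambda>z. g (\<Theta> z)) (\<lambda>\<omega>. I (\<phi> \<omega>))"
  unfolding ito_def
proof (intro conjI allI impI)
  note L = target.ito_L2[OF assms]
  show "(\<lambda>z. g (\<Theta> z)) \<in> L2_rv LM" "(\<lambda>\<omega>. I (\<phi> \<omega>)) \<in> L2_rv M" using L2_\<Theta>(1)[OF L(1)] L2_\<phi>(1)[OF L(2)] by auto
  fix \<epsilon> :: real assume "0 < \<epsilon>"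
  then obtain p S where p: "(p, S) \<in> simple_ito_pairs M' W' T"
    "L2_norm (lborel \<Otimes>\<^sub>M M') (\<lambda>x. p x - g x) < \<epsilon>" "L2_norm M' (\<lambda>\<omega>. S \<omega> - I \<omega>) < \<epsilon>"
    using assms unfolding target.ito_def by blast
  note L' = target.simple_ito_pairs_L2[OF p(1)]
  obtain S' where S': "((\<lambda>z. p (\<Theta> z)), S') \<in> simple_ito_pairs M W (T + h)" "\<forall>\<omega>\<in>space M. S' \<omega> = S (\<phi> \<omega>)"
    using simple_ito_pairs_factor[OF p(1)] by blast
  have "L2_norm LM (\<lambda>z. p (\<Theta> z) - g (\<Theta> z)) < \<epsilon>"
    using L2_\<Theta>(2)[OF L2_rv_diff[OF L'(1) L(1)]] p(2) by simp
  moreover have "L2_norm M (\<lambda>\<omega>. S' \<omega> - I (\<phi> \<omega>)) = L2_norm M (\<lambda>\<omega>. S (\<phi> \<omega>) - I (\<phi> \<omega>))"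
    unfolding L2_norm_def by (intro arg_cong[of _ _ sqrt] Bochner_Integration.integral_cong) (use S'(2) in auto)
  then have "L2_norm M (\<lambda>\<omega>. S' \<omega> - I (\<phi> \<omega>)) < \<epsilon>"
    using L2_\<phi>(2)[OF L2_rv_diff[OF L'(2) L(2)]] p(3) by simp
  ultimately show "\<exists>p S. (p, S) \<in> simple_ito_pairs M W (T + h) \<and>
       L2_norm LM (\<lambda>x. p x - g (\<Theta> x)) < \<epsilon> \<and> L2_norm M (\<lambda>\<omega>. S \<omega> - I (\<phi> \<omega>)) < \<epsilon>"
    using S'(1) by blast
qed

lemma drift_factor:
  "drift {t0 + h..t + h} (t + h) (\<lambda>z. f (\<Theta> z)) \<omega> = target.drift {t0..t} t f (\<phi> \<omega>)"
proof -
  have "drift {t0 + h..t + h} (t + h) (\<lambda>z. f (\<Theta> z)) \<omega> = (\<integral>s. indicat_real {t0 + h..t + h} s *\<^sub>R conv t (s - h) (f (s - h, \<phi> \<omega>)) \<partial>lborel)"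
    unfolding drift_def conv_translate by (simp add: \<Theta>_def)
  also have "\<dots> = (\<integral>s. indicat_real {t0 + h..t + h} (h + 1 * s) *\<^sub>R conv t ((h + 1 * s) - h) (f ((h + 1 * s) - h, \<phi> \<omega>)) \<partial>lborel)"
    using lborel_integral_real_affine[of 1 "\<lambda>s. indicat_real {t0 + h..t + h} s *\<^sub>R conv t (s - h) (f (s - h, \<phi> \<omega>))" h] by simp
  also have "\<dots> = target.drift {t0..t} t f (\<phi> \<omega>)"
    unfolding target.drift_def by (intro Bochner_Integration.integral_cong) (auto simp: indicator_def)
  finally show ?thesis .
qed

lemma response_factor:
  assumes "target.response {t0..t} t f g X"
  shows "response {t0 + h..t + h} (t + h) (\<lambda>z. f (\<Theta> z)) (\<lambda>z. g (\<Theta> z)) (\<lambda>\<omega>. X (\<phi> \<omega>))"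
proof -
  obtain I where I: "target.ito t (\<lambda>z. indicat_real {t0..t} (fst z) *\<^sub>R conv t (fst z) (g z)) I"
    and X: "AE \<omega> in M'. X \<omega> = target.drift {t0..t} t f \<omega> + I \<omega>" and Xm: "X \<in> borel_measurable M'"
    using assms unfolding target.response_def by blast
  have "(\<lambda>z. indicat_real {t0 + h..t + h} (fst z) *\<^sub>R conv (t + h) (fst z) (g (\<Theta> z))) =
    (\<lambda>z. indicat_real {t0..t} (fst (\<Theta> z)) *\<^sub>R conv t (fst (\<Theta> z)) (g (\<Theta> z)))"
    unfolding conv_translate by (auto simp: \<Theta>_def indicator_def fun_eq_iff)
  with ito_factor[OF I]
  have "ito (t + h) (\<lambda>z. indicat_real {t0 + h..t + h} (fst z) *\<^sub>R conv (t + h) (fst z) (g (\<Theta> z))) (\<lambda>\<omega>. I (\<phi> \<omega>))" by simp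
  moreover have "AE \<omega> in M. X (\<phi> \<omega>) = drift {t0 + h..t + h} (t + h) (\<lambda>z. f (\<Theta> z)) \<omega> + I (\<phi> \<omega>)"
    unfolding drift_factor by (rule AE_\<phi>[OF X])
  moreover have "(\<lambda>\<omega>. X (\<phi> \<omega>)) \<in> borel_measurable M" by (rule measurable_compose[OF \<phi> Xm])
  ultimately show ?thesis unfolding response_def by blast
qed

text \<open>The shift of the coefficients by \<open>h\<close> compensates the delay by
  \<open>h\<close> in the process, so the pulled back process solves the equation with the original
  coefficients and with noise \<open>W\<close>.\<close>

lemma increment_solution_factor:
  assumes z: "target.increment_solution (\<lambda>s. F (s + h)) (\<lambda>s. G (s + h)) z"
  shows "increment_solution F G (\<lambda>t \<omega>. z (t - h) (\<phi> \<omega>))"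
  unfolding increment_solution_def
proof (intro conjI allI impI)
  have zm: "(\<lambda>x. z (fst x) (snd x)) \<in> borel_measurable (lborel \<Otimes>\<^sub>M M')" and zL: "\<And>t. z t \<in> L2_rv M'"
    and zr: "\<And>t0 t. t0 \<le> t \<Longrightarrow> target.response {t0..t} t (\<lambda>x. F (fst x + h) (z (fst x) (snd x))) (\<lambda>x. G (fst x + h) (z (fst x) (snd x)))
      (\<lambda>\<omega>. z t \<omega> - U (t - t0) (z t0 \<omega>))"
    using z unfolding target.increment_solution_def by auto
  show "(\<lambda>x. z (fst x - h) (\<phi> (snd x))) \<in> borel_measurable LM"
    using measurable_compose[OF \<Theta>_measurable zm] by (simp add: \<Theta>_def)
  show "(\<lambda>\<omega>. z (t - h) (\<phi> \<omega>)) \<in> L2_rv M" for t by (rule L2_\<phi>(1)[OF zL])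
  fix t0 t :: real assume "t0 \<le> t"
  then have "t0 - h \<le> t - h" by simp
  from response_factor[OF zr[OF this]]
  show "response {t0..t} t (\<lambda>x. F (fst x) (z (fst x - h) (\<phi> (snd x)))) (\<lambda>x. G (fst x) (z (fst x - h) (\<phi> (snd x))))
      (\<lambda>\<omega>. z (t - h) (\<phi> \<omega>) - U (t - t0) (z (t0 - h) (\<phi> \<omega>)))"
    by (simp add: \<Theta>_def)
qed

end

text \<open>A test function in the unit ball has Lipschitz constant at most 1, since its sup bound
  is nonnegative. Hence the difference of the integrals is at most the mean distance in the given
  coupling, and this is at most the L2 distance.\<close>

lemma BL_dist_law_le:
  fixes X Y :: "'w \<Rightarrow> 'a::{real_inner, banach, second_countable_topology}"
  assumes "prob_space M" and X: "X \<in> L2_rv M" and Y: "Y \<in> L2_rv M"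
  shows "BL_dist (law M X) (law M Y) \<le> L2_norm M (\<lambda>\<omega>. X \<omega> - Y \<omega>)"
  unfolding BL_dist_def
proof (rule cSUP_least)
  interpret prob_space M by fact
  \<comment> \<open>\<open>cSUP_least\<close> bounds a real supremum only over a nonempty
    set.\<close>
  have "(\<lambda>_. 0) \<in> (BL_unit_ball :: ('a \<Rightarrow> real) set)"
    unfolding BL_unit_ball_def by (intro CollectI exI[of _ 0]) (auto intro: lipschitz_intros)
  then show "(BL_unit_ball :: ('a \<Rightarrow> real) set) \<noteq> {}" by blast
  fix f :: "'a \<Rightarrow> real" assume "f \<in> BL_unit_ball"
  then obtain l c where f: "l-lipschitz_on UNIV f" "\<And>x. \<bar>f x\<bar> \<le> c" "l + c \<le> 1" unfolding BL_unit_ball_def by blast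
  have "0 \<le> c" using f(2) abs_ge_zero order_trans by blast
  with f(3) have l: "l \<le> 1" by simp
  note [measurable] = L2_rv_measurable[OF X] L2_rv_measurable[OF Y]
  have fm[measurable]: "f \<in> borel_measurable borel"
    by (intro borel_measurable_continuous_onI lipschitz_on_continuous_on[OF f(1)])
  have int: "integrable M (\<lambda>\<omega>. f (Z \<omega>))" if [measurable]: "Z \<in> borel_measurable M" for Z
    by (rule integrable_const_bound[where B=c]) (use f(2) in auto)
  have "\<bar>(\<integral>x. f x \<partial>law M X) - (\<integral>x. f x \<partial>law M Y)\<bar> = \<bar>expectation (\<lambda>\<omega>. f (X \<omega>) - f (Y \<omega>))\<bar>"
    by (simp add: law_def integral_distr int)
  also have "\<dots> \<le> expectation (\<lambda>\<omega>. \<bar>f (X \<omega>) - f (Y \<omega>)\<bar>)" by (rule integral_abs_bound)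
  also have "\<dots> \<le> expectation (\<lambda>\<omega>. norm (X \<omega> - Y \<omega>))"
  proof (rule integral_mono)
    show "integrable M (\<lambda>\<omega>. \<bar>f (X \<omega>) - f (Y \<omega>)\<bar>)" by (intro integrable_abs Bochner_Integration.integrable_diff int) auto
    show "integrable M (\<lambda>\<omega>. norm (X \<omega> - Y \<omega>))" by (rule L2_rv_imp_integrable_norm[OF L2_rv_diff[OF X Y]])
    show "\<bar>f (X \<omega>) - f (Y \<omega>)\<bar> \<le> norm (X \<omega> - Y \<omega>)" for \<omega>
    proof -
      have "dist (f (X \<omega>)) (f (Y \<omega>)) \<le> l * dist (X \<omega>) (Y \<omega>)" by (rule lipschitz_onD[OF f(1)]) auto
      also have "\<dots> \<le> 1 * dist (X \<omega>) (Y \<omega>)" by (intro mult_right_mono l) simp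
      finally show ?thesis by (simp add: dist_norm)
    qed
  qed
  also have "\<dots> \<le> L2_norm M (\<lambda>\<omega>. X \<omega> - Y \<omega>)" by (rule integral_norm_le_L2_norm[OF L2_rv_diff[OF X Y]])
  finally show "\<bar>(\<integral>x. f x \<partial>law M X) - (\<integral>x. f x \<partial>law M Y)\<bar> \<le> L2_norm M (\<lambda>\<omega>. X \<omega> - Y \<omega>)" .
qed

lemma lipschitz_coefficient_shift:
  fixes F :: "real \<Rightarrow> 'a::real_normed_vector \<Rightarrow> 'a"
  assumes "lipschitz_coefficient A0 L F"
  shows "lipschitz_coefficient A0 L (\<lambda>t. F (t + h))"
proof -
  have 1: "continuous_on UNIV (\<lambda>(t, x). F t x)" using assms by (simp add: lipschitz_coefficient_def)
  have 2: "continuous_on UNIV (\<lambda>z :: real \<times> 'a. (fst z + h, snd z))" by (intro continuous_intros)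
  from continuous_on_compose2[OF 1 2] have "continuous_on UNIV (\<lambda>z. (\<lambda>(t, x). F t x) (fst z + h, snd z))" by simp
  with assms show ?thesis unfolding lipschitz_coefficient_def by (simp add: case_prod_beta')
qed

text \<open>The bounds pass to pointwise limits. Joint continuity need not; it comes from continuity
  in time at a fixed vector, contained in \<open>BUC\<close>, together with the Lipschitz
  bound.\<close>

lemma lipschitz_coefficient_limit:
  fixes F F' :: "real \<Rightarrow> 'a::real_normed_vector \<Rightarrow> 'a"
  assumes F: "lipschitz_coefficient A0 L F" and F': "F' \<in> BUC"
    and lim: "\<And>t x. (\<lambda>n. F (t + \<tau> n) x) \<longlonglongrightarrow> F' t x"
  shows "lipschitz_coefficient A0 L F'"
proof -
  have A: "0 \<le> A0" "0 \<le> L" using F by (auto simp: lipschitz_coefficient_def)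
  have lip: "norm (F' t x - F' t y) \<le> L * norm (x - y)" for t x y
  proof (rule LIMSEQ_le_const2[OF tendsto_norm[OF tendsto_diff[OF lim lim]]])
    show "\<exists>N. \<forall>n\<ge>N. norm (F (t + \<tau> n) x - F (t + \<tau> n) y) \<le> L * norm (x - y)"
      using F by (auto simp: lipschitz_coefficient_def)
  qed
  moreover have "norm (F' t 0) \<le> A0" for t
  proof (rule LIMSEQ_le_const2[OF tendsto_norm[OF lim]])
    show "\<exists>N. \<forall>n\<ge>N. norm (F (t + \<tau> n) 0) \<le> A0" using F by (auto simp: lipschitz_coefficient_def)
  qed
  moreover have "continuous_on UNIV (\<lambda>(t, x). F' t x)"
    unfolding continuous_on_sequentially
  proof (intro ballI allI impI)
    fix z :: "real \<times> 'a" and f assume f: "(\<forall>n. f n \<in> UNIV) \<and> f \<longlonglongrightarrow> z"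
    then have f1: "(\<lambda>n. fst (f n)) \<longlonglongrightarrow> fst z" and f2: "(\<lambda>n. snd (f n)) \<longlonglongrightarrow> snd z"
      by (auto intro: tendsto_fst tendsto_snd)
    have "(\<lambda>n. F' (fst (f n)) (snd z)) \<longlonglongrightarrow> F' (fst z) (snd z)"
    proof (rule tendstoI)
      fix \<epsilon> :: real assume "0 < \<epsilon>"
      moreover have "continuous_in_t_uniformly F' {snd z}" using F' by (simp add: BUC_def)
      ultimately obtain \<delta> where \<delta>: "0 < \<delta>" "\<And>t. \<bar>t - fst z\<bar> < \<delta> \<Longrightarrow> norm (F' t (snd z) - F' (fst z) (snd z)) < \<epsilon>"
        unfolding continuous_in_t_uniformly_def by (metis singletonI)
      from tendstoD[OF f1 \<delta>(1)] show "\<forall>\<^sub>F n in sequentially. dist (F' (fst (f n)) (snd z)) (F' (fst z) (snd z)) < \<epsilon>"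
        by eventually_elim (use \<delta>(2) in \<open>simp add: dist_norm\<close>)
    qed
    moreover have "(\<lambda>n. F' (fst (f n)) (snd (f n)) - F' (fst (f n)) (snd z)) \<longlonglongrightarrow> 0"
    proof (rule Lim_null_comparison)
      show "\<forall>\<^sub>F n in sequentially. norm (F' (fst (f n)) (snd (f n)) - F' (fst (f n)) (snd z)) \<le> L * norm (snd (f n) - snd z)"
        by (intro always_eventually allI lip)
      have "(\<lambda>n. L * norm (snd (f n) - snd z)) \<longlonglongrightarrow> L * norm (snd z - snd z)" by (intro tendsto_intros f2)
      then show "(\<lambda>n. L * norm (snd (f n) - snd z)) \<longlonglongrightarrow> 0" by simp
    qed
    ultimately have "(\<lambda>n. (F' (fst (f n)) (snd (f n)) - F' (fst (f n)) (snd z)) + F' (fst (f n)) (snd z)) \<longlonglongrightarrow> 0 + F' (fst z) (snd z)"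
      by (intro tendsto_add)
    then show "((\<lambda>(t, x). F' t x) \<circ> f) \<longlonglongrightarrow> (case z of (t, x) \<Rightarrow> F' t x)"
      by (simp add: comp_def case_prod_beta')
  qed
  ultimately show ?thesis using A unfolding lipschitz_coefficient_def by blast
qed

section \<open>Convergence of the laws and the constant of the theorem\<close>

locale stable_brownian = two_sided_brownian M W + stable_semigroup U N \<nu>
  for M :: "'w measure" and W and U :: "real \<Rightarrow> 'a::{real_inner, banach, second_countable_topology} \<Rightarrow>\<^sub>L 'a" and N \<nu>
begin

sublocale stable_wiener M W U N \<nu> ..

text \<open>On path space all shifted equations and the limit equation are driven by the coordinate
  process, so their solutions can be compared in L2. The sets in \<T> have to cover every time, so
  that the coefficients converge pointwise and \<open>F'\<close> and \<open>G'\<close> inherit the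
  Lipschitz bounds.\<close>

lemma laws_of_shifts_converge:
  assumes F: "lipschitz_coefficient A0 L F" and G: "lipschitz_coefficient A0 L G"
    and c: "gain \<le> c" "c * L < 1" and R: "R = c * A0 / (1 - c * L)"
    and \<xi>: "increment_solution F G \<xi>" "\<And>t. L2_norm M (\<xi> t) \<le> R"
    and F': "F' \<in> BUC" and G': "G' \<in> BUC"
    and \<T>: "\<And>S l. S \<in> \<T> \<Longrightarrow> 0 \<le> l \<Longrightarrow> \<exists>S'\<in>\<T>. \<forall>t\<in>S. {t - l..t} \<subseteq> S'" "\<And>t. \<exists>S\<in>\<T>. t \<in> S"
    and eF: "\<And>S \<rho> \<epsilon>. S \<in> \<T> \<Longrightarrow> 0 < \<epsilon> \<Longrightarrow> \<forall>\<^sub>F n in sequentially. \<forall>s\<in>S. \<forall>h\<in>cball 0 \<rho>. norm (F (s + \<tau> n) h - F' s h) \<le> \<epsilon>"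
    and eG: "\<And>S \<rho> \<epsilon>. S \<in> \<T> \<Longrightarrow> 0 < \<epsilon> \<Longrightarrow> \<forall>\<^sub>F n in sequentially. \<forall>s\<in>S. \<forall>h\<in>cball 0 \<rho>. norm (G (s + \<tau> n) h - G' s h) \<le> \<epsilon>"
  obtains \<mu> where "\<And>t. \<mu> t \<in> borel_prob_measures" "\<And>S. S \<in> \<T> \<Longrightarrow> laws_converge_uniformly_on S M (\<lambda>n t. \<xi> (t + \<tau> n)) \<mu>"
proof -
  let ?P = "distr M (PiM UNIV (\<lambda>_::real. borel :: real measure)) (shifted_path 0)"
  let ?Z = "\<lambda>t (p :: real \<Rightarrow> real). p t"
  have \<phi>: "shifted_path h \<in> measurable M ?P" for h using shifted_path_measurable by simp
  have distr: "distr M ?P (shifted_path h) = ?P" for h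
  proof -
    have "distr M ?P (shifted_path h) = distr M (PiM UNIV (\<lambda>_. borel)) (shifted_path h)" by (rule distr_cong) auto
    then show ?thesis using shifted_path_law[of h] by simp
  qed
  have inc: "?Z u (shifted_path h \<omega>) - ?Z v (shifted_path h \<omega>) = W (u + h) \<omega> - W (v + h) \<omega>" for u v h \<omega>
    by (simp add: shifted_path_def)
  have Zm: "?Z t \<in> borel_measurable ?P" for t by simp
  have wP: "wiener_process ?P ?Z"
    by (rule wiener_process_factor[where W'="?Z" and h=0, OF wiener_process_axioms \<phi>[of 0] distr[of 0] Zm]) (rule inc)
  interpret P: wiener_process ?P ?Z by (rule wP)
  interpret P: stable_wiener ?P ?Z U N \<nu> ..
  have lim: "(\<lambda>n. H (t + \<tau> n) x) \<longlonglongrightarrow> H' t x"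
    if e: "\<And>S \<rho> \<epsilon>. S \<in> \<T> \<Longrightarrow> 0 < \<epsilon> \<Longrightarrow> \<forall>\<^sub>F n in sequentially. \<forall>s\<in>S. \<forall>h\<in>cball 0 \<rho>. norm (H (s + \<tau> n) h - H' s h) \<le> \<epsilon>"
    for H H' :: "real \<Rightarrow> 'a \<Rightarrow> 'a" and t x
  proof (rule tendstoI)
    fix \<epsilon> :: real assume \<epsilon>: "0 < \<epsilon>"
    then have e2: "0 < \<epsilon> / 2" by simp
    obtain S where S: "S \<in> \<T>" "t \<in> S" using \<T>(2) by blast
    from e[OF S(1) e2, of "norm x"] show "\<forall>\<^sub>F n in sequentially. dist (H (t + \<tau> n) x) (H' t x) < \<epsilon>"
    proof eventually_elim
      fix n assume "\<forall>s\<in>S. \<forall>h\<in>cball 0 (norm x). norm (H (s + \<tau> n) h - H' s h) \<le> \<epsilon> / 2"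
      then have "norm (H (t + \<tau> n) x - H' t x) \<le> \<epsilon> / 2" using S(2) by simp
      then show "dist (H (t + \<tau> n) x) (H' t x) < \<epsilon>" using \<epsilon> by (simp add: dist_norm)
    qed
  qed
  have F'l: "lipschitz_coefficient A0 L F'" by (rule lipschitz_coefficient_limit[where \<tau>=\<tau>, OF F F' lim[OF eF]])
  have G'l: "lipschitz_coefficient A0 L G'" by (rule lipschitz_coefficient_limit[where \<tau>=\<tau>, OF G G' lim[OF eG]])
  let ?F = "\<lambda>n s. F (s + \<tau> n)" and ?G = "\<lambda>n s. G (s + \<tau> n)"
  note Fn = lipschitz_coefficient_shift[OF F] and Gn = lipschitz_coefficient_shift[OF G]
  obtain y where y: "P.global_solution F' G' y" "\<And>t. L2_norm ?P (y t) \<le> R"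
    "\<And>\<epsilon>. 0 < \<epsilon> \<Longrightarrow> \<exists>C Y. 0 \<le> C \<and> (\<forall>t. Y t \<in> L2_rv ?P \<and> L2_norm ?P (\<lambda>\<omega>. y t \<omega> - Y t \<omega>) \<le> \<epsilon> \<and>
       (\<integral>\<^sup>+\<omega>. ennreal (norm (Y t \<omega>) ^ 4) \<partial>?P) \<le> ennreal C)"
    by (rule P.solution_exists[OF F'l G'l c R]; rule that)
  have yi: "P.increment_solution F' G' y" by (rule P.global_imp_increment_solution[OF F'l G'l y(1,2)])
  then have yL: "y t \<in> L2_rv ?P" for t unfolding P.increment_solution_def by blast
  have "\<exists>z. P.increment_solution (?F n) (?G n) z \<and> (\<forall>t. L2_norm ?P (z t) \<le> R)" for n
  proof -
    obtain z where "P.global_solution (?F n) (?G n) z" "\<And>t. L2_norm ?P (z t) \<le> R"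
      by (rule P.solution_exists[OF Fn Gn c R]; rule that)
    then show ?thesis using P.global_imp_increment_solution[OF Fn Gn] by blast
  qed
  from choice[OF allI[OF this]] obtain z where "\<forall>n. P.increment_solution (?F n) (?G n) (z n) \<and> (\<forall>t. L2_norm ?P (z n t) \<le> R)" ..
  then have z: "P.increment_solution (?F n) (?G n) (z n)" "L2_norm ?P (z n t) \<le> R" for n t by blast+
  then have zL: "z n t \<in> L2_rv ?P" for n t unfolding P.increment_solution_def by blast
  \<comment> \<open>Composed with the shifted path, and with its time moved back, \<open>z n\<close>
    solves the original equation on \<open>M\<close> and therefore equals \<xi> by uniqueness; the
    image of \<open>M\<close> under the shifted path is the path measure for every shift.\<close>
  have law_eq: "law M (\<xi> (t + \<tau> n)) = law ?P (z n t)" for n t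
  proof -
    interpret shifted_factor M W U N \<nu> ?P ?Z "shifted_path (\<tau> n)" "\<tau> n"
      by unfold_locales (use \<phi> distr inc in auto)
    have sol: "increment_solution F G (\<lambda>t \<omega>. z n (t - \<tau> n) (shifted_path (\<tau> n) \<omega>))"
      by (rule increment_solution_factor[OF z(1)])
    have bd: "L2_norm M (\<lambda>\<omega>. z n (t - \<tau> n) (shifted_path (\<tau> n) \<omega>)) \<le> R" for t
      using L2_\<phi>(2)[OF zL] z(2) by simp
    have \<xi>L: "\<xi> s \<in> L2_rv M" for s using \<xi>(1) unfolding increment_solution_def by blast
    have "AE \<omega> in M. \<xi> (t + \<tau> n) \<omega> = z n (t + \<tau> n - \<tau> n) (shifted_path (\<tau> n) \<omega>)"
      by (rule solution_unique[OF F G c \<xi> sol bd])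
    then have "law M (\<xi> (t + \<tau> n)) = distr M borel (\<lambda>\<omega>. z n t (shifted_path (\<tau> n) \<omega>))"
      unfolding law_def by (intro distr_cong_AE) (use L2_rv_measurable[OF \<xi>L] measurable_compose[OF \<phi> L2_rv_measurable[OF zL]] in auto)
    also have "\<dots> = distr (distr M ?P (shifted_path (\<tau> n))) borel (z n t)"
      using distr_distr[OF L2_rv_measurable[OF zL[of n t]] \<phi>] by (simp only: comp_def)
    also have "\<dots> = law ?P (z n t)" unfolding distr law_def ..
    finally show ?thesis .
  qed
  show thesis
  proof (rule that[of "\<lambda>t. law ?P (y t)"])
    show "law ?P (y t) \<in> borel_prob_measures" for t
      unfolding borel_prob_measures_def law_def using P.prob_space_distr[OF L2_rv_measurable[OF yL]] by simp
    fix S assume S: "S \<in> \<T>"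
    show "laws_converge_uniformly_on S M (\<lambda>n t. \<xi> (t + \<tau> n)) (\<lambda>t. law ?P (y t))"
      unfolding laws_converge_uniformly_on_def law_eq
    proof (intro allI impI)
      fix \<epsilon> :: real assume \<epsilon>: "0 < \<epsilon>"
      have "\<forall>\<^sub>F n in sequentially. \<forall>t\<in>S. L2_norm ?P (\<lambda>\<omega>. z n t \<omega> - y t \<omega>) < \<epsilon>"
      proof (rule P.solution_stability[OF Fn Gn F'l G'l c z yi y(2) \<T>(1) _ _ S \<epsilon>])
        show "\<forall>\<^sub>F n in sequentially. \<forall>s\<in>S. L2_norm ?P (\<lambda>\<omega>. ?F n s (y s \<omega>) - F' s (y s \<omega>)) \<le> \<epsilon>"
          if "S \<in> \<T>" "0 < \<epsilon>" for S \<epsilon>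
          by (rule P.coefficient_error[OF Fn F'l yL y(3) eF[OF that(1)] that(2)])
        show "\<forall>\<^sub>F n in sequentially. \<forall>s\<in>S. L2_norm ?P (\<lambda>\<omega>. ?G n s (y s \<omega>) - G' s (y s \<omega>)) \<le> \<epsilon>"
          if "S \<in> \<T>" "0 < \<epsilon>" for S \<epsilon>
          by (rule P.coefficient_error[OF Gn G'l yL y(3) eG[OF that(1)] that(2)])
      qed
      then show "\<forall>\<^sub>F n in sequentially. \<forall>t\<in>S. BL_dist (law ?P (z n t)) (law ?P (y t)) < \<epsilon>"
        by eventually_elim (use BL_dist_law_le[OF P.prob_space_axioms zL yL] in \<open>blast intro: le_less_trans\<close>)
    qed
  qed
qed

text \<open>The origin of \<open>sqrt (2 + \<nu>)\<close>: with
  \<open>(a + b)^2 \<le> 2 a^2 + 2 b^2\<close> the two parts give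
  \<open>2 / \<nu>^2 + 1 / \<nu>\<close>, which is \<open>(2 + \<nu>) / \<nu>^2\<close>.\<close>

lemma gain_le: "gain \<le> N * sqrt (2 + \<nu>) / \<nu>"
proof -
  let ?a = "1 / \<nu>" and ?b = "1 / sqrt (2 * \<nu>)"
  have "(?a + ?b)\<^sup>2 \<le> 2 * ?a\<^sup>2 + 2 * ?b\<^sup>2"
    using sum_squares_bound[of ?a ?b] by (simp add: power2_sum)
  also have "\<dots> = (sqrt (2 + \<nu>) / \<nu>)\<^sup>2"
    using \<nu>_pos by (simp add: power_divide field_simps power2_eq_square)
  finally have "?a + ?b \<le> sqrt (2 + \<nu>) / \<nu>"
    by (rule power2_le_imp_le) (use \<nu>_pos in simp)
  from mult_left_mono[OF this, of N] show ?thesis using N_pos by (simp add: gain_def)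
qed

end

theorem theorem4p6:
  fixes M :: "'w measure"
    and W :: "real \<Rightarrow> 'w \<Rightarrow> real"
    and A :: "('a::{real_inner, banach, second_countable_topology} \<times> 'a) set"
    and U :: "real \<Rightarrow> 'a \<Rightarrow>\<^sub>L 'a"
    and F G :: "real \<Rightarrow> 'a \<Rightarrow> 'a"
    and N \<nu> A0 L r :: real
  assumes "prob_space M"
    and "two_sided_brownian_motion M W"
    and "C0_semigroup U"
    and "A = infinitesimal_generator U"
    and "N > 0" and "\<nu> > 0"
    and "\<forall>t\<ge>0. norm (U t) \<le> N * exp (- \<nu> * t)"
    and "continuous_on UNIV (\<lambda>(t, x). F t x)"
    and "continuous_on UNIV (\<lambda>(t, x). G t x)"
    and C1: "A0 \<ge> 0" "\<forall>t. norm (F t 0) \<le> A0 \<and> norm (G t 0) \<le> A0"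
    and C2: "L \<ge> 0" "\<forall>t x1 x2. norm (F t x1 - F t x2) \<le> L * norm (x1 - x2) \<and>
                              norm (G t x1 - G t x2) \<le> L * norm (x1 - x2)"
    and "r = N * A0 * sqrt (2 + \<nu>) / (\<nu> - N * L * sqrt (2 + \<nu>))"
  shows
    "(L < \<nu> / (N * sqrt (2 + \<nu>)) \<longrightarrow>
        (\<exists>\<xi>\<in>continuous_in_L2_ball M r. mild_solution M W U F G \<xi> \<and>
           (\<forall>\<eta>\<in>continuous_in_L2_ball M r. mild_solution M W U F G \<eta> \<longrightarrow>
              (\<forall>t. AE \<omega> in M. \<eta> t \<omega> = \<xi> t \<omega>)))) \<and>
     (L < \<nu> / (2 * N * sqrt (1 + \<nu>)) \<and>
      (\<forall>Q. bounded Q \<longrightarrow> continuous_in_t_uniformly F Q \<and> continuous_in_t_uniformly G Q) \<longrightarrow>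
        (\<forall>\<xi>\<in>continuous_in_L2_ball M r. mild_solution M W U F G \<xi> \<longrightarrow>
           coeff_seqs_unif F G \<subseteq> dist_seqs_unif M \<xi> \<and>
           uniformly_comparable_in_distribution M F G \<xi>))"
proof -
  interpret prob_space M by fact
  interpret stable_brownian M W U N \<nu>
    by unfold_locales (use assms in auto)
  define c where "c = N * sqrt (2 + \<nu>) / \<nu>"
  have gc: "gain \<le> c" unfolding c_def by (rule gain_le)
  have F: "lipschitz_coefficient A0 L F" and G: "lipschitz_coefficient A0 L G"
    using assms unfolding lipschitz_coefficient_def by auto
  have sq: "0 < N * sqrt (2 + \<nu>)" using N_pos \<nu>_pos by simp
  have cL: "c * L < 1" if "L < \<nu> / (N * sqrt (2 + \<nu>))"
  proof -
    have "L * (N * sqrt (2 + \<nu>)) < \<nu>" using that sq by (simp add: pos_less_divide_eq)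
    then show ?thesis using \<nu>_pos by (simp add: c_def pos_divide_less_eq mult_ac)
  qed
  have r: "r = c * A0 / (1 - c * L)" if "c * L < 1"
  proof -
    have "1 - c * L = (\<nu> - N * L * sqrt (2 + \<nu>)) / \<nu>"
      using \<nu>_pos by (simp add: c_def field_simps)
    then show ?thesis using assms(14) \<nu>_pos by (simp add: c_def)
  qed
  have ball: "\<eta> t \<in> L2_rv M" "L2_norm M (\<eta> t) \<le> r" if "\<eta> \<in> continuous_in_L2_ball M r" for \<eta> t
    using that by (auto simp: continuous_in_L2_ball_def L2_ball_def)
  show ?thesis
  proof (intro conjI impI)
    assume small: "L < \<nu> / (N * sqrt (2 + \<nu>))"
    note cL = cL[OF small]
    obtain \<xi> where \<xi>: "global_solution F G \<xi>" "\<And>t. L2_norm M (\<xi> t) \<le> r"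
      by (rule solution_exists[OF F G gc cL r[OF cL]]; rule that)
    have \<xi>c: "\<xi> \<in> continuous_in_L2_ball M r"
      unfolding continuous_in_L2_ball_def L2_ball_def
    proof (intro CollectI conjI allI)
      have c: "L2_continuous \<xi>" using \<xi>(1) by (simp add: global_solution_def)
      then show "\<xi> t \<in> L2_rv M" for t by (simp add: L2_continuous_def)
      show "L2_norm M (\<xi> t) \<le> r" for t by (rule \<xi>(2))
      show "((\<lambda>s. L2_norm M (\<lambda>\<omega>. \<xi> s \<omega> - \<xi> t \<omega>)) \<longlongrightarrow> 0) (at t)" for t
        unfolding tendsto_at_iff_sequentially comp_def using c by (auto simp: L2_continuous_def)
    qed
    show "\<exists>\<xi>\<in>continuous_in_L2_ball M r. mild_solution M W U F G \<xi> \<and>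
           (\<forall>\<eta>\<in>continuous_in_L2_ball M r. mild_solution M W U F G \<eta> \<longrightarrow>
              (\<forall>t. AE \<omega> in M. \<eta> t \<omega> = \<xi> t \<omega>))"
    proof (intro bexI[OF _ \<xi>c] conjI ballI impI allI)
      show "mild_solution M W U F G \<xi>" by (rule global_imp_mild_solution[OF F G \<xi>])
      fix \<eta> t assume \<eta>: "\<eta> \<in> continuous_in_L2_ball M r" "mild_solution M W U F G \<eta>"
      show "AE \<omega> in M. \<eta> t \<omega> = \<xi> t \<omega>"
        by (rule solution_unique[OF F G gc cL mild_imp_increment_solution[OF \<eta>(2) ball(1)[OF \<eta>(1)]] ball(2)[OF \<eta>(1)]
          global_imp_increment_solution[OF F G \<xi>] \<xi>(2)])
    qed
  next
    assume small: "L < \<nu> / (2 * N * sqrt (1 + \<nu>)) \<and>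
      (\<forall>Q. bounded Q \<longrightarrow> continuous_in_t_uniformly F Q \<and> continuous_in_t_uniformly G Q)"
    \<comment> \<open>The threshold of (ii) lies below that of (i), because
      \<open>2 + \<nu> \<le> 4 (1 + \<nu>)\<close>.\<close>
    have "sqrt (2 + \<nu>) \<le> sqrt (2\<^sup>2 * (1 + \<nu>))" using \<nu>_pos by (intro real_sqrt_le_mono) simp
    then have "sqrt (2 + \<nu>) \<le> 2 * sqrt (1 + \<nu>)" unfolding real_sqrt_mult by simp
    then have "N * sqrt (2 + \<nu>) \<le> N * (2 * sqrt (1 + \<nu>))" using N_pos by (intro mult_left_mono) auto
    then have "\<nu> / (2 * N * sqrt (1 + \<nu>)) \<le> \<nu> / (N * sqrt (2 + \<nu>))"
      using \<nu>_pos sq by (intro divide_left_mono) (auto simp: mult_ac intro!: mult_pos_pos N_pos)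
    with small have "L < \<nu> / (N * sqrt (2 + \<nu>))" by linarith
    note cL = cL[OF this]
    show "\<forall>\<xi>\<in>continuous_in_L2_ball M r. mild_solution M W U F G \<xi> \<longrightarrow>
           coeff_seqs_unif F G \<subseteq> dist_seqs_unif M \<xi> \<and> uniformly_comparable_in_distribution M F G \<xi>"
    proof (intro ballI impI conjI)
      fix \<xi> assume \<xi>: "\<xi> \<in> continuous_in_L2_ball M r" "mild_solution M W U F G \<xi>"
      note conv = laws_of_shifts_converge[OF F G gc cL r[OF cL] mild_imp_increment_solution[OF \<xi>(2) ball(1)[OF \<xi>(1)]] ball(2)[OF \<xi>(1)]]
      show "coeff_seqs_unif F G \<subseteq> dist_seqs_unif M \<xi>"
      proof
        fix \<tau> assume "\<tau> \<in> coeff_seqs_unif F G"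
        then obtain F' G' where F'G': "F' \<in> BUC" "G' \<in> BUC"
          and lim: "\<And>R. 0 < R \<Longrightarrow> uniform_limit (UNIV \<times> cball 0 R) (\<lambda>n (t, x). F (t + \<tau> n) x) (\<lambda>(t, x). F' t x) sequentially"
            "\<And>R. 0 < R \<Longrightarrow> uniform_limit (UNIV \<times> cball 0 R) (\<lambda>n (t, x). G (t + \<tau> n) x) (\<lambda>(t, x). G' t x) sequentially"
          unfolding coeff_seqs_unif_def by blast
        have e: "\<forall>\<^sub>F n in sequentially. \<forall>s\<in>S. \<forall>h\<in>cball 0 \<rho>. norm (H (s + \<tau> n) h - H' s h) \<le> \<epsilon>"
          if lim: "\<And>R. 0 < R \<Longrightarrow> uniform_limit (UNIV \<times> cball 0 R) (\<lambda>n (t, x). H (t + \<tau> n) x) (\<lambda>(t, x). H' t x) sequentially"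
            and "0 < \<epsilon>" for H H' :: "real \<Rightarrow> 'a \<Rightarrow> 'a" and S \<rho> \<epsilon>
        proof -
          \<comment> \<open>\<rho> may be 0 or negative, while the uniform limits are given for
            positive radii only.\<close>
          have "0 < max 1 \<rho>" by simp
          from uniform_limitD[OF lim[OF this] \<open>0 < \<epsilon>\<close>] show ?thesis
            by eventually_elim (force simp: dist_norm intro: less_imp_le)
        qed
        obtain \<mu> where "\<And>t. \<mu> t \<in> borel_prob_measures" "\<And>S. S \<in> {UNIV} \<Longrightarrow> laws_converge_uniformly_on S M (\<lambda>n t. \<xi> (t + \<tau> n)) \<mu>"
        proof (rule conv[OF F'G', of "{UNIV}" \<tau>])
          show "\<forall>\<^sub>F n in sequentially. \<forall>s\<in>S. \<forall>h\<in>cball 0 \<rho>. norm (F (s + \<tau> n) h - F' s h) \<le> \<epsilon>" if "0 < \<epsilon>" for S \<rho> \<epsilon>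
            by (rule e[OF lim(1) that])
          show "\<forall>\<^sub>F n in sequentially. \<forall>s\<in>S. \<forall>h\<in>cball 0 \<rho>. norm (G (s + \<tau> n) h - G' s h) \<le> \<epsilon>" if "0 < \<epsilon>" for S \<rho> \<epsilon>
            by (rule e[OF lim(2) that])
        qed auto
        then show "\<tau> \<in> dist_seqs_unif M \<xi>" unfolding dist_seqs_unif_def by blast
      qed
      show "uniformly_comparable_in_distribution M F G \<xi>"
        unfolding uniformly_comparable_in_distribution_def
      proof
        fix \<tau> assume "\<tau> \<in> coeff_seqs F G"
        then obtain F' G' where F'G': "F' \<in> BUC" "G' \<in> BUC"
          and lim: "\<And>B. bounded B \<Longrightarrow> uniform_limit B (\<lambda>n (t, x). F (t + \<tau> n) x) (\<lambda>(t, x). F' t x) sequentially"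
            "\<And>B. bounded B \<Longrightarrow> uniform_limit B (\<lambda>n (t, x). G (t + \<tau> n) x) (\<lambda>(t, x). G' t x) sequentially"
          unfolding coeff_seqs_def by blast
        \<comment> \<open>The compact intervals: extending \<open>{a..b}\<close> to the left by the
          lag \<open>l\<close> stays in the class.\<close>
        let ?\<T> = "range (\<lambda>(a, b). {a..b::real})"
        have e: "\<forall>\<^sub>F n in sequentially. \<forall>s\<in>S. \<forall>h\<in>cball 0 \<rho>. norm (H (s + \<tau> n) h - H' s h) \<le> \<epsilon>"
          if lim: "\<And>B. bounded B \<Longrightarrow> uniform_limit B (\<lambda>n (t, x). H (t + \<tau> n) x) (\<lambda>(t, x). H' t x) sequentially"
            and "S \<in> ?\<T>" "0 < \<epsilon>" for H H' :: "real \<Rightarrow> 'a \<Rightarrow> 'a" and S \<rho> \<epsilon>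
        proof -
          have "bounded (S \<times> cball 0 \<rho> :: (real \<times> 'a) set)" using \<open>S \<in> ?\<T>\<close> by (intro bounded_Times) auto
          from uniform_limitD[OF lim[OF this] \<open>0 < \<epsilon>\<close>] show ?thesis
            by eventually_elim (force simp: dist_norm intro: less_imp_le)
        qed
        obtain \<mu> where \<mu>: "\<And>t. \<mu> t \<in> borel_prob_measures" "\<And>S. S \<in> ?\<T> \<Longrightarrow> laws_converge_uniformly_on S M (\<lambda>n t. \<xi> (t + \<tau> n)) \<mu>"
        proof (rule conv[OF F'G', of ?\<T> \<tau>])
          fix S and l :: real assume "S \<in> ?\<T>" "0 \<le> l"
          then obtain a b where S: "S = {a..b}" by auto
          have "\<forall>t\<in>S. {t - l..t} \<subseteq> {a - l..b}" unfolding S by auto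
          moreover have "{a - l..b} \<in> ?\<T>" by auto
          ultimately show "\<exists>S'\<in>?\<T>. \<forall>t\<in>S. {t - l..t} \<subseteq> S'" by (rule bexI)
        next
          fix t :: real
          \<comment> \<open>The single time is kept in the form \<open>{t..t}\<close>, which
            exhibits it as a member of the class.\<close>
          have "{t..t} \<in> ?\<T>" "t \<in> {t..t}" by (auto simp del: atLeastAtMost_singleton)
          then show "\<exists>S\<in>?\<T>. t \<in> S" by (rule bexI[rotated])
        next
          show "\<forall>\<^sub>F n in sequentially. \<forall>s\<in>S. \<forall>h\<in>cball 0 \<rho>. norm (F (s + \<tau> n) h - F' s h) \<le> \<epsilon>"
            if "S \<in> ?\<T>" "0 < \<epsilon>" for S \<rho> \<epsilon>
            by (rule e[OF lim(1) that])
          show "\<forall>\<^sub>F n in sequentially. \<forall>s\<in>S. \<forall>h\<in>cball 0 \<rho>. norm (G (s + \<tau> n) h - G' s h) \<le> \<epsilon>"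
            if "S \<in> ?\<T>" "0 < \<epsilon>" for S \<rho> \<epsilon>
            by (rule e[OF lim(2) that])
        qed (rule that)
        have "laws_converge_uniformly_on {a..b} M (\<lambda>n t. \<xi> (t + \<tau> n)) \<mu>" for a b
          by (rule \<mu>(2)) auto
        with \<mu>(1) show "\<tau> \<in> dist_seqs M \<xi>" unfolding dist_seqs_def by blast
      qed
    qed
  qed
qed

end
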